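(* ${\rm LZFC}^{\Sigma_1sext}\vdash \text{V-P-H}$. Therefore $${\rm ZFC}\subseteq {\rm LZFC}^{\Sigma_1sext}+VP\subseteq {\rm LZFC}^{sext}+VP.$$
   Context: All theories are in the language $\{\in\}$; $S\subseteq T$ means that every theorem of $S$ is a theorem of $T$. BST is the theory with axioms: Empty set, Extensionality, Pair, Union, Cartesian Product, "$\omega$ exists", $\Delta_0$-Separation. $Loc({\rm ZFC})$ is the statement that every set belongs to a transitive model of ZFC; ${\rm LZFC}={\rm BST}+Loc({\rm ZFC})$. "Model" means a (set) transitive model of ZFC. A model $M$ is strongly extendible ($sext$) if for every set $x$ there is a model $N$ with $x\in N$ and $M\prec N$; $M$ is $\Sigma_1$-strongly extendible ($\Sigma_1sext$) if for every set $x$ there is a model $N$ with $x\in N$ and $M\prec_{\Sigma_1}N$ (i.e. $M$ and $N$, with $M\subseteq N$, satisfy the same $\Sigma_1$ sentences with parameters from $M$). For $\phi\in\{sext,\Sigma_1sext\}$, $Loc^{\phi}({\rm ZFC})$ says that every set belongs to a model with property $\phi$, and ${\rm LZFC}^{\phi}={\rm LZFC}+Loc^{\phi}({\rm ZFC})$. V-P-H is the statement: for every infinite set $A$ there is a binary relation $R\subset A\times A$ such that the graph $(A,R)$ is rigid, i.e., the only endomorphism of $(A,R)$ is the identity, where an endomorphism is a map $f:A\to A$ such that $(x,y)\in R\Rightarrow (f(x),f(y))\in R$ for all $x,y\in A$. (V-P-H is a theorem of ZFC, due to Vopěnka, Pultr and Hedrlín.) $VP$ (Vopěnka's Principle) is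 the scheme consisting of the following statement for each formula $\phi(x)$ of the language $\{\in\}$ (set parameters allowed), where $X_\phi=\{x:\phi(x)\}$: if $X_\phi$ is a proper class of structures of some fixed first-order language, then there are distinct $x,y\in X_\phi$ and an elementary embedding $j:x\rightarrow y$ (possibly trivial, i.e. $x\prec y$). *)

theory Defs
  imports Main
begin

section \<open>First-order logic in the language of set theory\<close>

text \<open>Formulas use de Bruijn indices: \<open>Forall p\<close> binds index 0 of \<open>p\<close>.\<close>

datatype fm =
    Falsum
  | Member nat nat
  | Equal nat nat
  | Impl fm fm
  | Forall fm

primrec ren :: "(nat \<Rightarrow> nat) \<Rightarrow> fm \<Rightarrow> fm" where
  "ren r Falsum = Falsum"
| "ren r (Member i j) = Member (r i) (r j)"
| "ren r (Equal i j) = Equal (r i) (r j)"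
| "ren r (Impl p q) = Impl (ren r p) (ren r q)"
| "ren r (Forall p) = Forall (ren (case_nat 0 (\<lambda>i. Suc (r i))) p)"

definition instantiate :: "nat \<Rightarrow> fm \<Rightarrow> fm" where
  "instantiate x p = ren (case_nat x (\<lambda>i. i)) p"

text \<open>Natural deduction for classical logic with equality. The image under \<open>ren Suc\<close> in
  \<open>ForallI\<close> makes index 0 fresh for the assumptions (the eigenvariable condition).\<close>

inductive derives :: "fm set \<Rightarrow> fm \<Rightarrow> bool" (infix "\<turnstile>" 50) where
  Assume: "p \<in> T \<Longrightarrow> T \<turnstile> p"
| ImplI: "insert p T \<turnstile> q \<Longrightarrow> T \<turnstile> Impl p q"
| ImplE: "T \<turnstile> Impl p q \<Longrightarrow> T \<turnstile> p \<Longrightarrow> T \<turnstile> q"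
| Contradiction: "insert (Impl p Falsum) T \<turnstile> Falsum \<Longrightarrow> T \<turnstile> p"
| ForallI: "ren Suc ` T \<turnstile> p \<Longrightarrow> T \<turnstile> Forall p"
| ForallE: "T \<turnstile> Forall p \<Longrightarrow> T \<turnstile> instantiate x p"
| EqualI: "T \<turnstile> Equal x x"
| EqualE: "T \<turnstile> Equal x y \<Longrightarrow> T \<turnstile> instantiate x p \<Longrightarrow> T \<turnstile> instantiate y p"

definition theorems_of :: "fm set \<Rightarrow> fm set" where
  "theorems_of T = {p. T \<turnstile> p}"

text \<open>All free indices of \<open>p\<close> are below \<open>free_bound p\<close>.\<close>

primrec free_bound :: "fm \<Rightarrow> nat" where
  "free_bound Falsum = 0"
| "free_bound (Member i j) = max (Suc i) (Suc j)"
| "free_bound (Equal i j) = max (Suc i) (Suc j)"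
| "free_bound (Impl p q) = max (free_bound p) (free_bound q)"
| "free_bound (Forall p) = free_bound p - 1"

definition closure :: "fm \<Rightarrow> fm" where
  "closure p = (Forall ^^ free_bound p) p"

text \<open>The guard \<open>Member 0 (Suc y)\<close> is the bounded quantifier \<open>\<forall>x\<in>y\<close>; as the bounding variable is
  shifted it differs from the bound one. The bounded existential quantifier is definable.\<close>

inductive_set Delta0 :: "fm set" where
  "Falsum \<in> Delta0"
| "Member i j \<in> Delta0"
| "Equal i j \<in> Delta0"
| "p \<in> Delta0 \<Longrightarrow> q \<in> Delta0 \<Longrightarrow> Impl p q \<in> Delta0"
| "p \<in> Delta0 \<Longrightarrow> Forall (Impl (Member 0 (Suc y)) p) \<in> Delta0"


section \<open>Writing formulas with named variables\<close>

text \<open>A formula is written as a function of the number \<open>n\<close> of quantifiers around it. A bound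
  variable is represented by its level, the number of quantifiers around its binder; below \<open>n\<close>
  quantifiers level \<open>x\<close> is the de Bruijn index \<open>n - 1 - x\<close>. Thus \<open>\<^bold>\<forall>x. P x\<close> below \<open>n\<close>
  quantifiers is \<open>Forall\<close> of \<open>P n\<close> below \<open>Suc n\<close> quantifiers, and the formula denoted by a closed
  expression \<open>P\<close> is \<open>P 0\<close>.\<close>

type_synonym var = nat
type_synonym form = "nat \<Rightarrow> fm"

definition fFalse :: form ("\<^bold>\<bottom>") where
  "\<^bold>\<bottom> = (\<lambda>n. Falsum)"

definition fMem :: "var \<Rightarrow> var \<Rightarrow> form" (infix "\<^bold>\<in>" 50) where
  "(x \<^bold>\<in> y) = (\<lambda>n. Member (n - 1 - x) (n - 1 - y))"

definition fEq :: "var \<Rightarrow> var \<Rightarrow> form" (infix "\<^bold>=" 50) where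
  "(x \<^bold>= y) = (\<lambda>n. Equal (n - 1 - x) (n - 1 - y))"

definition fImp :: "form \<Rightarrow> form \<Rightarrow> form" (infixr "\<^bold>\<longrightarrow>" 25) where
  "(P \<^bold>\<longrightarrow> Q) = (\<lambda>n. Impl (P n) (Q n))"

definition fAll :: "(var \<Rightarrow> form) \<Rightarrow> form" (binder "\<^bold>\<forall>" 10) where
  "fAll P = (\<lambda>n. Forall (P n (Suc n)))"

definition fNot :: "form \<Rightarrow> form" ("\<^bold>\<not> _" [40] 40) where
  "(\<^bold>\<not> P) = (P \<^bold>\<longrightarrow> \<^bold>\<bottom>)"

definition fAnd :: "form \<Rightarrow> form \<Rightarrow> form" (infixr "\<^bold>\<and>" 35) where
  "(P \<^bold>\<and> Q) = (\<^bold>\<not> (P \<^bold>\<longrightarrow> \<^bold>\<not> Q))"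

definition fOr :: "form \<Rightarrow> form \<Rightarrow> form" (infixr "\<^bold>\<or>" 30) where
  "(P \<^bold>\<or> Q) = (\<^bold>\<not> P \<^bold>\<longrightarrow> Q)"

definition fIff :: "form \<Rightarrow> form \<Rightarrow> form" (infix "\<^bold>\<longleftrightarrow>" 25) where
  "(P \<^bold>\<longleftrightarrow> Q) = ((P \<^bold>\<longrightarrow> Q) \<^bold>\<and> (Q \<^bold>\<longrightarrow> P))"

definition fEx :: "(var \<Rightarrow> form) \<Rightarrow> form" (binder "\<^bold>\<exists>" 10) where
  "fEx P = (\<^bold>\<not> (\<^bold>\<forall>x. \<^bold>\<not> P x))"

definition fBall :: "var \<Rightarrow> (var \<Rightarrow> form) \<Rightarrow> form" where
  "fBall a P = (\<^bold>\<forall>x. x \<^bold>\<in> a \<^bold>\<longrightarrow> P x)"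

definition fBex :: "var \<Rightarrow> (var \<Rightarrow> form) \<Rightarrow> form" where
  "fBex a P = (\<^bold>\<exists>x. x \<^bold>\<in> a \<^bold>\<and> P x)"

syntax
  "_fBall" :: "pttrn \<Rightarrow> var \<Rightarrow> form \<Rightarrow> form" ("(3\<^bold>\<forall>_\<^bold>\<in>_./ _)" [0, 51, 10] 10)
  "_fBex" :: "pttrn \<Rightarrow> var \<Rightarrow> form \<Rightarrow> form" ("(3\<^bold>\<exists>_\<^bold>\<in>_./ _)" [0, 51, 10] 10)
translations
  "\<^bold>\<forall>x\<^bold>\<in>a. P" == "CONST fBall a (\<lambda>x. P)"
  "\<^bold>\<exists>x\<^bold>\<in>a. P" == "CONST fBex a (\<lambda>x. P)"

definition fEx1 :: "(var \<Rightarrow> form) \<Rightarrow> form" (binder "\<^bold>\<exists>\<^bold>!" 10) where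
  "fEx1 P = (\<^bold>\<exists>x. \<^bold>\<forall>y. P y \<^bold>\<longleftrightarrow> y \<^bold>= x)"

text \<open>An arbitrary formula \<open>p\<close> at the variables \<open>x\<close> (index 0) and, for \<open>at2\<close>, \<open>y\<close> (index 1); its
  remaining free indices are parameters and stay free, to be quantified by \<open>closure\<close>.\<close>

definition at1 :: "fm \<Rightarrow> var \<Rightarrow> form" where
  "at1 p x = (\<lambda>n. ren (case_nat (n - 1 - x) (\<lambda>i. n + i)) p)"

definition at2 :: "fm \<Rightarrow> var \<Rightarrow> var \<Rightarrow> form" where
  "at2 p x y = (\<lambda>n. ren (case_nat (n - 1 - x) (case_nat (n - 1 - y) (\<lambda>i. n + i))) p)"


section \<open>The axioms of ZFC\<close>

text \<open>The universal quantifier \<open>A\<close> is a parameter: it is \<open>fAll\<close> for the theory ZFC itself, and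
  \<open>fBall M\<close> when the axioms are asserted of a set \<open>M\<close>.\<close>

context
  fixes A :: "(var \<Rightarrow> form) \<Rightarrow> form" (binder "\<^bold>\<And>" 10)
begin

definition some_of :: "(var \<Rightarrow> form) \<Rightarrow> form" (binder "\<^bold>\<Or>" 10) where
  "some_of P = (\<^bold>\<not> (\<^bold>\<And>x. \<^bold>\<not> P x))"

definition ax_extensionality :: form where
  "ax_extensionality = (\<^bold>\<And>x y. (\<^bold>\<And>z. z \<^bold>\<in> x \<^bold>\<longleftrightarrow> z \<^bold>\<in> y) \<^bold>\<longrightarrow> x \<^bold>= y)"

definition ax_foundation :: form where
  "ax_foundation = (\<^bold>\<And>x. (\<^bold>\<Or>y. y \<^bold>\<in> x) \<^bold>\<longrightarrow> (\<^bold>\<Or>y. y \<^bold>\<in> x \<^bold>\<and> \<^bold>\<not> (\<^bold>\<Or>z. z \<^bold>\<in> x \<^bold>\<and> z \<^bold>\<in> y)))"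

definition ax_pair :: form where
  "ax_pair = (\<^bold>\<And>x y. \<^bold>\<Or>z. \<^bold>\<And>u. u \<^bold>\<in> z \<^bold>\<longleftrightarrow> u \<^bold>= x \<^bold>\<or> u \<^bold>= y)"

definition ax_union :: form where
  "ax_union = (\<^bold>\<And>x. \<^bold>\<Or>z. \<^bold>\<And>u. u \<^bold>\<in> z \<^bold>\<longleftrightarrow> (\<^bold>\<Or>v. v \<^bold>\<in> x \<^bold>\<and> u \<^bold>\<in> v))"

definition ax_power :: form where
  "ax_power = (\<^bold>\<And>x. \<^bold>\<Or>z. \<^bold>\<And>u. u \<^bold>\<in> z \<^bold>\<longleftrightarrow> (\<^bold>\<And>v. v \<^bold>\<in> u \<^bold>\<longrightarrow> v \<^bold>\<in> x))"

definition ax_infinity :: form where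
  "ax_infinity =
    (\<^bold>\<Or>w. (\<^bold>\<Or>e. e \<^bold>\<in> w \<^bold>\<and> (\<^bold>\<And>u. \<^bold>\<not> u \<^bold>\<in> e)) \<^bold>\<and>
          (\<^bold>\<And>n. n \<^bold>\<in> w \<^bold>\<longrightarrow> (\<^bold>\<Or>m. m \<^bold>\<in> w \<^bold>\<and> (\<^bold>\<And>u. u \<^bold>\<in> m \<^bold>\<longleftrightarrow> u \<^bold>\<in> n \<^bold>\<or> u \<^bold>= n))))"

definition ax_choice :: form where
  "ax_choice =
    (\<^bold>\<And>x. (\<^bold>\<And>u. u \<^bold>\<in> x \<^bold>\<longrightarrow> (\<^bold>\<Or>v. v \<^bold>\<in> u)) \<^bold>\<and>
          (\<^bold>\<And>u v. u \<^bold>\<in> x \<^bold>\<and> v \<^bold>\<in> x \<^bold>\<and> \<^bold>\<not> u \<^bold>= v \<^bold>\<longrightarrow> \<^bold>\<not> (\<^bold>\<Or>z. z \<^bold>\<in> u \<^bold>\<and> z \<^bold>\<in> v)) \<^bold>\<longrightarrow>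
          (\<^bold>\<Or>c. \<^bold>\<And>u. u \<^bold>\<in> x \<^bold>\<longrightarrow> (\<^bold>\<Or>v. \<^bold>\<And>z. z \<^bold>\<in> u \<^bold>\<and> z \<^bold>\<in> c \<^bold>\<longleftrightarrow> z \<^bold>= v)))"

definition ax_separation :: "(var \<Rightarrow> form) \<Rightarrow> form" where
  "ax_separation P = (\<^bold>\<And>a. \<^bold>\<Or>b. \<^bold>\<And>x. x \<^bold>\<in> b \<^bold>\<longleftrightarrow> x \<^bold>\<in> a \<^bold>\<and> P x)"

definition ax_replacement :: "(var \<Rightarrow> var \<Rightarrow> form) \<Rightarrow> form" where
  "ax_replacement P =
    (\<^bold>\<And>a. (\<^bold>\<And>x. x \<^bold>\<in> a \<^bold>\<longrightarrow> (\<^bold>\<Or>y. \<^bold>\<And>z. P x z \<^bold>\<longleftrightarrow> z \<^bold>= y)) \<^bold>\<longrightarrow>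
          (\<^bold>\<Or>b. \<^bold>\<And>y. y \<^bold>\<in> b \<^bold>\<longleftrightarrow> (\<^bold>\<Or>x. x \<^bold>\<in> a \<^bold>\<and> P x y)))"

definition zfc_finite_part :: "form list" where
  "zfc_finite_part =
    [ax_extensionality, ax_foundation, ax_pair, ax_union, ax_power, ax_infinity, ax_choice]"

end

definition ZFC :: "fm set" where
  "ZFC = {ax 0 | ax. ax \<in> set (zfc_finite_part fAll)} \<union>
     {closure (ax_separation fAll (at1 p) 0) | p. True} \<union>
     {closure (ax_replacement fAll (at2 p) 0) | p. True}"


section \<open>Basic notions of set theory\<close>

definition is_subset :: "var \<Rightarrow> var \<Rightarrow> form" where
  "is_subset x y = (\<^bold>\<forall>z\<^bold>\<in>x. z \<^bold>\<in> y)"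

definition is_empty :: "var \<Rightarrow> form" where
  "is_empty x = (\<^bold>\<forall>z. \<^bold>\<not> z \<^bold>\<in> x)"

definition is_suc :: "var \<Rightarrow> var \<Rightarrow> form" where
  "is_suc n m = (\<^bold>\<forall>u. u \<^bold>\<in> m \<^bold>\<longleftrightarrow> u \<^bold>\<in> n \<^bold>\<or> u \<^bold>= n)"

definition is_inductive :: "var \<Rightarrow> form" where
  "is_inductive w = ((\<^bold>\<exists>e\<^bold>\<in>w. is_empty e) \<^bold>\<and> (\<^bold>\<forall>n\<^bold>\<in>w. \<^bold>\<exists>m\<^bold>\<in>w. is_suc n m))"

definition is_omega :: "var \<Rightarrow> form" where
  "is_omega w = (is_inductive w \<^bold>\<and> (\<^bold>\<forall>v. is_inductive v \<^bold>\<longrightarrow> is_subset w v))"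

definition is_nat :: "var \<Rightarrow> form" where
  "is_nat n = (\<^bold>\<exists>w. is_omega w \<^bold>\<and> n \<^bold>\<in> w)"

primrec is_numeral :: "nat \<Rightarrow> var \<Rightarrow> form" where
  "is_numeral 0 x = is_empty x"
| "is_numeral (Suc k) x = (\<^bold>\<exists>y. is_numeral k y \<^bold>\<and> is_suc y x)"

definition is_upair :: "var \<Rightarrow> var \<Rightarrow> var \<Rightarrow> form" where
  "is_upair x y z = (\<^bold>\<forall>u. u \<^bold>\<in> z \<^bold>\<longleftrightarrow> u \<^bold>= x \<^bold>\<or> u \<^bold>= y)"

definition is_pair :: "var \<Rightarrow> var \<Rightarrow> var \<Rightarrow> form" where
  "is_pair x y z = (\<^bold>\<exists>s t. is_upair x x s \<^bold>\<and> is_upair x y t \<^bold>\<and> is_upair s t z)"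

definition pair_in :: "var \<Rightarrow> var \<Rightarrow> var \<Rightarrow> form" where
  "pair_in x y r = (\<^bold>\<exists>z\<^bold>\<in>r. is_pair x y z)"

definition triple_in :: "var \<Rightarrow> var \<Rightarrow> var \<Rightarrow> var \<Rightarrow> form" where
  "triple_in x y z r = (\<^bold>\<exists>p. is_pair x y p \<^bold>\<and> pair_in p z r)"

definition is_fun_on :: "var \<Rightarrow> var \<Rightarrow> form" where
  "is_fun_on f a = ((\<^bold>\<forall>z\<^bold>\<in>f. \<^bold>\<exists>x\<^bold>\<in>a. \<^bold>\<exists>y. is_pair x y z) \<^bold>\<and> (\<^bold>\<forall>x\<^bold>\<in>a. \<^bold>\<exists>\<^bold>!y. pair_in x y f))"

definition is_fun :: "var \<Rightarrow> var \<Rightarrow> var \<Rightarrow> form" where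
  "is_fun f a b = (is_fun_on f a \<^bold>\<and> (\<^bold>\<forall>x y. pair_in x y f \<^bold>\<longrightarrow> y \<^bold>\<in> b))"

text \<open>\<open>g\<close> is the function on \<open>k\<close> that agrees with \<open>f\<close> except that it sends \<open>i\<close> to \<open>v\<close>, where
  \<open>i \<in> k\<close>.\<close>

definition is_update :: "var \<Rightarrow> var \<Rightarrow> var \<Rightarrow> var \<Rightarrow> var \<Rightarrow> form" where
  "is_update k f i v g =
    (is_fun_on g k \<^bold>\<and> pair_in i v g \<^bold>\<and>
     (\<^bold>\<forall>j\<^bold>\<in>k. \<^bold>\<not> j \<^bold>= i \<^bold>\<longrightarrow> (\<^bold>\<forall>u. pair_in j u g \<^bold>\<longleftrightarrow> pair_in j u f)))"

text \<open>\<open>c\<close> is the triple \<open>(t, (x, y))\<close>, where \<open>t\<close> is the numeral \<open>k\<close>.\<close>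

definition is_tagged :: "nat \<Rightarrow> var \<Rightarrow> var \<Rightarrow> var \<Rightarrow> form" where
  "is_tagged k x y c = (\<^bold>\<exists>t p. is_numeral k t \<^bold>\<and> is_pair x y p \<^bold>\<and> is_pair t p c)"

definition ax_empty :: form where
  "ax_empty = (\<^bold>\<exists>x. is_empty x)"

definition ax_product :: form where
  "ax_product = (\<^bold>\<forall>x y. \<^bold>\<exists>z. \<^bold>\<forall>u. u \<^bold>\<in> z \<^bold>\<longleftrightarrow> (\<^bold>\<exists>a\<^bold>\<in>x. \<^bold>\<exists>b\<^bold>\<in>y. is_pair a b u))"

definition ax_omega :: form where
  "ax_omega = (\<^bold>\<exists>w. is_omega w)"

definition BST :: "fm set" where
  "BST = {ax_empty 0, ax_extensionality fAll 0, ax_pair fAll 0, ax_union fAll 0,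
      ax_product 0, ax_omega 0} \<union>
     {closure (ax_separation fAll (at1 p) 0) | p. p \<in> Delta0}"


section \<open>Languages and structures as sets\<close>

text \<open>A relation symbol of arity \<open>n\<close> is a triple \<open>(0, (n, s))\<close> and a function symbol of arity \<open>n\<close> a
  triple \<open>(1, (n, s))\<close>, with an arbitrary set \<open>s\<close> as its name; constants are function symbols of
  arity 0. An \<open>n\<close>-tuple is a function on the natural number \<open>n = {0, ..., n - 1}\<close>.\<close>

definition is_rel_symbol :: "var \<Rightarrow> var \<Rightarrow> form" where
  "is_rel_symbol n f = (is_nat n \<^bold>\<and> (\<^bold>\<exists>s. is_tagged 0 n s f))"

definition is_fun_symbol :: "var \<Rightarrow> var \<Rightarrow> form" where
  "is_fun_symbol n f = (is_nat n \<^bold>\<and> (\<^bold>\<exists>s. is_tagged 1 n s f))"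

definition is_language :: "var \<Rightarrow> form" where
  "is_language L = (\<^bold>\<forall>f\<^bold>\<in>L. \<^bold>\<exists>n. is_rel_symbol n f \<^bold>\<or> is_fun_symbol n f)"

definition is_operation :: "var \<Rightarrow> var \<Rightarrow> var \<Rightarrow> form" where
  "is_operation g n D =
    ((\<^bold>\<forall>z\<^bold>\<in>g. \<^bold>\<exists>t y. is_fun t n D \<^bold>\<and> y \<^bold>\<in> D \<^bold>\<and> is_pair t y z) \<^bold>\<and>
     (\<^bold>\<forall>t. is_fun t n D \<^bold>\<longrightarrow> (\<^bold>\<exists>\<^bold>!y. pair_in t y g)))"

text \<open>\<open>I\<close> interprets the symbols of \<open>L\<close> on the nonempty domain \<open>D\<close>.\<close>

definition is_interpretation :: "var \<Rightarrow> var \<Rightarrow> var \<Rightarrow> form" where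
  "is_interpretation L D I =
    ((\<^bold>\<exists>x. x \<^bold>\<in> D) \<^bold>\<and> is_fun_on I L \<^bold>\<and>
     (\<^bold>\<forall>f r n. pair_in f r I \<^bold>\<and> is_rel_symbol n f \<^bold>\<longrightarrow> (\<^bold>\<forall>t\<^bold>\<in>r. is_fun t n D)) \<^bold>\<and>
     (\<^bold>\<forall>f g n. pair_in f g I \<^bold>\<and> is_fun_symbol n f \<^bold>\<longrightarrow> is_operation g n D))"

definition is_structure :: "var \<Rightarrow> var \<Rightarrow> form" where
  "is_structure L x = (\<^bold>\<exists>D I. is_pair D I x \<^bold>\<and> is_interpretation L D I)"


section \<open>Coded formulas\<close>

text \<open>Terms and formulas of a language \<open>L\<close> are coded by sets, with named variables \<open>v\<^sub>i\<close> for natural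
  numbers \<open>i\<close>:

  \<^item> \<open>v\<^sub>i\<close> is \<open>(0, (i, \<emptyset>))\<close>, and \<open>f(t)\<close> is \<open>(1, (f, t))\<close>;
  \<^item> \<open>t = u\<close> is \<open>(2, (t, u))\<close>, \<open>R(t)\<close> is \<open>(3, (R, t))\<close>, falsum is \<open>(6, (\<emptyset>, \<emptyset>))\<close>;
  \<^item> \<open>p \<longrightarrow> q\<close> is \<open>(4, (p, q))\<close>, and \<open>\<forall>v\<^sub>i. p\<close> is \<open>(5, (i, p))\<close>.

  \<open>is_term L k\<close>, \<open>is_formula L k\<close> etc. describe the codes in which all variables, free or bound, are
  among \<open>v\<^sub>i\<close> with \<open>i < k\<close>; an assignment for them is a function on \<open>k\<close>.

  \<open>is_built step c\<close>: there is a finite sequence \<open>g\<close> containing \<open>c\<close> each of whose entries \<open>d\<close>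
  satisfies \<open>step prev d\<close>, where \<open>prev e\<close> says that \<open>e\<close> is an earlier entry.\<close>

definition is_built :: "((var \<Rightarrow> form) \<Rightarrow> var \<Rightarrow> form) \<Rightarrow> var \<Rightarrow> form" where
  "is_built step c =
    (\<^bold>\<exists>m g. is_nat m \<^bold>\<and> is_fun_on g m \<^bold>\<and> (\<^bold>\<exists>i. pair_in i c g) \<^bold>\<and>
       (\<^bold>\<forall>i d. pair_in i d g \<^bold>\<longrightarrow> step (\<lambda>e. \<^bold>\<exists>j\<^bold>\<in>i. pair_in j e g) d))"

definition code_var :: "var \<Rightarrow> var \<Rightarrow> form" where
  "code_var i c = (\<^bold>\<exists>e. is_empty e \<^bold>\<and> is_tagged 0 i e c)"

abbreviation code_app :: "var \<Rightarrow> var \<Rightarrow> var \<Rightarrow> form" where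
  "code_app f t c \<equiv> is_tagged 1 f t c"

abbreviation code_eq :: "var \<Rightarrow> var \<Rightarrow> var \<Rightarrow> form" where
  "code_eq t u c \<equiv> is_tagged 2 t u c"

abbreviation code_rel :: "var \<Rightarrow> var \<Rightarrow> var \<Rightarrow> form" where
  "code_rel r t c \<equiv> is_tagged 3 r t c"

abbreviation code_imp :: "var \<Rightarrow> var \<Rightarrow> var \<Rightarrow> form" where
  "code_imp p q c \<equiv> is_tagged 4 p q c"

abbreviation code_all :: "var \<Rightarrow> var \<Rightarrow> var \<Rightarrow> form" where
  "code_all i p c \<equiv> is_tagged 5 i p c"

definition code_false :: "var \<Rightarrow> form" where
  "code_false c = (\<^bold>\<exists>e. is_empty e \<^bold>\<and> is_tagged 6 e e c)"

definition code_not :: "var \<Rightarrow> var \<Rightarrow> form" where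
  "code_not p c = (\<^bold>\<exists>f. code_false f \<^bold>\<and> code_imp p f c)"

definition code_ex :: "var \<Rightarrow> var \<Rightarrow> var \<Rightarrow> form" where
  "code_ex i p c = (\<^bold>\<exists>q r. code_not p q \<^bold>\<and> code_all i q r \<^bold>\<and> code_not r c)"

definition is_term :: "var \<Rightarrow> var \<Rightarrow> var \<Rightarrow> form" where
  "is_term L k = is_built (\<lambda>prev c.
     (\<^bold>\<exists>i\<^bold>\<in>k. code_var i c) \<^bold>\<or>
     (\<^bold>\<exists>f\<^bold>\<in>L. \<^bold>\<exists>n t. is_fun_symbol n f \<^bold>\<and> is_fun_on t n \<^bold>\<and>
        (\<^bold>\<forall>i e. pair_in i e t \<^bold>\<longrightarrow> prev e) \<^bold>\<and> code_app f t c))"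

definition is_atom :: "var \<Rightarrow> var \<Rightarrow> var \<Rightarrow> form" where
  "is_atom L k c =
    ((\<^bold>\<exists>t u. is_term L k t \<^bold>\<and> is_term L k u \<^bold>\<and> code_eq t u c) \<^bold>\<or>
     (\<^bold>\<exists>r\<^bold>\<in>L. \<^bold>\<exists>n t. is_rel_symbol n r \<^bold>\<and> is_fun_on t n \<^bold>\<and>
        (\<^bold>\<forall>i e. pair_in i e t \<^bold>\<longrightarrow> is_term L k e) \<^bold>\<and> code_rel r t c))"

definition is_formula :: "var \<Rightarrow> var \<Rightarrow> var \<Rightarrow> form" where
  "is_formula L k = is_built (\<lambda>prev c.
     is_atom L k c \<^bold>\<or> code_false c \<^bold>\<or>
     (\<^bold>\<exists>p q. prev p \<^bold>\<and> prev q \<^bold>\<and> code_imp p q c) \<^bold>\<or>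
     (\<^bold>\<exists>i\<^bold>\<in>k. \<^bold>\<exists>p. prev p \<^bold>\<and> code_all i p c))"


section \<open>Satisfaction in set structures\<close>

text \<open>\<open>s\<close> is the tuple of the values under the assignment \<open>a\<close> of the terms in the tuple \<open>t\<close>, where
  \<open>V\<close> is a set of triples \<open>((term, assignment), value)\<close>.\<close>

definition is_value_tuple :: "var \<Rightarrow> var \<Rightarrow> var \<Rightarrow> var \<Rightarrow> form" where
  "is_value_tuple V a t s =
    (\<^bold>\<exists>n. is_nat n \<^bold>\<and> is_fun_on t n \<^bold>\<and> is_fun_on s n \<^bold>\<and>
       (\<^bold>\<forall>i e x. pair_in i e t \<^bold>\<and> pair_in i x s \<^bold>\<longrightarrow> triple_in e a x V))"

definition is_valuation :: "var \<Rightarrow> var \<Rightarrow> var \<Rightarrow> var \<Rightarrow> form" where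
  "is_valuation L D I V =
    (\<^bold>\<forall>k a c. is_nat k \<^bold>\<and> is_fun a k D \<^bold>\<and> is_term L k c \<^bold>\<longrightarrow>
       (\<^bold>\<forall>x. triple_in c a x V \<^bold>\<longleftrightarrow>
          (\<^bold>\<exists>i. code_var i c \<^bold>\<and> pair_in i x a) \<^bold>\<or>
          (\<^bold>\<exists>f t g s. code_app f t c \<^bold>\<and> pair_in f g I \<^bold>\<and> is_value_tuple V a t s \<^bold>\<and> pair_in s x g)))"

text \<open>Tarski's clauses for a set \<open>S\<close> of pairs \<open>(formula, assignment)\<close>. Falsum matches none of the
  disjuncts, so it is never satisfied.\<close>

definition is_satisfaction :: "var \<Rightarrow> var \<Rightarrow> var \<Rightarrow> var \<Rightarrow> form" where
  "is_satisfaction L D I S =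
    (\<^bold>\<exists>V. is_valuation L D I V \<^bold>\<and>
      (\<^bold>\<forall>k a c. is_nat k \<^bold>\<and> is_fun a k D \<^bold>\<and> is_formula L k c \<^bold>\<longrightarrow>
        (pair_in c a S \<^bold>\<longleftrightarrow>
           (\<^bold>\<exists>t u x. code_eq t u c \<^bold>\<and> triple_in t a x V \<^bold>\<and> triple_in u a x V) \<^bold>\<or>
           (\<^bold>\<exists>f t r s. code_rel f t c \<^bold>\<and> pair_in f r I \<^bold>\<and> is_value_tuple V a t s \<^bold>\<and> s \<^bold>\<in> r) \<^bold>\<or>
           (\<^bold>\<exists>p q. code_imp p q c \<^bold>\<and> (pair_in p a S \<^bold>\<longrightarrow> pair_in q a S)) \<^bold>\<or>
           (\<^bold>\<exists>i p. code_all i p c \<^bold>\<and>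
              (\<^bold>\<forall>x\<^bold>\<in>D. \<^bold>\<forall>b. is_update k a i x b \<^bold>\<longrightarrow> pair_in p b S)))))"

text \<open>\<open>j\<close> is an elementary embedding between the \<open>L\<close>-structures \<open>x\<close> and \<open>y\<close>. Here and below
  satisfaction relations are required to exist: elementarity must not hold vacuously.\<close>

definition is_composition :: "var \<Rightarrow> var \<Rightarrow> var \<Rightarrow> form" where
  "is_composition j a b = (\<^bold>\<forall>i u v. pair_in i u a \<^bold>\<and> pair_in u v j \<^bold>\<longrightarrow> pair_in i v b)"

definition is_elementary_embedding :: "var \<Rightarrow> var \<Rightarrow> var \<Rightarrow> var \<Rightarrow> form" where
  "is_elementary_embedding L x y j =
    (\<^bold>\<exists>D I E J S T. is_pair D I x \<^bold>\<and> is_pair E J y \<^bold>\<and> is_fun j D E \<^bold>\<and>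
       is_satisfaction L D I S \<^bold>\<and> is_satisfaction L E J T \<^bold>\<and>
       (\<^bold>\<forall>k c a b. is_nat k \<^bold>\<and> is_formula L k c \<^bold>\<and> is_fun a k D \<^bold>\<and> is_fun b k E \<^bold>\<and>
          is_composition j a b \<^bold>\<longrightarrow> (pair_in c a S \<^bold>\<longleftrightarrow> pair_in c b T)))"


section \<open>Transitive models of ZFC\<close>

definition is_mem_symbol :: "var \<Rightarrow> form" where
  "is_mem_symbol f = (\<^bold>\<exists>n e. is_numeral 2 n \<^bold>\<and> is_empty e \<^bold>\<and> is_tagged 0 n e f)"

definition is_mem_language :: "var \<Rightarrow> form" where
  "is_mem_language L = (\<^bold>\<exists>f. is_mem_symbol f \<^bold>\<and> (\<^bold>\<forall>g. g \<^bold>\<in> L \<^bold>\<longleftrightarrow> g \<^bold>= f))"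

text \<open>\<open>t\<close> is the 2-tuple with entries \<open>x\<close> and \<open>y\<close>.\<close>

definition is_2tuple :: "var \<Rightarrow> var \<Rightarrow> var \<Rightarrow> form" where
  "is_2tuple x y t =
    (\<^bold>\<exists>zero one two. is_numeral 0 zero \<^bold>\<and> is_numeral 1 one \<^bold>\<and> is_numeral 2 two \<^bold>\<and>
       is_fun_on t two \<^bold>\<and> pair_in zero x t \<^bold>\<and> pair_in one y t)"

text \<open>\<open>S\<close> is a satisfaction relation for the structure \<open>(M, \<in>)\<close>.\<close>

definition is_mem_satisfaction :: "var \<Rightarrow> var \<Rightarrow> form" where
  "is_mem_satisfaction M S =
    (\<^bold>\<exists>L I. is_mem_language L \<^bold>\<and> is_interpretation L M I \<^bold>\<and>
       (\<^bold>\<forall>f r. pair_in f r I \<^bold>\<longrightarrow>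
          (\<^bold>\<forall>x\<^bold>\<in>M. \<^bold>\<forall>y\<^bold>\<in>M. \<^bold>\<forall>t. is_2tuple x y t \<^bold>\<longrightarrow> (t \<^bold>\<in> r \<^bold>\<longleftrightarrow> x \<^bold>\<in> y))) \<^bold>\<and>
       is_satisfaction L M I S)"

definition is_mem_formula :: "var \<Rightarrow> var \<Rightarrow> form" where
  "is_mem_formula k c = (\<^bold>\<exists>L. is_mem_language L \<^bold>\<and> is_formula L k c)"

text \<open>The formula \<open>c\<close> holds at \<open>x\<close> for \<open>v\<^sub>0\<close> (and \<open>y\<close> for \<open>v\<^sub>1\<close>), and at the parameters \<open>a\<close> for the
  other variables.\<close>

definition sat1 :: "var \<Rightarrow> var \<Rightarrow> var \<Rightarrow> var \<Rightarrow> var \<Rightarrow> form" where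
  "sat1 S k c a x = (\<^bold>\<exists>i b. is_numeral 0 i \<^bold>\<and> is_update k a i x b \<^bold>\<and> pair_in c b S)"

definition sat2 :: "var \<Rightarrow> var \<Rightarrow> var \<Rightarrow> var \<Rightarrow> var \<Rightarrow> var \<Rightarrow> form" where
  "sat2 S k c a x y =
    (\<^bold>\<exists>i j b d. is_numeral 0 i \<^bold>\<and> is_numeral 1 j \<^bold>\<and> is_update k a i x b \<^bold>\<and> is_update k b j y d \<^bold>\<and>
       pair_in c d S)"

text \<open>\<open>M\<close> is a transitive model of ZFC. The axioms are interpreted in \<open>(M, \<in>)\<close> by bounding their
  quantifiers by \<open>M\<close>. The schemes range over all formulas in the sense of the theory, not just over
  the codes of the formulas of type \<^typ>\<open>fm\<close>.\<close>

definition is_model :: "var \<Rightarrow> form" where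
  "is_model M =
    ((\<^bold>\<forall>x\<^bold>\<in>M. is_subset x M) \<^bold>\<and>
     foldr fAnd (zfc_finite_part (fBall M))
       (\<^bold>\<exists>S. is_mem_satisfaction M S \<^bold>\<and>
          (\<^bold>\<forall>k c a. is_nat k \<^bold>\<and> is_mem_formula k c \<^bold>\<and> is_fun a k M \<^bold>\<longrightarrow>
             ax_separation (fBall M) (sat1 S k c a) \<^bold>\<and>
             ax_replacement (fBall M) (sat2 S k c a))))"

text \<open>\<open>M\<close> is a substructure of \<open>N\<close>, elementary for the class \<open>\<Gamma>\<close> of codes.\<close>

definition is_elementary_for :: "(var \<Rightarrow> var \<Rightarrow> form) \<Rightarrow> var \<Rightarrow> var \<Rightarrow> form" where
  "is_elementary_for \<Gamma> M N =
    (is_subset M N \<^bold>\<and>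
     (\<^bold>\<exists>S T. is_mem_satisfaction M S \<^bold>\<and> is_mem_satisfaction N T \<^bold>\<and>
        (\<^bold>\<forall>k c a. is_nat k \<^bold>\<and> \<Gamma> k c \<^bold>\<and> is_fun a k M \<^bold>\<longrightarrow>
           (pair_in c a S \<^bold>\<longleftrightarrow> pair_in c a T))))"

definition code_mem :: "var \<Rightarrow> var \<Rightarrow> var \<Rightarrow> form" where
  "code_mem i j c =
    (\<^bold>\<exists>f x y t. is_mem_symbol f \<^bold>\<and> code_var i x \<^bold>\<and> code_var j y \<^bold>\<and> is_2tuple x y t \<^bold>\<and>
       code_rel f t c)"

definition is_Delta0 :: "var \<Rightarrow> var \<Rightarrow> form" where
  "is_Delta0 k = is_built (\<lambda>prev c.
     (\<^bold>\<exists>L. is_mem_language L \<^bold>\<and> is_atom L k c) \<^bold>\<or> code_false c \<^bold>\<or>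
     (\<^bold>\<exists>p q. prev p \<^bold>\<and> prev q \<^bold>\<and> code_imp p q c) \<^bold>\<or>
     (\<^bold>\<exists>i\<^bold>\<in>k. \<^bold>\<exists>j\<^bold>\<in>k. \<^bold>\<exists>p q r. \<^bold>\<not> i \<^bold>= j \<^bold>\<and> prev p \<^bold>\<and>
        code_mem i j q \<^bold>\<and> code_imp q p r \<^bold>\<and> code_all i r c))"

definition is_Sigma1 :: "var \<Rightarrow> var \<Rightarrow> form" where
  "is_Sigma1 k c = (\<^bold>\<exists>i\<^bold>\<in>k. \<^bold>\<exists>p. is_Delta0 k p \<^bold>\<and> code_ex i p c)"

definition is_extendible_for :: "(var \<Rightarrow> var \<Rightarrow> form) \<Rightarrow> var \<Rightarrow> form" where
  "is_extendible_for \<Gamma> M =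
    (is_model M \<^bold>\<and> (\<^bold>\<forall>x. \<^bold>\<exists>N. is_model N \<^bold>\<and> x \<^bold>\<in> N \<^bold>\<and> is_elementary_for \<Gamma> M N))"

definition is_sext :: "var \<Rightarrow> form" where
  "is_sext = is_extendible_for is_mem_formula"

definition is_Sigma1_sext :: "var \<Rightarrow> form" where
  "is_Sigma1_sext = is_extendible_for is_Sigma1"


section \<open>The theories and principles\<close>

definition Loc :: "(var \<Rightarrow> form) \<Rightarrow> form" where
  "Loc \<phi> = (\<^bold>\<forall>x. \<^bold>\<exists>M. x \<^bold>\<in> M \<^bold>\<and> \<phi> M)"

definition LZFC :: "fm set" where
  "LZFC = insert (Loc is_model 0) BST"

definition LZFC_sext :: "fm set" where
  "LZFC_sext = insert (Loc is_sext 0) LZFC"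

definition LZFC_Sigma1_sext :: "fm set" where
  "LZFC_Sigma1_sext = insert (Loc is_Sigma1_sext 0) LZFC"

definition is_finite :: "var \<Rightarrow> form" where
  "is_finite a = (\<^bold>\<exists>n f. is_nat n \<^bold>\<and> is_fun f n a \<^bold>\<and> (\<^bold>\<forall>y\<^bold>\<in>a. \<^bold>\<exists>\<^bold>!x. pair_in x y f))"

definition is_endomorphism :: "var \<Rightarrow> var \<Rightarrow> var \<Rightarrow> form" where
  "is_endomorphism a r f =
    (is_fun f a a \<^bold>\<and>
     (\<^bold>\<forall>x\<^bold>\<in>a. \<^bold>\<forall>y\<^bold>\<in>a. pair_in x y r \<^bold>\<longrightarrow>
        (\<^bold>\<exists>u v. pair_in x u f \<^bold>\<and> pair_in y v f \<^bold>\<and> pair_in u v r)))"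

definition VPH :: form where
  "VPH =
    (\<^bold>\<forall>a. \<^bold>\<not> is_finite a \<^bold>\<longrightarrow>
       (\<^bold>\<exists>r. (\<^bold>\<forall>z\<^bold>\<in>r. \<^bold>\<exists>x\<^bold>\<in>a. \<^bold>\<exists>y\<^bold>\<in>a. is_pair x y z) \<^bold>\<and>
            (\<^bold>\<forall>f. is_endomorphism a r f \<^bold>\<longrightarrow> (\<^bold>\<forall>x\<^bold>\<in>a. pair_in x x f))))"

text \<open>A class is proper if it is not a set; in the absence of full Separation this is weaker than
  not being included in a set.\<close>

definition vopenka :: "(var \<Rightarrow> form) \<Rightarrow> form" where
  "vopenka P =
    (\<^bold>\<forall>L. is_language L \<^bold>\<and> (\<^bold>\<forall>x. P x \<^bold>\<longrightarrow> is_structure L x) \<^bold>\<and>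
         \<^bold>\<not> (\<^bold>\<exists>z. \<^bold>\<forall>x. x \<^bold>\<in> z \<^bold>\<longleftrightarrow> P x) \<^bold>\<longrightarrow>
       (\<^bold>\<exists>x y j. P x \<^bold>\<and> P y \<^bold>\<and> \<^bold>\<not> x \<^bold>= y \<^bold>\<and> is_elementary_embedding L x y j))"

definition VP :: "fm set" where
  "VP = {closure (vopenka (at1 p) 0) | p. True}"

end

theory Submission
  imports Defs "HOL-Library.Countable" "HOL-Library.Infinite_Set"
begin

text \<open>Provability is handled through the completeness theorem, so that everything is argued inside an
  arbitrary model \<open>U\<close> of the theory in question.

  ZFC proves V-P-H: well-order the infinite set with a last element, and let its first limit segment
  serve as a set of colours. Colours and cofinal ladders of countable type are built into the
  edges so that every endomorphism \<open>f\<close> fixes the colours, preserves the colour of each element and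
  is increasing. If \<open>f\<close> moved \<open>a\<close>, the supremum of the points \<open>f\<^sup>n(a)\<close> would be fixed together with
  its ladder, and a ladder point above \<open>a\<close> would bound the orbit.

  In \<open>U\<close>, a transitive model \<open>M\<close> of ZFC has a rigid relation \<open>r\<close> on each of its infinite sets; that \<open>r\<close>
  admits a nontrivial endomorphism is a \<open>\<Sigma>\<^sub>1\<close> statement, so it cannot become true in \<open>U\<close> when
  \<open>M\<close> is \<open>\<Sigma>\<^sub>1\<close>-strongly extendible. Given V-P-H, a rigid graph on \<open>B\<close> expanded by a predicate
  \<open>Y\<close> and copied to \<open>B \<times> {d}\<close> embeds elementarily into another such structure only if the predicates
  agree. Vopenka's Principle hence says that \<open>{d | \<exists>Y. Q(Y, d)}\<close> is a set whenever \<open>Q\<close> is definable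
  and functional with domain in the power set of \<open>B\<close>; this yields Separation, Replacement and Power
  set, and the remaining axioms hold because they hold in transitive models.\<close>

section \<open>Semantics and completeness\<close>

text \<open>The detour through derivability moves V-P-H between domains. The graph is constructed
  over the whole domain of a model, while it is wanted in a set \<open>M\<close> of
  \<open>U\<close>; deriving V-P-H from ZFC and applying \<open>soundness\<close> over the elements
  of \<open>M\<close> carries it there. Completeness is arranged for models whose domain is all of
  \<open>nat\<close>, which is why it asks for infinite domains.

  The obstacle afterwards is that \<open>U\<close> has Separation for bounded formulas only and may
  have nonstandard natural numbers. A property whose quantifiers range over a transitive set
  \<open>M\<close> becomes bounded once \<open>M\<close> is a parameter, so arguments in
  \<open>U\<close> are confined to a suitable \<open>M\<close>, and induction is used for properties
  definable there. Internal satisfaction agrees with truth on actual formulas, but comparing the two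
  notions of strong extendibility also involves nonstandard codes and takes an internal induction
  over building sequences.

  Vopenka's Principle yields Separation because a proper class is one that is not a set: even a
  subclass of a set falls under the principle when it is not itself a set.\<close>

primrec sat :: "'a set \<Rightarrow> ('a \<Rightarrow> 'a \<Rightarrow> bool) \<Rightarrow> (nat \<Rightarrow> 'a) \<Rightarrow> fm \<Rightarrow> bool" where
  "sat D E e Falsum = False"
| "sat D E e (Member i j) = E (e i) (e j)"
| "sat D E e (Equal i j) = (e i = e j)"
| "sat D E e (Impl p q) = (sat D E e p \<longrightarrow> sat D E e q)"
| "sat D E e (Forall p) = (\<forall>a\<in>D. sat D E (case_nat a e) p)"

lemma case_nat_ren:
  "(\<lambda>i. case_nat a e (case i of 0 \<Rightarrow> 0 | Suc i \<Rightarrow> Suc (r i))) = case_nat a (\<lambda>i. e (r i))"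
  by (auto simp: fun_eq_iff split: nat.split)

lemma sat_ren [simp]: "sat D E e (ren r p) = sat D E (\<lambda>i. e (r i)) p"
  by (induction p arbitrary: e r) (simp_all add: case_nat_ren)

lemma sat_cong:
  "(\<And>i. i < free_bound p \<Longrightarrow> e i = e' i) \<Longrightarrow> sat D E e p = sat D E e' p"
proof (induction p arbitrary: e e')
  case (Impl p q)
  from Impl.IH(1)[of e e'] Impl.IH(2)[of e e'] Impl.prems show ?case by simp
next
  case (Forall p)
  have "sat D E (case_nat a e) p = sat D E (case_nat a e') p" for a
    using Forall.prems by (intro Forall.IH) (auto split: nat.split)
  then show ?case by simp
qed auto

lemma sat_instantiate [simp]: "sat D E e (instantiate x p) = sat D E (case_nat (e x) e) p"
proof -
  have "(\<lambda>i. e (case_nat x (\<lambda>i. i) i)) = case_nat (e x) e"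
    by (auto simp: fun_eq_iff split: nat.split)
  then show ?thesis by (simp add: instantiate_def)
qed

text \<open>The domain is a set and not a type, so that the result also applies to the elements of a
  set inside a model. Rule \<open>ForallI\<close> is sound since extending the environment by
  \<open>a\<close> undoes the renaming by \<open>Suc\<close> on the assumptions.\<close>

theorem soundness:
  "T \<turnstile> p \<Longrightarrow> range e \<subseteq> D \<Longrightarrow> \<forall>q\<in>T. sat D E e q \<Longrightarrow> sat D E e p"
proof (induction arbitrary: e rule: derives.induct)
  case (ForallI T p)
  have "sat D E (case_nat a e) p" if "a \<in> D" for a
    using ForallI.prems that
    by (intro ForallI.IH) (auto simp: image_subset_iff split: nat.split)
  then show ?case by simp
next
  case (Contradiction p T)
  then show ?case by fastforce
next
  case (ForallE T p x)
  then show ?case by (auto simp: image_subset_iff)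
next
  case (EqualE T x y p)
  then show ?case by (metis sat.simps(3) sat_instantiate)
qed auto

section \<open>Renaming, weakening and finiteness of derivations\<close>

lemma ren_ren: "ren r (ren s p) = ren (\<lambda>i. r (s i)) p"
proof (induction p arbitrary: r s)
  case (Forall p)
  have "(\<lambda>i. case case i of 0 \<Rightarrow> 0 | Suc i \<Rightarrow> Suc (s i) of 0 \<Rightarrow> 0 | Suc i \<Rightarrow> Suc (r i))
      = case_nat 0 (\<lambda>i. Suc (r (s i)))"
    by (auto simp: fun_eq_iff split: nat.split)
  with Forall show ?case by simp
qed auto

lemma ren_cong: "(\<And>i. i < free_bound p \<Longrightarrow> r i = s i) \<Longrightarrow> ren r p = ren s p"
proof (induction p arbitrary: r s)
  case (Impl p q)
  from Impl.IH(1)[of r s] Impl.IH(2)[of r s] Impl.prems show ?case by simp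
next
  case (Forall p)
  have "ren (case_nat 0 (\<lambda>i. Suc (r i))) p = ren (case_nat 0 (\<lambda>i. Suc (s i))) p"
    using Forall.prems by (intro Forall.IH) (auto split: nat.split)
  then show ?case by simp
qed auto

lemma ren_id [simp]: "ren (\<lambda>i. i) p = p"
proof (induction p)
  case (Forall p)
  have "case_nat 0 Suc = (\<lambda>i. i)" by (auto simp: fun_eq_iff split: nat.split)
  with Forall show ?case by simp
qed auto

lemma ren_instantiate:
  "ren r (instantiate x p) = instantiate (r x) (ren (case_nat 0 (\<lambda>i. Suc (r i))) p)"
  unfolding instantiate_def ren_ren
  by (rule arg_cong[where f = "\<lambda>s. ren s p"]) (auto simp: fun_eq_iff split: nat.split)

lemma derives_weaken: "T \<turnstile> p \<Longrightarrow> T \<subseteq> T' \<Longrightarrow> T' \<turnstile> p"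
proof (induction arbitrary: T' rule: derives.induct)
  case (ImplI p T q) then show ?case by (meson derives.ImplI insert_mono)
next
  case (Contradiction p T) then show ?case by (meson derives.Contradiction insert_mono)
next
  case (ForallI T p) then show ?case by (meson derives.ForallI image_mono)
next
  case (EqualE T x y p) then show ?case by (meson derives.EqualE)
qed (auto intro: derives.intros)

text \<open>Below a quantifier the renaming fixes 0 and shifts everything else, so it commutes with
  \<open>ren Suc\<close> and the eigenvariable condition survives even when \<open>r\<close>
  identifies variables.\<close>

lemma derives_ren: "T \<turnstile> p \<Longrightarrow> ren r ` T \<turnstile> ren r p"
proof (induction arbitrary: r rule: derives.induct)
  case (ImplI p T q) then show ?case by (auto intro: derives.ImplI)
next
  case (ImplE T p q) then show ?case by (metis derives.ImplE ren.simps(4))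
next
  case (Contradiction p T)
  then show ?case using derives.Contradiction by fastforce
next
  case (ForallI T p)
  have "ren (case_nat 0 (\<lambda>i. Suc (r i))) ` ren Suc ` T = ren Suc ` ren r ` T"
    by (simp add: image_image ren_ren)
  with ForallI.IH[of "case_nat 0 (\<lambda>i. Suc (r i))"] show ?case by (auto intro: derives.ForallI)
next
  case (ForallE T p x) then show ?case by (simp add: ren_instantiate derives.ForallE)
next
  case (EqualE T x y p) then show ?case by (metis derives.EqualE ren.simps(3) ren_instantiate)
qed (auto intro: derives.intros)

lemma derives_finite: "T \<turnstile> p \<Longrightarrow> \<exists>T'. finite T' \<and> T' \<subseteq> T \<and> T' \<turnstile> p"
proof (induction rule: derives.induct)
  case (Assume p T)
  show ?case by (rule exI[of _ "{p}"]) (auto intro: derives.Assume Assume)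
next
  case (ImplI p T q)
  then obtain T' where T': "finite T'" "T' \<subseteq> insert p T" "T' \<turnstile> q" by blast
  have "insert p (T' - {p}) \<turnstile> q" by (rule derives_weaken[OF T'(3)]) auto
  with T' show ?case by (intro exI[of _ "T' - {p}"]) (auto intro: derives.ImplI)
next
  case (ImplE T p q)
  then obtain A B where "finite A" "A \<subseteq> T" "A \<turnstile> Impl p q" "finite B" "B \<subseteq> T" "B \<turnstile> p" by blast
  then show ?case
    by (intro exI[of _ "A \<union> B"]) (auto intro: derives.ImplE[where p = p] derives_weaken)
next
  case (Contradiction p T)
  then obtain T' where T': "finite T'" "T' \<subseteq> insert (Impl p Falsum) T" "T' \<turnstile> Falsum" by blast
  have "insert (Impl p Falsum) (T' - {Impl p Falsum}) \<turnstile> Falsum"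
    by (rule derives_weaken[OF T'(3)]) auto
  with T' show ?case
    by (intro exI[of _ "T' - {Impl p Falsum}"]) (auto intro: derives.Contradiction)
next
  case (ForallI T p)
  then obtain T' where "finite T'" "T' \<subseteq> ren Suc ` T" "T' \<turnstile> p" by blast
  then show ?case by (metis finite_subset_image derives.ForallI)
next
  case (EqualE T x y p)
  then obtain A B where "finite A" "A \<subseteq> T" "A \<turnstile> Equal x y" "finite B" "B \<subseteq> T"
    "B \<turnstile> instantiate x p" by blast
  then show ?case
    by (intro exI[of _ "A \<union> B"]) (auto intro: derives.EqualE[where x = x] derives_weaken)
next
  case (ForallE T p x)
  then show ?case by (meson derives.ForallE)
next
  case (EqualI T x)
  show ?case by (rule exI[of _ "{}"]) (auto intro: derives.EqualI)
qed

lemma derives_cut: "insert p T \<turnstile> q \<Longrightarrow> T \<turnstile> p \<Longrightarrow> T \<turnstile> q"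
  by (meson derives.ImplI derives.ImplE)

text \<open>This is the eigenvariable rule for a variable \<open>x\<close> absent from the
  assumptions: either \<open>x\<close> exceeds all free indices, or it is odd while only even ones
  occur. The renaming that moves \<open>x\<close> to 0 and shifts the others then acts on the
  assumptions as \<open>ren Suc\<close>.\<close>

lemma derives_generalize:
  assumes "T \<turnstile> instantiate x p" and "\<forall>q\<in>T. free_bound q \<le> x \<or> odd x \<and> q \<in> range (ren ((*) 2))"
    and "free_bound p \<le> Suc x"
  shows "T \<turnstile> Forall p"
proof -
  define r where "r = (\<lambda>i. if i = x then 0 else Suc i)"
  have "ren r q = ren Suc q" if q: "q \<in> T" for q
  proof -
    consider "free_bound q \<le> x" | q' where "odd x" "q = ren ((*) 2) q'"
      using assms(2) q by blast
    then show ?thesis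
    proof cases
      case 1
      then show ?thesis by (intro ren_cong) (auto simp: r_def)
    next
      case 2
      then show ?thesis by (auto simp: ren_ren r_def intro!: ren_cong)
    qed
  qed
  then have T: "ren r ` T = ren Suc ` T" by (auto intro: image_cong)
  have "ren r (instantiate x p) = ren (\<lambda>i. i) p"
    unfolding instantiate_def ren_ren
    using assms(3) by (intro ren_cong) (auto simp: r_def split: nat.split)
  with derives_ren[OF assms(1), of r] T have "ren Suc ` T \<turnstile> p" by simp
  then show ?thesis by (rule derives.ForallI)
qed

section \<open>Henkin's construction, with variables as witnesses\<close>

abbreviation Neg :: "fm \<Rightarrow> fm" where
  "Neg p \<equiv> Impl p Falsum"

definition consistent :: "fm set \<Rightarrow> bool" where
  "consistent T \<longleftrightarrow> \<not> T \<turnstile> Falsum"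

lemma consistent_mono: "consistent T \<Longrightarrow> S \<subseteq> T \<Longrightarrow> consistent S"
  unfolding consistent_def using derives_weaken by blast

instance fm :: countable by countable_datatype

text \<open>Oddness keeps the variable out of \<open>T\<close>, whose variables are even; the bound
  keeps it out of the finitely many formulas added so far. Without the parity an infinite
  \<open>T\<close> could use up all variables.\<close>

definition fresh :: "fm set \<Rightarrow> nat" where
  "fresh X = (SOME x. odd x \<and> (\<forall>p\<in>X. free_bound p \<le> x))"

lemma fresh: "finite X \<Longrightarrow> odd (fresh X) \<and> (\<forall>p\<in>X. free_bound p \<le> fresh X)"
proof -
  assume "finite X"
  then have "\<exists>x. \<forall>p\<in>X. free_bound p \<le> x"
    by (meson finite_imageI finite_nat_set_iff_bounded_le imageI)
  then obtain x where "\<forall>p\<in>X. free_bound p \<le> x" ..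
  then have "odd (Suc (2 * x)) \<and> (\<forall>p\<in>X. free_bound p \<le> Suc (2 * x))" by force
  then show ?thesis unfolding fresh_def by (rule someI)
qed

fun witnesses :: "nat \<Rightarrow> fm \<Rightarrow> fm set" where
  "witnesses x (Impl (Forall q) Falsum) = {Neg (instantiate x q)}"
| "witnesses x _ = {}"

lemma finite_witnesses: "finite (witnesses x p)"
  by (induction x p rule: witnesses.induct) auto

text \<open>Stage \<open>n\<close> decides the formula with number \<open>n\<close>, so completion
  and witnessing happen in one pass. \<open>T\<close> is kept outside the stages, which stay finite
  and therefore leave fresh variables.\<close>

primrec henkin :: "fm set \<Rightarrow> fm set \<Rightarrow> nat \<Rightarrow> fm set" where
  "henkin T S 0 = S"
| "henkin T S (Suc n) =
    (let X = insert (from_nat n) (henkin T S n)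
     in if consistent (T \<union> X) then X \<union> witnesses (fresh X) (from_nat n) else henkin T S n)"

lemma finite_henkin: "finite S \<Longrightarrow> finite (henkin T S n)"
  by (induction n) (auto simp: Let_def finite_witnesses)

text \<open>If the witness produced an inconsistency, \<open>T\<close> and \<open>X\<close> would
  prove the instance at a fresh variable, hence the universal formula whose negation lies in
  \<open>X\<close>.\<close>

lemma consistent_witnesses:
  assumes T: "T \<subseteq> range (ren ((*) 2))" and X: "finite X" "p \<in> X" and con: "consistent (T \<union> X)"
  shows "consistent (T \<union> (X \<union> witnesses (fresh X) p))"
proof (cases "\<exists>q. p = Neg (Forall q)")
  case True
  then obtain q where p: "p = Neg (Forall q)" by blast
  show ?thesis
  proof (rule ccontr)
    assume "\<not> ?thesis"
    then have "insert (Neg (instantiate (fresh X) q)) (T \<union> X) \<turnstile> Falsum"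
      by (simp add: consistent_def p)
    then have "T \<union> X \<turnstile> instantiate (fresh X) q" by (rule derives.Contradiction)
    moreover have "\<forall>q\<in>T \<union> X. free_bound q \<le> fresh X \<or> odd (fresh X) \<and> q \<in> range (ren ((*) 2))"
      using T fresh[OF X(1)] by blast
    moreover have "free_bound q \<le> Suc (fresh X)" using fresh[OF X(1)] X(2) p by fastforce
    ultimately have "T \<union> X \<turnstile> Forall q" by (rule derives_generalize)
    moreover have "T \<union> X \<turnstile> Neg (Forall q)" using X p by (intro derives.Assume) auto
    ultimately show False using con derives.ImplE consistent_def by blast
  qed
next
  case False
  then have "witnesses (fresh X) p = {}"
    by (cases "(fresh X, p)" rule: witnesses.cases) auto
  with con show ?thesis by simp
qed

lemma consistent_henkin:
  assumes "T \<subseteq> range (ren ((*) 2))" "finite S" "consistent (T \<union> S)"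
  shows "consistent (T \<union> henkin T S n)"
proof (induction n)
  case (Suc n)
  define X where "X = insert (from_nat n) (henkin T S n)"
  have "finite X" by (simp add: X_def finite_henkin assms)
  then have "consistent (T \<union> (X \<union> witnesses (fresh X) (from_nat n)))" if "consistent (T \<union> X)"
    using assms that by (intro consistent_witnesses) (auto simp: X_def)
  with Suc show ?case by (auto simp: Let_def X_def[symmetric])
qed (use assms in auto)

lemma henkin_mono: "m \<le> n \<Longrightarrow> henkin T S m \<subseteq> henkin T S n"
proof -
  have "henkin T S n \<subseteq> henkin T S (Suc n)" for n by (auto simp: Let_def)
  then show "m \<le> n \<Longrightarrow> henkin T S m \<subseteq> henkin T S n" by (rule lift_Suc_mono_le)
qed

definition henkin_set :: "fm set \<Rightarrow> fm set \<Rightarrow> fm set" where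
  "henkin_set T S = T \<union> (\<Union>n. henkin T S n)"

context
  fixes T S :: "fm set"
  assumes even_variables: "T \<subseteq> range (ren ((*) 2))" and fin: "finite S" and con: "consistent (T \<union> S)"
begin

abbreviation (input) H where "H \<equiv> henkin_set T S"

lemma henkin_finite_subset: "finite X \<Longrightarrow> X \<subseteq> H \<Longrightarrow> \<exists>n. X \<subseteq> T \<union> henkin T S n"
proof (induction rule: finite_induct)
  case (insert x X)
  then obtain n where n: "X \<subseteq> T \<union> henkin T S n" by auto
  from insert.prems obtain m where m: "x \<in> T \<union> henkin T S m" by (auto simp: henkin_set_def)
  have "henkin T S m \<subseteq> henkin T S (max m n)" "henkin T S n \<subseteq> henkin T S (max m n)"
    by (auto intro!: henkin_mono)
  with n m show ?case by (intro exI[of _ "max m n"]) auto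
qed auto

lemma consistent_henkin_set: "consistent H"
proof (rule ccontr)
  assume "\<not> ?thesis"
  then obtain X where X: "finite X" "X \<subseteq> H" "X \<turnstile> Falsum"
    using derives_finite[of H Falsum] by (auto simp: consistent_def)
  then obtain n where "X \<subseteq> T \<union> henkin T S n" using henkin_finite_subset by blast
  with X consistent_henkin[OF even_variables fin con, of n] show False
    unfolding consistent_def using derives_weaken by blast
qed

text \<open>A formula consistent with the limit was consistent with the stage at which its number
  came up, and was accepted there.\<close>

lemma henkin_set_maximal: "consistent (insert p H) \<Longrightarrow> p \<in> H"
proof -
  assume c: "consistent (insert p H)"
  let ?X = "insert p (henkin T S (to_nat p))"
  have "T \<union> ?X \<subseteq> insert p H" by (auto simp: henkin_set_def)
  then have "consistent (T \<union> ?X)" by (rule consistent_mono[OF c])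
  then have "p \<in> henkin T S (Suc (to_nat p))" by (simp add: Let_def)
  then show "p \<in> H" unfolding henkin_set_def by blast
qed

lemma henkin_set_derives: "H \<turnstile> p \<longleftrightarrow> p \<in> H"
proof
  assume p: "H \<turnstile> p"
  show "p \<in> H"
  proof (rule henkin_set_maximal, rule ccontr)
    assume "\<not> consistent (insert p H)"
    then have "H \<turnstile> Falsum" using p derives_cut by (auto simp: consistent_def)
    then show False using consistent_henkin_set by (simp add: consistent_def)
  qed
qed (rule derives.Assume)

lemma henkin_set_Falsum: "Falsum \<notin> H"
  using consistent_henkin_set henkin_set_derives by (simp add: consistent_def)

lemma henkin_set_Neg: "p \<notin> H \<Longrightarrow> Neg p \<in> H"
  using henkin_set_maximal[of p] henkin_set_derives derives.ImplI by (auto simp: consistent_def)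

lemma henkin_set_Impl: "Impl p q \<in> H \<longleftrightarrow> (p \<in> H \<longrightarrow> q \<in> H)"
proof
  assume r: "p \<in> H \<longrightarrow> q \<in> H"
  show "Impl p q \<in> H"
  proof (cases "p \<in> H")
    case True
    with r have "insert p H \<turnstile> q" by (intro derives.Assume) auto
    then show ?thesis using henkin_set_derives derives.ImplI by blast
  next
    case False
    then have "insert p H \<turnstile> Neg p" by (intro derives.Assume) (auto simp: henkin_set_Neg)
    then have "insert p H \<turnstile> Falsum" by (rule derives.ImplE) (auto intro: derives.Assume)
    then have "insert p H \<turnstile> q" using derives.Contradiction derives_weaken subset_insertI by blast
    then show ?thesis using henkin_set_derives derives.ImplI by blast
  qed
qed (use henkin_set_derives derives.ImplE in blast)

lemma henkin_set_Forall: "Forall p \<in> H \<longleftrightarrow> (\<forall>x. instantiate x p \<in> H)"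
proof
  assume all: "\<forall>x. instantiate x p \<in> H"
  show "Forall p \<in> H"
  proof (rule ccontr)
    assume "Forall p \<notin> H"
    then have N: "Neg (Forall p) \<in> H" by (rule henkin_set_Neg)
    let ?n = "to_nat (Neg (Forall p))"
    let ?X = "insert (Neg (Forall p)) (henkin T S ?n)"
    have "T \<union> ?X \<subseteq> H" using N by (auto simp: henkin_set_def)
    then have "consistent (T \<union> ?X)" using consistent_henkin_set consistent_mono by blast
    then have "Neg (instantiate (fresh ?X) p) \<in> henkin T S (Suc ?n)" by (simp add: Let_def)
    then have "Neg (instantiate (fresh ?X) p) \<in> H" unfolding henkin_set_def by blast
    with all henkin_set_Impl henkin_set_Falsum show False by blast
  qed
qed (use henkin_set_derives derives.ForallE in blast)

lemma henkin_set_Equal_refl: "Equal x x \<in> H"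
  using henkin_set_derives derives.EqualI by blast

lemma henkin_set_replace: "Equal x y \<in> H \<Longrightarrow> instantiate x p \<in> H \<Longrightarrow> instantiate y p \<in> H"
  using henkin_set_derives derives.EqualE by blast

lemma henkin_set_Equal_sym: "Equal x y \<in> H \<Longrightarrow> Equal y x \<in> H"
  using henkin_set_replace[of x y "Equal 0 (Suc x)"] henkin_set_Equal_refl
  by (simp add: instantiate_def)

lemma henkin_set_Equal_trans: "Equal x y \<in> H \<Longrightarrow> Equal y z \<in> H \<Longrightarrow> Equal x z \<in> H"
  using henkin_set_replace[of y z "Equal (Suc x) 0"] by (simp add: instantiate_def)

text \<open>Least representatives in place of equivalence classes keep the domain inside
  \<open>nat\<close>.\<close>

definition rep :: "nat \<Rightarrow> nat" where
  "rep x = (LEAST y. Equal x y \<in> H)"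

lemma Equal_rep: "Equal x (rep x) \<in> H"
  unfolding rep_def by (rule LeastI[of _ x]) (rule henkin_set_Equal_refl)

lemma rep_eq: "rep x = rep y \<longleftrightarrow> Equal x y \<in> H"
proof
  assume "rep x = rep y"
  then show "Equal x y \<in> H"
    using Equal_rep[of x] Equal_rep[of y] henkin_set_Equal_sym henkin_set_Equal_trans by metis
next
  assume "Equal x y \<in> H"
  then have "(\<lambda>z. Equal x z \<in> H) = (\<lambda>z. Equal y z \<in> H)"
    using henkin_set_Equal_sym henkin_set_Equal_trans by blast
  then show "rep x = rep y" by (simp add: rep_def)
qed

lemma Member_rep: "Member (rep x) (rep y) \<in> H \<longleftrightarrow> Member x y \<in> H"
proof -
  have "Member x' y' \<in> H" if "Equal x x' \<in> H" "Equal y y' \<in> H" "Member x y \<in> H" for x y x' y'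
    using that henkin_set_replace[of x x' "Member 0 (Suc y)"]
      henkin_set_replace[of y y' "Member (Suc x') 0"] by (simp add: instantiate_def)
  with Equal_rep henkin_set_Equal_sym show ?thesis by blast
qed

text \<open>Carrying a renaming \<open>s\<close> lets the induction pass under a quantifier: every
  value of the bound variable is represented by a variable, which is absorbed into
  \<open>s\<close>.\<close>

lemma henkin_truth:
  "sat (range rep) (\<lambda>x y. Member x y \<in> H) (\<lambda>i. rep (s i)) p \<longleftrightarrow> ren s p \<in> H"
proof (induction p arbitrary: s)
  case (Forall p)
  have "case_nat (rep x) (\<lambda>i. rep (s i)) = (\<lambda>i. rep (case_nat x s i))" for x
    by (auto simp: fun_eq_iff split: nat.split)
  moreover have "instantiate x (ren (case_nat 0 (\<lambda>i. Suc (s i))) p) = ren (case_nat x s) p" for x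
    unfolding instantiate_def ren_ren
    by (rule arg_cong[where f = "\<lambda>s. ren s p"]) (auto simp: fun_eq_iff split: nat.split)
  ultimately show ?case by (simp add: henkin_set_Forall Forall.IH)
qed (auto simp: henkin_set_Falsum henkin_set_Impl Member_rep rep_eq)

end

lemma sat_bij:
  assumes "bij_betw h UNIV D" "\<And>x y. E' x y \<longleftrightarrow> E (h x) (h y)"
  shows "sat UNIV E' e p \<longleftrightarrow> sat D E (\<lambda>i. h (e i)) p"
proof (induction p arbitrary: e)
  case (Forall p)
  have "(\<lambda>i. h (case_nat a e i)) = case_nat (h a) (\<lambda>i. h (e i))" for a
    by (auto simp: fun_eq_iff split: nat.split)
  moreover have "D = range h" using assms(1) by (simp add: bij_betw_def)
  ultimately show ?case by (simp add: Forall.IH)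
qed (use assms in \<open>auto simp: bij_betw_def inj_eq\<close>)

text \<open>The Henkin model lives on a set of representatives inside \<open>nat\<close>. Being
  infinite, this set is in bijection with \<open>nat\<close>, so the premise on \<open>p\<close> is
  only called upon where the domain is the whole type, as in the locales below.\<close>

lemma completeness_even:
  assumes T: "T \<subseteq> range (ren ((*) 2))"
    and infinite: "\<And>D (E :: nat \<Rightarrow> nat \<Rightarrow> bool) e. range e \<subseteq> D \<Longrightarrow> \<forall>q\<in>T. sat D E e q \<Longrightarrow> infinite D"
    and p: "\<And>(E :: nat \<Rightarrow> nat \<Rightarrow> bool) e. \<forall>q\<in>T. sat UNIV E e q \<Longrightarrow> sat UNIV E e p"
  shows "T \<turnstile> p"
proof (rule ccontr)
  assume "\<not> T \<turnstile> p"
  then have con: "consistent (T \<union> {Neg p})"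
    using derives.Contradiction[of p T] by (auto simp: consistent_def)
  let ?H = "henkin_set T {Neg p}"
  let ?rep = "rep T {Neg p}"
  let ?D = "range ?rep"
  let ?E = "\<lambda>x y. Member x y \<in> ?H"
  have truth: "sat ?D ?E ?rep q \<longleftrightarrow> q \<in> ?H" for q
    using henkin_truth[OF T _ con, of "\<lambda>i. i" q] by simp
  have "henkin T {Neg p} 0 \<subseteq> ?H" unfolding henkin_set_def by blast
  then have sub: "T \<subseteq> ?H" "Neg p \<in> ?H" by (auto simp: henkin_set_def)
  have "infinite ?D" using truth sub(1) by (intro infinite[of ?rep ?D ?E]) auto
  then obtain h :: "nat \<Rightarrow> nat" where h: "bij_betw h UNIV ?D"
    using bij_enumerate by blast
  define E' where "E' = (\<lambda>x y. ?E (h x) (h y))"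
  define e where "e = (\<lambda>i. inv h (?rep i))"
  have "h (e i) = ?rep i" for i
    unfolding e_def using h by (intro f_inv_into_f) (auto simp: bij_betw_def)
  then have "(\<lambda>i. h (e i)) = ?rep" by auto
  then have "sat UNIV E' e q \<longleftrightarrow> q \<in> ?H" for q
    using sat_bij[OF h, of E' ?E e q] truth by (simp add: E'_def)
  with p[of E' e] sub consistent_henkin_set[OF T _ con] henkin_set_Falsum[OF T _ con]
    henkin_set_Impl[OF T _ con, of p Falsum] show False by auto
qed

text \<open>Renaming the variables of \<open>T\<close> to even ones makes room for the Henkin witnesses.\<close>

theorem completeness:
  assumes infinite: "\<And>D (E :: nat \<Rightarrow> nat \<Rightarrow> bool) e. range e \<subseteq> D \<Longrightarrow> \<forall>q\<in>T. sat D E e q \<Longrightarrow> infinite D"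
    and p: "\<And>(E :: nat \<Rightarrow> nat \<Rightarrow> bool) e. \<forall>q\<in>T. sat UNIV E e q \<Longrightarrow> sat UNIV E e p"
  shows "T \<turnstile> p"
proof -
  have "ren ((*) 2) ` T \<turnstile> ren ((*) 2) p"
  proof (rule completeness_even)
    fix D and E :: "nat \<Rightarrow> nat \<Rightarrow> bool" and e
    assume e: "range e \<subseteq> D" "\<forall>q\<in>ren ((*) 2) ` T. sat D E e q"
    then have "range (\<lambda>i. e (2 * i)) \<subseteq> D" by blast
    with e(2) show "infinite D" by (intro infinite[of "\<lambda>i. e (2 * i)" D E]) auto
  next
    fix E :: "nat \<Rightarrow> nat \<Rightarrow> bool" and e
    assume "\<forall>q\<in>ren ((*) 2) ` T. sat UNIV E e q"
    then show "sat UNIV E e (ren ((*) 2) p)" using p[of E "\<lambda>i. e (2 * i)"] by simp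
  qed auto
  from derives_ren[OF this, of "\<lambda>i. i div 2"] show ?thesis by (simp add: image_image ren_ren)
qed

section \<open>Evaluation of formulas with named variables\<close>

text \<open>The variable of level \<open>x\<close> takes the value \<open>v x\<close>, and the free index \<open>i\<close> the value \<open>w i\<close>.\<close>

definition holds ::
  "'a set \<Rightarrow> ('a \<Rightarrow> 'a \<Rightarrow> bool) \<Rightarrow> (nat \<Rightarrow> 'a) \<Rightarrow> nat \<Rightarrow> (nat \<Rightarrow> 'a) \<Rightarrow> form \<Rightarrow> bool" where
  "holds D E w n v P = sat D E (\<lambda>j. if j < n then v (n - 1 - j) else w (j - n)) (P n)"

lemma holds_False [simp]: "holds D E w n v \<^bold>\<bottom> \<longleftrightarrow> False"
  by (simp add: holds_def fFalse_def)

lemma holds_Mem [simp]: "x < n \<Longrightarrow> y < n \<Longrightarrow> holds D E w n v (x \<^bold>\<in> y) \<longleftrightarrow> E (v x) (v y)"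
  by (simp add: holds_def fMem_def)

lemma holds_Eq [simp]: "x < n \<Longrightarrow> y < n \<Longrightarrow> holds D E w n v (x \<^bold>= y) \<longleftrightarrow> v x = v y"
  by (simp add: holds_def fEq_def)

lemma holds_Imp [simp]:
  "holds D E w n v (P \<^bold>\<longrightarrow> Q) \<longleftrightarrow> (holds D E w n v P \<longrightarrow> holds D E w n v Q)"
  by (simp add: holds_def fImp_def)

lemma holds_Not [simp]: "holds D E w n v (\<^bold>\<not> P) \<longleftrightarrow> \<not> holds D E w n v P"
  by (simp add: fNot_def)

lemma holds_And [simp]:
  "holds D E w n v (P \<^bold>\<and> Q) \<longleftrightarrow> holds D E w n v P \<and> holds D E w n v Q"
  by (simp add: fAnd_def)

lemma holds_Or [simp]:
  "holds D E w n v (P \<^bold>\<or> Q) \<longleftrightarrow> holds D E w n v P \<or> holds D E w n v Q"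
  by (auto simp add: fOr_def)

lemma holds_Iff [simp]:
  "holds D E w n v (P \<^bold>\<longleftrightarrow> Q) \<longleftrightarrow> (holds D E w n v P \<longleftrightarrow> holds D E w n v Q)"
  by (auto simp add: fIff_def)

lemma holds_All [simp]:
  "holds D E w n v (fAll P) \<longleftrightarrow> (\<forall>a\<in>D. holds D E w (Suc n) (v(n := a)) (P n))"
proof -
  have "case_nat a (\<lambda>j. if j < n then v (n - 1 - j) else w (j - n))
      = (\<lambda>j. if j < Suc n then (v(n := a)) (Suc n - 1 - j) else w (j - Suc n))" for a
    by (auto simp: fun_eq_iff split: nat.split)
  then show ?thesis by (simp add: holds_def fAll_def)
qed

lemma holds_Ex [simp]:
  "holds D E w n v (fEx P) \<longleftrightarrow> (\<exists>a\<in>D. holds D E w (Suc n) (v(n := a)) (P n))"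
  by (simp add: fEx_def)

lemma holds_Ball [simp]:
  "x < n \<Longrightarrow> holds D E w n v (fBall x P) \<longleftrightarrow>
    (\<forall>a\<in>D. E a (v x) \<longrightarrow> holds D E w (Suc n) (v(n := a)) (P n))"
  by (simp add: fBall_def)

lemma holds_Bex [simp]:
  "x < n \<Longrightarrow> holds D E w n v (fBex x P) \<longleftrightarrow>
    (\<exists>a\<in>D. E a (v x) \<and> holds D E w (Suc n) (v(n := a)) (P n))"
  by (simp add: fBex_def)

lemma holds_Ex1 [simp]:
  "holds D E w n v (fEx1 P) \<longleftrightarrow>
    (\<exists>x\<in>D. \<forall>y\<in>D. holds D E w (Suc (Suc n)) (v(n := x, Suc n := y)) (P (Suc n)) \<longleftrightarrow> y = x)"
  by (simp add: fEx1_def)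

lemma holds_some_of_fAll [simp]:
  "holds D E w n v (some_of fAll P) \<longleftrightarrow> (\<exists>a\<in>D. holds D E w (Suc n) (v(n := a)) (P n))"
  by (simp add: some_of_def)

lemma holds_some_of_fBall [simp]:
  "x < n \<Longrightarrow> holds D E w n v (some_of (fBall x) P) \<longleftrightarrow>
    (\<exists>a\<in>D. E a (v x) \<and> holds D E w (Suc n) (v(n := a)) (P n))"
  by (simp add: some_of_def)

lemma holds_at1 [simp]: "x < n \<Longrightarrow> holds D E w n v (at1 p x) \<longleftrightarrow> sat D E (case_nat (v x) w) p"
  unfolding holds_def at1_def sat_ren
  by (rule arg_cong[where f = "\<lambda>e. sat D E e p"]) (auto simp: fun_eq_iff split: nat.split)

lemma holds_at2 [simp]:
  "x < n \<Longrightarrow> y < n \<Longrightarrow>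
    holds D E w n v (at2 p x y) \<longleftrightarrow> sat D E (case_nat (v x) (case_nat (v y) w)) p"
  unfolding holds_def at2_def sat_ren
  by (rule arg_cong[where f = "\<lambda>e. sat D E e p"]) (auto simp: fun_eq_iff split: nat.split)

lemma sat_holds: "sat D E e (P 0) \<longleftrightarrow> holds D E e 0 v P"
  by (simp add: holds_def)

section \<open>Iterated quantifiers and universal closures\<close>

lemma sat_Forall_funpow:
  "sat D E e ((Forall ^^ n) p) \<longleftrightarrow>
    (\<forall>a. (\<forall>i<n. a i \<in> D) \<longrightarrow> sat D E (\<lambda>i. if i < n then a i else e (i - n)) p)"
proof (induction n arbitrary: p)
  case (Suc n)
  have "sat D E e ((Forall ^^ Suc n) p) \<longleftrightarrow> (\<forall>a. (\<forall>i<n. a i \<in> D) \<longrightarrow>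
      (\<forall>b\<in>D. sat D E (case_nat b (\<lambda>i. if i < n then a i else e (i - n))) p))"
    using Suc[of "Forall p"] by (simp only: funpow_Suc_right o_apply sat.simps)
  also have "\<dots> \<longleftrightarrow> (\<forall>a. (\<forall>i<Suc n. a i \<in> D) \<longrightarrow>
      sat D E (\<lambda>i. if i < Suc n then a i else e (i - Suc n)) p)" (is "?L \<longleftrightarrow> ?R")
  proof
    assume L: ?L
    show ?R
    proof (intro allI impI)
      fix a assume a: "\<forall>i<Suc n. a i \<in> D"
      then have "sat D E (case_nat (a 0) (\<lambda>i. if i < n then a (Suc i) else e (i - n))) p"
        using L by (auto dest: spec[of _ "\<lambda>i. a (Suc i)"])
      moreover have "case_nat (a 0) (\<lambda>i. if i < n then a (Suc i) else e (i - n))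
          = (\<lambda>i. if i < Suc n then a i else e (i - Suc n))"
        by (auto simp: fun_eq_iff split: nat.split)
      ultimately show "sat D E (\<lambda>i. if i < Suc n then a i else e (i - Suc n)) p" by simp
    qed
  next
    assume R: ?R
    show ?L
    proof (intro allI impI ballI)
      fix a b assume a: "\<forall>i<n. a i \<in> D" and b: "b \<in> D"
      then have "\<forall>i<Suc n. case_nat b a i \<in> D" by (auto split: nat.split)
      with R have "sat D E (\<lambda>i. if i < Suc n then case_nat b a i else e (i - Suc n)) p" by blast
      moreover have "(\<lambda>i. if i < Suc n then case_nat b a i else e (i - Suc n))
          = case_nat b (\<lambda>i. if i < n then a i else e (i - n))"
        by (auto simp: fun_eq_iff split: nat.split)
      ultimately show "sat D E (case_nat b (\<lambda>i. if i < n then a i else e (i - n))) p" by simp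
    qed
  qed
  finally show ?case .
qed simp

lemma sat_closure:
  assumes "range e \<subseteq> D"
  shows "sat D E e (closure p) \<longleftrightarrow> (\<forall>w. range w \<subseteq> D \<longrightarrow> sat D E w p)"
proof -
  have "sat D E (\<lambda>i. if i < free_bound p then a i else e (i - free_bound p)) p = sat D E a p" for a
    by (rule sat_cong) simp
  then have "sat D E e (closure p) \<longleftrightarrow> (\<forall>a. (\<forall>i<free_bound p. a i \<in> D) \<longrightarrow> sat D E a p)"
    by (simp add: closure_def sat_Forall_funpow)
  also have "\<dots> \<longleftrightarrow> (\<forall>w. range w \<subseteq> D \<longrightarrow> sat D E w p)"
  proof
    assume R: "\<forall>w. range w \<subseteq> D \<longrightarrow> sat D E w p"
    show "\<forall>a. (\<forall>i<free_bound p. a i \<in> D) \<longrightarrow> sat D E a p"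
    proof (intro allI impI)
      fix a assume a: "\<forall>i<free_bound p. a i \<in> D"
      \<comment> \<open>Beyond the free indices any value in \<open>D\<close> will do;
        \<open>e 0\<close> is one at hand.\<close>
      let ?w = "\<lambda>i. if i < free_bound p then a i else e 0"
      have "range ?w \<subseteq> D" using a assms by auto
      with R have "sat D E ?w p" by blast
      moreover have "sat D E ?w p = sat D E a p" by (rule sat_cong) simp
      ultimately show "sat D E a p" by simp
    qed
  qed auto
  finally show ?thesis .
qed


section \<open>Definable predicates\<close>

text \<open>Interleaving leaves infinitely many places for variables and for parameters, so formulas
  combine without keeping track of bounds on their free indices.\<close>

definition mix :: "(nat \<Rightarrow> 'a) \<Rightarrow> (nat \<Rightarrow> 'a) \<Rightarrow> nat \<Rightarrow> 'a" where
  "mix e c i = (if even i then e (i div 2) else c (i div 2))"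

lemma mix_simps [simp]: "mix e c (2 * i) = e i" "mix e c (Suc (2 * i)) = c i"
  by (auto simp: mix_def)

text \<open>The parameters \<open>c\<close> occupy the odd indices of the environment.\<close>

definition Def :: "'a set \<Rightarrow> ('a \<Rightarrow> 'a \<Rightarrow> bool) \<Rightarrow> ((nat \<Rightarrow> 'a) \<Rightarrow> bool) \<Rightarrow> bool" where
  "Def D E P \<longleftrightarrow>
    (\<exists>p c. range c \<subseteq> D \<and> (\<forall>e. range e \<subseteq> D \<longrightarrow> (P e \<longleftrightarrow> sat D E (mix e c) p)))"

text \<open>Terms are handled through their graphs, with the value at index 0. That the value lies
  in \<open>D\<close> is what allows a quantifier over \<open>D\<close> to introduce it.\<close>

definition TDef :: "'a set \<Rightarrow> ('a \<Rightarrow> 'a \<Rightarrow> bool) \<Rightarrow> ((nat \<Rightarrow> 'a) \<Rightarrow> 'a) \<Rightarrow> bool" where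
  "TDef D E t \<longleftrightarrow>
    (\<forall>e. range e \<subseteq> D \<longrightarrow> t e \<in> D) \<and> Def D E (\<lambda>e. e 0 = t (\<lambda>i. e (Suc i)))"

lemma range_case_nat [simp]: "range (case_nat a e) \<subseteq> D \<longleftrightarrow> a \<in> D \<and> range e \<subseteq> D"
proof -
  have "range (case_nat a e) = insert a (range e)"
  proof
    show "insert a (range e) \<subseteq> range (case_nat a e)"
      using rangeI[of "case_nat a e" 0] rangeI[of "case_nat a e" "Suc _"] by auto
  qed (auto split: nat.splits)
  then show ?thesis by simp
qed

lemma DefI:
  assumes "range c \<subseteq> D" "\<And>e. range e \<subseteq> D \<Longrightarrow> P e \<longleftrightarrow> sat D E (mix e c) p"
  shows "Def D E P"
  using assms unfolding Def_def by blast

lemma Def_cong: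
  assumes "Def D E P" "\<And>e. range e \<subseteq> D \<Longrightarrow> P e \<longleftrightarrow> Q e"
  shows "Def D E Q"
  using assms unfolding Def_def by (metis (no_types, lifting))

lemma Def_Falsum: "D \<noteq> {} \<Longrightarrow> Def D E (\<lambda>e. False)"
  by (rule DefI[of "\<lambda>_. SOME x. x \<in> D" _ _ _ Falsum]) (auto simp: some_in_eq)

lemma Def_imp:
  assumes "Def D E P" "Def D E Q"
  shows "Def D E (\<lambda>e. P e \<longrightarrow> Q e)"
proof -
  obtain p c where p: "range c \<subseteq> D" "\<And>e. range e \<subseteq> D \<Longrightarrow> P e \<longleftrightarrow> sat D E (mix e c) p"
    using assms(1) unfolding Def_def by blast
  obtain q d where q: "range d \<subseteq> D" "\<And>e. range e \<subseteq> D \<Longrightarrow> Q e \<longleftrightarrow> sat D E (mix e d) q"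
    using assms(2) unfolding Def_def by blast
  \<comment> \<open>Parameter \<open>i\<close> of the first formula sits at index
    \<open>2i + 1\<close> and becomes parameter \<open>2i\<close> of \<open>mix c d\<close>, hence
    index \<open>4i + 1\<close>; that of the second becomes parameter \<open>2i + 1\<close>, hence
    index \<open>4i + 3\<close>.\<close>
  define r where "r = (\<lambda>i::nat. if even i then i else Suc (4 * (i div 2)))"
  define s where "s = (\<lambda>i::nat. if even i then i else Suc (4 * (i div 2) + 2))"
  have "mix e (mix c d) (r i) = mix e c i" "mix e (mix c d) (s i) = mix e d i" for e i
    unfolding r_def s_def by (auto simp: mix_def elim!: oddE)
  moreover have "range (mix c d) \<subseteq> D" using p(1) q(1) by (auto simp: mix_def)
  ultimately show ?thesis
    using p(2) q(2)
    by (intro DefI[of "mix c d" _ _ _ "Impl (ren r p) (ren s q)"]) auto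
qed

lemma Def_ren:
  assumes "Def D E P"
  shows "Def D E (\<lambda>e. P (\<lambda>i. e (g i)))"
proof -
  obtain p c where p: "range c \<subseteq> D" "\<And>e. range e \<subseteq> D \<Longrightarrow> P e \<longleftrightarrow> sat D E (mix e c) p"
    using assms unfolding Def_def by blast
  define r where "r = (\<lambda>i::nat. if even i then 2 * g (i div 2) else i)"
  have "(\<lambda>i. mix e c (r i)) = mix (\<lambda>i. e (g i)) c" for e
    unfolding r_def by (auto simp: mix_def fun_eq_iff)
  moreover have "range (\<lambda>i. e (g i)) \<subseteq> D" if "range e \<subseteq> D" for e using that by auto
  ultimately show ?thesis using p by (intro DefI[of c _ _ _ "ren r p"]) auto
qed

lemma Def_all:
  assumes "Def D E (\<lambda>e. P (e 0) (\<lambda>i. e (Suc i)))"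
  shows "Def D E (\<lambda>e. \<forall>x\<in>D. P x e)"
proof -
  obtain p c where p: "range c \<subseteq> D"
    "\<And>e. range e \<subseteq> D \<Longrightarrow> P (e 0) (\<lambda>i. e (Suc i)) \<longleftrightarrow> sat D E (mix e c) p"
    using assms unfolding Def_def by blast
  \<comment> \<open>The variable bound by \<open>Forall\<close> shifts all of \<open>mix e c\<close>
    by one place, while in \<open>mix (case_nat a e) c\<close> it shifts the variables by two and
    the parameters not at all. Hence even indices are lowered and odd ones raised by one.\<close>
  define r where "r = (\<lambda>i::nat. if i = 0 then 0 else if even i then i - 1 else Suc i)"
  have r: "(\<lambda>i. case_nat a (mix e c) (r i)) = mix (case_nat a e) c" for a e
  proof
    fix i
    show "case_nat a (mix e c) (r i) = mix (case_nat a e) c i"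
    proof (cases "even i")
      case True
      then obtain j where "i = 2 * j" by blast
      then show ?thesis by (cases j) (auto simp: r_def mix_def)
    next
      case False
      then show ?thesis by (auto simp: r_def mix_def)
    qed
  qed
  have "P x e \<longleftrightarrow> sat D E (mix (case_nat x e) c) p" if "range e \<subseteq> D" "x \<in> D" for x e
    using p(2)[of "case_nat x e"] that by simp
  with p(1) show ?thesis
    by (intro DefI[of c _ _ _ "Forall (ren r p)"]) (auto simp: r)
qed

lemma Def_not: "Def D E P \<Longrightarrow> D \<noteq> {} \<Longrightarrow> Def D E (\<lambda>e. \<not> P e)"
  using Def_imp[OF _ Def_Falsum] by auto

lemma Def_nonempty: "Def D E P \<Longrightarrow> D \<noteq> {}"
  unfolding Def_def by auto

lemma Def_neg: "Def D E P \<Longrightarrow> Def D E (\<lambda>e. \<not> P e)"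
  using Def_not Def_nonempty by blast

lemma Def_and: "Def D E P \<Longrightarrow> Def D E Q \<Longrightarrow> Def D E (\<lambda>e. P e \<and> Q e)"
  using Def_neg[OF Def_imp[OF _ Def_neg], of D E P Q] by simp

lemma Def_or: "Def D E P \<Longrightarrow> Def D E Q \<Longrightarrow> Def D E (\<lambda>e. P e \<or> Q e)"
  using Def_imp[OF Def_neg, of D E P Q] by (simp add: disj_imp)

lemma Def_iff: "Def D E P \<Longrightarrow> Def D E Q \<Longrightarrow> Def D E (\<lambda>e. P e \<longleftrightarrow> Q e)"
  using Def_and[OF Def_imp[of D E P Q] Def_imp[of D E Q P]] by (simp add: iff_conv_conj_imp)

lemma Def_ex: "Def D E (\<lambda>e. P (e 0) (\<lambda>i. e (Suc i))) \<Longrightarrow> Def D E (\<lambda>e. \<exists>x\<in>D. P x e)"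
  using Def_neg[OF Def_all[OF Def_neg[of D E "\<lambda>e. P (e 0) (\<lambda>i. e (Suc i))"]]] by simp

section \<open>Terms with definable graphs\<close>

lemma TDef_mem: "TDef D E t \<Longrightarrow> range e \<subseteq> D \<Longrightarrow> t e \<in> D"
  unfolding TDef_def by blast

lemma TDef_ren:
  assumes "TDef D E t"
  shows "TDef D E (\<lambda>e. t (\<lambda>i. e (g i)))"
proof -
  have "Def D E (\<lambda>e. e 0 = t (\<lambda>i. e (Suc i)))" using assms unfolding TDef_def by blast
  from Def_ren[OF this, of "case_nat 0 (\<lambda>i. Suc (g i))"]
  have "Def D E (\<lambda>e. e 0 = t (\<lambda>i. e (Suc (g i))))" by simp
  moreover have "range (\<lambda>i. e (g i)) \<subseteq> D" if "range e \<subseteq> D" for e using that by auto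
  ultimately show ?thesis using assms unfolding TDef_def by simp
qed

text \<open>The value of the term is introduced by an existential quantifier and pinned down by the
  graph of \<open>t\<close>.\<close>

lemma Def_subst:
  assumes "Def D E (\<lambda>e. Q (e 0) (\<lambda>i. e (Suc i)))" "TDef D E t"
  shows "Def D E (\<lambda>e. Q (t e) e)"
proof (rule Def_cong[OF Def_ex[OF Def_and]])
  show "Def D E (\<lambda>e. e 0 = t (\<lambda>i. e (Suc i)))" using assms(2) unfolding TDef_def by blast
  show "Def D E (\<lambda>e. Q (e 0) (\<lambda>i. e (Suc i)))" by (rule assms)
qed (use TDef_mem[OF assms(2)] in auto)

lemma Def_atoms:
  assumes "D \<noteq> {}"
  shows "Def D E (\<lambda>e. E (e i) (e j))" "Def D E (\<lambda>e. e i = e j)"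
proof -
  obtain c where "c \<in> D" using assms by blast
  then show "Def D E (\<lambda>e. E (e i) (e j))" "Def D E (\<lambda>e. e i = e j)"
    by (auto intro: DefI[of "\<lambda>_. c" _ _ _ "Member (2 * i) (2 * j)"]
        DefI[of "\<lambda>_. c" _ _ _ "Equal (2 * i) (2 * j)"])
qed

lemma Def_Mem:
  assumes "TDef D E s" "TDef D E t"
  shows "Def D E (\<lambda>e. E (s e) (t e))"
proof -
  have "D \<noteq> {}" using assms(1) Def_nonempty unfolding TDef_def by blast
  then have "Def D E (\<lambda>e. E (e 0) (t (\<lambda>i. e (Suc i))))"
    by (intro Def_subst[where Q = "\<lambda>y e. E (e 0) y", OF _ TDef_ren[OF assms(2)]] Def_atoms)
  then show ?thesis by (rule Def_subst[OF _ assms(1)])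
qed

lemma Def_eq:
  assumes "TDef D E s" "TDef D E t"
  shows "Def D E (\<lambda>e. s e = t e)"
proof -
  have "D \<noteq> {}" using assms(1) Def_nonempty unfolding TDef_def by blast
  then have "Def D E (\<lambda>e. e 0 = t (\<lambda>i. e (Suc i)))"
    by (intro Def_subst[where Q = "\<lambda>y e. e 0 = y", OF _ TDef_ren[OF assms(2)]] Def_atoms)
  then show ?thesis by (rule Def_subst[OF _ assms(1)])
qed

lemma TDef_var: "D \<noteq> {} \<Longrightarrow> TDef D E (\<lambda>e. e i)"
  unfolding TDef_def by (auto intro: Def_atoms)

lemma TDef_const: "c \<in> D \<Longrightarrow> TDef D E (\<lambda>e. c)"
  unfolding TDef_def by (auto intro!: DefI[of "\<lambda>_. c" _ _ _ "Equal 0 1"] simp: mix_def)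

lemma TDefI:
  assumes "\<And>e. range e \<subseteq> D \<Longrightarrow> t e \<in> D"
    and "\<And>e. range e \<subseteq> D \<Longrightarrow> R e \<longleftrightarrow> e 0 = t (\<lambda>i. e (Suc i))"
    and "Def D E R"
  shows "TDef D E t"
  unfolding TDef_def using assms(1) Def_cong[OF assms(3,2)] by simp

lemma Def_True: "D \<noteq> {} \<Longrightarrow> Def D E (\<lambda>e. True)"
  using Def_neg[OF Def_Falsum] by simp

lemma Def_all_UNIV: "Def UNIV E (\<lambda>e. P (e 0) (\<lambda>i. e (Suc i))) \<Longrightarrow> Def UNIV E (\<lambda>e. \<forall>x. P x e)"
  using Def_all[of UNIV] by simp

lemma Def_ex_UNIV: "Def UNIV E (\<lambda>e. P (e 0) (\<lambda>i. e (Suc i))) \<Longrightarrow> Def UNIV E (\<lambda>e. \<exists>x. P x e)"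
  using Def_ex[of UNIV] by simp

lemma TDef_UNIV: "TDef UNIV E (\<lambda>e. e i)" "TDef UNIV E (\<lambda>e. c)"
  by (auto intro: TDef_var TDef_const)

lemmas Def_connectives = Def_imp Def_neg Def_and Def_or Def_iff Def_Mem Def_eq

lemmas Def_UNIV = Def_connectives Def_all_UNIV Def_ex_UNIV TDef_UNIV

lemma Def_unary:
  assumes "Def D E (\<lambda>e. P (e 0))"
  obtains p w where "range w \<subseteq> D" "\<And>x. x \<in> D \<Longrightarrow> P x \<longleftrightarrow> sat D E (case_nat x w) p"
proof -
  obtain p c where p: "range c \<subseteq> D" "\<And>e. range e \<subseteq> D \<Longrightarrow> P (e 0) \<longleftrightarrow> sat D E (mix e c) p"
    using assms unfolding Def_def by blast
  \<comment> \<open>Only index 0 matters to \<open>P\<close>, so the environment may be taken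
    constant and all even indices collapse to 0.\<close>
  have mix: "(\<lambda>i. case_nat x c (if even i then 0 else Suc (i div 2))) = mix (\<lambda>_. x) c" for x
    by (auto simp: mix_def)
  have "P x \<longleftrightarrow> sat D E (case_nat x c) (ren (\<lambda>i. if even i then 0 else Suc (i div 2)) p)"
    if "x \<in> D" for x
    using p(2)[of "\<lambda>_. x"] that mix by auto
  with p(1) that show ?thesis by blast
qed

section \<open>Models of weak set theories\<close>

locale basic =
  fixes E :: "'a \<Rightarrow> 'a \<Rightarrow> bool" (infix "\<epsilon>" 50)
  assumes extensionality: "(\<And>z. z \<epsilon> x \<longleftrightarrow> z \<epsilon> y) \<Longrightarrow> x = y"
    and ex_empty: "\<exists>x. \<forall>z. \<not> z \<epsilon> x"
    and ex_upair: "\<exists>z. \<forall>u. u \<epsilon> z \<longleftrightarrow> u = x \<or> u = y"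
    and ex_union: "\<exists>z. \<forall>u. u \<epsilon> z \<longleftrightarrow> (\<exists>v. v \<epsilon> x \<and> u \<epsilon> v)"
begin

definition Coll :: "('a \<Rightarrow> bool) \<Rightarrow> 'a" where
  "Coll P = (THE b. \<forall>x. x \<epsilon> b \<longleftrightarrow> P x)"

definition is_set :: "('a \<Rightarrow> bool) \<Rightarrow> bool" where
  "is_set P \<longleftrightarrow> (\<exists>b. \<forall>x. x \<epsilon> b \<longleftrightarrow> P x)"

lemma in_Coll: "is_set P \<Longrightarrow> x \<epsilon> Coll P \<longleftrightarrow> P x"
proof -
  assume "is_set P"
  then obtain b where b: "\<forall>x. x \<epsilon> b \<longleftrightarrow> P x" unfolding is_set_def by blast
  then have "Coll P = b" unfolding Coll_def by (intro the_equality) (auto intro: extensionality)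
  with b show ?thesis by simp
qed

definition emp :: 'a where "emp = Coll (\<lambda>x. False)"
definition up :: "'a \<Rightarrow> 'a \<Rightarrow> 'a" where "up x y = Coll (\<lambda>u. u = x \<or> u = y)"
definition bigU :: "'a \<Rightarrow> 'a" where "bigU x = Coll (\<lambda>u. \<exists>v. v \<epsilon> x \<and> u \<epsilon> v)"
definition un :: "'a \<Rightarrow> 'a \<Rightarrow> 'a" where "un x y = bigU (up x y)"
definition sc :: "'a \<Rightarrow> 'a" where "sc x = un x (up x x)"
definition pr :: "'a \<Rightarrow> 'a \<Rightarrow> 'a" where "pr x y = up (up x x) (up x y)"

lemma in_emp [simp]: "\<not> x \<epsilon> emp"
  using in_Coll[of "\<lambda>x. False" x] ex_empty by (auto simp: emp_def is_set_def)

lemma in_up [simp]: "u \<epsilon> up x y \<longleftrightarrow> u = x \<or> u = y"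
  using in_Coll[of "\<lambda>u. u = x \<or> u = y" u] ex_upair[of x y] by (auto simp: up_def is_set_def)

lemma in_bigU [simp]: "u \<epsilon> bigU x \<longleftrightarrow> (\<exists>v. v \<epsilon> x \<and> u \<epsilon> v)"
  using in_Coll[of "\<lambda>u. \<exists>v. v \<epsilon> x \<and> u \<epsilon> v" u] ex_union[of x] by (auto simp: bigU_def is_set_def)

lemma in_un [simp]: "u \<epsilon> un x y \<longleftrightarrow> u \<epsilon> x \<or> u \<epsilon> y"
  by (auto simp: un_def)

lemma in_sc [simp]: "u \<epsilon> sc x \<longleftrightarrow> u \<epsilon> x \<or> u = x"
  by (auto simp: sc_def)

lemma eq_emp: "x = emp \<longleftrightarrow> (\<forall>z. \<not> z \<epsilon> x)"
  by (auto intro: extensionality)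

lemma eq_up: "z = up x y \<longleftrightarrow> (\<forall>u. u \<epsilon> z \<longleftrightarrow> u = x \<or> u = y)"
  by (auto intro: extensionality)

lemma eq_sc: "z = sc x \<longleftrightarrow> (\<forall>u. u \<epsilon> z \<longleftrightarrow> u \<epsilon> x \<or> u = x)"
  by (auto intro: extensionality)

lemma up_eq: "up a b = up c d \<longleftrightarrow> a = c \<and> b = d \<or> a = d \<and> b = c"
proof
  assume "up a b = up c d"
  then have "u = a \<or> u = b \<longleftrightarrow> u = c \<or> u = d" for u by (metis in_up)
  then show "a = c \<and> b = d \<or> a = d \<and> b = c" by metis
qed (auto intro: extensionality)

lemma pr_eq [simp]: "pr a b = pr c d \<longleftrightarrow> a = c \<and> b = d"
  by (auto simp: pr_def up_eq)

definition sub :: "'a \<Rightarrow> 'a \<Rightarrow> bool" where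
  "sub x y \<longleftrightarrow> (\<forall>z. z \<epsilon> x \<longrightarrow> z \<epsilon> y)"

definition ind :: "'a \<Rightarrow> bool" where
  "ind w \<longleftrightarrow> emp \<epsilon> w \<and> (\<forall>n. n \<epsilon> w \<longrightarrow> sc n \<epsilon> w)"

primrec num :: "nat \<Rightarrow> 'a" where
  "num 0 = emp"
| "num (Suc k) = sc (num k)"

definition tag :: "nat \<Rightarrow> 'a \<Rightarrow> 'a \<Rightarrow> 'a" where
  "tag k x y = pr (num k) (pr x y)"

definition funOn :: "'a \<Rightarrow> 'a \<Rightarrow> bool" where
  "funOn f a \<longleftrightarrow> (\<forall>z. z \<epsilon> f \<longrightarrow> (\<exists>x y. x \<epsilon> a \<and> z = pr x y)) \<and> (\<forall>x. x \<epsilon> a \<longrightarrow> (\<exists>!y. pr x y \<epsilon> f))"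

definition isFun :: "'a \<Rightarrow> 'a \<Rightarrow> 'a \<Rightarrow> bool" where
  "isFun f a b \<longleftrightarrow> funOn f a \<and> (\<forall>x y. pr x y \<epsilon> f \<longrightarrow> y \<epsilon> b)"

definition upd :: "'a \<Rightarrow> 'a \<Rightarrow> 'a \<Rightarrow> 'a \<Rightarrow> 'a \<Rightarrow> bool" where
  "upd k f i u g \<longleftrightarrow> funOn g k \<and> pr i u \<epsilon> g \<and>
    (\<forall>j. j \<epsilon> k \<longrightarrow> j \<noteq> i \<longrightarrow> (\<forall>y. pr j y \<epsilon> g \<longleftrightarrow> pr j y \<epsilon> f))"

definition app :: "'a \<Rightarrow> 'a \<Rightarrow> 'a" where
  "app f x = (THE y. pr x y \<epsilon> f)"

lemma funOn_app: "funOn f a \<Longrightarrow> x \<epsilon> a \<Longrightarrow> pr x y \<epsilon> f \<longleftrightarrow> y = app f x"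
proof -
  assume "funOn f a" "x \<epsilon> a"
  then have 1: "\<exists>!y. pr x y \<epsilon> f" unfolding funOn_def by blast
  from theI'[OF this] have "pr x (app f x) \<epsilon> f" unfolding app_def .
  with 1 show "pr x y \<epsilon> f \<longleftrightarrow> y = app f x" by blast
qed

lemma funOn_dom: "funOn f a \<Longrightarrow> pr x y \<epsilon> f \<Longrightarrow> x \<epsilon> a"
  unfolding funOn_def by fastforce

lemma isFun_app: "isFun f a b \<Longrightarrow> x \<epsilon> a \<Longrightarrow> app f x \<epsilon> b"
  unfolding isFun_def using funOn_app by blast

lemma isFun_funOn: "isFun f a b \<Longrightarrow> funOn f a"
  unfolding isFun_def by blast

text \<open>Transitive classes over which the basic notions are absolute.\<close>

definition good :: "'a set \<Rightarrow> bool" where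
  "good D \<longleftrightarrow> (\<forall>x\<in>D. \<forall>y. y \<epsilon> x \<longrightarrow> y \<in> D) \<and> emp \<in> D \<and> (\<forall>x\<in>D. \<forall>y\<in>D. up x y \<in> D) \<and>
    (\<forall>x\<in>D. bigU x \<in> D)"

lemma good_UNIV [simp]: "good UNIV"
  by (simp add: good_def)

context
  fixes D assumes D: "good D"
begin

lemma good_trans: "y \<epsilon> x \<Longrightarrow> x \<in> D \<Longrightarrow> y \<in> D" using D unfolding good_def by blast
lemma good_emp: "emp \<in> D" using D unfolding good_def by blast
lemma good_up: "x \<in> D \<Longrightarrow> y \<in> D \<Longrightarrow> up x y \<in> D" using D unfolding good_def by blast
lemma good_bigU: "x \<in> D \<Longrightarrow> bigU x \<in> D" using D unfolding good_def by blast
lemma good_un: "x \<in> D \<Longrightarrow> y \<in> D \<Longrightarrow> un x y \<in> D" unfolding un_def by (intro good_bigU good_up)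
lemma good_sc: "x \<in> D \<Longrightarrow> sc x \<in> D" unfolding sc_def by (intro good_un good_up)
lemma good_pr: "x \<in> D \<Longrightarrow> y \<in> D \<Longrightarrow> pr x y \<in> D" by (simp add: pr_def good_up)
lemma good_num: "num k \<in> D" by (induction k) (simp_all add: good_emp good_sc)

text \<open>A transitive class contains the components of its pairs because \<open>up x y\<close> is
  itself an element of \<open>pr x y\<close>.\<close>

lemma good_pr_eq: "pr x y \<in> D \<longleftrightarrow> x \<in> D \<and> y \<in> D"
proof
  assume "pr x y \<in> D"
  moreover have "up x y \<epsilon> pr x y" by (simp add: pr_def)
  ultimately have "up x y \<in> D" by (blast intro: good_trans)
  then show "x \<in> D \<and> y \<in> D" using good_trans[of _ "up x y"] by simp
qed (auto intro: good_pr)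

lemma good_pr_in: "pr x y \<epsilon> r \<Longrightarrow> r \<in> D \<Longrightarrow> x \<in> D \<and> y \<in> D"
  using good_trans good_pr_eq by blast

lemma holds_subset [simp]: "x < n \<Longrightarrow> y < n \<Longrightarrow> v x \<in> D \<Longrightarrow>
    holds D E w n v (is_subset x y) \<longleftrightarrow> sub (v x) (v y)"
  unfolding is_subset_def sub_def by (auto intro: good_trans)

lemma holds_empty [simp]: "x < n \<Longrightarrow> v x \<in> D \<Longrightarrow> holds D E w n v (is_empty x) \<longleftrightarrow> v x = emp"
  unfolding is_empty_def eq_emp by (auto intro: good_trans)

lemma holds_suc [simp]: "x < n \<Longrightarrow> y < n \<Longrightarrow> v x \<in> D \<Longrightarrow> v y \<in> D \<Longrightarrow>
    holds D E w n v (is_suc x y) \<longleftrightarrow> v y = sc (v x)"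
  unfolding is_suc_def eq_sc by (auto intro: good_trans)

lemma holds_inductive [simp]: "x < n \<Longrightarrow> v x \<in> D \<Longrightarrow>
    holds D E w n v (is_inductive x) \<longleftrightarrow> ind (v x)"
  unfolding is_inductive_def ind_def
  by (auto simp: good_trans good_emp good_sc)

text \<open>Inside \<open>D\<close> minimality is tested only against inductive sets of
  \<open>D\<close>. The notion becomes absolute in \<open>holds_is_omega\<close>, where
  \<open>om\<close> belongs to \<open>D\<close>.\<close>

lemma holds_omega: "x < n \<Longrightarrow> v x \<in> D \<Longrightarrow>
    holds D E w n v (is_omega x) \<longleftrightarrow> ind (v x) \<and> (\<forall>y\<in>D. ind y \<longrightarrow> sub (v x) y)"
  unfolding is_omega_def by (simp cong: ball_cong_simp)

lemma holds_numeral [simp]: "x < n \<Longrightarrow> v x \<in> D \<Longrightarrow>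
    holds D E w n v (is_numeral k x) \<longleftrightarrow> v x = num k"
  by (induction k arbitrary: x n v) (simp_all cong: bex_cong_simp add: good_num)

lemma holds_upair [simp]: "x < n \<Longrightarrow> y < n \<Longrightarrow> z < n \<Longrightarrow> v x \<in> D \<Longrightarrow> v y \<in> D \<Longrightarrow> v z \<in> D \<Longrightarrow>
    holds D E w n v (is_upair x y z) \<longleftrightarrow> v z = up (v x) (v y)"
  unfolding is_upair_def eq_up by (auto intro: good_trans)

lemma holds_pair [simp]: "x < n \<Longrightarrow> y < n \<Longrightarrow> z < n \<Longrightarrow> v x \<in> D \<Longrightarrow> v y \<in> D \<Longrightarrow> v z \<in> D \<Longrightarrow>
    holds D E w n v (is_pair x y z) \<longleftrightarrow> v z = pr (v x) (v y)"
  unfolding is_pair_def pr_def by (simp cong: bex_cong_simp add: good_up)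

lemma holds_pair_in [simp]: "x < n \<Longrightarrow> y < n \<Longrightarrow> r < n \<Longrightarrow> v x \<in> D \<Longrightarrow> v y \<in> D \<Longrightarrow>
    holds D E w n v (pair_in x y r) \<longleftrightarrow> pr (v x) (v y) \<epsilon> v r"
  unfolding pair_in_def by (auto cong: bex_cong_simp simp: good_pr)

lemma holds_triple_in [simp]: "x < n \<Longrightarrow> y < n \<Longrightarrow> z < n \<Longrightarrow> r < n \<Longrightarrow>
    v x \<in> D \<Longrightarrow> v y \<in> D \<Longrightarrow> v z \<in> D \<Longrightarrow>
    holds D E w n v (triple_in x y z r) \<longleftrightarrow> pr (pr (v x) (v y)) (v z) \<epsilon> v r"
  unfolding triple_in_def by (auto cong: bex_cong_simp simp: good_pr)

lemma Ex1_iff: "(\<exists>x\<in>D. \<forall>y\<in>D. P y \<longleftrightarrow> y = x) \<longleftrightarrow> (\<exists>!y. y \<in> D \<and> P y)"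
  by (auto simp: Ex1_def)

lemma holds_fun_on [simp]: "f < n \<Longrightarrow> a < n \<Longrightarrow> v f \<in> D \<Longrightarrow> v a \<in> D \<Longrightarrow>
    holds D E w n v (is_fun_on f a) \<longleftrightarrow> funOn (v f) (v a)"
proof -
  assume a: "f < n" "a < n" "v f \<in> D" "v a \<in> D"
  have "holds D E w n v (is_fun_on f a) \<longleftrightarrow>
      (\<forall>z\<in>D. z \<epsilon> v f \<longrightarrow> (\<exists>x\<in>D. x \<epsilon> v a \<and> (\<exists>y\<in>D. z = pr x y))) \<and>
      (\<forall>x\<in>D. x \<epsilon> v a \<longrightarrow> (\<exists>!y. y \<in> D \<and> pr x y \<epsilon> v f))"
    unfolding is_fun_on_def using a
    by (simp cong: ball_cong_simp bex_cong_simp conj_cong add: Ex1_iff[symmetric])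
  moreover have "(\<forall>z\<in>D. z \<epsilon> v f \<longrightarrow> (\<exists>x\<in>D. x \<epsilon> v a \<and> (\<exists>y\<in>D. z = pr x y))) \<longleftrightarrow>
      (\<forall>z. z \<epsilon> v f \<longrightarrow> (\<exists>x y. x \<epsilon> v a \<and> z = pr x y))"
    using a good_trans good_pr_in by (metis (no_types, lifting))
  moreover have "(y \<in> D \<and> pr x y \<epsilon> v f) \<longleftrightarrow> pr x y \<epsilon> v f" for x y
    using a good_pr_in by blast
  moreover have "(\<forall>x\<in>D. x \<epsilon> v a \<longrightarrow> P x) \<longleftrightarrow> (\<forall>x. x \<epsilon> v a \<longrightarrow> P x)" for P
    using a good_trans by blast
  ultimately show ?thesis unfolding funOn_def by simp
qed

lemma holds_fun [simp]: "f < n \<Longrightarrow> a < n \<Longrightarrow> b < n \<Longrightarrow> v f \<in> D \<Longrightarrow> v a \<in> D \<Longrightarrow>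
    holds D E w n v (is_fun f a b) \<longleftrightarrow> isFun (v f) (v a) (v b)"
  unfolding is_fun_def isFun_def
  by (auto cong: ball_cong_simp dest: good_pr_in)

lemma holds_update [simp]: "k < n \<Longrightarrow> f < n \<Longrightarrow> i < n \<Longrightarrow> x < n \<Longrightarrow> g < n \<Longrightarrow>
    v k \<in> D \<Longrightarrow> v f \<in> D \<Longrightarrow> v i \<in> D \<Longrightarrow> v x \<in> D \<Longrightarrow> v g \<in> D \<Longrightarrow>
    holds D E w n v (is_update k f i x g) \<longleftrightarrow> upd (v k) (v f) (v i) (v x) (v g)"
proof -
  assume a: "k < n" "f < n" "i < n" "x < n" "g < n"
    "v k \<in> D" "v f \<in> D" "v i \<in> D" "v x \<in> D" "v g \<in> D"
  have "(\<forall>y\<in>D. pr j y \<epsilon> v g \<longleftrightarrow> pr j y \<epsilon> v f) \<longleftrightarrow> (\<forall>y. pr j y \<epsilon> v g \<longleftrightarrow> pr j y \<epsilon> v f)" for j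
    using good_pr_in a by blast
  moreover have "(\<forall>x\<in>D. x \<epsilon> v k \<longrightarrow> P x) \<longleftrightarrow> (\<forall>x. x \<epsilon> v k \<longrightarrow> P x)" for P
    using a good_trans by blast
  ultimately show ?thesis
    unfolding is_update_def upd_def using a by (simp cong: ball_cong_simp)
qed

lemma holds_tagged [simp]: "x < n \<Longrightarrow> y < n \<Longrightarrow> c < n \<Longrightarrow> v x \<in> D \<Longrightarrow> v y \<in> D \<Longrightarrow> v c \<in> D \<Longrightarrow>
    holds D E w n v (is_tagged k x y c) \<longleftrightarrow> v c = tag k (v x) (v y)"
  unfolding is_tagged_def tag_def
  by (auto cong: bex_cong_simp simp: good_num good_pr)

end

lemma TDef_up:
  assumes "good D" "TDef D E s" "TDef D E t"
  shows "TDef D E (\<lambda>e. up (s e) (t e))"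
proof (rule TDefI)
  note D = TDef_mem[OF assms(2)] TDef_mem[OF assms(3)]
  have ne: "D \<noteq> {}" using assms(1) good_emp by blast
  note r = TDef_ren[OF assms(2)] TDef_ren[OF assms(3)] TDef_var[OF ne]
  show "up (s e) (t e) \<in> D" if "range e \<subseteq> D" for e using that D good_up[OF assms(1)] by blast
  let ?R = "\<lambda>e. \<forall>u\<in>D. u \<epsilon> e 0 \<longleftrightarrow> u = s (\<lambda>i. e (Suc i)) \<or> u = t (\<lambda>i. e (Suc i))"
  show "Def D E ?R"
    by (intro Def_ex Def_all Def_connectives r)
  show "?R e \<longleftrightarrow> e 0 = up (s (\<lambda>i. e (Suc i))) (t (\<lambda>i. e (Suc i)))" if "range e \<subseteq> D" for e
  proof -
    have "range (\<lambda>i. e (Suc i)) \<subseteq> D" "e 0 \<in> D" using that by auto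
    with D have "s (\<lambda>i. e (Suc i)) \<in> D" "t (\<lambda>i. e (Suc i)) \<in> D" "e 0 \<in> D" by blast+
    then show ?thesis unfolding eq_up using good_trans[OF assms(1)] by blast
  qed
qed

lemma TDef_pr:
  assumes "good D" "TDef D E s" "TDef D E t"
  shows "TDef D E (\<lambda>e. pr (s e) (t e))"
  unfolding pr_def by (intro TDef_up assms)

lemmas TDef_pr_UNIV = TDef_pr[OF good_UNIV] and TDef_up_UNIV = TDef_up[OF good_UNIV]

end

locale omega = basic E for E (infix "\<epsilon>" 50) +
  fixes om
  assumes ind_om: "ind om" and om_least: "ind w \<Longrightarrow> sub om w"
begin

lemma om_emp: "emp \<epsilon> om" and om_sc: "n \<epsilon> om \<Longrightarrow> sc n \<epsilon> om"
  using ind_om unfolding ind_def by auto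

lemma num_om: "num k \<epsilon> om"
  by (induction k) (simp_all add: om_emp om_sc)

text \<open>Induction reaches only as far as comprehension: the subset of \<open>om\<close> cut out
  by \<open>P\<close> has to exist before the minimality of \<open>om\<close> can be applied to
  it.\<close>

lemma om_induct:
  assumes "is_set (\<lambda>n. n \<epsilon> om \<and> P n)" "P emp" "\<And>n. n \<epsilon> om \<Longrightarrow> P n \<Longrightarrow> P (sc n)" "n \<epsilon> om"
  shows "P n"
proof -
  obtain b where b: "\<And>n. n \<epsilon> b \<longleftrightarrow> n \<epsilon> om \<and> P n" using assms(1) unfolding is_set_def by blast
  have "ind b" unfolding ind_def by (simp add: b assms(2,3) om_emp om_sc)
  then have "sub om b" by (rule om_least)
  with b assms(4) show ?thesis unfolding sub_def by blast
qed

section \<open>Finiteness, endomorphisms and rigidity relative to a class\<close>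

definition finite_in :: "'a set \<Rightarrow> 'a \<Rightarrow> bool" where
  "finite_in D a \<longleftrightarrow> (\<exists>n\<in>D. \<exists>f\<in>D. n \<epsilon> om \<and> isFun f n a \<and> (\<forall>y. y \<epsilon> a \<longrightarrow> (\<exists>!x. pr x y \<epsilon> f)))"

definition endo :: "'a \<Rightarrow> 'a \<Rightarrow> 'a \<Rightarrow> bool" where
  "endo a r f \<longleftrightarrow> isFun f a a \<and> (\<forall>x y. x \<epsilon> a \<longrightarrow> y \<epsilon> a \<longrightarrow> pr x y \<epsilon> r \<longrightarrow>
    (\<exists>u v. pr x u \<epsilon> f \<and> pr y v \<epsilon> f \<and> pr u v \<epsilon> r))"

text \<open>The endomorphisms range over \<open>D\<close>: rigidity in a transitive model and
  rigidity in the whole universe differ in this quantifier, and strong extendibility serves to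
  bridge the two.\<close>

definition rigid_in :: "'a set \<Rightarrow> 'a \<Rightarrow> 'a \<Rightarrow> bool" where
  "rigid_in D a r \<longleftrightarrow> (\<forall>z. z \<epsilon> r \<longrightarrow> (\<exists>x y. x \<epsilon> a \<and> y \<epsilon> a \<and> z = pr x y)) \<and>
    (\<forall>f\<in>D. endo a r f \<longrightarrow> (\<forall>x. x \<epsilon> a \<longrightarrow> pr x x \<epsilon> f))"

context
  fixes D assumes D: "good D" and om: "om \<in> D"
begin

lemma holds_is_omega [simp]: "x < n \<Longrightarrow> v x \<in> D \<Longrightarrow>
    holds D E w n v (is_omega x) \<longleftrightarrow> v x = om"
proof -
  assume x: "x < n" "v x \<in> D"
  have "v x = om" if "ind (v x)" "\<forall>y\<in>D. ind y \<longrightarrow> sub (v x) y"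
    using that om om_least ind_om unfolding sub_def by (intro extensionality) blast
  with x om_least ind_om show ?thesis by (auto simp: holds_omega[OF D])
qed

lemma holds_nat [simp]: "x < n \<Longrightarrow> v x \<in> D \<Longrightarrow> holds D E w n v (is_nat x) \<longleftrightarrow> v x \<epsilon> om"
  unfolding is_nat_def by (auto simp: om cong: bex_cong_simp)

lemma holds_finite [simp]: "x < n \<Longrightarrow> v x \<in> D \<Longrightarrow>
    holds D E w n v (is_finite x) \<longleftrightarrow> finite_in D (v x)"
proof -
  assume x: "x < n" "v x \<in> D"
  have "holds D E w n v (is_finite x) \<longleftrightarrow> (\<exists>m\<in>D. \<exists>f\<in>D. m \<epsilon> om \<and> isFun f m (v x) \<and>
    (\<forall>y\<in>D. y \<epsilon> v x \<longrightarrow> (\<exists>!z. z \<in> D \<and> pr z y \<epsilon> f)))"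
    unfolding is_finite_def using x D om
    by (simp cong: ball_cong_simp bex_cong_simp conj_cong add: Ex1_iff[OF D, symmetric])
  moreover have "(\<forall>y\<in>D. y \<epsilon> v x \<longrightarrow> P y) \<longleftrightarrow> (\<forall>y. y \<epsilon> v x \<longrightarrow> P y)" for P
    using good_trans[OF D] x by blast
  moreover have "(z \<in> D \<and> pr z y \<epsilon> f) \<longleftrightarrow> pr z y \<epsilon> f" if "f \<in> D" for z y f
    using good_pr_in[OF D] that by blast
  ultimately show ?thesis unfolding finite_in_def by (simp cong: bex_cong_simp)
qed

lemma holds_endo [simp]: "a < n \<Longrightarrow> r < n \<Longrightarrow> f < n \<Longrightarrow> v a \<in> D \<Longrightarrow> v r \<in> D \<Longrightarrow> v f \<in> D \<Longrightarrow>
    holds D E w n v (is_endomorphism a r f) \<longleftrightarrow> endo (v a) (v r) (v f)"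
proof -
  assume x: "a < n" "r < n" "f < n" "v a \<in> D" "v r \<in> D" "v f \<in> D"
  have "holds D E w n v (is_endomorphism a r f) \<longleftrightarrow> isFun (v f) (v a) (v a) \<and>
    (\<forall>x\<in>D. x \<epsilon> v a \<longrightarrow> (\<forall>y\<in>D. y \<epsilon> v a \<longrightarrow> pr x y \<epsilon> v r \<longrightarrow>
    (\<exists>z\<in>D. \<exists>u\<in>D. pr x z \<epsilon> v f \<and> pr y u \<epsilon> v f \<and> pr z u \<epsilon> v r)))"
    unfolding is_endomorphism_def using x D om
    by (simp cong: ball_cong_simp bex_cong_simp conj_cong)
  moreover have "(\<forall>y\<in>D. y \<epsilon> v a \<longrightarrow> P y) \<longleftrightarrow> (\<forall>y. y \<epsilon> v a \<longrightarrow> P y)" for P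
    using good_trans[OF D] x by blast
  moreover have "(\<exists>z\<in>D. \<exists>u\<in>D. pr x z \<epsilon> v f \<and> pr y u \<epsilon> v f \<and> pr z u \<epsilon> v r) \<longleftrightarrow>
      (\<exists>z u. pr x z \<epsilon> v f \<and> pr y u \<epsilon> v f \<and> pr z u \<epsilon> v r)" for x y
    using good_pr_in[OF D] x by blast
  ultimately show ?thesis unfolding endo_def by simp
qed

lemma holds_VPH: "holds D E w n v VPH \<longleftrightarrow>
    (\<forall>a\<in>D. \<not> finite_in D a \<longrightarrow> (\<exists>r\<in>D. rigid_in D a r))"
proof -
  have 1: "(\<forall>y\<in>D. y \<epsilon> a \<longrightarrow> P y) \<longleftrightarrow> (\<forall>y. y \<epsilon> a \<longrightarrow> P y)" if "a \<in> D" for P a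
    using good_trans[OF D] that by blast
  have 2: "(\<exists>y\<in>D. y \<epsilon> a \<and> P y) \<longleftrightarrow> (\<exists>y. y \<epsilon> a \<and> P y)" if "a \<in> D" for P a
    using good_trans[OF D] that by blast
  have "holds D E w n v VPH \<longleftrightarrow> (\<forall>a\<in>D. \<not> finite_in D a \<longrightarrow> (\<exists>r\<in>D.
    (\<forall>z\<in>D. z \<epsilon> r \<longrightarrow> (\<exists>x\<in>D. x \<epsilon> a \<and> (\<exists>y\<in>D. y \<epsilon> a \<and> z = pr x y))) \<and>
    (\<forall>f\<in>D. endo a r f \<longrightarrow> (\<forall>x\<in>D. x \<epsilon> a \<longrightarrow> pr x x \<epsilon> f))))"
    unfolding VPH_def using D om
    by (simp cong: ball_cong_simp bex_cong_simp conj_cong)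
  then show ?thesis unfolding rigid_in_def
    by (simp add: 1 2 cong: ball_cong_simp bex_cong_simp conj_cong) 
qed

end

end


section \<open>Zermelo set theory with choice\<close>

locale zermelo = basic E for E (infix "\<epsilon>" 50) +
  assumes ex_power: "\<exists>z. \<forall>u. u \<epsilon> z \<longleftrightarrow> sub u x"
    and ex_ind: "\<exists>w. ind w"
    and ex_choice: "(\<And>u. u \<epsilon> x \<Longrightarrow> \<exists>v. v \<epsilon> u) \<Longrightarrow>
      (\<And>u v z. u \<epsilon> x \<Longrightarrow> v \<epsilon> x \<Longrightarrow> z \<epsilon> u \<Longrightarrow> z \<epsilon> v \<Longrightarrow> u = v) \<Longrightarrow>
      \<exists>c. \<forall>u. u \<epsilon> x \<longrightarrow> (\<exists>v. \<forall>z. z \<epsilon> u \<and> z \<epsilon> c \<longleftrightarrow> z = v)"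
    and separation: "Def UNIV E (\<lambda>e. P (e 0)) \<Longrightarrow> is_set (\<lambda>x. x \<epsilon> a \<and> P x)"
begin

lemmas defs = Def_UNIV TDef_pr_UNIV

lemma separation_bounded:
  assumes "Def UNIV E (\<lambda>e. P (e 0))" "\<And>x. P x \<Longrightarrow> x \<epsilon> a"
  shows "is_set P"
proof -
  have "(\<lambda>x. x \<epsilon> a \<and> P x) = P" using assms(2) by blast
  then show ?thesis using separation[OF assms(1), of a] by simp
qed

lemma Def_sub: "TDef UNIV E s \<Longrightarrow> TDef UNIV E t \<Longrightarrow> Def UNIV E (\<lambda>e. sub (s e) (t e))"
  unfolding sub_def by (intro defs; rule TDef_ren)

definition power :: "'a \<Rightarrow> 'a" where
  "power x = Coll (\<lambda>u. sub u x)"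

lemma in_power [simp]: "u \<epsilon> power x \<longleftrightarrow> sub u x"
  unfolding power_def using ex_power[of x] by (subst in_Coll) (auto simp: is_set_def)

section \<open>Relations and choice functions as sets\<close>

definition relset :: "'a \<Rightarrow> 'a \<Rightarrow> ('a \<Rightarrow> 'a \<Rightarrow> bool) \<Rightarrow> 'a" where
  "relset a b Q = Coll (\<lambda>z. \<exists>x y. z = pr x y \<and> x \<epsilon> a \<and> y \<epsilon> b \<and> Q x y)"

lemma in_relset:
  assumes "Def UNIV E (\<lambda>e. Q (e 0) (e 1))"
  shows "z \<epsilon> relset a b Q \<longleftrightarrow> (\<exists>x y. z = pr x y \<and> x \<epsilon> a \<and> y \<epsilon> b \<and> Q x y)"
  unfolding relset_def
proof (rule in_Coll, rule separation_bounded)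
  have "Def UNIV E (\<lambda>e. Q (e 1) (e 0))"
    using Def_ren[OF assms, of "\<lambda>i. 1 - i"] by simp
  from Def_ren[OF this, of "\<lambda>i. i"]
  show "Def UNIV E (\<lambda>e. \<exists>x y. e 0 = pr x y \<and> x \<epsilon> a \<and> y \<epsilon> b \<and> Q x y)"
    by (intro defs) simp
  fix z assume "\<exists>x y. z = pr x y \<and> x \<epsilon> a \<and> y \<epsilon> b \<and> Q x y"
  \<comment> \<open>A Kuratowski pair of elements of \<open>a\<close> and \<open>b\<close> is a set
    of subsets of \<open>un a b\<close>, which gives separation a set to act on.\<close>
  then show "z \<epsilon> power (power (un a b))" by (auto simp: sub_def pr_def)
qed

lemma pr_relset:
  "Def UNIV E (\<lambda>e. Q (e 0) (e 1)) \<Longrightarrow> pr x y \<epsilon> relset a b Q \<longleftrightarrow> x \<epsilon> a \<and> y \<epsilon> b \<and> Q x y"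
  by (subst in_relset) auto

lemma isFun_relset:
  assumes "Def UNIV E (\<lambda>e. Q (e 0) (e 1))" "\<And>x. x \<epsilon> a \<Longrightarrow> \<exists>!y. y \<epsilon> b \<and> Q x y"
  shows "isFun (relset a b Q) a b"
  unfolding isFun_def funOn_def using in_relset[OF assms(1)] assms(2) by (auto simp: pr_relset[OF assms(1)]) 

text \<open>Choice is postulated for disjoint families, so it is applied to the sections of the
  relation: pairing each value with its argument makes sections over distinct arguments
  disjoint.\<close>

lemma choice_function:
  assumes Q: "Def UNIV E (\<lambda>e. Q (e 0) (e 1))" and ex: "\<And>x. x \<epsilon> a \<Longrightarrow> \<exists>y. y \<epsilon> b \<and> Q x y"
  obtains F where "isFun F a b" "\<And>x. x \<epsilon> a \<Longrightarrow> Q x (app F x)"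
proof -
  let ?G = "relset a b Q"
  have G: "pr x y \<epsilon> ?G \<longleftrightarrow> x \<epsilon> a \<and> y \<epsilon> b \<and> Q x y" for x y by (rule pr_relset[OF Q])
  let ?P = "\<lambda>w. \<exists>x. x \<epsilon> a \<and> (\<forall>p. p \<epsilon> w \<longleftrightarrow> (\<exists>y. p = pr x y \<and> pr x y \<epsilon> ?G))"
  have "is_set (\<lambda>w. w \<epsilon> power ?G \<and> ?P w)" by (intro separation defs)
  then obtain X where X: "\<And>w. w \<epsilon> X \<longleftrightarrow> w \<epsilon> power ?G \<and> ?P w" unfolding is_set_def by blast
  have "\<exists>c. \<forall>u. u \<epsilon> X \<longrightarrow> (\<exists>v. \<forall>z. z \<epsilon> u \<and> z \<epsilon> c \<longleftrightarrow> z = v)"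
  proof (rule ex_choice)
    fix u assume "u \<epsilon> X"
    then show "\<exists>v. v \<epsilon> u" using ex G by (auto simp: X)
  next
    fix u v z assume "u \<epsilon> X" "v \<epsilon> X" "z \<epsilon> u" "z \<epsilon> v"
    then show "u = v" by (intro extensionality) (auto simp: X)
  qed
  then obtain c where c: "\<And>u. u \<epsilon> X \<Longrightarrow> \<exists>v. \<forall>z. z \<epsilon> u \<and> z \<epsilon> c \<longleftrightarrow> z = v" by blast
  let ?F = "relset a b (\<lambda>x y. pr x y \<epsilon> ?G \<and> pr x y \<epsilon> c)"
  have d: "Def UNIV E (\<lambda>e. pr (e 0) (e 1) \<epsilon> ?G \<and> pr (e 0) (e 1) \<epsilon> c)" by (intro defs)
  have F: "pr x y \<epsilon> ?F \<longleftrightarrow> pr x y \<epsilon> ?G \<and> pr x y \<epsilon> c" for x y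
    using pr_relset[OF d, of x y a b] G by blast
  have "\<exists>!y. y \<epsilon> b \<and> pr x y \<epsilon> ?G \<and> pr x y \<epsilon> c" if x: "x \<epsilon> a" for x
  proof -
    have "is_set (\<lambda>p. p \<epsilon> ?G \<and> (\<exists>y. p = pr x y))" by (intro separation defs)
    then obtain u where u: "\<And>p. p \<epsilon> u \<longleftrightarrow> p \<epsilon> ?G \<and> (\<exists>y. p = pr x y)" unfolding is_set_def by blast
    then have "u \<epsilon> power ?G" "\<forall>p. p \<epsilon> u \<longleftrightarrow> (\<exists>y. p = pr x y \<and> pr x y \<epsilon> ?G)"
      by (auto simp: sub_def)
    then have "u \<epsilon> X" using x unfolding X by blast
    then obtain v where v: "\<And>z. z \<epsilon> u \<and> z \<epsilon> c \<longleftrightarrow> z = v" using c by blast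
    then obtain y where "v = pr x y" using u by blast
    with v have "pr x y' \<epsilon> ?G \<and> pr x y' \<epsilon> c \<longleftrightarrow> y' = y" for y'
      using u[of "pr x y'"] v[of "pr x y'"] by auto
    then show ?thesis using G by (intro ex1I[of _ y]) blast+
  qed
  then have F_fun: "isFun ?F a b" by (rule isFun_relset[OF d])
  have "Q x (app ?F x)" if "x \<epsilon> a" for x
    using funOn_app[OF isFun_funOn[OF F_fun] that] F G by blast
  with F_fun that show ?thesis by blast
qed

end

locale well_ordered = zermelo E for E (infix "\<epsilon>" 50) +
  fixes A W
  assumes dom: "pr x y \<epsilon> W \<Longrightarrow> x \<epsilon> A \<and> y \<epsilon> A"
    and irrefl: "\<not> pr x x \<epsilon> W"
    and trans: "pr x y \<epsilon> W \<Longrightarrow> pr y z \<epsilon> W \<Longrightarrow> pr x z \<epsilon> W"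
    and least_in: "sub S A \<Longrightarrow> x \<epsilon> S \<Longrightarrow> \<exists>m. m \<epsilon> S \<and> (\<forall>y. y \<epsilon> S \<longrightarrow> y = m \<or> pr m y \<epsilon> W)"

context zermelo
begin

text \<open>Zermelo's proof: the smallest family of subsets of \<open>A\<close> that contains \<open>A\<close> and is closed under
  intersections and under removing the chosen element is linearly ordered by inclusion.\<close>

context
  fixes A a0 c
  assumes a0: "a0 \<epsilon> A"
    and c: "\<And>X. sub X A \<Longrightarrow> X \<noteq> emp \<Longrightarrow>
      (\<exists>y. (\<forall>z. pr X z \<epsilon> c \<longleftrightarrow> z = y) \<and> y \<epsilon> X \<and> (y = a0 \<longrightarrow> X = up a0 a0))"
begin

definition ch :: "'a \<Rightarrow> 'a" where "ch X = app c X"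

lemma pr_ch: "sub X A \<Longrightarrow> X \<noteq> emp \<Longrightarrow> pr X z \<epsilon> c \<longleftrightarrow> z = ch X"
proof -
  assume "sub X A" "X \<noteq> emp"
  from c[OF this] obtain y where y: "\<forall>z. pr X z \<epsilon> c \<longleftrightarrow> z = y" by blast
  then have "app c X = y" unfolding app_def by blast
  with y show ?thesis by (simp add: ch_def)
qed

lemma ch: "sub X A \<Longrightarrow> X \<noteq> emp \<Longrightarrow> ch X \<epsilon> X \<and> (ch X = a0 \<longrightarrow> X = up a0 a0)"
proof -
  assume X: "sub X A" "X \<noteq> emp"
  from c[OF X] obtain y where "\<forall>z. pr X z \<epsilon> c \<longleftrightarrow> z = y" "y \<epsilon> X" "y = a0 \<longrightarrow> X = up a0 a0"
    by blast
  moreover from this(1) pr_ch[OF X] have "y = ch X" by simp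
  ultimately show ?thesis by blast
qed

definition del :: "'a \<Rightarrow> 'a" where "del X = Coll (\<lambda>z. z \<epsilon> X \<and> z \<noteq> ch X)"
definition meet :: "'a \<Rightarrow> 'a" where "meet F = Coll (\<lambda>z. z \<epsilon> A \<and> (\<forall>X. X \<epsilon> F \<longrightarrow> z \<epsilon> X))"

lemma in_del [simp]: "z \<epsilon> del X \<longleftrightarrow> z \<epsilon> X \<and> z \<noteq> ch X"
  unfolding del_def by (intro in_Coll separation defs)

lemma in_meet [simp]: "z \<epsilon> meet F \<longleftrightarrow> z \<epsilon> A \<and> (\<forall>X. X \<epsilon> F \<longrightarrow> z \<epsilon> X)"
  unfolding meet_def by (intro in_Coll separation defs)

text \<open>Deletion and intersection are spelled out by membership, not through \<open>del\<close>
  and \<open>meet\<close>, so that the property is visibly definable and separation can form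
  \<open>tower\<close>.\<close>

definition closed_family :: "'a \<Rightarrow> bool" where
  "closed_family Z \<longleftrightarrow> A \<epsilon> Z \<and>
    (\<forall>X Y y. X \<epsilon> Z \<longrightarrow> pr X y \<epsilon> c \<longrightarrow> (\<forall>z. z \<epsilon> Y \<longleftrightarrow> z \<epsilon> X \<and> z \<noteq> y) \<longrightarrow> Y \<epsilon> Z) \<and>
    (\<forall>F Y. (\<forall>X. X \<epsilon> F \<longrightarrow> X \<epsilon> Z) \<longrightarrow> (\<exists>X. X \<epsilon> F) \<longrightarrow>
      (\<forall>z. z \<epsilon> Y \<longleftrightarrow> z \<epsilon> A \<and> (\<forall>X. X \<epsilon> F \<longrightarrow> z \<epsilon> X)) \<longrightarrow> Y \<epsilon> Z)"

definition tower :: 'a where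
  "tower = Coll (\<lambda>X. X \<epsilon> power A \<and> (\<forall>Z. closed_family Z \<longrightarrow> X \<epsilon> Z))"

lemma in_tower: "X \<epsilon> tower \<longleftrightarrow> sub X A \<and> (\<forall>Z. closed_family Z \<longrightarrow> X \<epsilon> Z)"
proof -
  have "X \<epsilon> tower \<longleftrightarrow> X \<epsilon> power A \<and> (\<forall>Z. closed_family Z \<longrightarrow> X \<epsilon> Z)"
    unfolding tower_def closed_family_def by (intro in_Coll separation defs)
  then show ?thesis by simp
qed

lemma tower_A: "A \<epsilon> tower"
  unfolding in_tower closed_family_def by (auto simp: sub_def)

lemma tower_sub: "X \<epsilon> tower \<Longrightarrow> sub X A"
  by (simp add: in_tower)

lemma tower_del: "X \<epsilon> tower \<Longrightarrow> X \<noteq> emp \<Longrightarrow> del X \<epsilon> tower"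
proof -
  assume X: "X \<epsilon> tower" "X \<noteq> emp"
  have "del X \<epsilon> Z" if "closed_family Z" for Z
  proof -
    have "X \<epsilon> Z" "pr X (ch X) \<epsilon> c" using X that pr_ch[of X] by (auto simp: in_tower)
    with that show ?thesis unfolding closed_family_def using in_del[of _ X] by blast
  qed
  then show ?thesis using tower_sub[OF X(1)] by (auto simp: in_tower sub_def)
qed

lemma tower_meet: "sub F tower \<Longrightarrow> X \<epsilon> F \<Longrightarrow> meet F \<epsilon> tower"
proof -
  assume F: "sub F tower" "X \<epsilon> F"
  have "meet F \<epsilon> Z" if "closed_family Z" for Z
  proof -
    have "\<forall>X. X \<epsilon> F \<longrightarrow> X \<epsilon> Z" "\<exists>X. X \<epsilon> F" using F that by (auto simp: in_tower sub_def)
    with that show ?thesis unfolding closed_family_def using in_meet[of _ F] by blast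
  qed
  then show ?thesis by (auto simp: in_tower sub_def)
qed

lemma tower_induct:
  assumes P: "Def UNIV E (\<lambda>e. P (e 0))"
    and "P A" "\<And>X. X \<epsilon> tower \<Longrightarrow> X \<noteq> emp \<Longrightarrow> P X \<Longrightarrow> P (del X)"
    "\<And>F X. sub F tower \<Longrightarrow> X \<epsilon> F \<Longrightarrow> (\<And>X. X \<epsilon> F \<Longrightarrow> P X) \<Longrightarrow> P (meet F)"
    and X: "X \<epsilon> tower"
  shows "P X"
proof -
  obtain Z where Z: "\<And>X. X \<epsilon> Z \<longleftrightarrow> X \<epsilon> tower \<and> P X"
    using separation[OF P] unfolding is_set_def by blast
  have "closed_family Z"
    unfolding closed_family_def
  proof (intro conjI allI impI)
    show "A \<epsilon> Z" using assms(2) tower_A by (simp add: Z)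
  next
    fix X Y y assume XY: "X \<epsilon> Z" "pr X y \<epsilon> c" "\<forall>z. z \<epsilon> Y \<longleftrightarrow> z \<epsilon> X \<and> z \<noteq> y"
    show "Y \<epsilon> Z"
    proof (cases "X = emp")
      case True
      then have "Y = X" using XY(3) by (intro extensionality) auto
      with XY(1) show ?thesis by simp
    next
      case False
      then have "y = ch X" using XY pr_ch[of X y] tower_sub[of X] by (simp add: Z)
      then have "Y = del X" using XY(3) by (intro extensionality) auto
      with XY(1) False show ?thesis using assms(3) tower_del by (simp add: Z)
    qed
  next
    fix F Y assume F: "\<forall>X. X \<epsilon> F \<longrightarrow> X \<epsilon> Z" "\<exists>X. X \<epsilon> F"
      "\<forall>z. z \<epsilon> Y \<longleftrightarrow> z \<epsilon> A \<and> (\<forall>X. X \<epsilon> F \<longrightarrow> z \<epsilon> X)"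
    then have Y: "Y = meet F" by (intro extensionality) simp
    obtain X where X: "X \<epsilon> F" using F(2) by blast
    have "sub F tower" using F(1) by (simp add: Z sub_def)
    moreover from this have "P (meet F)" using assms(4)[OF _ X] F(1) Z by blast
    ultimately show "Y \<epsilon> Z" using tower_meet X Y Z by simp
  qed
  then have "X \<epsilon> Z" using X in_tower by blast
  with Z show ?thesis by simp
qed

section \<open>Comparability in the tower\<close>

definition comparable :: "'a \<Rightarrow> bool" where
  "comparable X \<longleftrightarrow> (\<forall>Y. Y \<epsilon> tower \<longrightarrow> sub X Y \<or> sub Y X)"

text \<open>Passing from \<open>Y\<close> to \<open>del Y\<close> removes one point only, so it
  cannot jump over \<open>X\<close>: if \<open>Y\<close> includes \<open>X\<close> and
  \<open>del Y\<close> is included in \<open>X\<close>, then \<open>X\<close> is one of the two.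
  Thus no member of the tower lies strictly between \<open>del X\<close> and
  \<open>X\<close>.\<close>

lemma comparable_del:
  assumes X: "X \<epsilon> tower" "X \<noteq> emp" "comparable X" and "Y \<epsilon> tower"
  shows "sub X Y \<or> sub Y (del X)"
proof (rule tower_induct[where P = "\<lambda>Y. sub X Y \<or> sub Y (del X)", OF _ _ _ _ assms(4)])
  show "Def UNIV E (\<lambda>e. sub X (e 0) \<or> sub (e 0) (del X))" by (intro defs Def_sub)
  show "sub X A \<or> sub A (del X)" using tower_sub X by blast
next
  fix Y assume Y: "Y \<epsilon> tower" "Y \<noteq> emp" "sub X Y \<or> sub Y (del X)"
  then have "del Y \<epsilon> tower" by (simp add: tower_del)
  then have "sub X (del Y) \<or> sub (del Y) X" using X(3) unfolding comparable_def by blast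
  moreover have "X = Y \<or> sub X (del Y)" if "sub X Y" "sub (del Y) X"
  proof (cases "ch Y \<epsilon> X")
    case True
    with that show ?thesis unfolding sub_def by (auto intro!: extensionality)
  next
    case False
    with that show ?thesis unfolding sub_def by auto
  qed
  ultimately show "sub X (del Y) \<or> sub (del Y) (del X)" using Y(3) unfolding sub_def by auto
next
  fix F Z assume F: "sub F tower" "Z \<epsilon> F" "\<And>Y. Y \<epsilon> F \<Longrightarrow> sub X Y \<or> sub Y (del X)"
  show "sub X (meet F) \<or> sub (meet F) (del X)"
  proof (cases "\<forall>Y. Y \<epsilon> F \<longrightarrow> sub X Y")
    case True
    with tower_sub[OF X(1)] show ?thesis unfolding sub_def by auto
  next
    case False
    with F(3) show ?thesis unfolding sub_def by auto
  qed
qed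

lemma tower_comparable: "X \<epsilon> tower \<Longrightarrow> comparable X"
proof (rule tower_induct[where P = comparable])
  show "Def UNIV E (\<lambda>e. comparable (e 0))" unfolding comparable_def by (intro defs Def_sub)
  show "comparable A" unfolding comparable_def using tower_sub by blast
next
  fix X assume X: "X \<epsilon> tower" "X \<noteq> emp" "comparable X"
  show "comparable (del X)"
    unfolding comparable_def
  proof (intro allI impI)
    fix Y assume "Y \<epsilon> tower"
    from comparable_del[OF X this] show "sub (del X) Y \<or> sub Y (del X)" unfolding sub_def by auto
  qed
next
  fix F Z assume F: "sub F tower" "Z \<epsilon> F" "\<And>X. X \<epsilon> F \<Longrightarrow> comparable X"
  show "comparable (meet F)"
    unfolding comparable_def
  proof (intro allI impI)
    fix Y assume Y: "Y \<epsilon> tower"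
    show "sub (meet F) Y \<or> sub Y (meet F)"
    proof (cases "\<forall>X. X \<epsilon> F \<longrightarrow> sub Y X")
      case True
      with tower_sub[OF Y] show ?thesis unfolding sub_def by auto
    next
      case False
      with F(3) Y show ?thesis unfolding sub_def comparable_def by (meson in_meet)
    qed
  qed
qed

text \<open>The intersection of all tower members including \<open>S\<close> is again in the tower.
  Were its chosen element outside \<open>S\<close>, deleting it would give a smaller such
  member.\<close>

lemma tower_hull:
  assumes "sub S A" "x \<epsilon> S"
  obtains Z where "Z \<epsilon> tower" "sub S Z" "\<And>X. X \<epsilon> tower \<Longrightarrow> sub S X \<Longrightarrow> sub Z X" "ch Z \<epsilon> S"
proof -
  have "is_set (\<lambda>X. X \<epsilon> tower \<and> sub S X)" by (intro separation defs Def_sub)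
  then obtain F where F: "\<And>X. X \<epsilon> F \<longleftrightarrow> X \<epsilon> tower \<and> sub S X" unfolding is_set_def by blast
  have "A \<epsilon> F" using assms tower_A F by blast
  moreover have "sub F tower" using F unfolding sub_def by blast
  ultimately have Z: "meet F \<epsilon> tower" by (intro tower_meet)
  have SZ: "sub S (meet F)" using assms F unfolding sub_def by auto
  have min: "sub (meet F) X" if "X \<epsilon> tower" "sub S X" for X
    using that F unfolding sub_def by auto
  have "x \<epsilon> meet F" using SZ assms(2) unfolding sub_def by blast
  then have ne: "meet F \<noteq> emp" by (metis in_emp)
  have "ch (meet F) \<epsilon> S"
  proof (rule ccontr)
    assume "\<not> ?thesis"
    then have "sub S (del (meet F))" using SZ unfolding sub_def by (metis in_del)
    then have "sub (meet F) (del (meet F))" using min tower_del[OF Z ne] by blast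
    moreover have "ch (meet F) \<epsilon> meet F" using ch[OF tower_sub[OF Z] ne] by blast
    ultimately show False unfolding sub_def by (metis in_del)
  qed
  with that Z SZ min show thesis by blast
qed

text \<open>The order \<open>le\<close> compares points by the members of the tower containing them;
  the hull of a singleton is the final segment of its point, which is also the chosen element of
  that hull. Since \<open>a0\<close> is chosen only from its own singleton, it leaves the tower last
  and becomes the greatest element.\<close>

lemma well_ordering_aux:
  "\<exists>W. well_ordered E A W \<and> (\<forall>x. x \<epsilon> A \<longrightarrow> x = a0 \<or> pr x a0 \<epsilon> W)"
proof -
  define le where "le x y \<longleftrightarrow> (\<forall>X. X \<epsilon> tower \<longrightarrow> x \<epsilon> X \<longrightarrow> y \<epsilon> X)" for x y
  define W where "W = relset A A (\<lambda>x y. x \<noteq> y \<and> le x y)"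
  have W: "pr x y \<epsilon> W \<longleftrightarrow> x \<epsilon> A \<and> y \<epsilon> A \<and> x \<noteq> y \<and> le x y" for x y
    unfolding W_def le_def by (intro pr_relset defs)
  have ne: "X \<noteq> emp" if "x \<epsilon> X" for x X using that by auto
  have least: "\<exists>m. m \<epsilon> S \<and> (\<forall>y. y \<epsilon> S \<longrightarrow> le m y)" if S: "sub S A" "x \<epsilon> S" for S x
  proof -
    obtain Z where Z: "Z \<epsilon> tower" "sub S Z" "ch Z \<epsilon> S" using tower_hull[OF S] by metis
    have "Z \<noteq> emp" using Z S unfolding sub_def by auto
    \<comment> \<open>A member containing \<open>ch Z\<close> is not included in
      \<open>del Z\<close>, so it includes the hull \<open>Z\<close> of \<open>S\<close> and with it
      \<open>y\<close>.\<close>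
    have "le (ch Z) y" if "y \<epsilon> S" for y
      unfolding le_def
    proof (intro allI impI)
      fix X assume X: "X \<epsilon> tower" "ch Z \<epsilon> X"
      from comparable_del[OF Z(1) \<open>Z \<noteq> emp\<close> tower_comparable[OF Z(1)] X(1)] X(2)
      have "sub Z X" unfolding sub_def by auto
      with Z(2) that show "y \<epsilon> X" unfolding sub_def by blast
    qed
    with Z show ?thesis by blast
  qed
  have hull: "\<exists>Z. Z \<epsilon> tower \<and> x \<epsilon> Z \<and> ch Z = x \<and> (\<forall>y. y \<epsilon> Z \<longleftrightarrow> le x y)" if x: "x \<epsilon> A" for x
  proof -
    have "sub (up x x) A" using x by (simp add: sub_def)
    then obtain Z where Z: "Z \<epsilon> tower" "sub (up x x) Z"
        "\<And>X. X \<epsilon> tower \<Longrightarrow> sub (up x x) X \<Longrightarrow> sub Z X" "ch Z \<epsilon> up x x"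
      using tower_hull[of "up x x" x] by auto
    have xZ: "x \<epsilon> Z" "ch Z = x" using Z(2,4) by (simp_all add: sub_def)
    have "sub Z X" if "X \<epsilon> tower" "x \<epsilon> X" for X using Z(3)[of X] that by (simp add: sub_def)
    then have "y \<epsilon> Z \<longleftrightarrow> le x y" for y using Z(1) xZ(1) unfolding le_def sub_def by blast
    with Z(1) xZ show ?thesis by blast
  qed
  have antisym: "x = y" if xy: "le x y" "le y x" "x \<epsilon> A" "y \<epsilon> A" for x y
  proof -
    obtain X where X: "ch X = x" "\<forall>z. z \<epsilon> X \<longleftrightarrow> le x z" using hull xy(3) by blast
    obtain Y where Y: "ch Y = y" "\<forall>z. z \<epsilon> Y \<longleftrightarrow> le y z" using hull xy(4) by blast
    have "X = Y" using X Y xy unfolding le_def by (intro extensionality) auto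
    with X Y show ?thesis by simp
  qed
  have "well_ordered E A W"
  proof
    fix x y z assume "pr x y \<epsilon> W" "pr y z \<epsilon> W"
    then have *: "x \<epsilon> A" "y \<epsilon> A" "z \<epsilon> A" "x \<noteq> y" "le x y" "le y z" unfolding W by auto
    then have "le x z" unfolding le_def by blast
    moreover have "x \<noteq> z" using * antisym by blast
    ultimately show "pr x z \<epsilon> W" unfolding W using * by blast
  next
    fix S x assume S: "sub S A" "x \<epsilon> S"
    from least[OF S] obtain m where m: "m \<epsilon> S" "\<And>y. y \<epsilon> S \<Longrightarrow> le m y" by blast
    have "y = m \<or> pr m y \<epsilon> W" if "y \<epsilon> S" for y
      using that m S(1) unfolding W sub_def by auto
    with m(1) show "\<exists>m. m \<epsilon> S \<and> (\<forall>y. y \<epsilon> S \<longrightarrow> y = m \<or> pr m y \<epsilon> W)" by blast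
  qed (auto simp: W)
  moreover have "x = a0 \<or> pr x a0 \<epsilon> W" if x: "x \<epsilon> A" for x
  proof -
    obtain Z where Z: "Z \<epsilon> tower" "a0 \<epsilon> Z" "ch Z = a0" using hull[OF a0] by blast
    then have Za: "Z = up a0 a0" using ch[OF tower_sub[OF Z(1)] ne] by blast
    have "le x a0" if "x \<noteq> a0"
      unfolding le_def
    proof (intro allI impI)
      fix X assume X: "X \<epsilon> tower" "x \<epsilon> X"
      then have "sub Z X \<or> sub X Z" using tower_comparable[OF Z(1)] unfolding comparable_def by blast
      with X that show "a0 \<epsilon> X" unfolding sub_def Za by auto
    qed
    with W x a0 show ?thesis by blast
  qed
  ultimately show ?thesis by blast
qed

end

text \<open>Choosing \<open>a0\<close> from a set only if nothing else is there prescribes the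
  greatest element. It later bounds the orbits of an endomorphism.\<close>

theorem well_ordering:
  assumes "a0 \<epsilon> A"
  obtains W where "well_ordered E A W" "\<And>x. x \<epsilon> A \<Longrightarrow> x = a0 \<or> pr x a0 \<epsilon> W"
proof -
  let ?N = "Coll (\<lambda>X. X \<epsilon> power A \<and> (\<exists>x. x \<epsilon> X))"
  have N: "X \<epsilon> ?N \<longleftrightarrow> X \<epsilon> power A \<and> (\<exists>x. x \<epsilon> X)" for X by (intro in_Coll separation defs)
  have ex: "\<exists>y. y \<epsilon> A \<and> y \<epsilon> X \<and> (y = a0 \<longrightarrow> X = up a0 a0)" if X: "X \<epsilon> ?N" for X
  proof (cases "\<exists>y. y \<epsilon> X \<and> y \<noteq> a0")
    case True
    with X N show ?thesis by (auto simp: sub_def)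
  next
    case False
    with X N have "X = up a0 a0" by (auto intro!: extensionality)
    with assms show ?thesis by auto
  qed
  have "Def UNIV E (\<lambda>e. e 1 \<epsilon> e 0 \<and> (e 1 = a0 \<longrightarrow> e 0 = up a0 a0))" by (intro defs)
  then obtain c where c: "isFun c ?N A"
    "\<And>X. X \<epsilon> ?N \<Longrightarrow> app c X \<epsilon> X \<and> (app c X = a0 \<longrightarrow> X = up a0 a0)"
    using choice_function[of "\<lambda>X y. y \<epsilon> X \<and> (y = a0 \<longrightarrow> X = up a0 a0)" ?N A] ex by blast
  have "\<exists>y. (\<forall>z. pr X z \<epsilon> c \<longleftrightarrow> z = y) \<and> y \<epsilon> X \<and> (y = a0 \<longrightarrow> X = up a0 a0)"
    if "sub X A" "X \<noteq> emp" for X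
  proof -
    have "X \<epsilon> ?N" using that unfolding N by (auto simp: eq_emp)
    with c(2) funOn_app[OF isFun_funOn[OF c(1)]] show ?thesis by blast
  qed
  from well_ordering_aux[OF assms this] that show thesis by blast
qed

end

section \<open>Recursion on well-orders\<close>

context well_ordered
begin

abbreviation lt (infix "\<prec>" 50) where "x \<prec> y \<equiv> pr x y \<epsilon> W"

lemma least:
  assumes "Def UNIV E (\<lambda>e. P (e 0))" "x \<epsilon> A" "P x"
  shows "\<exists>m. m \<epsilon> A \<and> P m \<and> (\<forall>y. y \<epsilon> A \<longrightarrow> P y \<longrightarrow> y = m \<or> m \<prec> y) \<and> (\<forall>y. y \<prec> m \<longrightarrow> \<not> P y)"
proof -
  obtain S where S: "\<And>x. x \<epsilon> S \<longleftrightarrow> x \<epsilon> A \<and> P x"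
    using separation[OF assms(1)] unfolding is_set_def by blast
  then have "sub S A" "x \<epsilon> S" using assms unfolding sub_def by auto
  from least_in[OF this] obtain m where m: "m \<epsilon> S" "\<forall>y. y \<epsilon> S \<longrightarrow> y = m \<or> m \<prec> y" by blast
  then have "\<not> P y" if "y \<prec> m" for y using that S dom trans irrefl by blast
  with m S show ?thesis by blast
qed

lemma induct:
  assumes P: "Def UNIV E (\<lambda>e. P (e 0))" and step: "\<And>x. x \<epsilon> A \<Longrightarrow> (\<And>y. y \<prec> x \<Longrightarrow> P y) \<Longrightarrow> P x"
    and "x \<epsilon> A"
  shows "P x"
proof (rule ccontr)
  assume "\<not> P x"
  moreover have "Def UNIV E (\<lambda>e. \<not> P (e 0))" using P by (rule Def_neg)
  ultimately obtain m where "m \<epsilon> A" "\<not> P m" "\<forall>y. y \<prec> m \<longrightarrow> \<not> \<not> P y"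
    using least[of "\<lambda>x. \<not> P x" x] assms(3) by auto
  with step[of m] show False by blast
qed

lemma total: "x \<epsilon> A \<Longrightarrow> y \<epsilon> A \<Longrightarrow> x = y \<or> x \<prec> y \<or> y \<prec> x"
  using least_in[of "up x y" x] by (auto simp: sub_def)

lemma asym: "x \<prec> y \<Longrightarrow> \<not> y \<prec> x"
  using trans irrefl by blast

definition S :: "'a \<Rightarrow> 'a \<Rightarrow> bool" where
  "S x y \<longleftrightarrow> x \<prec> y \<and> (\<forall>z. x \<prec> z \<longrightarrow> z = y \<or> y \<prec> z)"

text \<open>Limits here are the points without an immediate predecessor, and the least element is
  one of them.\<close>

definition lim :: "'a \<Rightarrow> bool" where
  "lim x \<longleftrightarrow> x \<epsilon> A \<and> (\<forall>y. \<not> S y x)"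

lemma Def_S: "TDef UNIV E s \<Longrightarrow> TDef UNIV E t \<Longrightarrow> Def UNIV E (\<lambda>e. S (s e) (t e))"
  unfolding S_def by (intro defs; (rule TDef_ren)?)

lemma Def_lim: "TDef UNIV E s \<Longrightarrow> Def UNIV E (\<lambda>e. lim (s e))"
  unfolding lim_def by (intro defs Def_S; (rule TDef_ren)?)

lemma S_lt: "S x y \<Longrightarrow> x \<prec> y" unfolding S_def by blast

lemma S_right_unique: "S x y \<Longrightarrow> S x z \<Longrightarrow> y = z"
  unfolding S_def using asym by blast

lemma S_left_unique: "S x z \<Longrightarrow> S y z \<Longrightarrow> x = y"
  unfolding S_def using asym total dom by blast

lemma S_ex: "x \<prec> z \<Longrightarrow> \<exists>y. S x y"
proof -
  assume "x \<prec> z"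
  moreover have d: "Def UNIV E (\<lambda>e. x \<prec> e 0)" by (intro defs)
  ultimately obtain y where "x \<prec> y" "\<forall>z. z \<epsilon> A \<longrightarrow> x \<prec> z \<longrightarrow> z = y \<or> y \<prec> z"
    using least[OF d, of z] dom[of x z] by auto
  then have "S x y" unfolding S_def using dom by auto
  then show ?thesis ..
qed

lemma S_le: "S x y \<Longrightarrow> x \<prec> z \<Longrightarrow> z = y \<or> y \<prec> z"
  unfolding S_def by blast

lemma lt_S: "S y z \<Longrightarrow> x \<prec> z \<Longrightarrow> x = y \<or> x \<prec> y"
  using S_le[of y z x] total[of x y] asym irrefl dom S_lt by metis

text \<open>Starting afresh from \<open>x0\<close> at every limit suits both uses: counting the
  distance from the last limit, and iterating a map along the first segment. The graph is obtained
  at once as the least relation closed under the two clauses.\<close>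

lemma recursion:
  assumes g: "isFun g X X" and x0: "x0 \<epsilon> X"
  shows "\<exists>h. isFun h A X \<and> (\<forall>x. lim x \<longrightarrow> app h x = x0) \<and>
    (\<forall>x y. S x y \<longrightarrow> app h y = app g (app h x))"
proof -
  define closed where "closed Z \<longleftrightarrow> (\<forall>x. lim x \<longrightarrow> pr x x0 \<epsilon> Z) \<and>
    (\<forall>x y u v. S x y \<longrightarrow> pr x u \<epsilon> Z \<longrightarrow> pr u v \<epsilon> g \<longrightarrow> pr y v \<epsilon> Z)" for Z
  define G where "G = relset A X (\<lambda>x u. \<forall>Z. closed Z \<longrightarrow> pr x u \<epsilon> Z)"
  have G: "pr x u \<epsilon> G \<longleftrightarrow> x \<epsilon> A \<and> u \<epsilon> X \<and> (\<forall>Z. closed Z \<longrightarrow> pr x u \<epsilon> Z)" for x u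
    unfolding G_def closed_def by (intro pr_relset defs Def_S Def_lim)
  have gX: "pr u v \<epsilon> g \<longleftrightarrow> v = app g u" "app g u \<epsilon> X" if "u \<epsilon> X" for u v
    using that g funOn_app isFun_funOn isFun_app by blast+
  have G_lim: "pr x x0 \<epsilon> G" if "lim x" for x
    using that x0 by (auto simp: G closed_def lim_def)
  have G_S: "pr y (app g u) \<epsilon> G" if "S x y" "pr x u \<epsilon> G" for x y u
    using that gX dom S_lt unfolding G closed_def by blast
  \<comment> \<open>By minimality each pair of \<open>G\<close> is there for one of two reasons; a
    pair without a reason could be deleted and would leave a smaller closed relation.\<close>
  have remove: "\<exists>x' u'. (lim x' \<and> x = x' \<and> u = x0) \<or> (S x' x \<and> pr x' u' \<epsilon> G \<and> u = app g u')"
    if xu: "pr x u \<epsilon> G" for x u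
  proof (rule ccontr)
    assume no: "\<not> ?thesis"
    define Z where "Z = relset A X (\<lambda>y w. pr y w \<epsilon> G \<and> pr y w \<noteq> pr x u)"
    have Z: "pr y w \<epsilon> Z \<longleftrightarrow> y \<epsilon> A \<and> w \<epsilon> X \<and> pr y w \<epsilon> G \<and> pr y w \<noteq> pr x u" for y w
      unfolding Z_def by (intro pr_relset defs)
    have "closed Z"
      unfolding closed_def
    proof (intro conjI allI impI)
      fix y assume "lim y"
      with no G_lim[OF this] show "pr y x0 \<epsilon> Z" unfolding Z using G by auto
    next
      fix y y' v w assume "S y y'" "pr y v \<epsilon> Z" "pr v w \<epsilon> g"
      moreover from this have "w = app g v" "pr y v \<epsilon> G" using gX unfolding Z by blast+
      moreover from calculation have "pr y' w \<epsilon> G" using G_S[of y y' v] by simp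
      moreover have "pr y' w \<noteq> pr x u" using calculation no by auto
      ultimately show "pr y' w \<epsilon> Z" using G unfolding Z by blast
    qed
    with xu have "pr x u \<epsilon> Z" unfolding G by blast
    then show False unfolding Z by simp
  qed
  have ex1: "\<exists>!u. u \<epsilon> X \<and> pr x u \<epsilon> G" if "x \<epsilon> A" for x
  proof (rule induct[where P = "\<lambda>x. \<exists>!u. u \<epsilon> X \<and> pr x u \<epsilon> G", OF _ _ that])
    show "Def UNIV E (\<lambda>e. \<exists>!u. u \<epsilon> X \<and> pr (e 0) u \<epsilon> G)" unfolding Ex1_def by (intro defs)
  next
    fix x assume x: "x \<epsilon> A" and IH: "\<And>y. y \<prec> x \<Longrightarrow> \<exists>!u. u \<epsilon> X \<and> pr y u \<epsilon> G"
    show "\<exists>!u. u \<epsilon> X \<and> pr x u \<epsilon> G"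
    proof (cases "lim x")
      case True
      then have "u = x0" if "pr x u \<epsilon> G" for u using remove[OF that] unfolding lim_def by blast
      with G_lim[OF True] x0 show ?thesis by blast
    next
      case False
      then obtain y where y: "S y x" using x unfolding lim_def by blast
      obtain v where v: "v \<epsilon> X" "pr y v \<epsilon> G" "\<And>u. pr y u \<epsilon> G \<Longrightarrow> u = v"
        using IH[OF S_lt[OF y]] G by blast
      have "u = app g v" if "pr x u \<epsilon> G" for u
        using remove[OF that] v y False S_left_unique by blast
      with G_S[OF y v(2)] gX(2)[OF v(1)] show ?thesis by blast
    qed
  qed
  have "isFun (relset A X (\<lambda>x u. pr x u \<epsilon> G)) A X"
    by (intro isFun_relset ex1 defs)
  moreover have "relset A X (\<lambda>x u. pr x u \<epsilon> G) = G"
  proof (rule extensionality)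
    fix z
    have "z \<epsilon> relset A X (\<lambda>x u. pr x u \<epsilon> G) \<longleftrightarrow> (\<exists>x u. z = pr x u \<and> x \<epsilon> A \<and> u \<epsilon> X \<and> pr x u \<epsilon> G)"
      by (intro in_relset defs)
    moreover have "z \<epsilon> G \<longrightarrow> (\<exists>x u. z = pr x u \<and> x \<epsilon> A \<and> u \<epsilon> X)"
      unfolding G_def closed_def by (subst in_relset) (intro defs Def_S Def_lim, blast)
    ultimately show "z \<epsilon> relset A X (\<lambda>x u. pr x u \<epsilon> G) \<longleftrightarrow> z \<epsilon> G" by blast
  qed
  ultimately have fG: "isFun G A X" by simp
  have appG: "pr x u \<epsilon> G \<longleftrightarrow> u = app G x" if "x \<epsilon> A" for x u
    using funOn_app[OF isFun_funOn[OF fG] that] .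
  have "app G x = x0" if "lim x" for x
    using appG[of x x0] G_lim[OF that] that unfolding lim_def by simp
  moreover have "app G y = app g (app G x)" if "S x y" for x y
    using appG[of y] appG[of x] G_S[OF that] dom[OF S_lt[OF that]] by metis
  ultimately show ?thesis using fG by blast
qed

end

section \<open>A rigid relation on a well-ordered set\<close>

text \<open>The point \<open>z0\<close> is zero and \<open>o'\<close> the first limit after it, so
  the points below \<open>o'\<close> form a copy of the natural numbers. They can serve as colours
  because they are vertices already: the relation has to live on \<open>A\<close> itself. The
  greatest element \<open>t\<close> keeps orbits bounded.\<close>

locale ranked = well_ordered E A W for E (infix "\<epsilon>" 50) and A W +
  fixes t z0 o'
  assumes t: "t \<epsilon> A" and t_top: "x \<epsilon> A \<Longrightarrow> x = t \<or> x \<prec> t"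
    and z0: "z0 \<epsilon> A" and z0_least: "x \<epsilon> A \<Longrightarrow> x = z0 \<or> z0 \<prec> x"
    and lim_o: "lim o'" and o_z0: "o' \<noteq> z0" and lim_cases: "lim x \<Longrightarrow> x = z0 \<or> x = o' \<or> o' \<prec> x"
begin

lemma lim_z0: "lim z0"
  unfolding lim_def using z0 z0_least asym irrefl dom S_lt by blast

lemma z0_o: "z0 \<prec> o'"
  using z0_least lim_o o_z0 unfolding lim_def by blast

lemma S_o: "S n m \<Longrightarrow> n \<prec> o' \<Longrightarrow> m \<prec> o'"
  using S_le lim_o unfolding lim_def by blast

lemma S_ex_o: "n \<prec> o' \<Longrightarrow> \<exists>m. S n m \<and> m \<prec> o'"
  using S_ex S_o by blast

lemma pred_o: "n \<prec> o' \<Longrightarrow> n \<noteq> z0 \<Longrightarrow> \<exists>m. S m n \<and> m \<prec> o'"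
  using lim_cases[of n] asym irrefl dom S_lt trans unfolding lim_def by blast

lemma o_induct:
  assumes P: "Def UNIV E (\<lambda>e. P (e 0))" and "P z0"
    and step: "\<And>n m. n \<prec> o' \<Longrightarrow> S n m \<Longrightarrow> P n \<Longrightarrow> P m" and n: "n \<prec> o'"
  shows "P n"
proof -
  have "n \<prec> o' \<longrightarrow> P n"
  proof (rule induct[where P = "\<lambda>n. n \<prec> o' \<longrightarrow> P n"])
    show "Def UNIV E (\<lambda>e. e 0 \<prec> o' \<longrightarrow> P (e 0))" by (intro defs P)
  next
    fix x assume IH: "\<And>y. y \<prec> x \<Longrightarrow> y \<prec> o' \<longrightarrow> P y"
    show "x \<prec> o' \<longrightarrow> P x"
      using pred_o[of x] assms(2) IH step S_lt by blast
  qed (use n dom in blast)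
  with n show ?thesis by blast
qed

end

text \<open>The function \<open>c\<close> sends a point to its distance from the last limit at or
  below it, counted in the segment below \<open>o'\<close>.\<close>

locale coloured = ranked +
  fixes c
  assumes c_fun: "funOn c A" and c_o: "pr x n \<epsilon> c \<Longrightarrow> n \<prec> o'"
    and c_lim: "lim x \<Longrightarrow> pr x n \<epsilon> c \<longleftrightarrow> n = z0"
    and c_S: "S x y \<Longrightarrow> pr x n \<epsilon> c \<Longrightarrow> pr y m \<epsilon> c \<Longrightarrow> S n m"
begin

lemma c_ex: "x \<epsilon> A \<Longrightarrow> \<exists>n. pr x n \<epsilon> c"
  using c_fun unfolding funOn_def by blast

lemma c_unique: "pr x n \<epsilon> c \<Longrightarrow> pr x m \<epsilon> c \<Longrightarrow> n = m"
  using c_fun funOn_dom unfolding funOn_def by blast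

lemma c_increasing:
  assumes "pr x n \<epsilon> c" "y \<epsilon> A"
  shows "x \<prec> y \<longrightarrow> (\<forall>l. lim l \<longrightarrow> x \<prec> l \<longrightarrow> \<not> (l = y \<or> l \<prec> y)) \<longrightarrow>
    (\<exists>m. pr y m \<epsilon> c \<and> n \<prec> m)" (is "?P y")
proof (rule induct[where P = ?P, OF _ _ assms(2)])
  show "Def UNIV E (\<lambda>e. ?P (e 0))" by (intro defs Def_lim)
next
  fix y assume y: "y \<epsilon> A" and IH: "\<And>z. z \<prec> y \<Longrightarrow> ?P z"
  show "?P y"
  proof (intro impI)
    assume xy: "x \<prec> y" and nl: "\<forall>l. lim l \<longrightarrow> x \<prec> l \<longrightarrow> \<not> (l = y \<or> l \<prec> y)"
    then have "\<not> lim y" by blast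
    then obtain z where z: "S z y" using y unfolding lim_def by blast
    obtain m where m: "pr y m \<epsilon> c" using c_ex y by blast
    show "\<exists>m. pr y m \<epsilon> c \<and> n \<prec> m"
    proof (cases "x = z")
      case True
      then show ?thesis using c_S[OF z _ m] assms(1) S_lt m by blast
    next
      case False
      then have "x \<prec> z" using lt_S[OF z xy] by blast
      then obtain k where k: "pr z k \<epsilon> c" "n \<prec> k" using IH[OF S_lt[OF z]] nl trans S_lt[OF z] by blast
      then show ?thesis using c_S[OF z k(1) m] S_lt trans m by blast
    qed
  qed
qed

text \<open>Between limits the colour strictly increases, so it can be repeated only after passing a
  limit.\<close>

lemma same_c_lim:
  assumes "x \<prec> y" "pr x n \<epsilon> c" "pr y n \<epsilon> c"
  shows "\<exists>l. lim l \<and> x \<prec> l \<and> (l = y \<or> l \<prec> y)"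
  using c_increasing[OF assms(2), of y] assms c_unique irrefl dom by blast

text \<open>From the limit \<open>l\<close> on, each colour is reached by successor steps. These
  steps do not arrive at \<open>g\<close>, because above every point below \<open>g\<close> there is
  another one below \<open>g\<close>.\<close>

lemma climb:
  assumes l: "lim l" "l \<prec> g" and g: "\<And>y. y \<prec> g \<Longrightarrow> \<exists>l'. y \<prec> l' \<and> l' \<prec> g" and n: "n \<prec> o'"
  shows "\<exists>x. (x = l \<or> l \<prec> x) \<and> x \<prec> g \<and> pr x n \<epsilon> c" (is "?P n")
proof (rule o_induct[where P = ?P, OF _ _ _ n])
  show "Def UNIV E (\<lambda>e. ?P (e 0))" by (intro defs)
  show "?P z0" using l c_lim by blast
next
  fix n m assume n: "n \<prec> o'" "S n m" "?P n"
  then obtain x where x: "x = l \<or> l \<prec> x" "x \<prec> g" "pr x n \<epsilon> c" by blast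
  obtain l' where l': "x \<prec> l'" "l' \<prec> g" using g x(2) by blast
  obtain y where y: "S x y" using S_ex[OF l'(1)] by blast
  then have "y \<prec> g" using S_le[OF y l'(1)] l'(2) trans by blast
  moreover obtain k where k: "pr y k \<epsilon> c" using c_ex dom[OF S_lt[OF y]] by blast
  moreover have "k = m" using c_S[OF y x(3) k] n(2) S_right_unique by blast
  ultimately show "?P m" using S_lt[OF y] x(1) trans by blast
qed

text \<open>Limits of limits of countable cofinality have such ladders. As a ladder has one point of each
  nonzero colour, a map that preserves colours and maps the ladder into itself fixes it pointwise.\<close>

definition Lad :: "'a \<Rightarrow> 'a \<Rightarrow> bool" where
  "Lad q l \<longleftrightarrow> (\<forall>x. x \<epsilon> l \<longrightarrow> x \<prec> q \<and> \<not> x \<prec> o' \<and> \<not> lim x) \<and>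
    (\<forall>n. n \<prec> o' \<longrightarrow> n \<noteq> z0 \<longrightarrow> (\<exists>x. x \<epsilon> l \<and> pr x n \<epsilon> c)) \<and>
    (\<forall>x y n. x \<epsilon> l \<longrightarrow> y \<epsilon> l \<longrightarrow> pr x n \<epsilon> c \<longrightarrow> pr y n \<epsilon> c \<longrightarrow> x = y) \<and>
    (\<forall>y. y \<prec> q \<longrightarrow> (\<exists>x. x \<epsilon> l \<and> y \<prec> x))"

definition special :: "'a \<Rightarrow> bool" where
  "special q \<longleftrightarrow> (\<exists>l. Lad q l) \<and> q \<epsilon> A"

text \<open>This is the colour that the edges show: zero is reserved for special points and the
  other colours move up by one. A map preserving it cannot confuse special points, where edges
  follow ladders, with the others. Nothing is lost, as special points are limits and have
  \<open>c\<close>-colour \<open>z0\<close> anyway.\<close>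

definition colr :: "'a \<Rightarrow> 'a \<Rightarrow> bool" where
  "colr q n \<longleftrightarrow> (special q \<and> n = z0) \<or> (\<not> special q \<and> (\<exists>m. pr q m \<epsilon> c \<and> S m n))"

lemma Def_Lad: "TDef UNIV E s \<Longrightarrow> TDef UNIV E u \<Longrightarrow> Def UNIV E (\<lambda>e. Lad (s e) (u e))"
  unfolding Lad_def by (intro defs Def_lim; (rule TDef_ren)?)

lemma Def_special: "TDef UNIV E s \<Longrightarrow> Def UNIV E (\<lambda>e. special (s e))"
  unfolding special_def by (intro defs Def_Lad; (rule TDef_ren)?)

lemma Def_colr: "TDef UNIV E s \<Longrightarrow> TDef UNIV E u \<Longrightarrow> Def UNIV E (\<lambda>e. colr (s e) (u e))"
  unfolding colr_def by (intro defs Def_special Def_S; (rule TDef_ren)?)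

text \<open>A cofinal ladder leaves no room for an immediate predecessor.\<close>

lemma special_lim: "special q \<Longrightarrow> lim q"
proof -
  assume q: "special q"
  then obtain l where l: "Lad q l" unfolding special_def by blast
  have False if yq: "S y q" for y
  proof -
    obtain x where "x \<epsilon> l" "y \<prec> x" "x \<prec> q" using l S_lt[OF yq] unfolding Lad_def by blast
    with S_le[OF yq, of x] show False using irrefl asym by blast
  qed
  with q show ?thesis unfolding lim_def special_def by blast
qed

lemma colr_ex: "q \<epsilon> A \<Longrightarrow> \<exists>n. colr q n \<and> n \<prec> o'"
  unfolding colr_def using c_ex c_o S_ex_o z0_o by blast

lemma colr_unique: "colr q n \<Longrightarrow> colr q m \<Longrightarrow> n = m"
  unfolding colr_def using c_unique S_right_unique by blast

lemma colr_special: "colr q n \<Longrightarrow> colr p n \<Longrightarrow> special q \<Longrightarrow> special p"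
  unfolding colr_def using lim_z0 unfolding lim_def by blast

lemma colr_c: "colr q n \<Longrightarrow> colr p n \<Longrightarrow> pr q m \<epsilon> c \<Longrightarrow> p \<epsilon> A \<Longrightarrow> pr p m \<epsilon> c"
proof -
  assume a: "colr q n" "colr p n" "pr q m \<epsilon> c" "p \<epsilon> A"
  show "pr p m \<epsilon> c"
  proof (cases "special q")
    case True
    then have "lim q" "lim p" using colr_special a special_lim by blast+
    with a show ?thesis using c_lim by blast
  next
    case False
    then have "\<not> special p" using a colr_special by blast
    with False a show ?thesis unfolding colr_def using c_unique S_left_unique by blast
  qed
qed

end

locale laddered = coloured +
  fixes L
  assumes L: "pr q l \<epsilon> L \<Longrightarrow> special q \<Longrightarrow> Lad q l" and L_ex: "special q \<Longrightarrow> \<exists>l. pr q l \<epsilon> L"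
    and L_unique: "pr q l \<epsilon> L \<Longrightarrow> pr q l' \<epsilon> L \<Longrightarrow> l = l'"
begin

text \<open>Only the segment below \<open>o'\<close> contains cycles of length 2, so it is mapped into itself; the steps
  by 1 and 2 and the edge from 0 to 3 make it rigid. A point of that segment is joined to all
  points outside except those of its own colour.\<close>

definition R :: "'a \<Rightarrow> 'a \<Rightarrow> bool" where
  "R p q \<longleftrightarrow>
    (p \<prec> o' \<and> q \<prec> o' \<and> (S p q \<or> S q p \<or> (\<exists>m. S p m \<and> S m q) \<or>
      (p = z0 \<and> (\<exists>a b. S z0 a \<and> S a b \<and> S b q)))) \<or>
    (p \<prec> o' \<and> q \<epsilon> A \<and> \<not> q \<prec> o' \<and> \<not> colr q p) \<or>
    (\<not> p \<prec> o' \<and> \<not> q \<prec> o' \<and> p \<prec> q \<and> (special q \<longrightarrow> (\<exists>l. pr q l \<epsilon> L \<and> p \<epsilon> l)))"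

lemma Def_R: "Def UNIV E (\<lambda>e. R (e 0) (e 1))"
  unfolding R_def by (intro defs Def_S Def_colr Def_special)

lemma R_irrefl: "\<not> R p p"
  unfolding R_def using irrefl S_lt trans by blast

text \<open>Apart from the edges between neighbours below \<open>o'\<close>, every edge goes up in
  the order.\<close>

lemma R_sym: "R p q \<Longrightarrow> R q p \<Longrightarrow> p \<prec> o' \<and> q \<prec> o' \<and> (S p q \<or> S q p)"
proof -
  assume pq: "R p q" "R q p"
  have o: "p \<prec> o' \<and> q \<prec> o'" using pq asym unfolding R_def by blast
  have lt: "p \<prec> q" if "R p q" "p \<prec> o'" "q \<prec> o'" "\<not> S p q" "\<not> S q p" for p q
    using that S_lt trans unfolding R_def by blast
  show ?thesis using o lt[OF pq(1)] lt[OF pq(2)] asym by blast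
qed

lemma R_o_SS: "R p q \<Longrightarrow> S q m \<Longrightarrow> S m p \<Longrightarrow> p \<prec> o' \<Longrightarrow> False"
proof -
  assume a: "R p q" "S q m" "S m p" "p \<prec> o'"
  then have qp: "q \<prec> p" using S_lt trans by blast
  then have "q \<prec> o'" using a trans by blast
  then have "S p q \<or> S q p \<or> p \<prec> q" using a(1,4) S_lt trans unfolding R_def by blast
  moreover have "\<not> S q p" using a(2,3) S_right_unique S_lt irrefl by blast
  ultimately show False using qp asym S_lt by blast
qed

text \<open>Upward edges below \<open>o'\<close> have length at most two, with the edge of length
  three from \<open>z0\<close> as the only exception; it thereby marks \<open>z0\<close>.\<close>

lemma R_z0_SSS: "R p q \<Longrightarrow> S p a \<Longrightarrow> S a b \<Longrightarrow> S b q \<Longrightarrow> q \<prec> o' \<Longrightarrow> p = z0"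
proof -
  assume a: "R p q" "S p a" "S a b" "S b q" "q \<prec> o'"
  have lt: "p \<prec> a" "a \<prec> b" "b \<prec> q" using a S_lt by blast+
  then have p: "p \<prec> o'" using a(5) trans by blast
  then have aq: "a \<prec> q" and pq: "p \<prec> q" using lt trans by blast+
  have "\<not> S p q" using S_right_unique[OF a(2)] aq irrefl by blast
  moreover have "\<not> S q p" using pq asym S_lt by blast
  moreover have "\<not> (S p m \<and> S m q)" for m using lt a S_right_unique irrefl by blast
  ultimately show ?thesis using a(1,5) p unfolding R_def by blast
qed

section \<open>Action of an endomorphism \<open>F\<close>, with graph \<open>f\<close>, on colours
  and order\<close>

context
  fixes f F
  assumes F_A: "p \<epsilon> A \<Longrightarrow> F p \<epsilon> A" and hom: "R p q \<Longrightarrow> R (F p) (F q)"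
    and f: "p \<epsilon> A \<Longrightarrow> pr p u \<epsilon> f \<longleftrightarrow> u = F p"
begin

text \<open>Neighbours form cycles of length 2, so their images are neighbours below
  \<open>o'\<close> and only the direction is in doubt. Were it reversed, the edge over two steps
  would become a loop or an edge two steps back, and there is neither.\<close>

lemma hom_S: "n \<prec> o' \<Longrightarrow> S n m \<Longrightarrow> S (F n) (F m) \<and> F n \<prec> o' \<and> F m \<prec> o'"
proof -
  assume n: "n \<prec> o'" "S n m"
  then have m: "m \<prec> o'" by (simp add: S_o)
  then obtain k where k: "S m k" "k \<prec> o'" using S_ex_o by blast
  have "R n m" "R m n" "R m k" "R k m" "R n k" using n m k unfolding R_def by blast+
  then have R: "R (F n) (F m)" "R (F m) (F n)" "R (F m) (F k)" "R (F k) (F m)" "R (F n) (F k)"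
    using hom by blast+
  note nm = R_sym[OF R(1,2)] and mk = R_sym[OF R(3,4)]
  have "\<not> S (F m) (F n)"
  proof
    assume mn: "S (F m) (F n)"
    show False
    proof (cases "S (F m) (F k)")
      case True
      then have "F k = F n" using mn S_right_unique by blast
      with R(5) R_irrefl show False by simp
    next
      case False
      with mk R_o_SS[OF R(5) _ mn] nm show False by blast
    qed
  qed
  with nm show ?thesis by blast
qed

text \<open>The edge of length three is carried to another one, so \<open>z0\<close> is fixed, and
  successors follow one by one.\<close>

lemma hom_o: "n \<prec> o' \<Longrightarrow> F n = n"
proof -
  assume n: "n \<prec> o'"
  obtain a where a: "S z0 a" "a \<prec> o'" using S_ex_o z0_o by blast
  obtain b where b: "S a b" "b \<prec> o'" using S_ex_o a by blast
  obtain d where d: "S b d" "d \<prec> o'" using S_ex_o b by blast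
  have "R z0 d" unfolding R_def using a b d z0_o by blast
  then have "F z0 = z0"
    using R_z0_SSS[OF hom] hom_S[OF z0_o a(1)] hom_S[OF a(2) b(1)] hom_S[OF b(2) d(1)] by blast
  \<comment> \<open>From here the claim is about the set \<open>f\<close>: induction applies to
    properties definable in the model, while \<open>F\<close> is a function outside it.\<close>
  then have "pr z0 z0 \<epsilon> f" using f z0 by simp
  moreover have "pr m m \<epsilon> f" if "n \<prec> o'" "S n m" "pr n n \<epsilon> f" for n m
  proof -
    have "S n (F m)" using hom_S[OF that(1,2)] that f dom by metis
    then have "m = F m" using that(2) S_right_unique by blast
    then show ?thesis using f dom[OF S_lt[OF that(2)]] by blast
  qed
  moreover have "Def UNIV E (\<lambda>e. pr (e 0) (e 0) \<epsilon> f)" by (intro defs)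
  ultimately have "pr n n \<epsilon> f" using n o_induct[of "\<lambda>n. pr n n \<epsilon> f" n] by blast
  then show ?thesis using f dom[OF n] by metis
qed

text \<open>A point outside receives edges from all points below \<open>o'\<close> but one. Were its
  image below \<open>o'\<close>, the points two and three steps above that image would both send no
  edge to it, so two would be missing.\<close>

lemma hom_B: "x \<epsilon> A \<Longrightarrow> \<not> x \<prec> o' \<Longrightarrow> \<not> F x \<prec> o'"
proof
  assume x: "x \<epsilon> A" "\<not> x \<prec> o'" and m: "F x \<prec> o'"
  obtain a where a: "S (F x) a" "a \<prec> o'" using S_ex_o m by blast
  obtain b where b: "S a b" "b \<prec> o'" using S_ex_o a by blast
  obtain d where d: "S b d" "d \<prec> o'" using S_ex_o b by blast
  have no: False if "R k (F x)" "S a k \<or> S b k" "k \<prec> o'" for k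
  proof (cases "S a k")
    case True
    with R_o_SS[OF that(1) a(1)] that(3) show False by blast
  next
    case False
    then have bk: "S b k" using that(2) by blast
    have lt: "F x \<prec> a" "a \<prec> b" "b \<prec> k" using a b bk S_lt by blast+
    then have "F x \<prec> k" using trans by blast
    moreover have "S k (F x) \<or> S (F x) k \<or> k \<prec> F x"
      using that(1,3) m S_lt trans unfolding R_def by blast
    moreover have "\<not> S (F x) k" using a(1) lt S_right_unique irrefl trans by blast
    ultimately show False using asym S_lt by blast
  qed
  have "R k (F x)" if "k \<prec> o'" "\<not> colr x k" for k
  proof -
    have "R k x" unfolding R_def using that x by blast
    from hom[OF this] hom_o that show ?thesis by simp
  qed
  with no b d have "colr x b" "colr x d" by blast+
  with colr_unique d S_lt irrefl show False by blast
qed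

text \<open>The colour of \<open>F x\<close> is a point below \<open>o'\<close> that sends no edge
  to \<open>F x\<close>. An edge from it to \<open>x\<close> would be carried to such an edge, so it
  sends none to \<open>x\<close> either and is the colour of \<open>x\<close>.\<close>

lemma hom_colr: "x \<epsilon> A \<Longrightarrow> \<not> x \<prec> o' \<Longrightarrow> colr x n \<Longrightarrow> colr (F x) n"
proof -
  assume x: "x \<epsilon> A" "\<not> x \<prec> o'" "colr x n"
  obtain k where k: "colr (F x) k" "k \<prec> o'" using colr_ex F_A x by blast
  have "colr x k"
  proof (rule ccontr)
    assume "\<not> colr x k"
    then have "R k x" unfolding R_def using k x by blast
    from hom[OF this] hom_o[OF k(2)] have "R k (F x)" by simp
    with hom_B[OF x(1,2)] k show False unfolding R_def by blast
  qed
  with x k colr_unique show ?thesis by blast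
qed

lemma R_lt: "R p q \<Longrightarrow> \<not> p \<prec> o' \<Longrightarrow> p \<prec> q"
  unfolding R_def by blast

text \<open>Where an edge joins \<open>x\<close> to \<open>y\<close> it is carried over. Otherwise
  \<open>y\<close> is special and some point \<open>z\<close> of its ladder lies above
  \<open>x\<close>: the edge from \<open>z\<close> to \<open>y\<close> is carried over, and the
  induction hypothesis handles \<open>x\<close> and \<open>z\<close>.\<close>

lemma hom_mono:
  assumes x: "\<not> x \<prec> o'" and xy: "x \<prec> y"
  shows "F x \<prec> F y"
proof -
  let ?P = "\<lambda>y. x \<prec> y \<longrightarrow> (\<exists>u v. pr x u \<epsilon> f \<and> pr y v \<epsilon> f \<and> u \<prec> v)"
  have xA: "x \<epsilon> A" and yA: "y \<epsilon> A" using dom[OF xy] by auto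
  have *: "F x \<prec> F z" if "R x z" for z using R_lt[OF hom[OF that] hom_B[OF xA x]] .
  have "?P y"
  proof (rule induct[where P = ?P, OF _ _ yA])
    show "Def UNIV E (\<lambda>e. ?P (e 0))" by (intro defs)
  next
    fix y assume y: "y \<epsilon> A" and IH: "\<And>z. z \<prec> y \<Longrightarrow> ?P z"
    show "?P y"
    proof
      assume xy: "x \<prec> y"
      then have yo: "\<not> y \<prec> o'" using x trans by blast
      have "F x \<prec> F y"
      proof (cases "R x y")
        case True
        then show ?thesis by (rule *)
      next
        case False
        then have sp: "special y" using x yo xy unfolding R_def by blast
        then obtain l where l: "pr y l \<epsilon> L" "Lad y l" using L L_ex by blast
        then obtain z where z: "z \<epsilon> l" "x \<prec> z" "z \<prec> y" "\<not> z \<prec> o'"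
          using xy unfolding Lad_def by blast
        have "R z y" unfolding R_def using z l yo by blast
        then have "F z \<prec> F y" using R_lt[OF hom hom_B] z dom by blast
        moreover have "F x \<prec> F z" using IH[OF z(3)] z(2) f xA dom[OF z(2)] by auto
        ultimately show ?thesis using trans by blast
      qed
      then show "\<exists>u v. pr x u \<epsilon> f \<and> pr y v \<epsilon> f \<and> u \<prec> v" using f xA y by blast
    qed
  qed
  then show ?thesis using xy f[OF xA] f[OF yA] by auto
qed

text \<open>By monotonicity, the image of the least point moved down would be moved down as
  well.\<close>

lemma hom_ge:
  assumes x: "x \<epsilon> A" "\<not> x \<prec> o'"
  shows "\<not> F x \<prec> x"
proof
  let ?P = "\<lambda>x. \<not> x \<prec> o' \<and> (\<exists>u. pr x u \<epsilon> f \<and> u \<prec> x)"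
  assume "F x \<prec> x"
  then have "?P x" using x f by blast
  moreover have "Def UNIV E (\<lambda>e. ?P (e 0))" by (intro defs)
  ultimately obtain m where m: "m \<epsilon> A" "?P m" "\<forall>y. y \<prec> m \<longrightarrow> \<not> ?P y"
    using least[of ?P x] x by auto
  then have "F m \<prec> m" using f[OF m(1)] by simp
  moreover have "F (F m) \<prec> F m" using hom_mono[OF hom_B] m calculation by blast
  ultimately have "?P (F m)" using f hom_B F_A m by blast
  with m(3) \<open>F m \<prec> m\<close> show False by blast
qed

lemma hom_t: "F t = t"
proof -
  have "\<not> t \<prec> o'" using t_top[of o'] lim_o asym irrefl unfolding lim_def by blast
  with hom_ge[OF t] t_top[OF F_A[OF t]] show ?thesis by blast
qed

text \<open>Consecutive values of \<open>s\<close> have a common colour, so a limit lies between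
  them, and above that limit every colour occurs below \<open>g\<close>. One point of each nonzero
  colour can therefore be selected above the corresponding value of \<open>s\<close>, which makes a
  ladder cofinal in \<open>g\<close>.\<close>

lemma special_sup:
  assumes s: "funOn s A" "\<And>x u. pr x u \<epsilon> s \<Longrightarrow> u \<epsilon> A \<and> \<not> u \<prec> o'"
    and inc: "\<And>n m u v. n \<prec> o' \<Longrightarrow> S n m \<Longrightarrow> pr n u \<epsilon> s \<Longrightarrow> pr m v \<epsilon> s \<Longrightarrow>
      u \<prec> v \<and> (\<exists>k. pr u k \<epsilon> c \<and> pr v k \<epsilon> c)"
    and g: "g \<epsilon> A" "\<And>n u. n \<prec> o' \<Longrightarrow> pr n u \<epsilon> s \<Longrightarrow> u \<prec> g"
      "\<And>y. y \<prec> g \<Longrightarrow> \<exists>n u. n \<prec> o' \<and> pr n u \<epsilon> s \<and> \<not> u \<prec> y"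
  shows "special g"
proof -
  have s_ex: "\<exists>!u. pr n u \<epsilon> s" if "n \<prec> o'" for n using that s(1) dom unfolding funOn_def by blast
  have next_s: "\<exists>m v. m \<prec> o' \<and> S n m \<and> pr m v \<epsilon> s \<and> u \<prec> v \<and> (\<exists>k. pr u k \<epsilon> c \<and> pr v k \<epsilon> c)"
    if n: "n \<prec> o'" "pr n u \<epsilon> s" for n u
  proof -
    obtain m where m: "S n m" "m \<prec> o'" using S_ex_o[OF n(1)] by blast
    obtain v where "pr m v \<epsilon> s" using s_ex[OF m(2)] by blast
    with inc[OF n(1) m(1) n(2) this] m show ?thesis by blast
  qed
  have above: "\<exists>l'. y \<prec> l' \<and> l' \<prec> g" if y: "y \<prec> g" for y
  proof -
    obtain n u where n: "n \<prec> o'" "pr n u \<epsilon> s" "\<not> u \<prec> y" using g(3)[OF y] by blast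
    obtain m v where m: "m \<prec> o'" "pr m v \<epsilon> s" "u \<prec> v" using next_s[OF n(1,2)] by blast
    have "y = u \<or> y \<prec> u" using total[of y u] n y s(2) dom by blast
    then have "y \<prec> v" using m(3) trans by blast
    then show ?thesis using g(2)[OF m(1,2)] by blast
  qed
  have rung: "\<exists>x. u \<prec> x \<and> x \<prec> g \<and> pr x n \<epsilon> c" if n: "n \<prec> o'" "pr n u \<epsilon> s" for n u
  proof -
    obtain m v where m: "m \<prec> o'" "pr m v \<epsilon> s" "u \<prec> v" "\<exists>k. pr u k \<epsilon> c \<and> pr v k \<epsilon> c"
      using next_s[OF n] by blast
    then obtain l where l: "lim l" "u \<prec> l" "l = v \<or> l \<prec> v" using same_c_lim by blast
    then have "l \<prec> g" using g(2)[OF m(1,2)] trans by blast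
    from climb[OF l(1) this above n(1)] l(2) trans show ?thesis by blast
  qed
  \<comment> \<open>The rung of colour \<open>n\<close> is the least point of that colour between
    the \<open>n\<close>-th value of \<open>s\<close> and \<open>g\<close>.\<close>
  let ?Q = "\<lambda>n x. \<exists>u. pr n u \<epsilon> s \<and> u \<prec> x \<and> x \<prec> g \<and> pr x n \<epsilon> c"
  let ?P = "\<lambda>x. \<exists>n. n \<prec> o' \<and> n \<noteq> z0 \<and> ?Q n x \<and> (\<forall>y. y \<prec> x \<longrightarrow> \<not> ?Q n y)"
  have "is_set (\<lambda>x. x \<epsilon> A \<and> ?P x)" by (intro separation defs)
  then obtain l where l': "\<And>x. x \<epsilon> l \<longleftrightarrow> x \<epsilon> A \<and> ?P x" unfolding is_set_def by blast
  then have l: "x \<epsilon> l \<longleftrightarrow> ?P x" for x using dom by blast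
  have l_ex: "\<exists>x. x \<epsilon> l \<and> ?Q n x" if n: "n \<prec> o'" "n \<noteq> z0" for n
  proof -
    have "Def UNIV E (\<lambda>e. ?Q n (e 0))" by (intro defs)
    moreover obtain x where "?Q n x" "x \<epsilon> A" using rung[OF n(1)] s_ex[OF n(1)] dom by blast
    ultimately obtain x where "?Q n x" "\<forall>y. y \<prec> x \<longrightarrow> \<not> ?Q n y" using least[of "?Q n"] by blast
    with n have "?P x" by blast
    with \<open>?Q n x\<close> show ?thesis using l by blast
  qed
  have "Lad g l"
    unfolding Lad_def
  proof (intro conjI allI impI)
    fix x assume "x \<epsilon> l"
    then obtain n u where x: "n \<prec> o'" "n \<noteq> z0" "pr n u \<epsilon> s" "u \<prec> x" "x \<prec> g" "pr x n \<epsilon> c"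
      unfolding l by blast
    show "x \<prec> g" by (rule x)
    show "\<not> x \<prec> o'" using s(2)[OF x(3)] x(4) trans by blast
    show "\<not> lim x" using c_lim x by blast
  next
    fix n assume "n \<prec> o'" "n \<noteq> z0"
    then show "\<exists>x. x \<epsilon> l \<and> pr x n \<epsilon> c" using l_ex by blast
  next
    fix x y n assume xy: "x \<epsilon> l" "y \<epsilon> l" "pr x n \<epsilon> c" "pr y n \<epsilon> c"
    have "?Q n x \<and> (\<forall>z. z \<prec> x \<longrightarrow> \<not> ?Q n z)" "?Q n y \<and> (\<forall>z. z \<prec> y \<longrightarrow> \<not> ?Q n z)"
      using xy c_unique unfolding l by blast+
    with total[of x y] dom show "x = y" by blast
  next
    fix y assume y: "y \<prec> g"
    obtain n u where n: "n \<prec> o'" "pr n u \<epsilon> s" "\<not> u \<prec> y" using g(3)[OF y] by blast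
    \<comment> \<open>The index moves on to the successor \<open>m\<close>, since the colour
      \<open>z0\<close> has no rung.\<close>
    obtain m v where m: "m \<prec> o'" "S n m" "pr m v \<epsilon> s" "u \<prec> v" using next_s[OF n(1,2)] by blast
    have yu: "y = u \<or> y \<prec> u" using total[of y u] n y s(2) dom by blast
    have "m \<noteq> z0" using m(2) lim_z0 unfolding lim_def by blast
    then obtain x where x: "x \<epsilon> l" "?Q m x" using l_ex m(1) by blast
    then have "v \<prec> x" using s_ex[OF m(1)] m(3) by blast
    then show "\<exists>x. x \<epsilon> l \<and> y \<prec> x" using x yu m(4) trans by blast
  qed
  then show ?thesis unfolding special_def using g(1) by blast
qed

text \<open>The map sends the ladder at \<open>g\<close> into the ladder at \<open>F g\<close> and
  keeps colours. If \<open>F g\<close> were above \<open>g\<close>, its ladder would have a point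
  above \<open>g\<close>, whose colour also occurs on the ladder at \<open>g\<close>; as colours are
  unique on a ladder, that point would be the image of a point below \<open>g\<close>, although such
  images stay below \<open>g\<close>. So the two ladders coincide, and uniqueness of colours fixes
  each rung.\<close>

lemma hom_fixes_ladder:
  assumes g: "special g" "\<not> g \<prec> o'" and below: "\<And>x. x \<prec> g \<Longrightarrow> F x \<prec> g"
  obtains l where "Lad g l" "\<And>x. x \<epsilon> l \<Longrightarrow> F x = x"
proof -
  have gA: "g \<epsilon> A" using g unfolding special_def by blast
  obtain l where l: "pr g l \<epsilon> L" "Lad g l" using L L_ex g by blast
  obtain n where "colr g n" using colr_ex gA by blast
  then have sp: "special (F g)" using g colr_special hom_colr[OF gA g(2)] by blast
  obtain l' where l': "pr (F g) l' \<epsilon> L" "Lad (F g) l'" using L L_ex sp by blast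
  have step: "F x \<epsilon> l' \<and> (\<forall>m. pr x m \<epsilon> c \<longrightarrow> pr (F x) m \<epsilon> c)" if x: "x \<epsilon> l" for x
  proof -
    have xB: "x \<epsilon> A" "\<not> x \<prec> o'" "x \<prec> g" using l(2) x dom unfolding Lad_def by blast+
    have "R x g" unfolding R_def using xB g x l by blast
    from hom[OF this] have "F x \<epsilon> l'"
      using hom_B[OF xB(1,2)] hom_B[OF gA g(2)] sp l' L_unique unfolding R_def by blast
    moreover obtain k where "colr x k" using colr_ex xB(1) by blast
    ultimately show ?thesis using colr_c hom_colr[OF xB(1,2)] F_A[OF xB(1)] by blast
  qed
  have "F g = g"
  proof (rule ccontr)
    assume "F g \<noteq> g"
    then have "g \<prec> F g" using hom_ge[OF gA g(2)] total F_A gA by blast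
    then obtain y where y: "y \<epsilon> l'" "g \<prec> y" using l'(2) unfolding Lad_def by blast
    have "y \<epsilon> A" "\<not> lim y" using y l'(2) dom unfolding Lad_def by blast+
    then obtain z k where z: "S z y" "pr y k \<epsilon> c" using c_ex unfolding lim_def by blast
    then obtain k' where "pr z k' \<epsilon> c" using c_ex dom S_lt by blast
    with c_S[OF z(1) _ z(2)] have "k \<noteq> z0" using lim_z0 unfolding lim_def by blast
    then obtain x where x: "x \<epsilon> l" "pr x k \<epsilon> c" using l(2) c_o[OF z(2)] unfolding Lad_def by blast
    then have "F x = y" using step y(1) z(2) l'(2) unfolding Lad_def by blast
    moreover have "F x \<prec> g" using below x l(2) unfolding Lad_def by blast
    ultimately show False using y(2) asym by blast
  qed
  then have "l' = l" using l(1) l'(1) L_unique by simp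
  have "F x = x" if "x \<epsilon> l" for x
  proof -
    have "x \<epsilon> A" using that l(2) dom unfolding Lad_def by blast
    then obtain m where "pr x m \<epsilon> c" using c_ex by blast
    then show ?thesis using step[OF that] that l(2) unfolding \<open>l' = l\<close> Lad_def by blast
  qed
  with l(2) that show thesis by blast
qed

theorem rigid: "a \<epsilon> A \<Longrightarrow> F a = a"
proof (rule ccontr)
  assume a: "a \<epsilon> A" "F a \<noteq> a"
  then have ao: "\<not> a \<prec> o'" using hom_o by blast
  let ?B = "Coll (\<lambda>x. x \<epsilon> A \<and> \<not> x \<prec> o')"
  have B: "x \<epsilon> ?B \<longleftrightarrow> x \<epsilon> A \<and> \<not> x \<prec> o'" for x by (intro in_Coll separation defs)
  \<comment> \<open>Restricting the map to the points not below \<open>o'\<close> keeps the orbit of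
    \<open>a\<close> where \<open>F\<close> is known to be monotone.\<close>
  let ?g = "relset ?B ?B (\<lambda>x y. pr x y \<epsilon> f)"
  have d: "Def UNIV E (\<lambda>e. pr (e 0) (e 1) \<epsilon> f)" by (intro defs)
  have gfun: "isFun ?g ?B ?B" 
  proof (rule isFun_relset[OF d])
    fix x assume "x \<epsilon> ?B"
    then have x: "x \<epsilon> A" "\<not> x \<prec> o'" using B by auto
    then have "F x \<epsilon> ?B" using B F_A hom_B by simp
    then show "\<exists>!y. y \<epsilon> ?B \<and> pr x y \<epsilon> f" using f[OF x(1)] by auto
  qed
  have appg: "app ?g x = F x" if "x \<epsilon> ?B" for x
  proof -
    have x: "x \<epsilon> A" "\<not> x \<prec> o'" using B that by auto
    then have "F x \<epsilon> ?B" using B F_A hom_B by simp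
    then have "pr x (F x) \<epsilon> ?g" using pr_relset[OF d] that f[OF x(1)] by simp
    then show ?thesis using funOn_app[OF isFun_funOn[OF gfun] that] by simp
  qed
  have "a \<epsilon> ?B" using a ao B by blast
  \<comment> \<open>Along the points below \<open>o'\<close>, the function \<open>s\<close> lists
    the orbit \<open>a\<close>, \<open>F a\<close>, \<open>F (F a)\<close> and so on.\<close>
  from recursion[OF gfun this] obtain s where s: "isFun s A ?B" "\<And>x. lim x \<Longrightarrow> app s x = a"
    "\<And>x y. S x y \<Longrightarrow> app s y = app ?g (app s x)" by auto
  have sB: "app s x \<epsilon> A" "\<not> app s x \<prec> o'" if "x \<epsilon> A" for x using isFun_app[OF s(1) that] B by auto
  have s_pr: "pr x u \<epsilon> s \<longleftrightarrow> u = app s x" if "x \<epsilon> A" for x u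
    using funOn_app[OF isFun_funOn[OF s(1)] that] .
  have s_S: "app s y = F (app s x)" if "S x y" for x y
    using s(3)[OF that] appg isFun_app[OF s(1)] dom[OF S_lt[OF that]] by simp
  have s_inc: "app s n \<prec> F (app s n)" if "n \<prec> o'" for n
  proof -
    have "\<exists>u v. pr n u \<epsilon> s \<and> pr u v \<epsilon> f \<and> u \<prec> v" (is "?P n")
    proof (rule o_induct[where P = ?P, OF _ _ _ that])
      show "Def UNIV E (\<lambda>e. ?P (e 0))" by (intro defs)
      have "a \<prec> F a" using total[OF a(1) F_A[OF a(1)]] hom_ge[OF a(1) ao] a(2) by metis
      then show "?P z0" using s_pr[OF z0] s(2)[OF lim_z0] f[OF a(1)] by blast
    next
      fix n m assume n: "n \<prec> o'" "S n m" "?P n"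
      have A: "n \<epsilon> A" "m \<epsilon> A" using n dom[OF S_lt] by blast+
      then have "app s n \<prec> F (app s n)" using n(3) s_pr[OF A(1)] f[OF sB(1)[OF A(1)]] by auto
      then have "app s m \<prec> F (app s m)" using hom_mono[OF sB(2)[OF A(1)]] s_S[OF n(2)] by simp
      then show "?P m" using s_pr[OF A(2)] f[OF sB(1)[OF A(2)]] by blast
    qed
    moreover have "n \<epsilon> A" using dom[OF that] by blast
    ultimately show ?thesis using s_pr f[OF sB(1)] by auto
  qed
  have s_app: "u = app s n" if "n \<prec> o'" "pr n u \<epsilon> s" for n u
    using that s_pr dom[OF that(1)] by simp
  \<comment> \<open>An orbit value \<open>t\<close> would be followed by \<open>F t = t\<close>, but
    the orbit strictly increases. So \<open>t\<close> is an upper bound, and there is a least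
    one.\<close>
  have s_t: "app s n \<prec> t" if "n \<prec> o'" for n
  proof -
    have "app s n \<epsilon> A" using sB(1) dom[OF that] by blast
    moreover have "app s n \<noteq> t" using s_inc[OF that] hom_t irrefl by metis
    ultimately show ?thesis using t_top by blast
  qed
  then have "\<forall>n u. n \<prec> o' \<longrightarrow> pr n u \<epsilon> s \<longrightarrow> u \<prec> t" using s_app by blast
  moreover have "Def UNIV E (\<lambda>e. \<forall>n u. n \<prec> o' \<longrightarrow> pr n u \<epsilon> s \<longrightarrow> u \<prec> e 0)" by (intro defs)
  ultimately obtain g where g: "g \<epsilon> A" "\<forall>n u. n \<prec> o' \<longrightarrow> pr n u \<epsilon> s \<longrightarrow> u \<prec> g"
    "\<forall>y. y \<prec> g \<longrightarrow> \<not> (\<forall>n u. n \<prec> o' \<longrightarrow> pr n u \<epsilon> s \<longrightarrow> u \<prec> y)"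
    using least[of "\<lambda>y. \<forall>n u. n \<prec> o' \<longrightarrow> pr n u \<epsilon> s \<longrightarrow> u \<prec> y" t] t by blast
  have sg: "app s n \<prec> g" if "n \<prec> o'" for n 
    using g(2) that s_pr dom[OF that] by simp
  have ag: "a \<prec> g" using sg[OF z0_o] s(2)[OF lim_z0] by simp
  then have go: "\<not> g \<prec> o'" using ao trans by blast
  have "special g"
  proof (rule special_sup[OF isFun_funOn[OF s(1)]])
    show "u \<epsilon> A \<and> \<not> u \<prec> o'" if "pr x u \<epsilon> s" for x u using that s(1) B unfolding isFun_def by blast
    show "u \<prec> v \<and> (\<exists>k. pr u k \<epsilon> c \<and> pr v k \<epsilon> c)"
      if "n \<prec> o'" "S n m" "pr n u \<epsilon> s" "pr m v \<epsilon> s" for n m u v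
    proof -
      have A: "n \<epsilon> A" "m \<epsilon> A" using that dom[OF S_lt] by blast+
      then have uv: "u = app s n" "v = F u" using that s_pr s_S[OF that(2)] by auto
      have uA: "u \<epsilon> A" "\<not> u \<prec> o'" using sB[OF A(1)] uv by auto
      obtain k where k: "pr u k \<epsilon> c" using c_ex uA by blast
      obtain j where "colr u j" using colr_ex uA by blast
      then have "pr v k \<epsilon> c" using colr_c hom_colr[OF uA] k F_A[OF uA(1)] uv(2) by blast
      with k s_inc[OF that(1)] uv show ?thesis by blast
    qed
  qed (use g in blast)+
  moreover have "F x \<prec> g" if x: "x \<prec> g" for x
  proof (cases "x \<prec> o'")
    case True
    with hom_o x show ?thesis by simp
  next
    case False
    obtain n where n: "n \<prec> o'" "\<not> app s n \<prec> x" using g(3) x s_app by blast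
    obtain m where m: "S n m" "m \<prec> o'" using S_ex_o n by blast
    have "app s n \<epsilon> A" "x \<epsilon> A" using sB(1) dom n(1) x by blast+
    then have "x = app s n \<or> x \<prec> app s n" using total n(2) by blast
    then have "F x = app s m \<or> F x \<prec> app s m" using hom_mono[OF False] s_S[OF m(1)] by auto
    with sg[OF m(2)] trans[of "F x"] show ?thesis by auto
  qed
  ultimately obtain l where l: "Lad g l" "\<And>x. x \<epsilon> l \<Longrightarrow> F x = x" using hom_fixes_ladder go by blast
  then obtain x where x: "x \<epsilon> l" "a \<prec> x" "x \<prec> g" using ag unfolding Lad_def by blast
  have "app s n \<prec> x" if "n \<prec> o'" for n
  proof -
    have "\<exists>u. pr n u \<epsilon> s \<and> u \<prec> x" (is "?P n")
    proof (rule o_induct[where P = ?P, OF _ _ _ that])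
      show "Def UNIV E (\<lambda>e. ?P (e 0))" by (intro defs)
      show "?P z0" using s_pr[OF z0] s(2)[OF lim_z0] x by blast
    next
      fix n m assume n: "n \<prec> o'" "S n m" "?P n"
      have A: "n \<epsilon> A" "m \<epsilon> A" using n dom[OF S_lt] by blast+
      then have "app s n \<prec> x" using n(1,3) s_app by blast
      then have "F (app s n) \<prec> F x" using hom_mono[OF sB(2)[OF A(1)]] by blast
      then show "?P m" using s_S[OF n(2)] s_pr[OF A(2)] l(2)[OF x(1)] by auto
    qed
    then show ?thesis using s_app that by blast
  qed
  with g(3) x(3) s_app show False by blast
qed

end

end

section \<open>Natural numbers and finiteness in Zermelo set theory\<close>

context zermelo
begin

lemma ex_omega: "\<exists>om. omega E om"
proof -
  obtain w where w: "ind w" using ex_ind by blast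
  have "Def UNIV E (\<lambda>e. \<forall>v. ((\<exists>x. (\<forall>u. \<not> u \<epsilon> x) \<and> x \<epsilon> v) \<and>
      (\<forall>n m. n \<epsilon> v \<longrightarrow> (\<forall>u. u \<epsilon> m \<longleftrightarrow> u \<epsilon> n \<or> u = n) \<longrightarrow> m \<epsilon> v)) \<longrightarrow> e 0 \<epsilon> v)"
    by (intro defs)
  moreover have "ind v \<longleftrightarrow> (\<exists>x. (\<forall>u. \<not> u \<epsilon> x) \<and> x \<epsilon> v) \<and>
      (\<forall>n m. n \<epsilon> v \<longrightarrow> (\<forall>u. u \<epsilon> m \<longleftrightarrow> u \<epsilon> n \<or> u = n) \<longrightarrow> m \<epsilon> v)" for v
    unfolding ind_def eq_emp[symmetric] eq_sc[symmetric] by blast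
  ultimately have "is_set (\<lambda>n. n \<epsilon> w \<and> (\<forall>v. ind v \<longrightarrow> n \<epsilon> v))"
    by (intro separation) simp
  then obtain om where om: "\<And>n. n \<epsilon> om \<longleftrightarrow> n \<epsilon> w \<and> (\<forall>v. ind v \<longrightarrow> n \<epsilon> v)"
    unfolding is_set_def by blast
  have "omega E om"
    by unfold_locales (use w in \<open>auto simp: ind_def om sub_def\<close>)
  then show ?thesis ..
qed

lemma TDef_sc:
  assumes "TDef UNIV E s"
  shows "TDef UNIV E (\<lambda>e. sc (s e))"
  by (rule TDefI[where R = "\<lambda>e. \<forall>u. u \<epsilon> e 0 \<longleftrightarrow> u \<epsilon> s (\<lambda>i. e (Suc i)) \<or> u = s (\<lambda>i. e (Suc i))"])
    (auto simp: eq_sc intro!: Def_UNIV TDef_ren[OF assms])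

end

locale zermelo_omega = zermelo + omega
begin

lemma om_trans: "n \<epsilon> om \<Longrightarrow> m \<epsilon> n \<Longrightarrow> k \<epsilon> m \<Longrightarrow> k \<epsilon> n"
proof -
  assume n: "n \<epsilon> om" and mk: "m \<epsilon> n" "k \<epsilon> m"
  have "\<forall>m k. m \<epsilon> n \<longrightarrow> k \<epsilon> m \<longrightarrow> k \<epsilon> n"
    by (rule om_induct[OF _ _ _ n, where P = "\<lambda>n. \<forall>m k. m \<epsilon> n \<longrightarrow> k \<epsilon> m \<longrightarrow> k \<epsilon> n"],
        intro separation defs) auto
  with mk show ?thesis by blast
qed

text \<open>Induction takes the place of Foundation, which \<open>zermelo\<close> does not assume:
  if \<open>sc n\<close> were an element of itself, transitivity would bring \<open>n\<close> into
  \<open>n\<close>.\<close>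

lemma om_irrefl: "n \<epsilon> om \<Longrightarrow> \<not> n \<epsilon> n"
proof (rule om_induct[where P = "\<lambda>n. \<not> n \<epsilon> n"])
  show "is_set (\<lambda>n. n \<epsilon> om \<and> \<not> n \<epsilon> n)" by (intro separation defs)
next
  fix n assume "n \<epsilon> om" "\<not> n \<epsilon> n"
  moreover have "n \<epsilon> sc n" by simp
  ultimately show "\<not> sc n \<epsilon> sc n" using om_trans[of n "sc n" n] by (metis in_sc)
qed auto

text \<open>With \<open>z0\<close> as the only limit, counting steps from it numbers all of
  \<open>A\<close> without gaps. The greatest element \<open>t\<close> gets the last number, so the
  numbers used are exactly those below \<open>sc (app h t)\<close>.\<close>

lemma finite_ranked:
  assumes "well_ordered E A W" "t \<epsilon> A" "\<And>x. x \<epsilon> A \<Longrightarrow> x = t \<or> pr x t \<epsilon> W"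
    and "z0 \<epsilon> A" "\<And>x. x \<epsilon> A \<Longrightarrow> x = z0 \<or> pr z0 x \<epsilon> W"
    and only: "\<And>x. well_ordered.lim E A W x \<Longrightarrow> x = z0"
  shows "finite_in UNIV A"
proof -
  interpret well_ordered E A W by fact
  have d: "Def UNIV E (\<lambda>e. e 1 = sc (e 0))" by (intro defs TDef_sc)
  let ?g = "relset om om (\<lambda>x y. y = sc x)"
  have g: "isFun ?g om om" by (rule isFun_relset[OF d]) (auto simp: om_sc)
  from recursion[OF g om_emp] obtain h where h: "isFun h A om"
    "\<forall>x. lim x \<longrightarrow> app h x = emp" "\<forall>x y. S x y \<longrightarrow> app h y = app ?g (app h x)" by auto
  have h_om: "app h x \<epsilon> om" if "x \<epsilon> A" for x using isFun_app[OF h(1) that] .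
  have h_pr: "pr x n \<epsilon> h \<longleftrightarrow> n = app h x" if "x \<epsilon> A" for x n
    using funOn_app[OF isFun_funOn[OF h(1)] that] .
  have h_S: "app h y = sc (app h x)" if "S x y" for x y
  proof -
    have x: "x \<epsilon> A" using dom[OF S_lt[OF that]] by blast
    have "pr (app h x) (sc (app h x)) \<epsilon> ?g" using pr_relset[OF d] h_om[OF x] om_sc by simp
    then show ?thesis using funOn_app[OF isFun_funOn[OF g] h_om[OF x]] h(3) that by simp
  qed
  have mono: "app h x \<epsilon> app h y" if xy: "pr x y \<epsilon> W" for x y
  proof -
    have xA: "x \<epsilon> A" and yA: "y \<epsilon> A" using dom[OF xy] by auto
    have "pr x y \<epsilon> W \<longrightarrow> (\<exists>n. pr y n \<epsilon> h \<and> app h x \<epsilon> n)" (is "?P y")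
    proof (rule induct[where P = ?P, OF _ _ yA])
      show "Def UNIV E (\<lambda>e. ?P (e 0))" by (intro defs)
    next
      fix y assume y: "y \<epsilon> A" and IH: "\<And>z. pr z y \<epsilon> W \<Longrightarrow> ?P z"
      show "?P y"
      proof
        assume xy: "pr x y \<epsilon> W"
        then have "y \<noteq> z0" using assms(5)[OF xA] asym irrefl by blast
        then have "\<not> lim y" using only by blast
        then obtain z where z: "S z y" using y unfolding lim_def by blast
        have "app h x \<epsilon> app h y"
          using lt_S[OF z xy] IH[OF S_lt[OF z]] h_pr dom[OF S_lt[OF z]] h_S[OF z] by auto
        then show "\<exists>n. pr y n \<epsilon> h \<and> app h x \<epsilon> n" using h_pr[OF y] by blast
      qed
    qed
    with xy h_pr[OF yA] show ?thesis by auto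
  qed
  have surj: "\<exists>y. y \<epsilon> A \<and> app h y = n" if n: "n \<epsilon> app h x" and x: "x \<epsilon> A" for n x
  proof -
    have "\<forall>m. pr x m \<epsilon> h \<longrightarrow> n \<epsilon> m \<longrightarrow> (\<exists>y. y \<epsilon> A \<and> pr y n \<epsilon> h)" (is "?P x")
    proof (rule induct[where P = ?P, OF _ _ x])
      show "Def UNIV E (\<lambda>e. ?P (e 0))" by (intro defs)
    next
      fix x assume x: "x \<epsilon> A" and IH: "\<And>z. pr z x \<epsilon> W \<Longrightarrow> ?P z"
      show "?P x"
      proof (intro allI impI)
        fix m assume m: "pr x m \<epsilon> h" "n \<epsilon> m"
        then have mx: "m = app h x" using h_pr[OF x] by simp
        then have "\<not> lim x" using h(2) m(2) by auto
        then obtain z where z: "S z x" using x unfolding lim_def by blast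
        have zA: "z \<epsilon> A" using dom[OF S_lt[OF z]] by blast
        have "n \<epsilon> app h z \<or> n = app h z" using m(2) mx h_S[OF z] by simp
        moreover have "pr z (app h z) \<epsilon> h" using h_pr[OF zA] by simp
        ultimately show "\<exists>y. y \<epsilon> A \<and> pr y n \<epsilon> h" using IH[OF S_lt[OF z]] zA by auto
      qed
    qed
    moreover have "pr x (app h x) \<epsilon> h" using h_pr[OF x] by simp
    ultimately obtain y where "y \<epsilon> A" "pr y n \<epsilon> h" using n by auto
    then show ?thesis using h_pr by auto
  qed
  have inj: "x = y" if "x \<epsilon> A" "y \<epsilon> A" "app h x = app h y" for x y
    using total[OF that(1,2)] mono om_irrefl h_om that by metis
  let ?n = "sc (app h t)"
  have d: "Def UNIV E (\<lambda>e. pr (e 1) (e 0) \<epsilon> h)" by (intro defs)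
  let ?f = "relset ?n A (\<lambda>n x. pr x n \<epsilon> h)"
  have f: "pr n x \<epsilon> ?f \<longleftrightarrow> n \<epsilon> ?n \<and> x \<epsilon> A \<and> pr x n \<epsilon> h" for n x by (rule pr_relset[OF d])
  have "isFun ?f ?n A"
  proof (rule isFun_relset[OF d])
    fix n assume "n \<epsilon> ?n"
    then obtain y where y: "y \<epsilon> A" "app h y = n" using surj[OF _ assms(2)] assms(2) by auto
    show "\<exists>!x. x \<epsilon> A \<and> pr x n \<epsilon> h"
      using y h_pr inj by (intro ex1I[of _ y]) auto
  qed
  moreover have "\<exists>!n. pr n y \<epsilon> ?f" if y: "y \<epsilon> A" for y
  proof -
    have "app h y \<epsilon> ?n" using assms(3)[OF y] mono by auto
    with y h_pr[OF y] f show ?thesis by (intro ex1I[of _ "app h y"]) auto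
  qed
  moreover have "?n \<epsilon> om" using h_om[OF assms(2)] om_sc by blast
  ultimately show ?thesis unfolding finite_in_def by blast
qed

theorem ex_rigid:
  assumes inf: "\<not> finite_in UNIV A"
  shows "\<exists>r. rigid_in UNIV A r"
proof -
  have "\<exists>t. t \<epsilon> A"
  proof (rule ccontr)
    assume "\<not> ?thesis"
    then have "isFun emp emp A" "\<forall>y. y \<epsilon> A \<longrightarrow> (\<exists>!x. pr x y \<epsilon> emp)"
      by (auto simp: isFun_def funOn_def)
    with om_emp inf show False unfolding finite_in_def by blast
  qed
  then obtain t where t: "t \<epsilon> A" by blast
  obtain W where W: "well_ordered E A W" "\<And>x. x \<epsilon> A \<Longrightarrow> x = t \<or> pr x t \<epsilon> W"
    using well_ordering[OF t] by metis
  interpret well_ordered E A W by fact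
  obtain z0 where z0: "z0 \<epsilon> A" "\<forall>x. x \<epsilon> A \<longrightarrow> x = z0 \<or> pr z0 x \<epsilon> W"
    using least[OF Def_True t] by auto
  let ?P = "\<lambda>x. lim x \<and> x \<noteq> z0"
  \<comment> \<open>If \<open>z0\<close> were the only limit, \<open>A\<close> would be
    finite.\<close>
  have "\<exists>x. ?P x" using finite_ranked[OF W(1) t W(2) z0(1)] z0(2) inf by blast
  moreover have "Def UNIV E (\<lambda>e. ?P (e 0))" by (intro defs Def_lim)
  ultimately obtain l where l: "?P l" "\<forall>y. y \<epsilon> A \<longrightarrow> ?P y \<longrightarrow> y = l \<or> pr l y \<epsilon> W"
    using least[of ?P] unfolding lim_def by blast
  interpret ranked E A W t z0 l
    by unfold_locales (use t W z0 l lim_def in blast)+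
  let ?X = "Coll (\<lambda>x. x \<epsilon> A \<and> pr x l \<epsilon> W)"
  have X: "x \<epsilon> ?X \<longleftrightarrow> x \<epsilon> A \<and> pr x l \<epsilon> W" for x by (intro in_Coll separation defs)
  \<comment> \<open>Colours are counted by iterating the successor on the segment below
    \<open>l\<close>, starting at \<open>z0\<close>.\<close>
  let ?g = "relset ?X ?X S"
  have d: "Def UNIV E (\<lambda>e. S (e 0) (e 1))" by (intro defs Def_S)
  have g: "isFun ?g ?X ?X"
  proof (rule isFun_relset[OF d])
    fix x assume "x \<epsilon> ?X"
    then have "pr x l \<epsilon> W" using X by blast
    from S_ex_o[OF this] obtain y where "S x y" "pr y l \<epsilon> W" by blast
    then show "\<exists>!y. y \<epsilon> ?X \<and> S x y" using X dom[of y l] S_right_unique[of x] by blast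
  qed
  have "z0 \<epsilon> ?X" using X z0 z0_o by simp
  from recursion[OF g this] obtain c where c: "isFun c A ?X"
    "\<forall>x. lim x \<longrightarrow> app c x = z0" "\<forall>x y. S x y \<longrightarrow> app c y = app ?g (app c x)" by auto
  have c_pr: "pr x n \<epsilon> c \<longleftrightarrow> n = app c x" if "x \<epsilon> A" for x n
    using funOn_app[OF isFun_funOn[OF c(1)] that] .
  interpret coloured E A W t z0 l c
  proof
    show "funOn c A" using c(1) isFun_funOn by blast
    show "pr n l \<epsilon> W" if "pr x n \<epsilon> c" for x n using c(1) that X unfolding isFun_def by blast
    show "pr x n \<epsilon> c \<longleftrightarrow> n = z0" if "lim x" for x n
      using c_pr c(2) that unfolding lim_def by simp
    show "S n m" if xy: "S x y" and n: "pr x n \<epsilon> c" and m: "pr y m \<epsilon> c" for x y n m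
    proof -
      have A: "x \<epsilon> A" "y \<epsilon> A" using dom[OF S_lt[OF xy]] by auto
      then have "m = app ?g n" "n \<epsilon> ?X" using n m xy c(3) c_pr isFun_app[OF c(1)] by auto
      then have "pr n m \<epsilon> ?g" using funOn_app[OF isFun_funOn[OF g]] by blast
      then show ?thesis using pr_relset[OF d] by blast
    qed
  qed
  have d: "Def UNIV E (\<lambda>e. special (e 0) \<longrightarrow> Lad (e 0) (e 1))" by (intro defs Def_special Def_Lad)
  have "\<exists>y. y \<epsilon> power A \<and> (special q \<longrightarrow> Lad q y)" if "q \<epsilon> A" for q
  proof (cases "special q")
    case True
    then obtain y where y: "Lad q y" unfolding special_def by blast
    then have "sub y A" using dom unfolding Lad_def sub_def by blast
    with y show ?thesis by auto
  next
    case False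
    \<comment> \<open>Points that are not special receive some subset of \<open>A\<close> too, so
      that the choice function is total.\<close>
    have "emp \<epsilon> power A" by (simp add: sub_def)
    with False show ?thesis by blast
  qed
  then obtain L where L: "isFun L A (power A)" "\<And>q. q \<epsilon> A \<Longrightarrow> special q \<longrightarrow> Lad q (app L q)"
    using choice_function[OF d] by metis
  have L_pr: "pr q y \<epsilon> L \<longleftrightarrow> y = app L q" if "q \<epsilon> A" for q y
    using funOn_app[OF isFun_funOn[OF L(1)] that] .
  interpret laddered E A W t z0 l c L
  proof
    show "Lad q y" if "pr q y \<epsilon> L" "special q" for q y
    proof -
      have "q \<epsilon> A" using that(2) unfolding special_def by blast
      with that L(2) L_pr show ?thesis by auto
    qed
    show "\<exists>y. pr q y \<epsilon> L" if "special q" for q using that L_pr unfolding special_def by blast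
    show "y = y'" if "pr q y \<epsilon> L" "pr q y' \<epsilon> L" for q y y'
      using that L_pr[OF funOn_dom[OF isFun_funOn[OF L(1)] that(1)]] by simp
  qed
  have r: "pr x y \<epsilon> relset A A R \<longleftrightarrow> x \<epsilon> A \<and> y \<epsilon> A \<and> R x y" for x y
    by (rule pr_relset[OF Def_R])
  have "pr x x \<epsilon> f" if f: "endo A (relset A A R) f" and x: "x \<epsilon> A" for f x
  proof -
    have fA: "isFun f A A" using f unfolding endo_def by blast
    note f_pr = funOn_app[OF isFun_funOn[OF fA]]
    have R_dom: "p \<epsilon> A \<and> q \<epsilon> A" if "R p q" for p q
      using that dom unfolding R_def by blast
    have "app f x = x"
    proof (rule rigid[where f = f])
      show "app f p \<epsilon> A" if "p \<epsilon> A" for p using isFun_app[OF fA that] .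
      show "R (app f p) (app f q)" if pq: "R p q" for p q
      proof -
        have "\<exists>u v. pr p u \<epsilon> f \<and> pr q v \<epsilon> f \<and> pr u v \<epsilon> relset A A R"
          using f R_dom[OF pq] pq r unfolding endo_def by blast
        then show ?thesis using f_pr R_dom[OF pq] r by auto
      qed
    qed (use f_pr x in auto)
    then show ?thesis using f_pr[OF x] by simp
  qed
  then have "rigid_in UNIV A (relset A A R)"
    unfolding rigid_in_def using in_relset[OF Def_R] by blast
  then show ?thesis ..
qed

end

text \<open>Taking singletons is injective and misses the empty set. This supplies the infinity that
  \<open>completeness\<close> asks for.\<close>

lemma infinite_domain:
  assumes "\<exists>x\<in>D. \<forall>z\<in>D. \<not> E z x" "\<forall>x\<in>D. \<exists>y\<in>D. \<forall>z\<in>D. E z y \<longleftrightarrow> z = x"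
  shows "infinite D"
proof
  assume fin: "finite D"
  obtain e where e: "e \<in> D" "\<forall>z\<in>D. \<not> E z e" using assms(1) by blast
  obtain s where s: "\<And>x. x \<in> D \<Longrightarrow> s x \<in> D \<and> (\<forall>z\<in>D. E z (s x) \<longleftrightarrow> z = x)"
    using assms(2) by metis
  have "inj_on s D" using s by (intro inj_onI) metis
  moreover have "s ` D \<subseteq> D" using s by blast
  ultimately have "s ` D = D" using fin endo_inj_surj by blast
  then obtain x where "x \<in> D" "e = s x" using e(1) by blast
  with s e show False by blast
qed

section \<open>The axioms of ZFC over an arbitrary domain\<close>

lemma sat_ZFC_iff:
  assumes e: "range e \<subseteq> D"
  shows "(\<forall>q\<in>ZFC. sat D E e q) \<longleftrightarrow>
    (\<forall>ax\<in>set (zfc_finite_part fAll). holds D E e 0 e ax) \<and>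
    (\<forall>p w. range w \<subseteq> D \<longrightarrow> (\<forall>a\<in>D. \<exists>b\<in>D. \<forall>x\<in>D. E x b \<longleftrightarrow> E x a \<and> sat D E (case_nat x w) p)) \<and>
    (\<forall>p w. range w \<subseteq> D \<longrightarrow> (\<forall>a\<in>D.
      (\<forall>x\<in>D. E x a \<longrightarrow> (\<exists>y\<in>D. \<forall>z\<in>D. sat D E (case_nat x (case_nat z w)) p \<longleftrightarrow> z = y)) \<longrightarrow>
      (\<exists>b\<in>D. \<forall>y\<in>D. E y b \<longleftrightarrow> (\<exists>x\<in>D. E x a \<and> sat D E (case_nat x (case_nat y w)) p))))"
proof -
  have "sat D E w (ax_separation fAll (at1 p) 0) \<longleftrightarrow>
      (\<forall>a\<in>D. \<exists>b\<in>D. \<forall>x\<in>D. E x b \<longleftrightarrow> E x a \<and> sat D E (case_nat x w) p)" for p w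
    unfolding sat_holds[of D E w _ w] by (simp add: ax_separation_def)
  moreover have "sat D E w (ax_replacement fAll (at2 p) 0) \<longleftrightarrow> (\<forall>a\<in>D.
      (\<forall>x\<in>D. E x a \<longrightarrow> (\<exists>y\<in>D. \<forall>z\<in>D. sat D E (case_nat x (case_nat z w)) p \<longleftrightarrow> z = y)) \<longrightarrow>
      (\<exists>b\<in>D. \<forall>y\<in>D. E y b \<longleftrightarrow> (\<exists>x\<in>D. E x a \<and> sat D E (case_nat x (case_nat y w)) p)))" for p w
    unfolding sat_holds[of D E w _ w] by (simp add: ax_replacement_def)
  moreover have "(\<forall>q\<in>{ax 0 | ax. ax \<in> X}. sat D E e q) \<longleftrightarrow> (\<forall>ax\<in>X. holds D E e 0 e ax)" for X
    unfolding sat_holds[of D E e _ e, symmetric] by blast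
  moreover have "(\<forall>q\<in>{closure (f p) | p. True}. sat D E e q) \<longleftrightarrow>
      (\<forall>p w. range w \<subseteq> D \<longrightarrow> sat D E w (f p))" for f :: "fm \<Rightarrow> fm"
    unfolding sat_closure[OF e, symmetric] by blast
  ultimately show ?thesis
    unfolding ZFC_def ball_Un by simp
qed

lemmas zfc_axiom_defs = zfc_finite_part_def ax_extensionality_def ax_foundation_def ax_pair_def
  ax_union_def ax_power_def ax_infinity_def ax_choice_def

lemma holds_choice: "holds D E w n v (ax_choice fAll) \<longleftrightarrow> (\<forall>x\<in>D.
    (\<forall>u\<in>D. E u x \<longrightarrow> (\<exists>v\<in>D. E v u)) \<and>
    (\<forall>u\<in>D. \<forall>v\<in>D. E u x \<and> E v x \<and> u \<noteq> v \<longrightarrow> \<not> (\<exists>z\<in>D. E z u \<and> E z v)) \<longrightarrow>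
    (\<exists>c\<in>D. \<forall>u\<in>D. E u x \<longrightarrow> (\<exists>v\<in>D. \<forall>z\<in>D. E z u \<and> E z c \<longleftrightarrow> z = v)))"
  by (simp add: ax_choice_def cong del: imp_cong)

lemma zermelo_ZFC:
  assumes ZFC: "\<forall>q\<in>ZFC. sat UNIV E e q"
  shows "zermelo E"
proof -
  have ax: "\<forall>ax\<in>set (zfc_finite_part fAll). holds UNIV E e 0 e ax"
    and sep: "\<And>p w a. \<exists>b. \<forall>x. E x b \<longleftrightarrow> E x a \<and> sat UNIV E (case_nat x w) p"
    using ZFC sat_ZFC_iff[of e UNIV E] by simp_all
  have h: "holds UNIV E e 0 e (ax_extensionality fAll)" "holds UNIV E e 0 e (ax_pair fAll)"
    "holds UNIV E e 0 e (ax_union fAll)" "holds UNIV E e 0 e (ax_power fAll)"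
    "holds UNIV E e 0 e (ax_infinity fAll)" "holds UNIV E e 0 e (ax_choice fAll)"
    using ax by (simp_all add: zfc_finite_part_def)
  have ext: "(\<forall>z. E z x \<longleftrightarrow> E z y) \<longrightarrow> x = y" for x y
    using h(1) by (simp add: ax_extensionality_def)
  have pair: "\<exists>z. \<forall>u. E u z \<longleftrightarrow> u = x \<or> u = y" for x y
    using h(2) by (simp add: ax_pair_def)
  have union: "\<exists>z. \<forall>u. E u z \<longleftrightarrow> (\<exists>v. E v x \<and> E u v)" for x
    using h(3) by (simp add: ax_union_def)
  have power: "\<exists>z. \<forall>u. E u z \<longleftrightarrow> (\<forall>v. E v u \<longrightarrow> E v x)" for x
    using h(4) by (simp add: ax_power_def)
  have inf: "\<exists>w. (\<exists>e. E e w \<and> (\<forall>u. \<not> E u e)) \<and>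
      (\<forall>n. E n w \<longrightarrow> (\<exists>m. E m w \<and> (\<forall>u. E u m \<longleftrightarrow> E u n \<or> u = n)))"
    using h(5) by (simp add: ax_infinity_def)
  have choice: "(\<forall>u. E u x \<longrightarrow> (\<exists>v. E v u)) \<Longrightarrow>
      (\<forall>u v. E u x \<and> E v x \<and> u \<noteq> v \<longrightarrow> \<not> (\<exists>z. E z u \<and> E z v)) \<Longrightarrow>
      (\<exists>c. \<forall>u. E u x \<longrightarrow> (\<exists>v. \<forall>z. E z u \<and> E z c \<longleftrightarrow> z = v))" for x
    using h(6) unfolding holds_choice ball_UNIV bex_UNIV
    by (drule_tac spec[of _ x]) (erule mp, intro conjI, assumption+)
  interpret basic E
    by unfold_locales (use ext pair union inf in blast)+
  show ?thesis
  proof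
    show "\<exists>w. ind w"
      using inf unfolding ind_def eq_emp[symmetric] eq_sc[symmetric] by blast
    show "\<exists>z. \<forall>u. E u z \<longleftrightarrow> sub u x" for x unfolding sub_def by (rule power)
    show "is_set (\<lambda>x. E x a \<and> P x)" if P: "Def UNIV E (\<lambda>e. P (e 0))" for P a
    proof -
      obtain p w where "\<And>x. P x \<longleftrightarrow> sat UNIV E (case_nat x w) p"
        by (rule Def_unary[OF P]) auto
      with sep[of a w p] show ?thesis unfolding is_set_def by simp
    qed
    show "\<exists>c. \<forall>u. E u x \<longrightarrow> (\<exists>v. \<forall>z. E z u \<and> E z c \<longleftrightarrow> z = v)"
      if "\<And>u. E u x \<Longrightarrow> \<exists>v. E v u" "\<And>u v z. E u x \<Longrightarrow> E v x \<Longrightarrow> E z u \<Longrightarrow> E z v \<Longrightarrow> u = v" for x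
      by (rule choice) (use that in blast)+
  qed
qed

theorem ZFC_VPH: "ZFC \<turnstile> VPH 0"
proof (rule completeness)
  fix D and E :: "nat \<Rightarrow> nat \<Rightarrow> bool" and e
  assume e: "range e \<subseteq> D" and ZFC: "\<forall>q\<in>ZFC. sat D E e q"
  then have "\<forall>ax\<in>set (zfc_finite_part fAll). holds D E e 0 e ax"
    by (simp add: sat_ZFC_iff)
  then have "holds D E e 0 e (ax_pair fAll)" "holds D E e 0 e (ax_infinity fAll)"
    by (simp_all add: zfc_finite_part_def)
  then have "\<forall>x\<in>D. \<forall>y\<in>D. \<exists>z\<in>D. \<forall>u\<in>D. E u z \<longleftrightarrow> u = x \<or> u = y" "\<exists>x\<in>D. \<forall>z\<in>D. \<not> E z x"
    by (auto simp add: ax_pair_def ax_infinity_def)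
  then show "infinite D" by (intro infinite_domain[of D E]) (auto, metis)
next
  fix E :: "nat \<Rightarrow> nat \<Rightarrow> bool" and e
  assume "\<forall>q\<in>ZFC. sat UNIV E e q"
  then interpret zermelo E by (rule zermelo_ZFC)
  obtain om where "omega E om" using ex_omega by blast
  then interpret omega E om .
  interpret zermelo_omega E om ..
  show "sat UNIV E e (VPH 0)"
    unfolding sat_holds[of UNIV E e VPH e] using ex_rigid by (simp add: holds_VPH)
qed

section \<open>Syntax and satisfaction inside a model\<close>

context omega
begin

section \<open>Meaning in a model of the formulas for languages, codes and satisfaction\<close>

definition relSym :: "'a \<Rightarrow> 'a \<Rightarrow> bool" where
  "relSym n f \<longleftrightarrow> n \<epsilon> om \<and> (\<exists>s. f = tag 0 n s)"

definition funSym :: "'a \<Rightarrow> 'a \<Rightarrow> bool" where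
  "funSym n f \<longleftrightarrow> n \<epsilon> om \<and> (\<exists>s. f = tag 1 n s)"

definition isLang :: "'a \<Rightarrow> bool" where
  "isLang L \<longleftrightarrow> (\<forall>f. f \<epsilon> L \<longrightarrow> (\<exists>n. relSym n f \<or> funSym n f))"

definition isOper :: "'a \<Rightarrow> 'a \<Rightarrow> 'a \<Rightarrow> bool" where
  "isOper g n D \<longleftrightarrow> (\<forall>z. z \<epsilon> g \<longrightarrow> (\<exists>t y. isFun t n D \<and> y \<epsilon> D \<and> z = pr t y)) \<and>
    (\<forall>t. isFun t n D \<longrightarrow> (\<exists>x. \<forall>y. pr t y \<epsilon> g \<longleftrightarrow> y = x))"

definition isInterp :: "'a \<Rightarrow> 'a \<Rightarrow> 'a \<Rightarrow> bool" where
  "isInterp L D I \<longleftrightarrow> (\<exists>x. x \<epsilon> D) \<and> funOn I L \<and>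
    (\<forall>f r n. pr f r \<epsilon> I \<and> relSym n f \<longrightarrow> (\<forall>t. t \<epsilon> r \<longrightarrow> isFun t n D)) \<and>
    (\<forall>f g n. pr f g \<epsilon> I \<and> funSym n f \<longrightarrow> isOper g n D)"

text \<open>The length \<open>m\<close> is a natural number in the sense of the model and may be
  nonstandard, so such codes need not come from actual formulas. The counterpart with genuine finite
  lists is \<open>gen\<close>.\<close>

definition built :: "(('a \<Rightarrow> bool) \<Rightarrow> 'a \<Rightarrow> bool) \<Rightarrow> 'a \<Rightarrow> bool" where
  "built step c \<longleftrightarrow> (\<exists>m g. m \<epsilon> om \<and> funOn g m \<and> (\<exists>i. pr i c \<epsilon> g) \<and>
    (\<forall>i d. pr i d \<epsilon> g \<longrightarrow> step (\<lambda>e. \<exists>j. j \<epsilon> i \<and> pr j e \<epsilon> g) d))"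

definition term_step :: "'a \<Rightarrow> 'a \<Rightarrow> ('a \<Rightarrow> bool) \<Rightarrow> 'a \<Rightarrow> bool" where
  "term_step L k prev c \<longleftrightarrow> (\<exists>i. i \<epsilon> k \<and> c = tag 0 i emp) \<or>
    (\<exists>f. f \<epsilon> L \<and> (\<exists>n t. funSym n f \<and> funOn t n \<and> (\<forall>i e. pr i e \<epsilon> t \<longrightarrow> prev e) \<and> c = tag 1 f t))"

definition isTerm :: "'a \<Rightarrow> 'a \<Rightarrow> 'a \<Rightarrow> bool" where
  "isTerm L k = built (term_step L k)"

definition isAtom :: "'a \<Rightarrow> 'a \<Rightarrow> 'a \<Rightarrow> bool" where
  "isAtom L k c \<longleftrightarrow> (\<exists>t u. isTerm L k t \<and> isTerm L k u \<and> c = tag 2 t u) \<or>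
    (\<exists>r. r \<epsilon> L \<and> (\<exists>n t. relSym n r \<and> funOn t n \<and> (\<forall>i e. pr i e \<epsilon> t \<longrightarrow> isTerm L k e) \<and> c = tag 3 r t))"

definition flsc :: 'a where "flsc = tag 6 emp emp"

definition formula_step :: "'a \<Rightarrow> 'a \<Rightarrow> ('a \<Rightarrow> bool) \<Rightarrow> 'a \<Rightarrow> bool" where
  "formula_step L k prev c \<longleftrightarrow> isAtom L k c \<or> c = flsc \<or>
    (\<exists>p q. prev p \<and> prev q \<and> c = tag 4 p q) \<or> (\<exists>i. i \<epsilon> k \<and> (\<exists>p. prev p \<and> c = tag 5 i p))"

definition isFormula :: "'a \<Rightarrow> 'a \<Rightarrow> 'a \<Rightarrow> bool" where
  "isFormula L k = built (formula_step L k)"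

definition valueTuple :: "'a \<Rightarrow> 'a \<Rightarrow> 'a \<Rightarrow> 'a \<Rightarrow> bool" where
  "valueTuple V a t s \<longleftrightarrow> (\<exists>n. n \<epsilon> om \<and> funOn t n \<and> funOn s n \<and>
    (\<forall>i e x. pr i e \<epsilon> t \<and> pr i x \<epsilon> s \<longrightarrow> pr (pr e a) x \<epsilon> V))"

definition valuation :: "'a \<Rightarrow> 'a \<Rightarrow> 'a \<Rightarrow> 'a \<Rightarrow> bool" where
  "valuation L D I V \<longleftrightarrow> (\<forall>k a c. k \<epsilon> om \<and> isFun a k D \<and> isTerm L k c \<longrightarrow>
    (\<forall>x. pr (pr c a) x \<epsilon> V \<longleftrightarrow> (\<exists>i. c = tag 0 i emp \<and> pr i x \<epsilon> a) \<or>
      (\<exists>f t g s. c = tag 1 f t \<and> pr f g \<epsilon> I \<and> valueTuple V a t s \<and> pr s x \<epsilon> g)))"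

definition satisfaction :: "'a \<Rightarrow> 'a \<Rightarrow> 'a \<Rightarrow> 'a \<Rightarrow> bool" where
  "satisfaction L D I S \<longleftrightarrow> (\<exists>V. valuation L D I V \<and>
    (\<forall>k a c. k \<epsilon> om \<and> isFun a k D \<and> isFormula L k c \<longrightarrow>
      (pr c a \<epsilon> S \<longleftrightarrow>
        (\<exists>t u x. c = tag 2 t u \<and> pr (pr t a) x \<epsilon> V \<and> pr (pr u a) x \<epsilon> V) \<or>
        (\<exists>f t r s. c = tag 3 f t \<and> pr f r \<epsilon> I \<and> valueTuple V a t s \<and> s \<epsilon> r) \<or>
        (\<exists>p q. c = tag 4 p q \<and> (pr p a \<epsilon> S \<longrightarrow> pr q a \<epsilon> S)) \<or>
        (\<exists>i p. c = tag 5 i p \<and> (\<forall>x. x \<epsilon> D \<longrightarrow> (\<forall>b. upd k a i x b \<longrightarrow> pr p b \<epsilon> S))))))"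

definition elementary_embedding :: "'a \<Rightarrow> 'a \<Rightarrow> 'a \<Rightarrow> 'a \<Rightarrow> bool" where
  "elementary_embedding L x y j \<longleftrightarrow> (\<exists>D I D' J S T. x = pr D I \<and> y = pr D' J \<and> isFun j D D' \<and>
    satisfaction L D I S \<and> satisfaction L D' J T \<and>
    (\<forall>k c a b. k \<epsilon> om \<and> isFormula L k c \<and> isFun a k D \<and> isFun b k D' \<and>
      (\<forall>i u v. pr i u \<epsilon> a \<and> pr u v \<epsilon> j \<longrightarrow> pr i v \<epsilon> b) \<longrightarrow> (pr c a \<epsilon> S \<longleftrightarrow> pr c b \<epsilon> T)))"

definition msym :: 'a where "msym = tag 0 (num 2) emp"

definition mlang :: 'a where "mlang = up msym msym"

definition is2tup :: "'a \<Rightarrow> 'a \<Rightarrow> 'a \<Rightarrow> bool" where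
  "is2tup x y t \<longleftrightarrow> funOn t (num 2) \<and> pr (num 0) x \<epsilon> t \<and> pr (num 1) y \<epsilon> t"

definition msat :: "'a \<Rightarrow> 'a \<Rightarrow> bool" where
  "msat M S \<longleftrightarrow> (\<exists>I. isInterp mlang M I \<and>
    (\<forall>f r. pr f r \<epsilon> I \<longrightarrow> (\<forall>x. x \<epsilon> M \<longrightarrow> (\<forall>y. y \<epsilon> M \<longrightarrow> (\<forall>t. is2tup x y t \<longrightarrow> (t \<epsilon> r \<longleftrightarrow> x \<epsilon> y))))) \<and>
    satisfaction mlang M I S)"

definition elementary :: "('a \<Rightarrow> 'a \<Rightarrow> bool) \<Rightarrow> 'a \<Rightarrow> 'a \<Rightarrow> bool" where
  "elementary \<Gamma> M N \<longleftrightarrow> sub M N \<and> (\<exists>S T. msat M S \<and> msat N T \<and>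
    (\<forall>k c a. k \<epsilon> om \<and> \<Gamma> k c \<and> isFun a k M \<longrightarrow> (pr c a \<epsilon> S \<longleftrightarrow> pr c a \<epsilon> T)))"

definition mformula :: "'a \<Rightarrow> 'a \<Rightarrow> bool" where "mformula = isFormula mlang"

definition delta_step :: "'a \<Rightarrow> ('a \<Rightarrow> bool) \<Rightarrow> 'a \<Rightarrow> bool" where
  "delta_step k prev c \<longleftrightarrow> isAtom mlang k c \<or> c = flsc \<or>
    (\<exists>p q. prev p \<and> prev q \<and> c = tag 4 p q) \<or>
    (\<exists>i. i \<epsilon> k \<and> (\<exists>j. j \<epsilon> k \<and> (\<exists>p q r. i \<noteq> j \<and> prev p \<and>
      (\<exists>t. is2tup (tag 0 i emp) (tag 0 j emp) t \<and> q = tag 3 msym t) \<and> r = tag 4 q p \<and> c = tag 5 i r)))"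

definition sigma1 :: "'a \<Rightarrow> 'a \<Rightarrow> bool" where
  "sigma1 k c \<longleftrightarrow> (\<exists>i. i \<epsilon> k \<and> (\<exists>p. built (delta_step k) p \<and> c = tag 4 (tag 5 i (tag 4 p flsc)) flsc))"

definition sat1S :: "'a \<Rightarrow> 'a \<Rightarrow> 'a \<Rightarrow> 'a \<Rightarrow> 'a \<Rightarrow> bool" where
  "sat1S S k c a x \<longleftrightarrow> (\<exists>b. upd k a (num 0) x b \<and> pr c b \<epsilon> S)"

definition sat2S :: "'a \<Rightarrow> 'a \<Rightarrow> 'a \<Rightarrow> 'a \<Rightarrow> 'a \<Rightarrow> 'a \<Rightarrow> bool" where
  "sat2S S k c a x y \<longleftrightarrow> (\<exists>b d. upd k a (num 0) x b \<and> upd k b (num 1) y d \<and> pr c d \<epsilon> S)"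

text \<open>The finite part is evaluated over the domain of the elements of \<open>M\<close>, in
  line with \<open>sat\<close>; the schemes stay internal, over all codes of the model and a
  satisfaction relation \<open>S\<close>.\<close>

definition model :: "'a \<Rightarrow> bool" where
  "model M \<longleftrightarrow> (\<forall>x. x \<epsilon> M \<longrightarrow> sub x M) \<and>
    (\<forall>ax\<in>set (zfc_finite_part fAll). holds {x. x \<epsilon> M} E (\<lambda>_. M) 0 (\<lambda>_. M) ax) \<and>
    (\<exists>S. msat M S \<and> (\<forall>k c a. k \<epsilon> om \<and> mformula k c \<and> isFun a k M \<longrightarrow>
      (\<forall>b. b \<epsilon> M \<longrightarrow> (\<exists>d. d \<epsilon> M \<and> (\<forall>x. x \<epsilon> M \<longrightarrow> (x \<epsilon> d \<longleftrightarrow> x \<epsilon> b \<and> sat1S S k c a x)))) \<and>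
      (\<forall>b. b \<epsilon> M \<longrightarrow>
        (\<forall>x. x \<epsilon> M \<longrightarrow> x \<epsilon> b \<longrightarrow> (\<exists>y. y \<epsilon> M \<and> (\<forall>z. z \<epsilon> M \<longrightarrow> (sat2S S k c a x z \<longleftrightarrow> z = y)))) \<longrightarrow>
        (\<exists>d. d \<epsilon> M \<and> (\<forall>y. y \<epsilon> M \<longrightarrow> (y \<epsilon> d \<longleftrightarrow> (\<exists>x. x \<epsilon> M \<and> x \<epsilon> b \<and> sat2S S k c a x y)))))))"

abbreviation (input) H where "H \<equiv> holds UNIV E"

section \<open>Evaluation of these formulas\<close>

lemma holds_rel_symbol [simp]:
  "n < l \<Longrightarrow> f < l \<Longrightarrow> H w l v (is_rel_symbol n f) \<longleftrightarrow> relSym (v n) (v f)"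
  by (simp add: is_rel_symbol_def relSym_def)

lemma holds_fun_symbol [simp]:
  "n < l \<Longrightarrow> f < l \<Longrightarrow> H w l v (is_fun_symbol n f) \<longleftrightarrow> funSym (v n) (v f)"
  by (simp add: is_fun_symbol_def funSym_def)

lemma holds_language [simp]: "L < l \<Longrightarrow> H w l v (is_language L) \<longleftrightarrow> isLang (v L)"
  by (simp add: is_language_def isLang_def)

lemma holds_operation [simp]:
  "g < l \<Longrightarrow> n < l \<Longrightarrow> D < l \<Longrightarrow> H w l v (is_operation g n D) \<longleftrightarrow> isOper (v g) (v n) (v D)"
  by (simp add: is_operation_def isOper_def)

lemma holds_interpretation [simp]:
  "L < l \<Longrightarrow> D < l \<Longrightarrow> I < l \<Longrightarrow>
    H w l v (is_interpretation L D I) \<longleftrightarrow> isInterp (v L) (v D) (v I)"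
  by (simp add: is_interpretation_def isInterp_def)

lemma holds_structure [simp]:
  "L < l \<Longrightarrow> x < l \<Longrightarrow> H w l v (is_structure L x) \<longleftrightarrow> (\<exists>D I. v x = pr D I \<and> isInterp (v L) D I)"
  by (simp add: is_structure_def)

lemma holds_code_var [simp]: "i < l \<Longrightarrow> c < l \<Longrightarrow> H w l v (code_var i c) \<longleftrightarrow> v c = tag 0 (v i) emp"
  by (simp add: code_var_def)

lemma holds_code_false [simp]: "c < l \<Longrightarrow> H w l v (code_false c) \<longleftrightarrow> v c = flsc"
  by (simp add: code_false_def flsc_def)

lemma holds_term [simp]:
  "L < l \<Longrightarrow> k < l \<Longrightarrow> c < l \<Longrightarrow> H w l v (is_term L k c) \<longleftrightarrow> isTerm (v L) (v k) (v c)"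
  by (simp add: is_term_def isTerm_def is_built_def built_def term_step_def)

lemma holds_atom [simp]:
  "L < l \<Longrightarrow> k < l \<Longrightarrow> c < l \<Longrightarrow> H w l v (is_atom L k c) \<longleftrightarrow> isAtom (v L) (v k) (v c)"
  by (simp add: is_atom_def isAtom_def)

lemma holds_formula [simp]:
  "L < l \<Longrightarrow> k < l \<Longrightarrow> c < l \<Longrightarrow> H w l v (is_formula L k c) \<longleftrightarrow> isFormula (v L) (v k) (v c)"
  by (simp add: is_formula_def isFormula_def is_built_def built_def formula_step_def)

lemma holds_value_tuple [simp]:
  "V < l \<Longrightarrow> a < l \<Longrightarrow> t < l \<Longrightarrow> s < l \<Longrightarrow>
    H w l v (is_value_tuple V a t s) \<longleftrightarrow> valueTuple (v V) (v a) (v t) (v s)"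
  by (simp add: is_value_tuple_def valueTuple_def)

lemma holds_valuation [simp]:
  "L < l \<Longrightarrow> D < l \<Longrightarrow> I < l \<Longrightarrow> V < l \<Longrightarrow>
    H w l v (is_valuation L D I V) \<longleftrightarrow> valuation (v L) (v D) (v I) (v V)"
  by (simp add: is_valuation_def valuation_def)

lemma holds_satisfaction [simp]:
  "L < l \<Longrightarrow> D < l \<Longrightarrow> I < l \<Longrightarrow> S < l \<Longrightarrow>
    H w l v (is_satisfaction L D I S) \<longleftrightarrow> satisfaction (v L) (v D) (v I) (v S)"
  by (simp add: is_satisfaction_def satisfaction_def)

lemma holds_elementary_embedding [simp]:
  "L < l \<Longrightarrow> x < l \<Longrightarrow> y < l \<Longrightarrow> j < l \<Longrightarrow>
    H w l v (is_elementary_embedding L x y j) \<longleftrightarrow> elementary_embedding (v L) (v x) (v y) (v j)"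
  by (simp add: is_elementary_embedding_def elementary_embedding_def is_composition_def)

lemma holds_mem_symbol [simp]: "f < l \<Longrightarrow> H w l v (is_mem_symbol f) \<longleftrightarrow> v f = msym"
  by (simp add: is_mem_symbol_def msym_def del: num.simps)

lemma holds_mem_language [simp]: "L < l \<Longrightarrow> H w l v (is_mem_language L) \<longleftrightarrow> v L = mlang"
  by (simp add: is_mem_language_def mlang_def eq_up)

lemma holds_2tuple [simp]:
  "x < l \<Longrightarrow> y < l \<Longrightarrow> t < l \<Longrightarrow> H w l v (is_2tuple x y t) \<longleftrightarrow> is2tup (v x) (v y) (v t)"
  by (simp add: is_2tuple_def is2tup_def del: num.simps is_numeral.simps)

lemma holds_mem_satisfaction [simp]:
  "M < l \<Longrightarrow> S < l \<Longrightarrow> H w l v (is_mem_satisfaction M S) \<longleftrightarrow> msat (v M) (v S)"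
  by (simp add: is_mem_satisfaction_def msat_def)

lemma holds_mem_formula [simp]:
  "k < l \<Longrightarrow> c < l \<Longrightarrow> H w l v (is_mem_formula k c) \<longleftrightarrow> mformula (v k) (v c)"
  by (simp add: is_mem_formula_def mformula_def)

lemma holds_Delta0 [simp]:
  "k < l \<Longrightarrow> c < l \<Longrightarrow> H w l v (is_Delta0 k c) \<longleftrightarrow> built (delta_step (v k)) (v c)"
  by (simp add: is_Delta0_def is_built_def built_def delta_step_def code_mem_def)

lemma holds_Sigma1 [simp]:
  "k < l \<Longrightarrow> c < l \<Longrightarrow> H w l v (is_Sigma1 k c) \<longleftrightarrow> sigma1 (v k) (v c)"
  by (simp add: is_Sigma1_def sigma1_def code_ex_def code_not_def)

lemma holds_sat1 [simp]: "S < l \<Longrightarrow> k < l \<Longrightarrow> c < l \<Longrightarrow> a < l \<Longrightarrow> x < l \<Longrightarrow>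
    H w l v (sat1 S k c a x) \<longleftrightarrow> sat1S (v S) (v k) (v c) (v a) (v x)"
  by (simp add: sat1_def sat1S_def del: num.simps is_numeral.simps)

lemma holds_sat2 [simp]: "S < l \<Longrightarrow> k < l \<Longrightarrow> c < l \<Longrightarrow> a < l \<Longrightarrow> x < l \<Longrightarrow> y < l \<Longrightarrow>
    H w l v (sat2 S k c a x y) \<longleftrightarrow> sat2S (v S) (v k) (v c) (v a) (v x) (v y)"
  by (simp add: sat2_def sat2S_def del: num.simps is_numeral.simps)

text \<open>Bounding every quantifier of an axiom by \<open>M\<close> amounts to shrinking the
  domain to \<open>M\<close>. As the axioms are closed, the environments on the right may be chosen
  freely.\<close>

lemma holds_finite_part_fBall:
  "M < l \<Longrightarrow> H w l v (ax_extensionality (fBall M)) \<longleftrightarrow>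
    holds {x. x \<epsilon> v M} E w' 0 v' (ax_extensionality fAll)"
  "M < l \<Longrightarrow> H w l v (ax_foundation (fBall M)) \<longleftrightarrow> holds {x. x \<epsilon> v M} E w' 0 v' (ax_foundation fAll)"
  "M < l \<Longrightarrow> H w l v (ax_pair (fBall M)) \<longleftrightarrow> holds {x. x \<epsilon> v M} E w' 0 v' (ax_pair fAll)"
  "M < l \<Longrightarrow> H w l v (ax_union (fBall M)) \<longleftrightarrow> holds {x. x \<epsilon> v M} E w' 0 v' (ax_union fAll)"
  "M < l \<Longrightarrow> H w l v (ax_power (fBall M)) \<longleftrightarrow> holds {x. x \<epsilon> v M} E w' 0 v' (ax_power fAll)"
  "M < l \<Longrightarrow> H w l v (ax_infinity (fBall M)) \<longleftrightarrow> holds {x. x \<epsilon> v M} E w' 0 v' (ax_infinity fAll)"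
  "M < l \<Longrightarrow> H w l v (ax_choice (fBall M)) \<longleftrightarrow> holds {x. x \<epsilon> v M} E w' 0 v' (ax_choice fAll)"
  by (simp_all add: zfc_axiom_defs cong del: imp_cong)

lemma holds_model [simp]: "M < l \<Longrightarrow> H w l v (is_model M) \<longleftrightarrow> model (v M)"
  by (simp add: is_model_def model_def zfc_finite_part_def ax_separation_def ax_replacement_def
      holds_finite_part_fBall[where w' = "\<lambda>_. v M" and v' = "\<lambda>_. v M"] cong del: imp_cong)

lemma holds_elementary_for:
  assumes "\<And>l v k c. k < l \<Longrightarrow> c < l \<Longrightarrow> H w l v (\<Gamma> k c) \<longleftrightarrow> \<Gamma>' (v k) (v c)"
  shows "M < l \<Longrightarrow> N < l \<Longrightarrow> H w l v (is_elementary_for \<Gamma> M N) \<longleftrightarrow> elementary \<Gamma>' (v M) (v N)"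
  by (simp add: is_elementary_for_def elementary_def assms)

lemma holds_extendible:
  assumes "\<And>l v k c. k < l \<Longrightarrow> c < l \<Longrightarrow> H w l v (\<Gamma> k c) \<longleftrightarrow> \<Gamma>' (v k) (v c)"
  shows "M < l \<Longrightarrow> H w l v (is_extendible_for \<Gamma> M) \<longleftrightarrow>
    model (v M) \<and> (\<forall>x. \<exists>N. model N \<and> x \<epsilon> N \<and> elementary \<Gamma>' (v M) N)"
  by (simp add: is_extendible_for_def holds_elementary_for[where \<Gamma> = \<Gamma> and \<Gamma>' = \<Gamma>'] assms)

lemma holds_sext [simp]: "M < l \<Longrightarrow> H w l v (is_sext M) \<longleftrightarrow>
    model (v M) \<and> (\<forall>x. \<exists>N. model N \<and> x \<epsilon> N \<and> elementary mformula (v M) N)"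
  unfolding is_sext_def by (rule holds_extendible) simp_all

lemma holds_Sigma1_sext [simp]: "M < l \<Longrightarrow> H w l v (is_Sigma1_sext M) \<longleftrightarrow>
    model (v M) \<and> (\<forall>x. \<exists>N. model N \<and> x \<epsilon> N \<and> elementary sigma1 (v M) N)"
  unfolding is_Sigma1_sext_def by (rule holds_extendible) simp_all

end

section \<open>Relativization and the separation it yields\<close>

primrec rel :: "nat \<Rightarrow> fm \<Rightarrow> fm" where
  "rel m Falsum = Falsum"
| "rel m (Member i j) = Member i j"
| "rel m (Equal i j) = Equal i j"
| "rel m (Impl p q) = Impl (rel m p) (rel m q)"
| "rel m (Forall p) = Forall (Impl (Member 0 (Suc m)) (rel (Suc m) p))"

lemma rel_Delta0: "rel m p \<in> Delta0"
  by (induction p arbitrary: m) (auto intro: Delta0.intros)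

lemma sat_rel: "sat UNIV E e (rel m p) \<longleftrightarrow> sat {x. E x (e m)} E e p"
  by (induction p arbitrary: e m) auto

text \<open>Of the transitive models provided by Loc(ZFC), \<open>local\<close> retains the closure
  properties on which absoluteness rests.\<close>

locale weak = omega E om for E (infix "\<epsilon>" 50) and om +
  assumes delta0_separation: "p \<in> Delta0 \<Longrightarrow> is_set (\<lambda>x. x \<epsilon> a \<and> sat UNIV E (case_nat x w) p)"
    and local: "\<exists>M. x \<epsilon> M \<and> good {y. y \<epsilon> M}"
begin

abbreviation ext :: "'a \<Rightarrow> 'a set" where "ext M \<equiv> {x. x \<epsilon> M}"

text \<open>Relativized to \<open>M\<close>, any formula is bounded with \<open>M\<close> as an
  additional parameter. So bounded separation covers every property definable over a set, whatever
  its quantifier complexity.\<close>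

lemma separation_in:
  assumes P: "Def (ext M) E (\<lambda>e. P (e 0))" and a: "sub a M"
  shows "is_set (\<lambda>x. x \<epsilon> a \<and> P x)"
proof -
  obtain p w where w: "range w \<subseteq> ext M"
      and p: "\<And>x. x \<in> ext M \<Longrightarrow> P x \<longleftrightarrow> sat (ext M) E (case_nat x w) p"
    by (rule Def_unary[OF P]) blast
  \<comment> \<open>\<open>M\<close> is inserted at index 1, behind the separated variable, and the
    parameters move up by one.\<close>
  let ?p = "rel 1 (ren (case_nat 0 (\<lambda>i. Suc (Suc i))) p)"
  have "(\<lambda>i. case_nat x (case_nat M w) (case_nat 0 (\<lambda>i. Suc (Suc i)) i)) = case_nat x w" for x
    by (auto simp: fun_eq_iff split: nat.split)
  then have "sat UNIV E (case_nat x (case_nat M w)) ?p \<longleftrightarrow> sat (ext M) E (case_nat x w) p" for x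
    by (simp add: sat_rel)
  with delta0_separation[OF rel_Delta0, of a "case_nat M w" 1 "ren (case_nat 0 (\<lambda>i. Suc (Suc i))) p"]
  have "is_set (\<lambda>x. x \<epsilon> a \<and> sat (ext M) E (case_nat x w) p)" by simp
  moreover have "(\<lambda>x. x \<epsilon> a \<and> sat (ext M) E (case_nat x w) p) = (\<lambda>x. x \<epsilon> a \<and> P x)"
    using p a unfolding sub_def by auto
  ultimately show ?thesis by simp
qed

lemma local2:
  obtains M where "x \<epsilon> M" "y \<epsilon> M" "good (ext M)"
proof -
  obtain M where M: "pr x y \<epsilon> M" "good (ext M)" using local by blast
  then show thesis using that[of M] good_pr_eq[OF M(2), of x y] by simp
qed

lemma good_sub: "good (ext M) \<Longrightarrow> x \<epsilon> M \<Longrightarrow> sub x M"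
  using good_trans[of "ext M"] unfolding sub_def by auto

lemma om_trans: "n \<epsilon> om \<Longrightarrow> m \<epsilon> n \<Longrightarrow> k \<epsilon> m \<Longrightarrow> k \<epsilon> n"
proof -
  assume n: "n \<epsilon> om" and mk: "m \<epsilon> n" "k \<epsilon> m"
  obtain M where M: "om \<epsilon> M" "good (ext M)" using local by blast
  note om = good_sub[OF M(2,1)]
  have ne: "ext M \<noteq> {}" using M by blast
  let ?P = "\<lambda>n. \<forall>m\<in>ext M. \<forall>k\<in>ext M. m \<epsilon> n \<longrightarrow> k \<epsilon> m \<longrightarrow> k \<epsilon> n"
  have d: "Def (ext M) E (\<lambda>e. ?P (e 0))" by (intro Def_all Def_connectives TDef_var ne)
  have "?P n"
  proof (rule om_induct[OF separation_in[OF d om] _ _ n])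
    fix n assume n: "?P n"
    show "?P (sc n)"
    proof (intro ballI impI)
      fix m k assume mk: "m \<in> ext M" "k \<in> ext M" "m \<epsilon> sc n" "k \<epsilon> m"
      then have "k \<epsilon> n" using n unfolding in_sc by blast
      then show "k \<epsilon> sc n" by simp
    qed
  qed simp
  moreover have "n \<epsilon> M" using om n unfolding sub_def by blast
  then have "m \<epsilon> M" "k \<epsilon> M" using mk good_sub[OF M(2)] unfolding sub_def by blast+
  ultimately show ?thesis using mk by blast
qed

lemma om_irrefl: "n \<epsilon> om \<Longrightarrow> \<not> n \<epsilon> n"
proof -
  assume n: "n \<epsilon> om"
  obtain M where M: "om \<epsilon> M" "good (ext M)" using local by blast
  note om = good_sub[OF M(2,1)]
  have ne: "ext M \<noteq> {}" using M by blast
  have d: "Def (ext M) E (\<lambda>e. \<not> e 0 \<epsilon> e 0)" by (intro Def_connectives TDef_var ne)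
  show ?thesis
  proof (rule om_induct[OF separation_in[OF d om] _ _ n])
    fix n assume "n \<epsilon> om" "\<not> n \<epsilon> n"
    moreover have "n \<epsilon> sc n" by simp
    ultimately show "\<not> sc n \<epsilon> sc n" using om_trans[of n "sc n" n] by (metis in_sc)
  qed auto
qed

lemma in_num: "x \<epsilon> num k \<longleftrightarrow> (\<exists>i<k. x = num i)"
  by (induction k) (auto simp: less_Suc_eq)

lemma num_eq [simp]: "num i = num j \<longleftrightarrow> i = j"
proof -
  have "num i \<noteq> num j" if "i < j" for i j
    using in_num[of "num i" j] om_irrefl[OF num_om] that by metis
  then show ?thesis by (metis linorder_neqE_nat)
qed

lemma tag_eq [simp]: "tag i x y = tag j u v \<longleftrightarrow> i = j \<and> x = u \<and> y = v"
  by (simp add: tag_def)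

section \<open>Finite sequences of standard length\<close>

primrec fin :: "nat \<Rightarrow> (nat \<Rightarrow> 'a) \<Rightarrow> 'a" where
  "fin 0 a = emp"
| "fin (Suc k) a = un (fin k a) (up (pr (num k) (a k)) (pr (num k) (a k)))"

lemma in_fin: "z \<epsilon> fin k a \<longleftrightarrow> (\<exists>i<k. z = pr (num i) (a i))"
  by (induction k) (auto simp: less_Suc_eq)

lemma pr_fin: "pr x y \<epsilon> fin k a \<longleftrightarrow> (\<exists>i<k. x = num i \<and> y = a i)"
  by (auto simp: in_fin)

lemma pr_num_fin: "i < k \<Longrightarrow> pr (num i) y \<epsilon> fin k a \<longleftrightarrow> y = a i"
  by (auto simp: in_fin)

lemma funOn_fin: "funOn (fin k a) (num k)"
  unfolding funOn_def by (auto simp: in_fin in_num)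

lemma fin_cong: "(\<And>i. i < k \<Longrightarrow> a i = b i) \<Longrightarrow> fin k a = fin k b"
  by (induction k) auto

text \<open>A standard numeral has only standard elements, so the entries of a tuple of that length
  can be read off as an actual sequence.\<close>

lemma funOn_num: "funOn f (num k) \<longleftrightarrow> (\<exists>a. f = fin k a)"
proof
  assume f: "funOn f (num k)"
  have "f = fin k (\<lambda>i. app f (num i))"
  proof (rule extensionality)
    fix z
    have "(\<exists>x y. z = pr x y \<and> pr x y \<epsilon> f) \<longleftrightarrow> z \<epsilon> f" using f unfolding funOn_def by blast
    moreover have "pr x y \<epsilon> f \<longleftrightarrow> (\<exists>i<k. x = num i \<and> y = app f x)" for x y
      using funOn_app[OF f] funOn_dom[OF f, of x y] by (auto simp: in_num)
    ultimately show "z \<epsilon> f \<longleftrightarrow> z \<epsilon> fin k (\<lambda>i. app f (num i))" by (auto simp: in_fin)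
  qed
  then show "\<exists>a. f = fin k a" by blast
qed (auto intro: funOn_fin)

lemma isFun_fin: "isFun (fin k a) (num k) b \<longleftrightarrow> (\<forall>i<k. a i \<epsilon> b)"
  unfolding isFun_def pr_fin using funOn_fin by blast

lemma funOn_unique_dom: "funOn f m \<Longrightarrow> funOn f n \<Longrightarrow> m = n"
  by (rule extensionality) (metis funOn_def funOn_dom)

lemma fin_eq: "fin k a = fin l b \<longleftrightarrow> k = l \<and> (\<forall>i<k. a i = b i)"
proof
  assume eq: "fin k a = fin l b"
  have "num k = num l" using funOn_unique_dom[OF funOn_fin[of k a]] funOn_fin[of l b] eq by simp
  then have "k = l" by simp
  then have "a i = b i" if "i < k" for i
    using pr_num_fin[OF that, of "a i" a] pr_num_fin[of i l "a i" b] eq that by simp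
  with \<open>k = l\<close> show "k = l \<and> (\<forall>i<k. a i = b i)" by blast
qed (auto intro: fin_cong)

lemma upd_fin: "i < k \<Longrightarrow> upd (num k) (fin k a) (num i) x b \<longleftrightarrow> b = fin k (a(i := x))"
proof
  assume i: "i < k" and u: "upd (num k) (fin k a) (num i) x b"
  then obtain c where c: "b = fin k c" unfolding upd_def funOn_num by blast
  have "c j = (a(i := x)) j" if "j < k" for j
  proof (cases "j = i")
    case True
    with u i show ?thesis unfolding upd_def c by (simp add: pr_num_fin)
  next
    case False
    with u that have "\<forall>y. pr (num j) y \<epsilon> b \<longleftrightarrow> pr (num j) y \<epsilon> fin k a"
      unfolding upd_def by (auto simp: in_num)
    then have "c j = y \<longleftrightarrow> a j = y" for y using that unfolding c by (auto simp: pr_num_fin)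
    with False show ?thesis by simp
  qed
  then show "b = fin k (a(i := x))" unfolding c by (rule fin_cong)
next
  assume "i < k" "b = fin k (a(i := x))"
  then show "upd (num k) (fin k a) (num i) x b"
    unfolding upd_def by (auto simp: funOn_fin pr_num_fin in_num)
qed

lemma is2tup_iff: "is2tup x y t \<longleftrightarrow> t = fin 2 (\<lambda>i. if i = 0 then x else y)"
proof
  assume t: "is2tup x y t"
  then obtain a where a: "t = fin 2 a" unfolding is2tup_def funOn_num by blast
  have "a 0 = x" "a 1 = y" using t unfolding is2tup_def a by (auto simp: pr_num_fin simp del: num.simps)
  then show "t = fin 2 (\<lambda>i. if i = 0 then x else y)"
    unfolding a by (intro fin_cong) (auto simp: numeral_2_eq_2 less_Suc_eq)
next
  assume "t = fin 2 (\<lambda>i. if i = 0 then x else y)"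
  then show "is2tup x y t" unfolding is2tup_def by (simp add: funOn_fin pr_num_fin del: num.simps)
qed

definition seq :: "(('a \<Rightarrow> bool) \<Rightarrow> 'a \<Rightarrow> bool) \<Rightarrow> 'a list \<Rightarrow> bool" where
  "seq step xs \<longleftrightarrow> (\<forall>i<length xs. step (\<lambda>e. \<exists>j<i. e = xs ! j) (xs ! i))"

definition gen :: "(('a \<Rightarrow> bool) \<Rightarrow> 'a \<Rightarrow> bool) \<Rightarrow> 'a \<Rightarrow> bool" where
  "gen step c \<longleftrightarrow> (\<exists>xs. seq step xs \<and> c \<in> set xs)"

lemma gen_built: "gen step c \<Longrightarrow> built step c"
proof -
  assume "gen step c"
  then obtain xs where xs: "seq step xs" "c \<in> set xs" unfolding gen_def by blast
  let ?g = "fin (length xs) ((!) xs)"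
  have "step (\<lambda>e. \<exists>j. j \<epsilon> i \<and> pr j e \<epsilon> ?g) d" if "pr i d \<epsilon> ?g" for i d
  proof -
    obtain i' where i': "i' < length xs" "i = num i'" "d = xs ! i'" using \<open>pr i d \<epsilon> ?g\<close> pr_fin by auto
    have "(\<lambda>e. \<exists>j. j \<epsilon> i \<and> pr j e \<epsilon> ?g) = (\<lambda>e. \<exists>j<i'. e = xs ! j)"
      using i' by (auto simp: fun_eq_iff in_num pr_fin)
    with xs(1) i' show ?thesis unfolding seq_def by simp
  qed
  moreover have "\<exists>i. pr i c \<epsilon> ?g" using xs(2) by (auto simp: pr_fin in_set_conv_nth)
  ultimately show ?thesis unfolding built_def using num_om funOn_fin by blast
qed

text \<open>Monotonicity in the supply of earlier entries is what permits concatenating and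
  extending building sequences.\<close>

definition mono_step :: "(('a \<Rightarrow> bool) \<Rightarrow> 'a \<Rightarrow> bool) \<Rightarrow> bool" where
  "mono_step step \<longleftrightarrow> (\<forall>P Q c. step P c \<longrightarrow> (\<forall>e. P e \<longrightarrow> Q e) \<longrightarrow> step Q c)"

lemma mono_stepD: "mono_step step \<Longrightarrow> step P c \<Longrightarrow> (\<And>e. P e \<Longrightarrow> Q e) \<Longrightarrow> step Q c"
  unfolding mono_step_def by blast

lemma nth_prefix:
  assumes "i \<le> length xs"
  shows "(\<lambda>e. \<exists>j<i. e = (xs @ ys) ! j) = (\<lambda>e. \<exists>j<i. e = xs ! j)"
proof -
  have "(xs @ ys) ! j = xs ! j" if "j < i" for j
    using that assms by (simp add: nth_append)
  then have "(\<exists>j<i. e = (xs @ ys) ! j) \<longleftrightarrow> (\<exists>j<i. e = xs ! j)" for e by metis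
  then show ?thesis by (rule ext)
qed

lemma seq_append:
  assumes "mono_step step" "seq step xs" "seq step ys"
  shows "seq step (xs @ ys)"
  unfolding seq_def
proof (intro allI impI)
  fix i assume i: "i < length (xs @ ys)"
  show "step (\<lambda>e. \<exists>j<i. e = (xs @ ys) ! j) ((xs @ ys) ! i)"
  proof (cases "i < length xs")
    case True
    then have "step (\<lambda>e. \<exists>j<i. e = xs ! j) (xs ! i)" using assms(2) unfolding seq_def by blast
    with True nth_prefix[of i xs ys] show ?thesis by (simp add: nth_append)
  next
    case False
    then have "step (\<lambda>e. \<exists>j<i - length xs. e = ys ! j) (ys ! (i - length xs))"
      using assms(3) i unfolding seq_def by auto
    then have "step (\<lambda>e. \<exists>j<i. e = (xs @ ys) ! j) (ys ! (i - length xs))"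
    proof (rule mono_stepD[OF assms(1)])
      fix e assume "\<exists>j<i - length xs. e = ys ! j"
      then obtain j where "j < i - length xs" "e = ys ! j" by blast
      then have "length xs + j < i" "e = (xs @ ys) ! (length xs + j)" by (auto simp: nth_append)
      then show "\<exists>j<i. e = (xs @ ys) ! j" by blast
    qed
    with False show ?thesis by (simp add: nth_append)
  qed
qed

lemma seq_snoc:
  assumes "seq step xs" "step (\<lambda>e. e \<in> set xs) c"
  shows "seq step (xs @ [c])"
  unfolding seq_def
proof (intro allI impI)
  fix i assume i: "i < length (xs @ [c])"
  show "step (\<lambda>e. \<exists>j<i. e = (xs @ [c]) ! j) ((xs @ [c]) ! i)"
  proof (cases "i < length xs")
    case True
    then have "step (\<lambda>e. \<exists>j<i. e = xs ! j) (xs ! i)" using assms(1) unfolding seq_def by blast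
    with True nth_prefix[of i xs "[c]"] show ?thesis by (simp add: nth_append)
  next
    case False
    with i have i': "i = length xs" by simp
    have "(\<lambda>e. \<exists>j<i. e = xs ! j) = (\<lambda>e. e \<in> set xs)"
      unfolding i' in_set_conv_nth by (intro ext) blast
    with nth_prefix[of i xs "[c]"] i' assms(2) show ?thesis by simp
  qed
qed

lemma gen_step:
  assumes "mono_step step" "gen step p" "gen step q" "step (\<lambda>e. e = p \<or> e = q) c"
  shows "gen step c"
proof -
  obtain xs ys where xs: "seq step xs" "p \<in> set xs" and ys: "seq step ys" "q \<in> set ys"
    using assms(2,3) unfolding gen_def by blast
  have "seq step ((xs @ ys) @ [c])"
    by (rule seq_snoc[OF seq_append[OF assms(1) xs(1) ys(1)]], rule mono_stepD[OF assms(1,4)])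
      (use xs ys in auto)
  then show ?thesis unfolding gen_def by force
qed

lemma gen_base: "step (\<lambda>e. False) c \<Longrightarrow> gen step c"
  unfolding gen_def by (rule exI[of _ "[c]"]) (simp add: seq_def)

definition vr :: "nat \<Rightarrow> 'a" where "vr i = tag 0 (num i) emp"

definition relc :: "'a \<Rightarrow> nat \<Rightarrow> (nat \<Rightarrow> nat) \<Rightarrow> 'a" where
  "relc \<sigma> n f = tag 3 \<sigma> (fin n (\<lambda>i. vr (f i)))"

lemma vr_eq [simp]: "vr i = vr j \<longleftrightarrow> i = j" by (simp add: vr_def)

lemma isTerm_vr: "i < k \<Longrightarrow> isTerm L (num k) (vr i)"
  unfolding isTerm_def by (rule gen_built, rule gen_base) (auto simp: term_step_def vr_def in_num)

lemma isAtom_eq: "i < k \<Longrightarrow> j < k \<Longrightarrow> isAtom L (num k) (tag 2 (vr i) (vr j))"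
  unfolding isAtom_def using isTerm_vr by blast

lemma isAtom_rel:
  assumes "\<sigma> \<epsilon> L" "relSym (num n) \<sigma>" "\<forall>i<n. f i < k"
  shows "isAtom L (num k) (relc \<sigma> n f)"
proof -
  have "isTerm L (num k) e" if "pr i e \<epsilon> fin n (\<lambda>i. vr (f i))" for i e
    using that assms(3) isTerm_vr by (auto simp: pr_fin)
  with assms show ?thesis unfolding isAtom_def relc_def using funOn_fin by blast
qed

lemma isFormula_atom: "isAtom L k c \<Longrightarrow> isFormula L k c"
  unfolding isFormula_def by (rule gen_built, rule gen_base) (simp add: formula_step_def)

section \<open>Tarski's clauses at standard lengths\<close>

lemma valuation_vr:
  assumes "valuation L D I V" "i < k" "\<forall>i<k. a i \<epsilon> D"
  shows "pr (pr (vr i) (fin k a)) x \<epsilon> V \<longleftrightarrow> x = a i"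
proof -
  have "pr (pr (vr i) (fin k a)) x \<epsilon> V \<longleftrightarrow> (\<exists>j. vr i = tag 0 j emp \<and> pr j x \<epsilon> fin k a) \<or>
      (\<exists>f t g s. vr i = tag 1 f t \<and> pr f g \<epsilon> I \<and> valueTuple V (fin k a) t s \<and> pr s x \<epsilon> g)"
    using assms num_om isFun_fin isTerm_vr unfolding valuation_def by blast
  with assms(2) show ?thesis by (simp add: vr_def pr_num_fin)
qed

lemma valueTuple_vr:
  assumes "valuation L D I V" "\<forall>i<n. f i < k" "\<forall>i<k. a i \<epsilon> D"
  shows "valueTuple V (fin k a) (fin n (\<lambda>i. vr (f i))) s \<longleftrightarrow> s = fin n (\<lambda>i. a (f i))"
proof
  assume s: "valueTuple V (fin k a) (fin n (\<lambda>i. vr (f i))) s"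
  then obtain m where m: "funOn (fin n (\<lambda>i. vr (f i))) m" "funOn s m"
    "\<forall>i e x. pr i e \<epsilon> fin n (\<lambda>i. vr (f i)) \<and> pr i x \<epsilon> s \<longrightarrow> pr (pr e (fin k a)) x \<epsilon> V"
    unfolding valueTuple_def by blast
  have "m = num n" using funOn_unique_dom[OF m(1) funOn_fin] .
  then obtain b where b: "s = fin n b" using m(2) funOn_num by blast
  have "b i = a (f i)" if "i < n" for i
    using m(3) that valuation_vr[OF assms(1) _ assms(3)] assms(2) unfolding b
    by (metis pr_num_fin)
  then show "s = fin n (\<lambda>i. a (f i))" unfolding b by (rule fin_cong)
next
  assume s: "s = fin n (\<lambda>i. a (f i))"
  have "pr (pr e (fin k a)) x \<epsilon> V"
    if "pr i e \<epsilon> fin n (\<lambda>i. vr (f i)) \<and> pr i x \<epsilon> s" for i e x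
    using that valuation_vr[OF assms(1) _ assms(3)] assms(2) unfolding s by (auto simp: pr_fin)
  then show "valueTuple V (fin k a) (fin n (\<lambda>i. vr (f i))) s"
    unfolding valueTuple_def using num_om funOn_fin s by blast
qed

context
  fixes L D I S
  assumes S: "satisfaction L D I S"
begin

text \<open>The tags are distinct numerals, so only the disjunct belonging to the shape of the code
  can apply. The clauses below are extracted in the same way.\<close>

lemma satisfaction_eq:
  assumes "i < k" "j < k" "\<forall>i<k. a i \<epsilon> D"
  shows "pr (tag 2 (vr i) (vr j)) (fin k a) \<epsilon> S \<longleftrightarrow> a i = a j"
proof -
  obtain V where V: "valuation L D I V" "\<And>k a c. k \<epsilon> om \<Longrightarrow> isFun a k D \<Longrightarrow> isFormula L k c \<Longrightarrow>
      (pr c a \<epsilon> S \<longleftrightarrow> (\<exists>t u x. c = tag 2 t u \<and> pr (pr t a) x \<epsilon> V \<and> pr (pr u a) x \<epsilon> V) \<or>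
        (\<exists>f t r s. c = tag 3 f t \<and> pr f r \<epsilon> I \<and> valueTuple V a t s \<and> s \<epsilon> r) \<or>
        (\<exists>p q. c = tag 4 p q \<and> (pr p a \<epsilon> S \<longrightarrow> pr q a \<epsilon> S)) \<or>
        (\<exists>i p. c = tag 5 i p \<and> (\<forall>x. x \<epsilon> D \<longrightarrow> (\<forall>b. upd k a i x b \<longrightarrow> pr p b \<epsilon> S))))"
    using S unfolding satisfaction_def by blast
  have "isFun (fin k a) (num k) D" using assms isFun_fin by blast
  from V(2)[OF num_om this isFormula_atom[OF isAtom_eq[OF assms(1,2)]]] show ?thesis
    using valuation_vr[OF V(1) assms(1,3)] valuation_vr[OF V(1) assms(2,3)] by auto
qed

lemma satisfaction_rel:
  assumes "\<sigma> \<epsilon> L" "relSym (num n) \<sigma>" "\<forall>i<n. f i < k" "\<forall>i<k. a i \<epsilon> D"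
  shows "pr (relc \<sigma> n f) (fin k a) \<epsilon> S \<longleftrightarrow> (\<exists>r. pr \<sigma> r \<epsilon> I \<and> fin n (\<lambda>i. a (f i)) \<epsilon> r)"
proof -
  obtain V where V: "valuation L D I V" "\<And>k a c. k \<epsilon> om \<Longrightarrow> isFun a k D \<Longrightarrow> isFormula L k c \<Longrightarrow>
      (pr c a \<epsilon> S \<longleftrightarrow> (\<exists>t u x. c = tag 2 t u \<and> pr (pr t a) x \<epsilon> V \<and> pr (pr u a) x \<epsilon> V) \<or>
        (\<exists>f t r s. c = tag 3 f t \<and> pr f r \<epsilon> I \<and> valueTuple V a t s \<and> s \<epsilon> r) \<or>
        (\<exists>p q. c = tag 4 p q \<and> (pr p a \<epsilon> S \<longrightarrow> pr q a \<epsilon> S)) \<or>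
        (\<exists>i p. c = tag 5 i p \<and> (\<forall>x. x \<epsilon> D \<longrightarrow> (\<forall>b. upd k a i x b \<longrightarrow> pr p b \<epsilon> S))))"
    using S unfolding satisfaction_def by blast
  have "isFun (fin k a) (num k) D" using assms isFun_fin by blast
  from V(2)[OF num_om this isFormula_atom[OF isAtom_rel[OF assms(1-3)]]] show ?thesis
    using valueTuple_vr[OF V(1) assms(3,4)] by (simp add: relc_def)
qed

lemma satisfaction_false:
  assumes "isFormula L (num k) flsc" "\<forall>i<k. a i \<epsilon> D"
  shows "\<not> pr flsc (fin k a) \<epsilon> S"
proof -
  have "isFun (fin k a) (num k) D" using assms isFun_fin by blast
  with S assms(1) num_om[of k] show ?thesis unfolding satisfaction_def flsc_def by auto
qed

lemma satisfaction_imp: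
  assumes "isFormula L (num k) (tag 4 p q)" "\<forall>i<k. a i \<epsilon> D"
  shows "pr (tag 4 p q) (fin k a) \<epsilon> S \<longleftrightarrow> (pr p (fin k a) \<epsilon> S \<longrightarrow> pr q (fin k a) \<epsilon> S)"
proof -
  have "isFun (fin k a) (num k) D" using assms isFun_fin by blast
  with S assms(1) num_om[of k] show ?thesis unfolding satisfaction_def by auto
qed

lemma satisfaction_all:
  assumes "isFormula L (num k) (tag 5 (num i) p)" "\<forall>i<k. a i \<epsilon> D" "i < k"
  shows "pr (tag 5 (num i) p) (fin k a) \<epsilon> S \<longleftrightarrow> (\<forall>x. x \<epsilon> D \<longrightarrow> pr p (fin k (a(i := x))) \<epsilon> S)"
proof -
  have "isFun (fin k a) (num k) D" using assms isFun_fin by blast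
  with S assms(1) num_om[of k] upd_fin[OF assms(3)] show ?thesis
    unfolding satisfaction_def by auto
qed

end

text \<open>The code of a standard formula: the free index \<open>i\<close> becomes the variable \<open>\<rho> i\<close>, and the
  variables from \<open>m\<close> on are used for the bound ones.\<close>

primrec code :: "(nat \<Rightarrow> nat) \<Rightarrow> nat \<Rightarrow> fm \<Rightarrow> 'a" where
  "code \<rho> m Falsum = flsc"
| "code \<rho> m (Member i j) = relc msym 2 (\<lambda>l. if l = 0 then \<rho> i else \<rho> j)"
| "code \<rho> m (Equal i j) = tag 2 (vr (\<rho> i)) (vr (\<rho> j))"
| "code \<rho> m (Impl p q) = tag 4 (code \<rho> m p) (code \<rho> m q)"
| "code \<rho> m (Forall p) = tag 5 (num m) (code (case_nat m \<rho>) (Suc m) p)"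

end

text \<open>Each nested quantifier takes a new variable, so \<open>m + qdepth p\<close> variables
  suffice for a code whose bound variables start at \<open>m\<close>.\<close>

primrec qdepth :: "fm \<Rightarrow> nat" where
  "qdepth Falsum = 0"
| "qdepth (Member i j) = 0"
| "qdepth (Equal i j) = 0"
| "qdepth (Impl p q) = max (qdepth p) (qdepth q)"
| "qdepth (Forall p) = Suc (qdepth p)"

context weak
begin

section \<open>Codes of actual formulas and their truth\<close>

lemma msym: "msym \<epsilon> mlang" "relSym (num 2) msym"
  using num_om unfolding msym_def mlang_def relSym_def by (auto simp del: num.simps)

lemma mono_formula_step: "mono_step (formula_step L k)"
  unfolding mono_step_def formula_step_def by blast

lemma mono_delta_step: "mono_step (delta_step k)"
  unfolding mono_step_def delta_step_def by blast

lemma isAtom_mem: "i < k \<Longrightarrow> j < k \<Longrightarrow> isAtom mlang (num k) (relc msym 2 (\<lambda>l. if l = 0 then i else j))"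
  by (rule isAtom_rel[OF msym]) simp

lemma gen_formula_code:
  "(\<And>i. i < free_bound p \<Longrightarrow> \<rho> i < m) \<Longrightarrow> m + qdepth p \<le> k \<Longrightarrow>
    gen (formula_step mlang (num k)) (code \<rho> m p)"
proof (induction p arbitrary: \<rho> m)
  case Falsum
  show ?case by (rule gen_base) (simp add: formula_step_def)
next
  case (Member i j)
  then have "\<rho> i < m" "\<rho> j < m" "m \<le> k" by simp_all
  then have "\<rho> i < k" "\<rho> j < k" by simp_all
  then show ?case by (intro gen_base) (simp add: formula_step_def isAtom_mem)
next
  case (Equal i j)
  then have "\<rho> i < m" "\<rho> j < m" "m \<le> k" by simp_all
  then have "\<rho> i < k" "\<rho> j < k" by simp_all
  then show ?case by (intro gen_base) (simp add: formula_step_def isAtom_eq)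
next
  case (Impl p q)
  have "gen (formula_step mlang (num k)) (code \<rho> m p)" "gen (formula_step mlang (num k)) (code \<rho> m q)"
    using Impl.prems by (intro Impl.IH; simp)+
  then show ?case
    by (rule gen_step[OF mono_formula_step]) (auto simp: formula_step_def)
next
  case (Forall p)
  let ?c = "code (case_nat m \<rho>) (Suc m) p"
  have g: "gen (formula_step mlang (num k)) ?c"
  proof (rule Forall.IH)
    show "case_nat m \<rho> i < Suc m" if "i < free_bound p" for i
      by (cases i) (use that Forall.prems(1)[of "i - 1"] in \<open>simp_all add: less_diff_conv less_SucI\<close>)
  qed (use Forall.prems in simp)
  have "num m \<epsilon> num k" using Forall.prems(2) by (auto simp: in_num)
  then have "formula_step mlang (num k) (\<lambda>e. e = ?c \<or> e = ?c) (code \<rho> m (Forall p))"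
    unfolding formula_step_def code.simps by blast
  then show ?case by (rule gen_step[OF mono_formula_step g g])
qed

lemma mformula_code:
  "(\<And>i. i < free_bound p \<Longrightarrow> \<rho> i < m) \<Longrightarrow> m + qdepth p \<le> k \<Longrightarrow> mformula (num k) (code \<rho> m p)"
  unfolding mformula_def isFormula_def by (intro gen_built gen_formula_code)

text \<open>Any satisfaction relation of the model obeys Tarski's clauses, and induction on the
  actual formula, carried out outside the model, unwinds them to truth over the elements of
  \<open>M\<close>.\<close>

lemma msat_code:
  assumes S: "msat M S"
  shows "(\<And>i. i < free_bound p \<Longrightarrow> \<rho> i < m) \<Longrightarrow> m + qdepth p \<le> k \<Longrightarrow> \<forall>i<k. a i \<epsilon> M \<Longrightarrow>
    pr (code \<rho> m p) (fin k a) \<epsilon> S \<longleftrightarrow> sat (ext M) E (\<lambda>i. a (\<rho> i)) p"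
proof (induction p arbitrary: \<rho> m a)
  case Falsum
  obtain I where I: "satisfaction mlang M I S" using S unfolding msat_def by blast
  have "isFormula mlang (num k) flsc"
    unfolding isFormula_def by (rule gen_built, rule gen_base) (simp add: formula_step_def)
  with satisfaction_false[OF I _ Falsum(3)] show ?case by simp
next
  case (Member i j)
  obtain I where I: "isInterp mlang M I" "satisfaction mlang M I S"
    "\<forall>f r. pr f r \<epsilon> I \<longrightarrow> (\<forall>x. x \<epsilon> M \<longrightarrow> (\<forall>y. y \<epsilon> M \<longrightarrow> (\<forall>t. is2tup x y t \<longrightarrow> (t \<epsilon> r \<longleftrightarrow> x \<epsilon> y))))"
    using S unfolding msat_def by blast
  have "\<rho> i < m" "\<rho> j < m" by (rule Member(1), simp)+
  then have ij: "\<rho> i < k" "\<rho> j < k" using Member(2) by simp_all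
  let ?f = "\<lambda>l::nat. if l = 0 then \<rho> i else \<rho> j"
  have t: "is2tup (a (\<rho> i)) (a (\<rho> j)) (fin 2 (\<lambda>l. a (?f l)))"
    unfolding is2tup_iff by (rule fin_cong) simp
  have "\<exists>r. pr msym r \<epsilon> I" using I(1) msym(1) unfolding isInterp_def funOn_def by blast
  then have "(\<exists>r. pr msym r \<epsilon> I \<and> fin 2 (\<lambda>l. a (?f l)) \<epsilon> r) \<longleftrightarrow> a (\<rho> i) \<epsilon> a (\<rho> j)"
    using I(3) t ij Member(3) by blast
  with satisfaction_rel[OF I(2) msym, of ?f k a] ij Member(3) show ?case by simp
next
  case (Equal i j)
  obtain I where I: "satisfaction mlang M I S" using S unfolding msat_def by blast
  have "\<rho> i < m" "\<rho> j < m" by (rule Equal(1), simp)+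
  then have ij: "\<rho> i < k" "\<rho> j < k" using Equal(2) by simp_all
  with satisfaction_eq[OF I _ _ Equal(3)] show ?case by simp
next
  case (Impl p q)
  obtain I where I: "satisfaction mlang M I S" using S unfolding msat_def by blast
  have f: "isFormula mlang (num k) (code \<rho> m (Impl p q))"
    using mformula_code[of "Impl p q" \<rho> m k] Impl.prems unfolding mformula_def by blast
  have "pr (code \<rho> m p) (fin k a) \<epsilon> S \<longleftrightarrow> sat (ext M) E (\<lambda>i. a (\<rho> i)) p"
    "pr (code \<rho> m q) (fin k a) \<epsilon> S \<longleftrightarrow> sat (ext M) E (\<lambda>i. a (\<rho> i)) q"
    using Impl.prems by (intro Impl.IH; simp)+
  with satisfaction_imp[OF I _ Impl.prems(3)] f show ?case by simp
next
  case (Forall p)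
  obtain I where I: "satisfaction mlang M I S" using S unfolding msat_def by blast
  have f: "isFormula mlang (num k) (code \<rho> m (Forall p))"
    using mformula_code[of "Forall p" \<rho> m k] Forall.prems unfolding mformula_def by blast
  have m: "m < k" using Forall.prems(2) by simp
  have "pr (code (case_nat m \<rho>) (Suc m) p) (fin k (a(m := x))) \<epsilon> S \<longleftrightarrow>
      sat (ext M) E (case_nat x (\<lambda>i. a (\<rho> i))) p" if x: "x \<epsilon> M" for x
  proof -
    have "pr (code (case_nat m \<rho>) (Suc m) p) (fin k (a(m := x))) \<epsilon> S \<longleftrightarrow>
        sat (ext M) E (\<lambda>i. (a(m := x)) (case_nat m \<rho> i)) p"
    proof (rule Forall.IH)
      show "case_nat m \<rho> i < Suc m" if "i < free_bound p" for i
        by (cases i) (use that Forall.prems(1)[of "i - 1"] in \<open>simp_all add: less_diff_conv less_SucI\<close>)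
    qed (use Forall.prems x in auto)
    also have "\<dots> \<longleftrightarrow> sat (ext M) E (case_nat x (\<lambda>i. a (\<rho> i))) p"
    proof (rule sat_cong)
      fix i assume "i < free_bound p"
      then show "(a(m := x)) (case_nat m \<rho> i) = case_nat x (\<lambda>i. a (\<rho> i)) i"
        by (cases i) (use Forall.prems(1)[of "i - 1"] in \<open>simp_all add: less_diff_conv\<close>)
    qed
    finally show ?thesis .
  qed
  with satisfaction_all[OF I _ Forall.prems(3) m] f show ?case by simp
qed

end

section \<open>\<open>\<Delta>\<^sub>0\<close> predicates\<close>

text \<open>Parameters are passed through the environment, so that one bounded formula can be
  evaluated over several transitive domains.\<close>

definition D0 :: "('a \<Rightarrow> 'a \<Rightarrow> bool) \<Rightarrow> ((nat \<Rightarrow> 'a) \<Rightarrow> bool) \<Rightarrow> bool" where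
  "D0 E P \<longleftrightarrow> (\<exists>p\<in>Delta0. \<forall>e. P e \<longleftrightarrow> sat UNIV E e p)"

lemma D0I: "p \<in> Delta0 \<Longrightarrow> (\<And>e. P e \<longleftrightarrow> sat UNIV E e p) \<Longrightarrow> D0 E P"
  unfolding D0_def by blast

lemma D0_Mem: "D0 E (\<lambda>e. E (e i) (e j))"
  by (rule D0I[of "Member i j"]) (auto intro: Delta0.intros)

lemma D0_Eq: "D0 E (\<lambda>e. e i = e j)"
  by (rule D0I[of "Equal i j"]) (auto intro: Delta0.intros)

lemma D0_imp: "D0 E P \<Longrightarrow> D0 E Q \<Longrightarrow> D0 E (\<lambda>e. P e \<longrightarrow> Q e)"
  unfolding D0_def by (metis Delta0.intros(4) sat.simps(4))

lemma D0_not: "D0 E P \<Longrightarrow> D0 E (\<lambda>e. \<not> P e)"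
  unfolding D0_def by (metis Delta0.intros(1,4) sat.simps(1,4))

lemma D0_and: "D0 E P \<Longrightarrow> D0 E Q \<Longrightarrow> D0 E (\<lambda>e. P e \<and> Q e)"
  using D0_not[OF D0_imp[OF _ D0_not], of E P Q] by simp

lemma D0_or: "D0 E P \<Longrightarrow> D0 E Q \<Longrightarrow> D0 E (\<lambda>e. P e \<or> Q e)"
  using D0_imp[OF D0_not, of E P Q] by (simp add: disj_imp)

lemma D0_ball:
  assumes "D0 E (\<lambda>e. P (e 0) (\<lambda>i. e (Suc i)))"
  shows "D0 E (\<lambda>e. \<forall>x. E x (e j) \<longrightarrow> P x e)"
proof -
  obtain p where p: "p \<in> Delta0" "\<And>e. P (e 0) (\<lambda>i. e (Suc i)) \<longleftrightarrow> sat UNIV E e p"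
    using assms unfolding D0_def by blast
  have "P x e \<longleftrightarrow> sat UNIV E (case_nat x e) p" for x e
    using p(2)[of "case_nat x e"] by simp
  then show ?thesis
    by (intro D0I[of "Forall (Impl (Member 0 (Suc j)) p)"] Delta0.intros p) simp
qed

lemma D0_bex:
  assumes "D0 E (\<lambda>e. P (e 0) (\<lambda>i. e (Suc i)))"
  shows "D0 E (\<lambda>e. \<exists>x. E x (e j) \<and> P x e)"
  using D0_not[OF D0_ball[of E "\<lambda>x e. \<not> P x e" j]] D0_not[OF assms] by simp

lemmas D0_rules = D0_imp D0_not D0_and D0_or D0_ball D0_bex D0_Mem D0_Eq

lemma Delta0_absolute:
  "p \<in> Delta0 \<Longrightarrow> (\<And>x y. x \<in> D \<Longrightarrow> E y x \<Longrightarrow> y \<in> D) \<Longrightarrow> range e \<subseteq> D \<Longrightarrow>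
    sat D E e p \<longleftrightarrow> sat UNIV E e p"
proof (induction arbitrary: e rule: Delta0.induct)
  case (5 p y)
  then have "sat D E (case_nat a e) p \<longleftrightarrow> sat UNIV E (case_nat a e) p" if "a \<in> D" for a
    using that by simp
  moreover have "a \<in> D" if "E a (e y)" for a using 5 that by blast
  ultimately show ?case by auto
qed auto

context basic
begin

lemma eq_up_bounded: "z = up x y \<longleftrightarrow> x \<epsilon> z \<and> y \<epsilon> z \<and> (\<forall>u. u \<epsilon> z \<longrightarrow> u = x \<or> u = y)"
  unfolding eq_up by blast

lemma D0_up: "D0 E (\<lambda>e. e i = up (e j) (e k))"
  unfolding eq_up_bounded by (intro D0_rules)

lemma D0_pr: "D0 E (\<lambda>e. e i = pr (e j) (e k))"
proof -
  have "z = pr x y \<longleftrightarrow> (\<exists>s. s \<epsilon> z \<and> (\<exists>t. t \<epsilon> z \<and> s = up x x \<and> t = up x y \<and> z = up s t))" for x y z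
    unfolding pr_def using in_up[of _ "up x x" "up x y"] by blast
  then show ?thesis by (simp only:, intro D0_rules D0_up)
qed

lemma D0_pr_in: "D0 E (\<lambda>e. pr (e j) (e k) \<epsilon> e i)"
proof -
  have "pr x y \<epsilon> f \<longleftrightarrow> (\<exists>z. z \<epsilon> f \<and> z = pr x y)" for x y f by blast
  then show ?thesis by (simp only:, intro D0_rules D0_pr)
qed

end

text \<open>A function from \<open>a\<close> to \<open>a\<close> has its arguments and values in
  \<open>a\<close>, so every quantifier can be bounded by \<open>a\<close> or by the function
  itself.\<close>

lemma (in omega) D0_endo: "D0 E (\<lambda>e. endo (e i) (e j) (e k))"
proof -
  have "endo a r f \<longleftrightarrow> (\<forall>z. z \<epsilon> f \<longrightarrow> (\<exists>x. x \<epsilon> a \<and> (\<exists>y. y \<epsilon> a \<and> z = pr x y))) \<and>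
    (\<forall>x. x \<epsilon> a \<longrightarrow> (\<exists>y. y \<epsilon> a \<and> pr x y \<epsilon> f \<and> (\<forall>z. z \<epsilon> a \<longrightarrow> pr x z \<epsilon> f \<longrightarrow> z = y))) \<and>
    (\<forall>x. x \<epsilon> a \<longrightarrow> (\<forall>y. y \<epsilon> a \<longrightarrow> pr x y \<epsilon> r \<longrightarrow>
      (\<exists>u. u \<epsilon> a \<and> (\<exists>v. v \<epsilon> a \<and> pr x u \<epsilon> f \<and> pr y v \<epsilon> f \<and> pr u v \<epsilon> r))))" (is "_ \<longleftrightarrow> ?R")
    for a r f
  proof
    assume e: "endo a r f"
    then have f: "isFun f a a" unfolding endo_def by blast
    then have ran: "pr x y \<epsilon> f \<Longrightarrow> y \<epsilon> a" for x y unfolding isFun_def by blast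
    show ?R
    proof (intro conjI allI impI)
      fix z assume z: "z \<epsilon> f"
      then obtain x y where "x \<epsilon> a" "z = pr x y" using f unfolding isFun_def funOn_def by blast
      with ran z show "\<exists>x. x \<epsilon> a \<and> (\<exists>y. y \<epsilon> a \<and> z = pr x y)" by blast
    next
      fix x assume x: "x \<epsilon> a"
      note app = funOn_app[OF isFun_funOn[OF f] x]
      show "\<exists>y. y \<epsilon> a \<and> pr x y \<epsilon> f \<and> (\<forall>z. z \<epsilon> a \<longrightarrow> pr x z \<epsilon> f \<longrightarrow> z = y)"
        using app isFun_app[OF f x] by blast
    next
      fix x y assume "x \<epsilon> a" "y \<epsilon> a" "pr x y \<epsilon> r"
      with e ran show "\<exists>u. u \<epsilon> a \<and> (\<exists>v. v \<epsilon> a \<and> pr x u \<epsilon> f \<and> pr y v \<epsilon> f \<and> pr u v \<epsilon> r)"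
        unfolding endo_def by blast
    qed
  next
    assume R: ?R
    then have *: "x \<epsilon> a \<and> y \<epsilon> a" if "pr x y \<epsilon> f" for x y using that by fastforce
    have "funOn f a" unfolding funOn_def
    proof (intro conjI allI impI)
      fix z assume "z \<epsilon> f"
      with R show "\<exists>x y. x \<epsilon> a \<and> z = pr x y" by blast
    next
      fix x assume "x \<epsilon> a"
      with R obtain y where "pr x y \<epsilon> f" "\<forall>z. z \<epsilon> a \<longrightarrow> pr x z \<epsilon> f \<longrightarrow> z = y" by blast
      with * show "\<exists>!y. pr x y \<epsilon> f" by blast
    qed
    with R * show "endo a r f" unfolding endo_def isFun_def by blast
  qed
  then show ?thesis by (simp only:, intro D0_rules D0_pr D0_pr_in)
qed

section \<open>Transitive models of ZFC inside a model\<close>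

context omega
begin

text \<open>Since \<open>M\<close> is transitive, what it takes for a pair, a union or the empty set
  really is one.\<close>

lemma model_good:
  assumes "model M"
  shows "good {x. x \<epsilon> M}"
proof -
  let ?D = "{x. x \<epsilon> M}"
  have trans: "y \<epsilon> M" if "y \<epsilon> x" "x \<epsilon> M" for x y
    using assms that unfolding model_def sub_def by blast
  have h: "holds ?D E (\<lambda>_. M) 0 (\<lambda>_. M) (ax_pair fAll)"
    "holds ?D E (\<lambda>_. M) 0 (\<lambda>_. M) (ax_union fAll)"
    "holds ?D E (\<lambda>_. M) 0 (\<lambda>_. M) (ax_infinity fAll)"
    using assms by (simp_all add: model_def zfc_finite_part_def)
  have up: "up x y \<epsilon> M" if xy: "x \<epsilon> M" "y \<epsilon> M" for x y
  proof -
    have "\<forall>x\<in>?D. \<forall>y\<in>?D. \<exists>z\<in>?D. \<forall>u\<in>?D. u \<epsilon> z \<longleftrightarrow> u = x \<or> u = y"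
      using h(1) by (simp add: ax_pair_def)
    from this[THEN bspec, THEN bspec, of x y] xy
    obtain z where z: "z \<epsilon> M" "\<And>u. u \<epsilon> M \<Longrightarrow> u \<epsilon> z \<longleftrightarrow> u = x \<or> u = y" by auto
    then have "z = up x y" unfolding eq_up using trans xy by blast
    with z show ?thesis by simp
  qed
  have bigU: "bigU x \<epsilon> M" if x: "x \<epsilon> M" for x
  proof -
    have "\<forall>x\<in>?D. \<exists>z\<in>?D. \<forall>u\<in>?D. u \<epsilon> z \<longleftrightarrow> (\<exists>v\<in>?D. v \<epsilon> x \<and> u \<epsilon> v)"
      using h(2) by (simp add: ax_union_def)
    from this[THEN bspec, of x] x
    obtain z where z: "z \<epsilon> M" "\<And>u. u \<epsilon> M \<Longrightarrow> u \<epsilon> z \<longleftrightarrow> (\<exists>v. v \<epsilon> M \<and> v \<epsilon> x \<and> u \<epsilon> v)" by auto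
    have "z = bigU x"
    proof (rule extensionality)
      fix u
      have "u \<epsilon> z \<longleftrightarrow> (\<exists>v. v \<epsilon> M \<and> v \<epsilon> x \<and> u \<epsilon> v)" if "u \<epsilon> M" using z(2) that .
      moreover have "u \<epsilon> M" if "u \<epsilon> z" using trans that z(1) .
      moreover have "v \<epsilon> M" if "v \<epsilon> x" for v using trans that x .
      moreover from this have "u \<epsilon> M" if "u \<epsilon> v" "v \<epsilon> x" for v using trans that by blast
      ultimately show "u \<epsilon> z \<longleftrightarrow> u \<epsilon> bigU x" unfolding in_bigU by blast
    qed
    with z show ?thesis by simp
  qed
  obtain e where "e \<epsilon> M" "\<forall>u. u \<epsilon> M \<longrightarrow> \<not> u \<epsilon> e" using h(3) by (auto simp: ax_infinity_def)
  then have "emp \<epsilon> M" using trans eq_emp[of e] by blast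
  then show ?thesis unfolding good_def using up bigU trans by simp
qed

end

context weak
begin

text \<open>The internal schemes range over all codes of the model, so they apply in particular to
  the code of an actual formula, where \<open>msat_code\<close> replaces internal satisfaction by
  truth.\<close>

lemma model_ZFC:
  assumes M: "model M" and e: "range e \<subseteq> ext M"
  shows "\<forall>q\<in>ZFC. sat (ext M) E e q"
proof -
  obtain S where S: "msat M S" and schema:
    "\<forall>k c a. k \<epsilon> om \<and> mformula k c \<and> isFun a k M \<longrightarrow>
      (\<forall>b. b \<epsilon> M \<longrightarrow> (\<exists>d. d \<epsilon> M \<and> (\<forall>x. x \<epsilon> M \<longrightarrow> (x \<epsilon> d \<longleftrightarrow> x \<epsilon> b \<and> sat1S S k c a x)))) \<and>
      (\<forall>b. b \<epsilon> M \<longrightarrow>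
        (\<forall>x. x \<epsilon> M \<longrightarrow> x \<epsilon> b \<longrightarrow> (\<exists>y. y \<epsilon> M \<and> (\<forall>z. z \<epsilon> M \<longrightarrow> (sat2S S k c a x z \<longleftrightarrow> z = y)))) \<longrightarrow>
        (\<exists>d. d \<epsilon> M \<and> (\<forall>y. y \<epsilon> M \<longrightarrow> (y \<epsilon> d \<longleftrightarrow> (\<exists>x. x \<epsilon> M \<and> x \<epsilon> b \<and> sat2S S k c a x y)))))"
    using M unfolding model_def by (elim conjE exE) (rule that; assumption)
  note schema = schema[THEN spec, THEN spec, THEN spec, THEN mp, OF conjI, OF _ conjI]
  have fin: "holds (ext M) E e 0 e ax" if "ax \<in> set (zfc_finite_part fAll)" for ax
  proof -
    have "holds (ext M) E (\<lambda>_. M) 0 (\<lambda>_. M) ax" using M that unfolding model_def by blast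
    moreover have "holds (ext M) E (\<lambda>_. M) 0 (\<lambda>_. M) ax \<longleftrightarrow> holds (ext M) E e 0 e ax"
      using that by (auto simp add: zfc_axiom_defs simp del: imp_cong cong del: imp_cong)
    ultimately show ?thesis by simp
  qed
  \<comment> \<open>Two more than the free bound makes room for the variables 0 and 1, which
    \<open>sat1S\<close> and \<open>sat2S\<close> overwrite, whatever the formula.\<close>
  let ?m = "\<lambda>p. Suc (Suc (free_bound p))" let ?k = "\<lambda>p. ?m p + qdepth p"
  let ?c = "\<lambda>p. code (\<lambda>i. i) (?m p) p"
  have c: "mformula (num (?k p)) (?c p)" for p by (rule mformula_code) auto
  have code: "pr (?c p) (fin (?k p) a) \<epsilon> S \<longleftrightarrow> sat (ext M) E a p" if "\<forall>i<?k p. a i \<epsilon> M" for p a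
    using msat_code[OF S, of p "\<lambda>i. i" "?m p" "?k p" a] that by auto
  have w: "w i \<epsilon> M" if "range w \<subseteq> ext M" for w and i :: nat using that by blast
  have sat1: "sat1S S (num (?k p)) (?c p) (fin (?k p) a) x \<longleftrightarrow> sat (ext M) E (a(0 := x)) p"
    if a: "\<forall>i. a i \<epsilon> M" and x: "x \<epsilon> M" for p a x
    unfolding sat1S_def using upd_fin[of 0 "?k p" a x] code[of p "a(0 := x)"] a x
    by (simp del: num.simps)
  have sat2: "sat2S S (num (?k p)) (?c p) (fin (?k p) a) x y \<longleftrightarrow> sat (ext M) E (a(0 := x, 1 := y)) p"
    if a: "\<forall>i. a i \<epsilon> M" and x: "x \<epsilon> M" "y \<epsilon> M" for p a x y
    unfolding sat2S_def
    using upd_fin[of 0 "?k p" a x] upd_fin[of 1 "?k p" "a(0 := x)" y] code[of p "a(0 := x, 1 := y)"] a x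
    by (simp del: num.simps)
  have sep: "\<exists>d. d \<epsilon> M \<and> (\<forall>x. x \<epsilon> M \<longrightarrow> (x \<epsilon> d \<longleftrightarrow> x \<epsilon> b \<and> sat (ext M) E (case_nat x w) p))"
    if w: "range w \<subseteq> ext M" and b: "b \<epsilon> M" for p w b
  proof -
    \<comment> \<open>The entry at 0 is a placeholder that \<open>sat1S\<close> overwrites; any
      element of \<open>M\<close> would do, and \<open>b\<close> is at hand.\<close>
    let ?a = "case_nat b w"
    have a: "\<forall>i. ?a i \<epsilon> M" using w b by (auto split: nat.split)
    then have "isFun (fin (?k p) ?a) (num (?k p)) M" using isFun_fin by blast
    from schema[OF num_om c this] b
    obtain d where d: "d \<epsilon> M" "\<forall>x. x \<epsilon> M \<longrightarrow>
        (x \<epsilon> d \<longleftrightarrow> x \<epsilon> b \<and> sat1S S (num (?k p)) (?c p) (fin (?k p) ?a) x)" by blast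
    have "?a(0 := x) = case_nat x w" for x by (auto simp: fun_eq_iff split: nat.split)
    with sat1[OF a, of _ p] d show ?thesis by auto
  qed
  have rep: "(\<forall>x. x \<epsilon> M \<longrightarrow> x \<epsilon> b \<longrightarrow>
      (\<exists>y. y \<epsilon> M \<and> (\<forall>z. z \<epsilon> M \<longrightarrow> (sat (ext M) E (case_nat x (case_nat z w)) p \<longleftrightarrow> z = y)))) \<longrightarrow>
    (\<exists>d. d \<epsilon> M \<and> (\<forall>y. y \<epsilon> M \<longrightarrow>
      (y \<epsilon> d \<longleftrightarrow> (\<exists>x. x \<epsilon> M \<and> x \<epsilon> b \<and> sat (ext M) E (case_nat x (case_nat y w)) p))))"
    if w: "range w \<subseteq> ext M" and b: "b \<epsilon> M" for p w b
  proof -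
    let ?a = "case_nat b (case_nat b w)"
    have a: "\<forall>i. ?a i \<epsilon> M" using w b by (auto split: nat.split)
    then have "isFun (fin (?k p) ?a) (num (?k p)) M" using isFun_fin by blast
    note s = schema[OF num_om c this, THEN conjunct2, rule_format, OF b]
    have "?a(0 := x, 1 := y) = case_nat x (case_nat y w)" for x y
      by (auto simp: fun_eq_iff split: nat.split)
    then have s2: "sat2S S (num (?k p)) (?c p) (fin (?k p) ?a) x y \<longleftrightarrow>
        sat (ext M) E (case_nat x (case_nat y w)) p" if "x \<epsilon> M" "y \<epsilon> M" for x y
      using sat2[OF a that, of p] by simp
    show ?thesis
    proof
      assume h: "\<forall>x. x \<epsilon> M \<longrightarrow> x \<epsilon> b \<longrightarrow>
        (\<exists>y. y \<epsilon> M \<and> (\<forall>z. z \<epsilon> M \<longrightarrow> (sat (ext M) E (case_nat x (case_nat z w)) p \<longleftrightarrow> z = y)))"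
      have "\<exists>d. d \<epsilon> M \<and> (\<forall>y. y \<epsilon> M \<longrightarrow> (y \<epsilon> d \<longleftrightarrow>
          (\<exists>x. x \<epsilon> M \<and> x \<epsilon> b \<and> sat2S S (num (?k p)) (?c p) (fin (?k p) ?a) x y)))"
      proof (rule s)
        fix x assume x: "x \<epsilon> M" "x \<epsilon> b"
        with h obtain y where y: "y \<epsilon> M" "\<forall>z. z \<epsilon> M \<longrightarrow>
            (sat (ext M) E (case_nat x (case_nat z w)) p \<longleftrightarrow> z = y)" by blast
        then have "\<forall>z. z \<epsilon> M \<longrightarrow> (sat2S S (num (?k p)) (?c p) (fin (?k p) ?a) x z \<longleftrightarrow> z = y)"
          using s2[OF x(1)] by blast
        with y(1) show "\<exists>y. y \<epsilon> M \<and> (\<forall>z. z \<epsilon> M \<longrightarrow>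
            (sat2S S (num (?k p)) (?c p) (fin (?k p) ?a) x z \<longleftrightarrow> z = y))" by blast
      qed
      then obtain d where d: "d \<epsilon> M" "\<forall>y. y \<epsilon> M \<longrightarrow> (y \<epsilon> d \<longleftrightarrow>
          (\<exists>x. x \<epsilon> M \<and> x \<epsilon> b \<and> sat2S S (num (?k p)) (?c p) (fin (?k p) ?a) x y))" by blast
      then have "\<forall>y. y \<epsilon> M \<longrightarrow>
          (y \<epsilon> d \<longleftrightarrow> (\<exists>x. x \<epsilon> M \<and> x \<epsilon> b \<and> sat (ext M) E (case_nat x (case_nat y w)) p))"
        using s2 by blast
      with d(1) show "\<exists>d. d \<epsilon> M \<and> (\<forall>y. y \<epsilon> M \<longrightarrow>
          (y \<epsilon> d \<longleftrightarrow> (\<exists>x. x \<epsilon> M \<and> x \<epsilon> b \<and> sat (ext M) E (case_nat x (case_nat y w)) p)))" by blast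
    qed
  qed
  show ?thesis
    unfolding sat_ZFC_iff[OF e]
  proof (intro conjI allI impI ballI)
    show "holds (ext M) E e 0 e ax" if "ax \<in> set (zfc_finite_part fAll)" for ax
      by (rule fin[OF that])
  next
    fix p b and w :: "nat \<Rightarrow> 'a" assume "range w \<subseteq> ext M" "b \<in> ext M"
    then have "range w \<subseteq> ext M" "b \<epsilon> M" by auto
    from sep[OF this, of p]
    show "\<exists>d\<in>ext M. \<forall>x\<in>ext M. x \<epsilon> d \<longleftrightarrow> x \<epsilon> b \<and> sat (ext M) E (case_nat x w) p" by blast
  next
    fix p b and w :: "nat \<Rightarrow> 'a" assume "range w \<subseteq> ext M" "b \<in> ext M"
      and h: "\<forall>x\<in>ext M. x \<epsilon> b \<longrightarrow>
        (\<exists>y\<in>ext M. \<forall>z\<in>ext M. sat (ext M) E (case_nat x (case_nat z w)) p \<longleftrightarrow> z = y)"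
    then have "range w \<subseteq> ext M" "b \<epsilon> M" by auto
    from rep[OF this, of p] h
    show "\<exists>d\<in>ext M. \<forall>y\<in>ext M. y \<epsilon> d \<longleftrightarrow>
        (\<exists>x\<in>ext M. x \<epsilon> b \<and> sat (ext M) E (case_nat x (case_nat y w)) p)"
      by (simp add: Ball_def Bex_def)
  qed
qed

lemma model_VPH:
  assumes M: "model M" and om: "om \<epsilon> M" and a: "a \<epsilon> M" "\<not> finite_in UNIV a"
  obtains r where "r \<epsilon> M" "rigid_in (ext M) a r"
proof -
  have e: "range (\<lambda>_. om) \<subseteq> ext M" using om by auto
  have "sat (ext M) E (\<lambda>_. om) (VPH 0)"
    by (rule soundness[OF ZFC_VPH e model_ZFC[OF M e]])
  then have "\<forall>a\<in>ext M. \<not> finite_in (ext M) a \<longrightarrow> (\<exists>r\<in>ext M. rigid_in (ext M) a r)"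
    unfolding sat_holds[of "ext M" E "\<lambda>_. om" VPH "\<lambda>_. om"]
    using holds_VPH[OF model_good[OF M]] om by simp
  moreover have "\<not> finite_in (ext M) a" using a(2) unfolding finite_in_def by blast
  ultimately show thesis using that a(1) by blast
qed

section \<open>Reflection of Sigma_1 statements\<close>

lemma delta_step_all:
  assumes "i \<epsilon> k" "j \<epsilon> k" "i \<noteq> j" "is2tup (tag 0 i emp) (tag 0 j emp) u" "prev p"
  shows "delta_step k prev (tag 5 i (tag 4 (tag 3 msym u) p))"
  unfolding delta_step_def by (intro disjI2 exI conjI) (use assms in auto)

text \<open>The variable \<open>m\<close> is new, hence distinct from the bounding variable
  \<open>\<rho> y\<close>, as \<open>delta_step\<close> demands of a bounded quantifier.\<close>

lemma gen_delta_code: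
  "p \<in> Delta0 \<Longrightarrow> (\<And>i. i < free_bound p \<Longrightarrow> \<rho> i < m) \<Longrightarrow> m + qdepth p \<le> k \<Longrightarrow>
    gen (delta_step (num k)) (code \<rho> m p)"
proof (induction arbitrary: \<rho> m rule: Delta0.induct)
  case 1
  show ?case by (rule gen_base) (simp add: delta_step_def)
next
  case (2 i j)
  have "\<rho> i < m" "\<rho> j < m" by (rule 2, simp)+
  with 2(2) have "\<rho> i < k" "\<rho> j < k" by simp_all
  then show ?case by (intro gen_base) (simp add: delta_step_def isAtom_mem)
next
  case (3 i j)
  have "\<rho> i < m" "\<rho> j < m" by (rule 3, simp)+
  with 3(2) have "\<rho> i < k" "\<rho> j < k" by simp_all
  then show ?case by (intro gen_base) (simp add: delta_step_def isAtom_eq)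
next
  case (4 p q)
  have "gen (delta_step (num k)) (code \<rho> m p)" "gen (delta_step (num k)) (code \<rho> m q)"
    using 4 by simp_all
  then show ?case
    by (rule gen_step[OF mono_delta_step]) (auto simp: delta_step_def)
next
  case (5 p y)
  let ?c = "code (case_nat m \<rho>) (Suc m) p"
  have g: "gen (delta_step (num k)) ?c"
  proof (rule 5)
    show "case_nat m \<rho> i < Suc m" if "i < free_bound p" for i
      by (cases i) (use that 5(3)[of "i - 1"] in \<open>simp_all add: less_diff_conv less_SucI\<close>)
  qed (use 5(4) in simp)
  have y: "\<rho> y < m" by (rule 5) simp
  have "num m \<epsilon> num k" "num (\<rho> y) \<epsilon> num k" "num m \<noteq> num (\<rho> y)"
    using 5(4) y by (auto simp: in_num)
  moreover have "is2tup (tag 0 (num m) emp) (tag 0 (num (\<rho> y)) emp)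
      (fin 2 (\<lambda>l. vr (if l = 0 then m else \<rho> y)))"
    unfolding is2tup_iff by (rule fin_cong) (simp add: vr_def)
  moreover have "code \<rho> m (Forall (Impl (Member 0 (Suc y)) p)) =
      tag 5 (num m) (tag 4 (tag 3 msym (fin 2 (\<lambda>l. vr (if l = 0 then m else \<rho> y)))) ?c)"
    by (simp add: relc_def cong: if_cong)
  ultimately have "delta_step (num k) (\<lambda>e. e = ?c \<or> e = ?c)
      (code \<rho> m (Forall (Impl (Member 0 (Suc y)) p)))"
    using delta_step_all[of _ _ _ _ "\<lambda>e. e = ?c \<or> e = ?c" ?c] by metis
  then show ?case by (rule gen_step[OF mono_delta_step g g])
qed

text \<open>The existential statement is written with the negations that \<open>sigma1\<close>
  prescribes. It holds in \<open>N\<close> because of \<open>x\<close>, hence in \<open>M\<close> by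
  elementarity; as the matrix is bounded, both sets agree with \<open>U\<close> on its
  meaning.\<close>

lemma sigma1_elementary:
  assumes "elementary sigma1 M N" and "good (ext M)" "good (ext N)"
    and P: "D0 E P" and a: "range a \<subseteq> ext M" and x: "x \<epsilon> N" "P (case_nat x a)"
  obtains y where "y \<epsilon> M" "P (case_nat y a)"
proof -
  obtain p where p: "p \<in> Delta0" "\<And>e. P e \<longleftrightarrow> sat UNIV E e p" using P unfolding D0_def by blast
  have MN: "sub M N" using assms(1) unfolding elementary_def by blast
  let ?q = "Neg (Forall (Neg p))"
  have abs: "sat (ext K) E e p \<longleftrightarrow> P e" if "good (ext K)" "range e \<subseteq> ext K" for K e
    using Delta0_absolute[OF p(1), of "ext K" E e] good_trans[OF that(1)] that(2) p(2) by blast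
  have q: "sat (ext K) E a ?q \<longleftrightarrow> (\<exists>y. y \<epsilon> K \<and> P (case_nat y a))"
    if K: "good (ext K)" "range a \<subseteq> ext K" for K
    using abs[OF K(1)] K(2) by auto
  let ?m = "free_bound p" let ?k = "?m + Suc (qdepth p)" let ?c = "code (\<lambda>i. i) ?m ?q"
  obtain S T where ST: "msat M S" "msat N T" "\<And>k c a. k \<epsilon> om \<Longrightarrow> sigma1 k c \<Longrightarrow> isFun a k M \<Longrightarrow>
      (pr c a \<epsilon> S \<longleftrightarrow> pr c a \<epsilon> T)" using assms(1) unfolding elementary_def by blast
  have sig: "sigma1 (num ?k) ?c"
  proof -
    have "gen (delta_step (num ?k)) (code (case_nat ?m (\<lambda>i. i)) (Suc ?m) p)"
      by (rule gen_delta_code[OF p(1)]) (auto split: nat.split)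
    moreover have "num ?m \<epsilon> num ?k" by (auto simp: in_num)
    ultimately show ?thesis unfolding sigma1_def using gen_built by auto
  qed
  have code: "pr ?c (fin ?k a) \<epsilon> U \<longleftrightarrow> sat (ext K) E a ?q"
    if "msat K U" "range a \<subseteq> ext K" for K U
  proof (rule msat_code[OF that(1)])
    show "i < ?m" if "i < free_bound ?q" for i using that by simp
    show "\<forall>i<?k. a i \<epsilon> K" using that(2) by blast
  qed simp
  have aN: "range a \<subseteq> ext N" using a MN unfolding sub_def by blast
  have "sat (ext N) E a ?q" using q[OF assms(3) aN] x by blast
  then have "pr ?c (fin ?k a) \<epsilon> T" using code[OF ST(2) aN] by blast
  moreover have "isFun (fin ?k a) (num ?k) M" using a isFun_fin by blast
  ultimately have "pr ?c (fin ?k a) \<epsilon> S" using ST(3)[OF num_om sig] by blast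
  then show thesis using code[OF ST(1) a] q[OF assms(2) a] that by blast
qed

theorem VPH_of_Sigma1_sext:
  assumes sext: "\<And>x. \<exists>M. x \<epsilon> M \<and> model M \<and> (\<forall>x. \<exists>N. model N \<and> x \<epsilon> N \<and> elementary sigma1 M N)"
    and inf: "\<not> finite_in UNIV a"
  shows "\<exists>r. rigid_in UNIV a r"
proof -
  \<comment> \<open>\<open>om\<close> is put into \<open>M\<close> as well, so that finiteness in
    \<open>M\<close> refers to the true natural numbers.\<close>
  obtain M where M: "pr a om \<epsilon> M" "model M" "\<And>x. \<exists>N. model N \<and> x \<epsilon> N \<and> elementary sigma1 M N"
    using sext by blast
  note good = model_good[OF M(2)]
  have aM: "a \<epsilon> M" "om \<epsilon> M" using good_pr_eq[OF good, of a om] M(1) by simp_all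
  obtain r where r: "r \<epsilon> M" "rigid_in (ext M) a r" using model_VPH[OF M(2) aM(2,1) inf] .
  have "pr x x \<epsilon> f" if f: "endo a r f" and x: "x \<epsilon> a" for f x
  proof (rule ccontr)
    assume nx: "\<not> pr x x \<epsilon> f"
    obtain N where N: "model N" "f \<epsilon> N" "elementary sigma1 M N" using M(3) by blast
    let ?P = "\<lambda>e. endo (e 1) (e 2) (e 0) \<and> (\<exists>x. x \<epsilon> e 1 \<and> \<not> pr x x \<epsilon> e 0)"
    have D: "D0 E ?P" by (intro D0_rules D0_endo D0_pr_in)
    let ?a = "case_nat a (\<lambda>_. r)"
    have "range ?a \<subseteq> ext M" using aM(1) r(1) by (auto split: nat.split)
    moreover have "?P (case_nat f ?a)" using f x nx by (auto simp: numeral_2_eq_2)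
    ultimately obtain g where "g \<epsilon> M" "?P (case_nat g ?a)"
      using sigma1_elementary[OF N(3) good model_good[OF N(1)] D _ N(2)] by blast
    then show False using r(2) unfolding rigid_in_def by (auto simp: numeral_2_eq_2)
  qed
  with r(2) show ?thesis unfolding rigid_in_def by blast
qed

end

section \<open>Consequences of Vopenka's Principle\<close>

context weak
begin

section \<open>Natural numbers under bounded Separation\<close>

lemma om_induct_in:
  assumes M: "om \<epsilon> M" "good (ext M)" and P: "Def (ext M) E (\<lambda>e. P (e 0))"
    and "P emp" "\<And>n. n \<epsilon> om \<Longrightarrow> P n \<Longrightarrow> P (sc n)" "n \<epsilon> om"
  shows "P n"
  by (rule om_induct[OF separation_in[OF P good_sub[OF M(2,1)]] assms(4-6)])

lemma emp_sc: "n \<epsilon> om \<Longrightarrow> emp \<epsilon> sc n"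
proof -
  assume n: "n \<epsilon> om"
  obtain M where M: "om \<epsilon> M" "good (ext M)" using local by blast
  have ne: "ext M \<noteq> {}" using M by blast
  have e: "emp \<in> ext M" using M(2) by (rule good_emp)
  have d: "Def (ext M) E (\<lambda>e. e 0 = emp \<or> emp \<epsilon> e 0)"
    by (intro Def_connectives TDef_var TDef_const ne e)
  have "n = emp \<or> emp \<epsilon> n"
    by (rule om_induct_in[OF M d _ _ n]) auto
  then show ?thesis by auto
qed

lemma sc_mono: "m \<epsilon> om \<Longrightarrow> n \<epsilon> m \<Longrightarrow> sc n \<epsilon> sc m"
proof -
  assume m: "m \<epsilon> om" and nm: "n \<epsilon> m"
  obtain M where M: "om \<epsilon> M" "n \<epsilon> M" "good (ext M)" using local2 by blast
  have ne: "ext M \<noteq> {}" using M by blast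
  have nM: "n \<in> ext M" "sc n \<in> ext M" using M good_sc[OF M(3)] by auto
  have d: "Def (ext M) E (\<lambda>e. n \<epsilon> e 0 \<longrightarrow> sc n = e 0 \<or> sc n \<epsilon> e 0)"
    by (intro Def_connectives TDef_var TDef_const ne nM)
  have "n \<epsilon> m \<longrightarrow> sc n = m \<or> sc n \<epsilon> m"
    by (rule om_induct_in[OF M(1,3) d _ _ m]) auto
  with nm show ?thesis by auto
qed

text \<open>Induction on \<open>n\<close> gives a common upper bound directly, without the linearity
  of \<open>om\<close>: a bound \<open>k\<close> for \<open>n\<close> turns into the bound
  \<open>sc k\<close> for \<open>sc n\<close>.\<close>

lemma om_directed: "m \<epsilon> om \<Longrightarrow> n \<epsilon> om \<Longrightarrow> \<exists>k. k \<epsilon> om \<and> sub m k \<and> n \<epsilon> k"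
proof -
  assume m: "m \<epsilon> om" and n: "n \<epsilon> om"
  obtain M where M: "om \<epsilon> M" "m \<epsilon> M" "good (ext M)" using local2 by blast
  have ne: "ext M \<noteq> {}" using M by blast
  have mM: "m \<in> ext M" "om \<in> ext M" using M by auto
  let ?P = "\<lambda>n. \<exists>k\<in>ext M. k \<epsilon> om \<and> (\<forall>x\<in>ext M. x \<epsilon> m \<longrightarrow> x \<epsilon> k) \<and> n \<epsilon> k"
  have d: "Def (ext M) E (\<lambda>e. ?P (e 0))"
    by (intro Def_ex Def_all Def_connectives TDef_var TDef_const ne mM)
  have scM: "sc x \<in> ext M" if "x \<in> ext M" for x using that good_sc[OF M(3)] by blast
  have "?P n"
  proof (rule om_induct_in[OF M(1,3) d _ _ n])
    show "?P emp" using emp_sc[OF m] om_sc[OF m] scM[OF mM(1)] by (intro bexI[of _ "sc m"]) auto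
  next
    fix n assume "?P n"
    then obtain k where k: "k \<in> ext M" "k \<epsilon> om" "\<forall>x\<in>ext M. x \<epsilon> m \<longrightarrow> x \<epsilon> k" "n \<epsilon> k" by blast
    show "?P (sc n)"
      using k om_sc[OF k(2)] scM[OF k(1)] sc_mono[OF k(2,4)] by (intro bexI[of _ "sc k"]) auto
  qed
  moreover have "x \<in> ext M" if "x \<epsilon> m" for x using that good_trans[OF M(3)] mM(1) by blast
  ultimately show ?thesis unfolding sub_def by blast
qed

text \<open>By induction on \<open>j\<close>, the members of \<open>om\<close> among the values of
  \<open>f\<close> on \<open>j\<close> all lie in some \<open>m\<close> of \<open>om\<close>. For
  \<open>j = n\<close> every natural number would lie in \<open>m\<close>, including
  \<open>m\<close> itself.\<close>

lemma om_infinite: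
  assumes "sub om a"
  shows "\<not> finite_in UNIV a"
proof
  assume "finite_in UNIV a"
  then obtain n f where n: "n \<epsilon> om" and f: "isFun f n a" and onto: "\<And>y. y \<epsilon> a \<Longrightarrow> \<exists>x. pr x y \<epsilon> f"
    unfolding finite_in_def by blast
  obtain M where M: "om \<epsilon> M" "f \<epsilon> M" "good (ext M)" using local2 by blast
  have ne: "ext M \<noteq> {}" using M by blast
  have mM: "f \<in> ext M" "om \<in> ext M" using M by auto
  let ?P = "\<lambda>j. \<exists>m\<in>ext M. m \<epsilon> om \<and> (\<forall>i\<in>ext M. \<forall>y\<in>ext M. i \<epsilon> j \<longrightarrow> y \<epsilon> om \<longrightarrow> pr i y \<epsilon> f \<longrightarrow> y \<epsilon> m)"
  have d: "Def (ext M) E (\<lambda>e. ?P (e 0))"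
    by (intro Def_ex Def_all Def_connectives TDef_var TDef_const TDef_pr M(3) ne mM)
  have omM: "x \<in> ext M" if "x \<epsilon> om" for x using that good_trans[OF M(3)] mM(2) by blast
  have "?P n"
  proof (rule om_induct_in[OF M(1,3) d _ _ n])
    show "?P emp" using om_emp omM by (intro bexI[of _ emp]) auto
  next
    fix j assume j: "j \<epsilon> om" and "?P j"
    then obtain m where m: "m \<epsilon> om"
      "\<And>i y. i \<in> ext M \<Longrightarrow> i \<epsilon> j \<Longrightarrow> y \<epsilon> om \<Longrightarrow> pr i y \<epsilon> f \<Longrightarrow> y \<epsilon> m" using omM by blast
    show "?P (sc j)"
    proof (cases "\<exists>y. y \<epsilon> om \<and> pr j y \<epsilon> f")
      case True
      then obtain y where y: "y \<epsilon> om" "pr j y \<epsilon> f" by blast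
      obtain k where k: "k \<epsilon> om" "sub m k" "y \<epsilon> k" using om_directed[OF m(1) y(1)] by blast
      have "z = y" if "pr j z \<epsilon> f" for z
        using that y(2) funOn_dom[OF isFun_funOn[OF f] that] funOn_app[OF isFun_funOn[OF f]] by metis
      then have "z \<epsilon> k" if "i \<in> ext M" "i \<epsilon> sc j" "z \<epsilon> om" "pr i z \<epsilon> f" for i z
        using that m(2)[of i z] k unfolding sub_def by (cases "i = j") auto
      with k(1) omM show ?thesis by blast
    next
      case False
      then have "z \<epsilon> m" if "i \<in> ext M" "i \<epsilon> sc j" "z \<epsilon> om" "pr i z \<epsilon> f" for i z
        using that m(2)[of i z] by (cases "i = j") auto
      with m(1) omM show ?thesis by blast
    qed
  qed
  then obtain m where m: "m \<epsilon> om"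
    "\<And>i y. i \<in> ext M \<Longrightarrow> i \<epsilon> n \<Longrightarrow> y \<epsilon> om \<Longrightarrow> pr i y \<epsilon> f \<Longrightarrow> y \<epsilon> m" using omM by blast
  obtain i where i: "pr i m \<epsilon> f" using onto m(1) assms unfolding sub_def by blast
  then have "i \<epsilon> n" using funOn_dom[OF isFun_funOn[OF f]] by blast
  moreover have "i \<in> ext M" using good_pr_in[OF M(3) i] mM by blast
  ultimately have "m \<epsilon> m" using m i by blast
  with om_irrefl m(1) show False by blast
qed

lemma fin_2: "fin 2 a = up (pr emp (a 0)) (pr (num 1) (a 1))"
  unfolding eq_up in_fin by (auto simp: numeral_2_eq_2 less_Suc_eq)

lemma fin_1: "fin 1 a = up (pr emp (a 0)) (pr emp (a 0))"
  unfolding eq_up in_fin by auto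

text \<open>A graph on \<open>B\<close> expanded by a unary predicate \<open>Y\<close>, copied to \<open>B \<times> {d}\<close>.\<close>

definition usym :: 'a where "usym = tag 0 (num 1) emp"

definition pointed :: "'a \<Rightarrow> 'a \<Rightarrow> 'a \<Rightarrow> 'a \<Rightarrow> 'a \<Rightarrow> bool" where
  "pointed B r Y d s \<longleftrightarrow> (\<exists>D p q. s = pr D (up (pr msym p) (pr usym q)) \<and>
    (\<forall>z. z \<epsilon> D \<longleftrightarrow> (\<exists>x. x \<epsilon> B \<and> z = pr x d)) \<and>
    (\<forall>t. t \<epsilon> p \<longleftrightarrow> (\<exists>x y. pr x y \<epsilon> r \<and> t = up (pr emp (pr x d)) (pr (num 1) (pr y d)))) \<and>
    (\<forall>t. t \<epsilon> q \<longleftrightarrow> (\<exists>x. x \<epsilon> Y \<and> t = up (pr emp (pr x d)) (pr emp (pr x d)))))"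

lemma Def_pointed: "Def UNIV E (\<lambda>e. pointed B r (e 0) (e 1) (e 2))"
  unfolding pointed_def by (intro Def_UNIV TDef_pr_UNIV TDef_up_UNIV)

lemma usym_msym [simp]: "usym \<noteq> msym" "msym \<noteq> usym"
  by (simp_all add: usym_def msym_def del: num.simps)

lemma relSym_usym: "relSym n usym \<longleftrightarrow> n = num 1" and relSym_msym: "relSym n msym \<longleftrightarrow> n = num 2"
  using num_om[of 1] num_om[of 2] by (auto simp: relSym_def usym_def msym_def simp del: num.simps)

lemma not_funSym: "\<not> funSym n usym" "\<not> funSym n msym"
  by (auto simp: funSym_def usym_def msym_def simp del: num.simps)

text \<open>All pairs and tuples involved lie in a good \<open>M\<close> containing
  \<open>B\<close>, \<open>r\<close>, \<open>Y\<close> and \<open>d\<close>, which turns the three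
  comprehensions into bounded ones.\<close>

lemma pointed_ex: "\<exists>s. pointed B r Y d s"
proof -
  obtain M where M: "pr (pr B r) (pr Y d) \<epsilon> M" "good (ext M)" using local by blast
  then have in_M: "B \<in> ext M" "r \<in> ext M" "Y \<in> ext M" "d \<in> ext M"
    using good_pr_eq[OF M(2)] by auto
  have ne: "ext M \<noteq> {}" using in_M by blast
  have c: "emp \<in> ext M" "num 1 \<in> ext M" using good_emp good_num M(2) by blast+
  note defs = Def_ex Def_all Def_connectives TDef_var TDef_const TDef_pr TDef_up M(2) ne in_M c
  note tr = good_trans[OF M(2)] and prM = good_pr[OF M(2)] and upM = good_up[OF M(2)]
  have sep: "is_set (\<lambda>x. x \<epsilon> M \<and> P x)" if "Def (ext M) E (\<lambda>e. P (e 0))" for P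
    using separation_in[OF that, of M] by (simp add: sub_def)
  have "is_set (\<lambda>z. z \<epsilon> M \<and> (\<exists>x\<in>ext M. x \<epsilon> B \<and> z = pr x d))" by (intro sep defs)
  moreover have "z \<epsilon> M \<and> (\<exists>x\<in>ext M. x \<epsilon> B \<and> z = pr x d) \<longleftrightarrow> (\<exists>x. x \<epsilon> B \<and> z = pr x d)" for z
    using tr[OF _ in_M(1)] prM in_M(4) by blast
  ultimately obtain D where D: "\<forall>z. z \<epsilon> D \<longleftrightarrow> (\<exists>x. x \<epsilon> B \<and> z = pr x d)"
    unfolding is_set_def by auto
  have "is_set (\<lambda>t. t \<epsilon> M \<and> (\<exists>x\<in>ext M. \<exists>y\<in>ext M. pr x y \<epsilon> r \<and>
      t = up (pr emp (pr x d)) (pr (num 1) (pr y d))))" by (intro sep defs)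
  moreover have "t \<epsilon> M \<and> (\<exists>x\<in>ext M. \<exists>y\<in>ext M. pr x y \<epsilon> r \<and>
      t = up (pr emp (pr x d)) (pr (num 1) (pr y d))) \<longleftrightarrow>
      (\<exists>x y. pr x y \<epsilon> r \<and> t = up (pr emp (pr x d)) (pr (num 1) (pr y d)))" (is "?L \<longleftrightarrow> ?R") for t
  proof
    assume ?R
    then obtain x y where xy: "pr x y \<epsilon> r" "t = up (pr emp (pr x d)) (pr (num 1) (pr y d))" by blast
    then have "x \<in> ext M" "y \<in> ext M" using good_pr_in[OF M(2)] in_M by blast+
    moreover from this have "t \<in> ext M" unfolding xy(2) by (intro upM prM c in_M)
    ultimately show ?L using xy by blast
  qed blast
  ultimately obtain p where p: "\<forall>t. t \<epsilon> p \<longleftrightarrow>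
      (\<exists>x y. pr x y \<epsilon> r \<and> t = up (pr emp (pr x d)) (pr (num 1) (pr y d)))"
    unfolding is_set_def by auto
  have "is_set (\<lambda>t. t \<epsilon> M \<and> (\<exists>x\<in>ext M. x \<epsilon> Y \<and> t = up (pr emp (pr x d)) (pr emp (pr x d))))"
    by (intro sep defs)
  moreover have "t \<epsilon> M \<and> (\<exists>x\<in>ext M. x \<epsilon> Y \<and> t = up (pr emp (pr x d)) (pr emp (pr x d))) \<longleftrightarrow>
      (\<exists>x. x \<epsilon> Y \<and> t = up (pr emp (pr x d)) (pr emp (pr x d)))" (is "?L \<longleftrightarrow> ?R") for t
  proof
    assume ?R
    then obtain x where x: "x \<epsilon> Y" "t = up (pr emp (pr x d)) (pr emp (pr x d))" by blast
    then have "x \<in> ext M" using tr[OF _ in_M(3)] by blast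
    moreover from this have "t \<in> ext M" unfolding x(2) by (intro upM prM c in_M)
    ultimately show ?L using x by blast
  qed blast
  ultimately obtain q where q: "\<forall>t. t \<epsilon> q \<longleftrightarrow>
      (\<exists>x. x \<epsilon> Y \<and> t = up (pr emp (pr x d)) (pr emp (pr x d)))"
    unfolding is_set_def by auto
  from D p q show ?thesis unfolding pointed_def by blast
qed

lemma pointed_unique: "pointed B r Y d s \<Longrightarrow> pointed B r Y d s' \<Longrightarrow> s = s'"
  unfolding pointed_def by (metis extensionality)

lemma pointed_structure:
  assumes s: "pointed B r Y d s" and B: "emp \<epsilon> B" "sub Y B" "\<And>x y. pr x y \<epsilon> r \<Longrightarrow> x \<epsilon> B \<and> y \<epsilon> B"
  shows "\<exists>D I. s = pr D I \<and> isInterp (up msym usym) D I"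
proof -
  obtain D p q where D: "s = pr D (up (pr msym p) (pr usym q))"
    "\<And>z. z \<epsilon> D \<longleftrightarrow> (\<exists>x. x \<epsilon> B \<and> z = pr x d)"
    "\<And>t. t \<epsilon> p \<longleftrightarrow> (\<exists>x y. pr x y \<epsilon> r \<and> t = up (pr emp (pr x d)) (pr (num 1) (pr y d)))"
    "\<And>t. t \<epsilon> q \<longleftrightarrow> (\<exists>x. x \<epsilon> Y \<and> t = up (pr emp (pr x d)) (pr emp (pr x d)))"
    using s unfolding pointed_def by blast
  let ?I = "up (pr msym p) (pr usym q)"
  have I: "pr f g \<epsilon> ?I \<longleftrightarrow> f = msym \<and> g = p \<or> f = usym \<and> g = q" for f g by auto
  have "isInterp (up msym usym) D ?I"
    unfolding isInterp_def
  proof (intro conjI allI impI)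
    show "\<exists>x. x \<epsilon> D" using B(1) D(2) by blast
    show "funOn ?I (up msym usym)" unfolding funOn_def I by auto
  next
    fix f g n t assume fg: "pr f g \<epsilon> ?I \<and> relSym n f" and t: "t \<epsilon> g"
    then consider "g = p" "n = num 2" | "g = q" "n = num 1"
      unfolding I using relSym_usym relSym_msym by blast
    then show "isFun t n D"
    proof cases
      case 1
      then obtain x y where xy: "pr x y \<epsilon> r" "t = up (pr emp (pr x d)) (pr (num 1) (pr y d))"
        using t D(3) by blast
      then have "t = fin 2 (\<lambda>i. if i = 0 then pr x d else pr y d)" by (simp add: fin_2)
      with 1 B(3)[OF xy(1)] D(2) show ?thesis by (simp add: isFun_fin del: num.simps)
    next
      case 2
      then obtain x where x: "x \<epsilon> Y" "t = up (pr emp (pr x d)) (pr emp (pr x d))"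
        using t D(4) by blast
      then have "t = fin 1 (\<lambda>i. pr x d)" unfolding fin_1 by blast
      moreover have "pr x d \<epsilon> D" using B(2) x(1) D(2) unfolding sub_def by blast
      ultimately show ?thesis unfolding 2(2) using isFun_fin by blast
    qed
  next
    fix f g n assume "pr f g \<epsilon> ?I \<and> funSym n f"
    then show "isOper g n D" unfolding I using not_funSym by blast
  qed
  with D(1) show ?thesis by blast
qed

text \<open>An elementary embedding between two such structures induces an endomorphism of the graph.\<close>

lemma pointed_embedding:
  assumes s: "pointed B r Y d s" "sub Y B" and s': "pointed B r Y' d' s'" "sub Y' B"
    and r: "rigid_in UNIV B r" and j: "elementary_embedding (up msym usym) s s' j"
  shows "Y = Y'"
proof -
  let ?L = "up msym usym"
  obtain D p q where D: "s = pr D (up (pr msym p) (pr usym q))"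
    "\<And>z. z \<epsilon> D \<longleftrightarrow> (\<exists>x. x \<epsilon> B \<and> z = pr x d)"
    "\<And>t. t \<epsilon> p \<longleftrightarrow> (\<exists>x y. pr x y \<epsilon> r \<and> t = up (pr emp (pr x d)) (pr (num 1) (pr y d)))"
    "\<And>t. t \<epsilon> q \<longleftrightarrow> (\<exists>x. x \<epsilon> Y \<and> t = up (pr emp (pr x d)) (pr emp (pr x d)))"
    using s unfolding pointed_def by blast
  obtain D' p' q' where D': "s' = pr D' (up (pr msym p') (pr usym q'))"
    "\<And>z. z \<epsilon> D' \<longleftrightarrow> (\<exists>x. x \<epsilon> B \<and> z = pr x d')"
    "\<And>t. t \<epsilon> p' \<longleftrightarrow> (\<exists>x y. pr x y \<epsilon> r \<and> t = up (pr emp (pr x d')) (pr (num 1) (pr y d')))"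
    "\<And>t. t \<epsilon> q' \<longleftrightarrow> (\<exists>x. x \<epsilon> Y' \<and> t = up (pr emp (pr x d')) (pr emp (pr x d')))"
    using s' unfolding pointed_def by blast
  let ?I = "up (pr msym p) (pr usym q)" let ?J = "up (pr msym p') (pr usym q')"
  obtain S T where jf: "isFun j D D'" and S: "satisfaction ?L D ?I S" and T: "satisfaction ?L D' ?J T"
    and el: "\<And>k c a b. k \<epsilon> om \<Longrightarrow> isFormula ?L k c \<Longrightarrow> isFun a k D \<Longrightarrow> isFun b k D' \<Longrightarrow>
      (\<forall>i u v. pr i u \<epsilon> a \<and> pr u v \<epsilon> j \<longrightarrow> pr i v \<epsilon> b) \<Longrightarrow> (pr c a \<epsilon> S \<longleftrightarrow> pr c b \<epsilon> T)"
    using j unfolding elementary_embedding_def D(1) D'(1) by auto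
  note j_app = funOn_app[OF isFun_funOn[OF jf]] and j_ran = isFun_app[OF jf]
  \<comment> \<open>Elementarity is applied to the atomic formula \<open>R(v0, ..., v(n-1))\<close>
    alone, with the elements supplied by the assignment.\<close>
  have transfer: "(\<exists>g. pr \<sigma> g \<epsilon> ?I \<and> fin n a \<epsilon> g) \<longleftrightarrow> (\<exists>g. pr \<sigma> g \<epsilon> ?J \<and> fin n (\<lambda>i. app j (a i)) \<epsilon> g)"
    if \<sigma>: "\<sigma> \<epsilon> ?L" "relSym (num n) \<sigma>" and a: "\<forall>i<n. a i \<epsilon> D" for \<sigma> n a
  proof -
    have b: "\<forall>i<n. app j (a i) \<epsilon> D'" using a j_ran by blast
    have at: "isAtom ?L (num n) (relc \<sigma> n (\<lambda>i. i))" by (rule isAtom_rel[OF \<sigma>]) simp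
    have "pr (relc \<sigma> n (\<lambda>i. i)) (fin n a) \<epsilon> S \<longleftrightarrow>
        pr (relc \<sigma> n (\<lambda>i. i)) (fin n (\<lambda>i. app j (a i))) \<epsilon> T"
      by (rule el[OF num_om isFormula_atom[OF at]]) (use a b j_app in \<open>auto simp: isFun_fin pr_fin\<close>)
    then show ?thesis
      using satisfaction_rel[OF S \<sigma>, of "\<lambda>i. i" n a] satisfaction_rel[OF T \<sigma>, of "\<lambda>i. i" n] a b by simp
  qed
  obtain M where M: "pr (pr B j) (pr d d') \<epsilon> M" "good (ext M)" using local by blast
  then have in_M: "B \<in> ext M" "j \<in> ext M" "d \<in> ext M" "d' \<in> ext M"
    using good_pr_eq[OF M(2)] by auto
  have ne: "ext M \<noteq> {}" using in_M by blast
  have BM: "x \<in> ext M" if "x \<epsilon> B" for x using good_trans[OF M(2) that in_M(1)] .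
  \<comment> \<open>\<open>f\<close> is \<open>j\<close> with the tags \<open>d\<close> and
    \<open>d'\<close> stripped off, hence a relation on \<open>B\<close> to which rigidity can be
    applied.\<close>
  have "is_set (\<lambda>z. z \<epsilon> M \<and> (\<exists>x\<in>ext M. \<exists>y\<in>ext M. z = pr x y \<and> x \<epsilon> B \<and> y \<epsilon> B \<and>
      pr (pr x d) (pr y d') \<epsilon> j))"
    by (rule separation_in[where M = M],
        intro Def_ex Def_connectives TDef_var TDef_const TDef_pr M(2) ne in_M) (simp add: sub_def)
  then obtain f where f0: "\<And>z. z \<epsilon> f \<longleftrightarrow> z \<epsilon> M \<and> (\<exists>x\<in>ext M. \<exists>y\<in>ext M. z = pr x y \<and>
      x \<epsilon> B \<and> y \<epsilon> B \<and> pr (pr x d) (pr y d') \<epsilon> j)" unfolding is_set_def by blast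
  have f: "pr x y \<epsilon> f \<longleftrightarrow> x \<epsilon> B \<and> y \<epsilon> B \<and> pr (pr x d) (pr y d') \<epsilon> j" for x y
    unfolding f0 using BM good_pr[OF M(2)] by auto
  have dom: "pr x d \<epsilon> D" if "x \<epsilon> B" for x using that D(2) by blast
  have f_ex: "\<exists>y. y \<epsilon> B \<and> app j (pr x d) = pr y d'" if "x \<epsilon> B" for x
    using j_ran[OF dom[OF that]] D'(2) by blast
  have f_app: "pr x y \<epsilon> f \<longleftrightarrow> y \<epsilon> B \<and> app j (pr x d) = pr y d'" if "x \<epsilon> B" for x y
    using f j_app[OF dom[OF that]] that by auto
  have "isFun f B B"
    unfolding isFun_def funOn_def
  proof (intro conjI allI impI)
    fix z assume "z \<epsilon> f"
    then show "\<exists>x y. x \<epsilon> B \<and> z = pr x y" unfolding f0 by blast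
  next
    fix x assume x: "x \<epsilon> B"
    obtain y where y: "y \<epsilon> B" "app j (pr x d) = pr y d'" using f_ex[OF x] by blast
    show "\<exists>!y. pr x y \<epsilon> f" unfolding f_app[OF x] using y by auto
  qed (use f in blast)
  moreover have "\<exists>u v. pr x u \<epsilon> f \<and> pr y v \<epsilon> f \<and> pr u v \<epsilon> r"
    if xy: "x \<epsilon> B" "y \<epsilon> B" "pr x y \<epsilon> r" for x y
  proof -
    obtain u v where u: "u \<epsilon> B" "app j (pr x d) = pr u d'" and v: "v \<epsilon> B" "app j (pr y d) = pr v d'"
      using f_ex xy by blast
    let ?a = "\<lambda>i::nat. if i = 0 then pr x d else pr y d"
    have "fin 2 ?a \<epsilon> p" unfolding D(3) fin_2 using xy(3) by auto
    then have "\<exists>g. pr msym g \<epsilon> ?I \<and> fin 2 ?a \<epsilon> g" by auto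
    then have "\<exists>g. pr msym g \<epsilon> ?J \<and> fin 2 (\<lambda>i. app j (?a i)) \<epsilon> g"
      using transfer[of msym 2 ?a] xy dom relSym_msym by (simp del: num.simps)
    then have "fin 2 (\<lambda>i. app j (?a i)) \<epsilon> p'" by auto
    then obtain u' v' where uv': "pr u' v' \<epsilon> r"
        "fin 2 (\<lambda>i. app j (?a i)) = up (pr emp (pr u' d')) (pr (num 1) (pr v' d'))"
      unfolding D'(3) by blast
    then have "fin 2 (\<lambda>i. app j (?a i)) = fin 2 (\<lambda>i. if i = 0 then pr u' d' else pr v' d')"
      unfolding fin_2 by simp
    then have "\<forall>i<2. app j (?a i) = (if i = 0 then pr u' d' else pr v' d')" unfolding fin_eq by blast
    from this[rule_format, of 0] this[rule_format, of 1] have "u' = u" "v' = v" using u v by auto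
    with uv' u v f_app xy show ?thesis by auto
  qed
  ultimately have "endo B r f" unfolding endo_def by blast
  then have fixed: "app j (pr x d) = pr x d'" if "x \<epsilon> B" for x
    using r f_app that unfolding rigid_in_def by blast
  have mem: "x \<epsilon> Y \<longleftrightarrow> x \<epsilon> Y'" if x: "x \<epsilon> B" for x
  proof -
    have q: "fin 1 (\<lambda>_. pr x d) \<epsilon> q \<longleftrightarrow> x \<epsilon> Y" and q': "fin 1 (\<lambda>_. pr x d') \<epsilon> q' \<longleftrightarrow> x \<epsilon> Y'"
      unfolding D(4) D'(4) fin_1 by (auto simp: up_eq)
    have "(\<exists>g. pr usym g \<epsilon> ?I \<and> fin 1 (\<lambda>_. pr x d) \<epsilon> g) \<longleftrightarrow>
        (\<exists>g. pr usym g \<epsilon> ?J \<and> fin 1 (\<lambda>_. app j (pr x d)) \<epsilon> g)"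
      using transfer[of usym 1 "\<lambda>_. pr x d"] x dom relSym_usym by (simp del: num.simps fin.simps)
    then show ?thesis unfolding fixed[OF x] using q q' by (simp del: fin.simps)
  qed
  then show "Y = Y'"
    by (intro extensionality) (use s(2) s'(2) in \<open>auto simp: sub_def\<close>)
qed

section \<open>Separation, Replacement and Power set from V-P-H and Vopenka's Principle\<close>

context
  assumes vph: "\<And>a. \<not> finite_in UNIV a \<Longrightarrow> \<exists>r. rigid_in UNIV a r"
    and vopenka: "\<And>P L. Def UNIV E (\<lambda>e. P (e 0)) \<Longrightarrow> isLang L \<Longrightarrow>
      (\<And>x. P x \<Longrightarrow> \<exists>D I. x = pr D I \<and> isInterp L D I) \<Longrightarrow> \<not> is_set P \<Longrightarrow>
      \<exists>x y j. P x \<and> P y \<and> x \<noteq> y \<and> elementary_embedding L x y j"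
begin

text \<open>Each pair with \<open>Q Y d\<close> gives one structure. An embedding between two of
  them forces equal predicates, hence equal tags by \<open>unique\<close>, hence equal structures,
  whereas Vopenka's Principle provides distinct ones. So the class of structures is a set, and the
  tags are recovered from it by separation inside a good set.\<close>

lemma indexed_set:
  assumes Q: "Def UNIV E (\<lambda>e. Q (e 0) (e 1))" and A: "\<And>Y d. Q Y d \<Longrightarrow> sub Y A"
    and unique: "\<And>Y d d'. Q Y d \<Longrightarrow> Q Y d' \<Longrightarrow> d = d'"
  shows "is_set (\<lambda>d. \<exists>Y. Q Y d)"
proof -
  \<comment> \<open>Adding \<open>om\<close> makes the base infinite, as V-P-H requires; its element
    \<open>emp\<close> also marks the point of the domain from which the tag is read off.\<close>
  let ?B = "un A om"
  have AB: "sub Y ?B" if "Q Y d" for Y d using A[OF that] unfolding sub_def by simp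
  have eB: "emp \<epsilon> ?B" using om_emp by simp
  obtain r where r: "rigid_in UNIV ?B r" using vph om_infinite[of ?B] by (auto simp: sub_def)
  then have rB: "x \<epsilon> ?B \<and> y \<epsilon> ?B" if "pr x y \<epsilon> r" for x y
    using that unfolding rigid_in_def by fastforce
  let ?P = "\<lambda>s. \<exists>Y d. Q Y d \<and> pointed ?B r Y d s"
  have Q': "Def UNIV E (\<lambda>e. Q (e (Suc 0)) (e 0))" using Def_ren[OF Q, of "\<lambda>i. 1 - i"] by simp
  have "Def UNIV E (\<lambda>e. pointed ?B r (e (Suc 0)) (e 0) (e (Suc (Suc 0))))"
    using Def_ren[OF Def_pointed[of ?B r], of "\<lambda>i. if i = 0 then 1 else if i = 1 then 0 else 2"]
    by (simp add: numeral_2_eq_2)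
  then have P: "Def UNIV E (\<lambda>e. ?P (e 0))"
    by (intro Def_ex_UNIV Def_and Q')
  have "is_set ?P"
  proof (rule ccontr)
    assume "\<not> is_set ?P"
    moreover have "isLang (up msym usym)"
      unfolding isLang_def using relSym_msym relSym_usym by auto
    moreover have "\<exists>D I. s = pr D I \<and> isInterp (up msym usym) D I" if "?P s" for s
      using that pointed_structure[OF _ eB AB rB] by blast
    ultimately obtain s s' j where s: "?P s" "?P s'" "s \<noteq> s'" "elementary_embedding (up msym usym) s s' j"
      using vopenka[OF P] by blast
    then obtain Y d Y' d' where *: "Q Y d" "pointed ?B r Y d s" "Q Y' d'" "pointed ?B r Y' d' s'" by blast
    have "Y = Y'" by (rule pointed_embedding[OF *(2) AB[OF *(1)] *(4) AB[OF *(3)] r s(4)])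
    with * unique pointed_unique s(3) show False by blast
  qed
  then obtain Z where Z: "\<And>s. s \<epsilon> Z \<longleftrightarrow> ?P s" unfolding is_set_def by blast
  obtain M where M: "Z \<epsilon> M" "good (ext M)" using local by blast
  have ne: "ext M \<noteq> {}" and ZM: "Z \<in> ext M" using M by auto
  have e: "emp \<in> ext M" using good_emp[OF M(2)] .
  let ?R = "\<lambda>d. \<exists>D\<in>ext M. \<exists>I\<in>ext M. pr D I \<epsilon> Z \<and> pr emp d \<epsilon> D"
  have "is_set (\<lambda>d. d \<epsilon> M \<and> ?R d)"
    by (rule separation_in[where M = M],
        intro Def_ex Def_connectives TDef_var TDef_const TDef_pr M(2) ne ZM e) (simp add: sub_def)
  moreover have "d \<epsilon> M \<and> ?R d \<longleftrightarrow> (\<exists>Y. Q Y d)" for d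
  proof
    assume "d \<epsilon> M \<and> ?R d"
    then obtain D I where D: "pr D I \<epsilon> Z" "pr emp d \<epsilon> D" by blast
    then obtain Y d' where "Q Y d'" "pointed ?B r Y d' (pr D I)" using Z by blast
    moreover from this(2) D(2) have "d = d'" unfolding pointed_def by auto
    ultimately show "\<exists>Y. Q Y d" by blast
  next
    assume "\<exists>Y. Q Y d"
    then obtain Y where Y: "Q Y d" by blast
    obtain s where s: "pointed ?B r Y d s" using pointed_ex by blast
    then obtain D I where D: "s = pr D I" "pr emp d \<epsilon> D" unfolding pointed_def using eB by blast
    have "s \<epsilon> Z" using Z Y s by blast
    then have DI: "D \<in> ext M" "I \<in> ext M" using good_pr_in[OF M(2) _ ZM] D(1) by blast+
    moreover have "d \<in> ext M" using good_pr_in[OF M(2) D(2) DI(1)] by blast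
    ultimately show "d \<epsilon> M \<and> ?R d" using D \<open>s \<epsilon> Z\<close> by blast
  qed
  ultimately show ?thesis by simp
qed

text \<open>Each element is indexed by its singleton, a subset of \<open>a\<close> that determines
  it.\<close>

lemma full_separation:
  assumes P: "Def UNIV E (\<lambda>e. P (e 0))"
  shows "is_set (\<lambda>x. x \<epsilon> a \<and> P x)"
proof -
  have "Def UNIV E (\<lambda>e. P (e 1))" using Def_ren[OF P, of "\<lambda>_. 1"] by simp
  then have "Def UNIV E (\<lambda>e. e 0 = up (e 1) (e 1) \<and> e 1 \<epsilon> a \<and> P (e 1))"
    by (intro Def_and Def_eq Def_Mem TDef_UNIV TDef_up_UNIV)
  then have "is_set (\<lambda>d. \<exists>Y. Y = up d d \<and> d \<epsilon> a \<and> P d)"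
    by (rule indexed_set[where A = a]) (auto simp: sub_def up_eq)
  then show ?thesis by simp
qed

text \<open>The index is the singleton of the argument, again a subset of \<open>a\<close>; it
  determines the value because \<open>R\<close> is single-valued on \<open>a\<close>.\<close>

lemma full_replacement:
  assumes R: "Def UNIV E (\<lambda>e. R (e 0) (e 1))"
    and unique: "\<And>x y z. x \<epsilon> a \<Longrightarrow> R x y \<Longrightarrow> R x z \<Longrightarrow> y = z"
  shows "is_set (\<lambda>y. \<exists>x. x \<epsilon> a \<and> R x y)"
proof -
  have "Def UNIV E (\<lambda>e. R (e 0) (e 2))"
    using Def_ren[OF R, of "\<lambda>i. 2 * i"] by simp
  then have "Def UNIV E (\<lambda>e. \<exists>x. x \<epsilon> a \<and> e 0 = up x x \<and> R x (e 1))"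
    by (intro Def_ex_UNIV Def_and Def_eq Def_Mem TDef_UNIV TDef_up_UNIV) (simp add: numeral_2_eq_2)
  then have "is_set (\<lambda>d. \<exists>Y. \<exists>x. x \<epsilon> a \<and> Y = up x x \<and> R x d)"
    by (rule indexed_set[where A = a]) (use unique in \<open>auto simp: sub_def up_eq\<close>)
  moreover have "(\<lambda>d. \<exists>Y x. x \<epsilon> a \<and> Y = up x x \<and> R x d) = (\<lambda>d. \<exists>x. x \<epsilon> a \<and> R x d)" by blast
  ultimately show ?thesis by simp
qed

text \<open>A subset of \<open>a\<close> is its own index.\<close>

lemma power_set: "is_set (\<lambda>x. sub x a)"
proof -
  have "Def UNIV E (\<lambda>e. e 0 = e 1 \<and> sub (e 1) a)" unfolding sub_def by (intro Def_UNIV)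
  then have "is_set (\<lambda>d. \<exists>Y. Y = d \<and> sub d a)" by (rule indexed_set[where A = a]) auto
  then show ?thesis by simp
qed

theorem ZFC_of_vopenka:
  assumes loc: "\<And>x. \<exists>M. x \<epsilon> M \<and> model M"
  shows "\<forall>q\<in>ZFC. sat UNIV E e q"
proof -
  have H: "holds UNIV E e 0 e ax" if "ax \<in> set (zfc_finite_part fAll)" for ax
  proof -
    \<comment> \<open>Foundation and Choice for \<open>x\<close> concern \<open>x\<close>, its
      elements and their elements, all of which lie in a transitive model containing
      \<open>x\<close>.\<close>
    have found: "(\<exists>y. y \<epsilon> x) \<longrightarrow> (\<exists>y. y \<epsilon> x \<and> \<not> (\<exists>z. z \<epsilon> x \<and> z \<epsilon> y))" for x
    proof -
      obtain M where M: "x \<epsilon> M" "model M" using loc by blast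
      note tr = good_trans[OF model_good[OF M(2)]]
      have "holds (ext M) E (\<lambda>_. M) 0 (\<lambda>_. M) (ax_foundation fAll)"
        using M(2) by (simp add: model_def zfc_finite_part_def)
      then have "\<forall>x\<in>ext M. (\<exists>y\<in>ext M. y \<epsilon> x) \<longrightarrow>
          (\<exists>y\<in>ext M. y \<epsilon> x \<and> \<not> (\<exists>z\<in>ext M. z \<epsilon> x \<and> z \<epsilon> y))"
        by (simp add: ax_foundation_def)
      then have "(\<exists>y\<in>ext M. y \<epsilon> x) \<longrightarrow> (\<exists>y\<in>ext M. y \<epsilon> x \<and> \<not> (\<exists>z\<in>ext M. z \<epsilon> x \<and> z \<epsilon> y))"
        using M(1) by blast
      then show ?thesis using tr[of _ x] M(1) by blast
    qed
    have choice: "\<exists>c. \<forall>u. u \<epsilon> x \<longrightarrow> (\<exists>v. \<forall>z. z \<epsilon> u \<and> z \<epsilon> c \<longleftrightarrow> z = v)"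
      if x: "(\<forall>u. u \<epsilon> x \<longrightarrow> (\<exists>v. v \<epsilon> u)) \<and>
        (\<forall>u v. u \<epsilon> x \<and> v \<epsilon> x \<and> u \<noteq> v \<longrightarrow> \<not> (\<exists>z. z \<epsilon> u \<and> z \<epsilon> v))" for x
    proof -
      obtain M where M: "x \<epsilon> M" "model M" using loc by blast
      note tr = good_trans[OF model_good[OF M(2)]]
      have xM: "x \<in> ext M" using M(1) by simp
      have "holds (ext M) E (\<lambda>_. M) 0 (\<lambda>_. M) (ax_choice fAll)"
        using M(2) by (simp add: model_def zfc_finite_part_def)
      note c = this[unfolded holds_choice, THEN bspec, OF xM, THEN mp]
      have "\<exists>c\<in>ext M. \<forall>u\<in>ext M. u \<epsilon> x \<longrightarrow> (\<exists>v\<in>ext M. \<forall>z\<in>ext M. z \<epsilon> u \<and> z \<epsilon> c \<longleftrightarrow> z = v)"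
      proof (rule c, intro conjI ballI impI)
        fix u assume "u \<in> ext M" "u \<epsilon> x"
        then obtain v where "v \<epsilon> u" using x by blast
        with tr \<open>u \<in> ext M\<close> show "\<exists>v\<in>ext M. v \<epsilon> u" by blast
      qed (use x in blast)
      then obtain c where c: "c \<in> ext M" "\<And>u. u \<in> ext M \<Longrightarrow> u \<epsilon> x \<Longrightarrow>
          \<exists>v\<in>ext M. \<forall>z\<in>ext M. z \<epsilon> u \<and> z \<epsilon> c \<longleftrightarrow> z = v" by blast
      have "\<exists>v. \<forall>z. z \<epsilon> u \<and> z \<epsilon> c \<longleftrightarrow> z = v" if u: "u \<epsilon> x" for u
      proof -
        have uM: "u \<in> ext M" using tr[OF u xM] .
        obtain v where v: "v \<in> ext M" "\<forall>z\<in>ext M. z \<epsilon> u \<and> z \<epsilon> c \<longleftrightarrow> z = v" using c(2)[OF uM u] by blast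
        have "z \<epsilon> u \<and> z \<epsilon> c \<longleftrightarrow> z = v" for z using v tr[OF _ uM, of z] by blast
        then show ?thesis by blast
      qed
      then show ?thesis by blast
    qed
    have inf: "\<exists>w. (\<exists>e. e \<epsilon> w \<and> (\<forall>u. \<not> u \<epsilon> e)) \<and>
        (\<forall>n. n \<epsilon> w \<longrightarrow> (\<exists>m. m \<epsilon> w \<and> (\<forall>u. u \<epsilon> m \<longleftrightarrow> u \<epsilon> n \<or> u = n)))"
      using ind_om unfolding ind_def eq_emp[symmetric] eq_sc[symmetric] by blast
    have "holds UNIV E e 0 e (ax_extensionality fAll)"
      by (simp add: ax_extensionality_def) (blast intro: extensionality)
    moreover have "holds UNIV E e 0 e (ax_foundation fAll)"
      by (simp add: ax_foundation_def cong del: imp_cong) (use found in blast)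
    moreover have "holds UNIV E e 0 e (ax_pair fAll)"
      by (simp add: ax_pair_def ex_upair)
    moreover have "holds UNIV E e 0 e (ax_union fAll)"
      by (simp add: ax_union_def ex_union)
    moreover have "holds UNIV E e 0 e (ax_power fAll)"
      using power_set by (simp add: ax_power_def is_set_def sub_def)
    moreover have "holds UNIV E e 0 e (ax_infinity fAll)"
      using inf by (simp add: ax_infinity_def)
    moreover have "holds UNIV E e 0 e (ax_choice fAll)"
      unfolding holds_choice ball_UNIV bex_UNIV using choice by blast
    ultimately show ?thesis using that by (auto simp: zfc_finite_part_def)
  qed
  \<comment> \<open>An actual formula with parameters \<open>w\<close> fits \<open>Def\<close> once
    the parameters are moved to the odd indices.\<close>
  have sat1: "Def UNIV E (\<lambda>e. sat UNIV E (case_nat (e 0) w) p)" for w p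
  proof (rule DefI)
    show "sat UNIV E (case_nat (e 0) w) p \<longleftrightarrow>
        sat UNIV E (mix e w) (ren (case_nat 0 (\<lambda>i. Suc (2 * i))) p)" for e
      unfolding sat_ren
      by (rule arg_cong[where f = "\<lambda>e. sat UNIV E e p"]) (auto simp: fun_eq_iff mix_def split: nat.split)
  qed simp
  have sat2: "Def UNIV E (\<lambda>e. sat UNIV E (case_nat (e 0) (case_nat (e 1) w)) p)" for w p
  proof (rule DefI)
    show "sat UNIV E (case_nat (e 0) (case_nat (e 1) w)) p \<longleftrightarrow>
        sat UNIV E (mix e w) (ren (case_nat 0 (case_nat 2 (\<lambda>i. Suc (2 * i)))) p)" for e
      unfolding sat_ren
      by (rule arg_cong[where f = "\<lambda>e. sat UNIV E e p"]) (auto simp: fun_eq_iff mix_def split: nat.split)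
  qed simp
  show ?thesis
    unfolding sat_ZFC_iff[OF subset_UNIV] ball_UNIV bex_UNIV
  proof (intro conjI allI impI ballI)
    show "holds UNIV E e 0 e ax" if "ax \<in> set (zfc_finite_part fAll)" for ax by (rule H[OF that])
  next
    fix p a and w :: "nat \<Rightarrow> 'a"
    from full_separation[OF sat1]
    show "\<exists>b. \<forall>x. x \<epsilon> b \<longleftrightarrow> x \<epsilon> a \<and> sat UNIV E (case_nat x w) p" unfolding is_set_def .
  next
    fix p a and w :: "nat \<Rightarrow> 'a"
    assume u: "\<forall>x. x \<epsilon> a \<longrightarrow> (\<exists>y. \<forall>z. sat UNIV E (case_nat x (case_nat z w)) p \<longleftrightarrow> z = y)"
    have "is_set (\<lambda>y. \<exists>x. x \<epsilon> a \<and> sat UNIV E (case_nat x (case_nat y w)) p)"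
      by (rule full_replacement[OF sat2]) (use u in metis)
    then show "\<exists>b. \<forall>y. y \<epsilon> b \<longleftrightarrow> (\<exists>x. x \<epsilon> a \<and> sat UNIV E (case_nat x (case_nat y w)) p)"
      unfolding is_set_def .
  qed
qed

end

end

section \<open>\<open>\<Sigma>\<^sub>1\<close> codes are codes of formulas\<close>

context weak
begin

text \<open>The only symbol is a relation symbol, so building a term never goes beyond a
  variable.\<close>

lemma isTerm_mlang: "isTerm mlang k c \<longleftrightarrow> (\<exists>i. i \<epsilon> k \<and> c = tag 0 i emp)"
proof
  assume "isTerm mlang k c"
  then obtain prev where "term_step mlang k prev c" unfolding isTerm_def built_def by blast
  then show "\<exists>i. i \<epsilon> k \<and> c = tag 0 i emp"
    unfolding term_step_def using not_funSym(2) by (auto simp: mlang_def)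
next
  assume "\<exists>i. i \<epsilon> k \<and> c = tag 0 i emp"
  then show "isTerm mlang k c"
    unfolding isTerm_def by (intro gen_built gen_base) (auto simp: term_step_def)
qed

text \<open>Describing an atom by its two variables removes the existential quantifier over building
  sequences of terms hidden in \<open>isAtom\<close>, so that formula steps become expressible over
  a transitive set.\<close>

definition mem_atom :: "'a \<Rightarrow> 'a \<Rightarrow> 'a \<Rightarrow> bool" where
  "mem_atom i j c \<longleftrightarrow> c = tag 2 (tag 0 i emp) (tag 0 j emp) \<or>
    c = tag 3 msym (up (pr emp (tag 0 i emp)) (pr (num 1) (tag 0 j emp)))"

lemma isAtom_mlang: "isAtom mlang k c \<longleftrightarrow> (\<exists>i. i \<epsilon> k \<and> (\<exists>j. j \<epsilon> k \<and> mem_atom i j c))"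
proof
  assume "isAtom mlang k c"
  then consider t u where "isTerm mlang k t" "isTerm mlang k u" "c = tag 2 t u" |
    n t where "relSym n msym" "funOn t n" "\<And>i e. pr i e \<epsilon> t \<Longrightarrow> isTerm mlang k e" "c = tag 3 msym t"
    unfolding isAtom_def by (auto simp: mlang_def)
  then show "\<exists>i. i \<epsilon> k \<and> (\<exists>j. j \<epsilon> k \<and> mem_atom i j c)"
  proof cases
    case 1
    then show ?thesis unfolding isTerm_mlang mem_atom_def by blast
  next
    case 2
    then have "funOn t (num 2)" unfolding relSym_msym by blast
    then obtain a where a: "t = fin 2 a" using funOn_num by blast
    have "isTerm mlang k (a 0)" "isTerm mlang k (a 1)"
      using 2(3)[of "num 0" "a 0"] 2(3)[of "num 1" "a 1"] pr_num_fin[of 0 2 "a 0" a]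
        pr_num_fin[of 1 2 "a 1" a] unfolding a by simp_all
    then obtain i j where "i \<epsilon> k" "a 0 = tag 0 i emp" "j \<epsilon> k" "a 1 = tag 0 j emp"
      unfolding isTerm_mlang by blast
    then show ?thesis unfolding mem_atom_def 2(4) a fin_2
      by (intro exI[of _ i] exI[of _ j] conjI) simp_all
  qed
next
  assume "\<exists>i. i \<epsilon> k \<and> (\<exists>j. j \<epsilon> k \<and> mem_atom i j c)"
  then obtain i j where ij: "i \<epsilon> k" "j \<epsilon> k" "mem_atom i j c" by blast
  then have v: "isTerm mlang k (tag 0 i emp)" "isTerm mlang k (tag 0 j emp)"
    unfolding isTerm_mlang by blast+
  let ?t = "fin 2 (\<lambda>l. if l = 0 then tag 0 i emp else tag 0 j emp)"
  have "isTerm mlang k e" if "pr l e \<epsilon> ?t" for l e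
    using that v by (auto simp: pr_fin simp del: fin.simps split: if_splits)
  then have a3: "isAtom mlang k (tag 3 msym ?t)"
    unfolding isAtom_def using msym funOn_fin by blast
  have t: "?t = up (pr emp (tag 0 i emp)) (pr (num 1) (tag 0 j emp))" unfolding fin_2 by simp
  have "isAtom mlang k (tag 2 (tag 0 i emp) (tag 0 j emp))" unfolding isAtom_def using v by blast
  with ij(3) a3[unfolded t] show "isAtom mlang k c"
    unfolding mem_atom_def by (elim disjE) (simp_all only:)
qed

section \<open>Building sequences of formulas inside a transitive class\<close>

definition valid :: "'a \<Rightarrow> 'a \<Rightarrow> 'a \<Rightarrow> bool" where
  "valid k m g \<longleftrightarrow> m \<epsilon> om \<and> funOn g m \<and>
    (\<forall>i d. pr i d \<epsilon> g \<longrightarrow> formula_step mlang k (\<lambda>e. \<exists>j. j \<epsilon> i \<and> pr j e \<epsilon> g) d)"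

lemma mformula_valid: "mformula k c \<longleftrightarrow> (\<exists>m g. valid k m g \<and> (\<exists>i. pr i c \<epsilon> g))"
  unfolding mformula_def isFormula_def built_def valid_def by blast

text \<open>The new code is appended at position \<open>m\<close>. The longer sequence stays in the
  same class \<open>D\<close>, so an induction over \<open>D\<close> can quantify over
  sequences.\<close>

lemma valid_extend:
  assumes g: "valid k m g" and c: "formula_step mlang k (\<lambda>e. \<exists>j. pr j e \<epsilon> g) c"
    and D: "good D" "m \<in> D" "g \<in> D" "c \<in> D"
  shows "\<exists>m'\<in>D. \<exists>g'\<in>D. valid k m' g' \<and> (\<forall>i d. pr i d \<epsilon> g \<longrightarrow> pr i d \<epsilon> g') \<and> (\<exists>i. pr i c \<epsilon> g')"
proof -
  let ?g = "un g (up (pr m c) (pr m c))"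
  have f: "funOn g m" and m: "m \<epsilon> om" using g unfolding valid_def by auto
  have in_g: "pr i d \<epsilon> ?g \<longleftrightarrow> pr i d \<epsilon> g \<or> i = m \<and> d = c" for i d by auto
  have dom: "i \<epsilon> m" if "pr i d \<epsilon> g" for i d using funOn_dom[OF f that] .
  have mm: "\<not> m \<epsilon> m" using om_irrefl[OF m] .
  have "funOn ?g (sc m)"
    unfolding funOn_def
  proof (intro conjI allI impI)
    fix z assume "z \<epsilon> ?g"
    then have "z \<epsilon> g \<or> z = pr m c" by auto
    then show "\<exists>x y. x \<epsilon> sc m \<and> z = pr x y"
      using f unfolding funOn_def by (metis in_sc)
  next
    fix x assume "x \<epsilon> sc m"
    then consider "x \<epsilon> m" | "x = m" by auto
    then show "\<exists>!y. pr x y \<epsilon> ?g"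
    proof cases
      case 1
      then have "x \<noteq> m" using mm by blast
      with 1 f show ?thesis unfolding in_g funOn_def by simp
    next
      case 2
      then have "\<not> pr x y \<epsilon> g" for y using dom mm by blast
      with 2 show ?thesis unfolding in_g by simp
    qed
  qed
  moreover have "formula_step mlang k (\<lambda>e. \<exists>j. j \<epsilon> i \<and> pr j e \<epsilon> ?g) d" if "pr i d \<epsilon> ?g" for i d
  proof (cases "pr i d \<epsilon> g")
    case True
    then have "formula_step mlang k (\<lambda>e. \<exists>j. j \<epsilon> i \<and> pr j e \<epsilon> g) d"
      using g unfolding valid_def by blast
    then show ?thesis by (rule mono_stepD[OF mono_formula_step]) (use in_g in blast)
  next
    case False
    then have "i = m" "d = c" using that in_g by blast+
    then show ?thesis
      by (simp only:, intro mono_stepD[OF mono_formula_step c]) (use in_g dom in blast)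
  qed
  ultimately have "valid k (sc m) ?g" unfolding valid_def using om_sc[OF m] by blast
  moreover have "sc m \<in> D" using good_sc D by blast
  moreover have "?g \<in> D" using D by (intro good_un good_up good_pr)
  moreover have "\<forall>i d. pr i d \<epsilon> g \<longrightarrow> pr i d \<epsilon> ?g" "\<exists>i. pr i c \<epsilon> ?g" by auto
  ultimately show ?thesis by blast
qed

lemma Def_funOn:
  assumes D: "good D" and s: "TDef D E s" and t: "TDef D E t"
  shows "Def D E (\<lambda>e. funOn (s e) (t e))"
proof (rule Def_cong)
  have ne: "D \<noteq> {}" using D good_emp by blast
  note r = TDef_ren[OF s] TDef_ren[OF t] TDef_var[OF ne]
  let ?R = "\<lambda>f a. (\<forall>z\<in>D. z \<epsilon> f \<longrightarrow> (\<exists>x\<in>D. \<exists>y\<in>D. x \<epsilon> a \<and> z = pr x y)) \<and>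
    (\<forall>x\<in>D. x \<epsilon> a \<longrightarrow> (\<exists>y\<in>D. pr x y \<epsilon> f \<and> (\<forall>z\<in>D. pr x z \<epsilon> f \<longrightarrow> z = y)))"
  show "Def D E (\<lambda>e. ?R (s e) (t e))"
    by (intro Def_ex Def_all Def_connectives TDef_pr D s t r)
  have "?R f a \<longleftrightarrow> funOn f a" if fa: "f \<in> D" "a \<in> D" for f a
  proof
    assume R: "?R f a"
    show "funOn f a"
      unfolding funOn_def
    proof (intro conjI allI impI)
      fix z assume z: "z \<epsilon> f"
      then have "z \<in> D" using good_trans[OF D] fa by blast
      with R z show "\<exists>x y. x \<epsilon> a \<and> z = pr x y" by blast
    next
      fix x assume x: "x \<epsilon> a"
      then have "x \<in> D" using good_trans[OF D] fa by blast
      with R x obtain y where "pr x y \<epsilon> f" "\<forall>z\<in>D. pr x z \<epsilon> f \<longrightarrow> z = y" by blast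
      then show "\<exists>!y. pr x y \<epsilon> f" using good_pr_in[OF D _ fa(1)] by blast
    qed
  next
    assume f: "funOn f a"
    show "?R f a"
    proof (intro conjI ballI impI)
      fix z assume z: "z \<epsilon> f"
      then obtain x y where "x \<epsilon> a" "z = pr x y" using f unfolding funOn_def by blast
      with z good_pr_in[OF D _ fa(1)] show "\<exists>x\<in>D. \<exists>y\<in>D. x \<epsilon> a \<and> z = pr x y" by blast
    next
      fix x assume x: "x \<epsilon> a"
      from funOn_app[OF f x] have y: "pr x (app f x) \<epsilon> f" "\<And>z. pr x z \<epsilon> f \<Longrightarrow> z = app f x" by blast+
      then show "\<exists>y\<in>D. pr x y \<epsilon> f \<and> (\<forall>z\<in>D. pr x z \<epsilon> f \<longrightarrow> z = y)"
        using good_pr_in[OF D _ fa(1)] by blast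
    qed
  qed
  then show "?R (s e) (t e) \<longleftrightarrow> funOn (s e) (t e)" if "range e \<subseteq> D" for e
    using TDef_mem[OF s that] TDef_mem[OF t that] by blast
qed

lemma formula_step_mlang: "formula_step mlang k prev c \<longleftrightarrow>
    (\<exists>i. i \<epsilon> k \<and> (\<exists>j. j \<epsilon> k \<and> mem_atom i j c)) \<or> c = flsc \<or>
    (\<exists>p q. prev p \<and> prev q \<and> c = tag 4 p q) \<or> (\<exists>i. i \<epsilon> k \<and> (\<exists>p. prev p \<and> c = tag 5 i p))"
  unfolding formula_step_def isAtom_mlang ..

text \<open>Indices and entries of a sequence in \<open>D\<close> lie in \<open>D\<close> by
  transitivity, so restricting all quantifiers of \<open>valid\<close> to \<open>D\<close> does not
  change its meaning.\<close>

lemma Def_valid: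
  assumes D: "good D" "om \<in> D" "k \<in> D" and s: "TDef D E s" and t: "TDef D E t"
  shows "Def D E (\<lambda>e. valid k (s e) (t e))"
proof (rule Def_cong)
  have ne: "D \<noteq> {}" using D by blast
  have c: "num n \<in> D" "emp \<in> D" for n using good_num[OF D(1)] good_emp[OF D(1)] by blast+
  have c': "msym \<in> D" "flsc \<in> D"
    unfolding msym_def flsc_def tag_def by (intro good_pr[OF D(1)] c)+
  note r = TDef_ren[OF s] TDef_ren[OF t] TDef_var[OF ne]
  let ?A = "\<lambda>i d. \<exists>l\<in>D. l \<epsilon> k \<and> (\<exists>j\<in>D. j \<epsilon> k \<and> mem_atom l j d)"
  let ?prev = "\<lambda>g i p. \<exists>j\<in>D. j \<epsilon> i \<and> pr j p \<epsilon> g"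
  let ?R = "\<lambda>m g. m \<epsilon> om \<and> funOn g m \<and> (\<forall>i\<in>D. \<forall>d\<in>D. pr i d \<epsilon> g \<longrightarrow>
    (\<exists>l\<in>D. l \<epsilon> k \<and> (\<exists>j\<in>D. j \<epsilon> k \<and> mem_atom l j d)) \<or> d = flsc \<or>
    (\<exists>p\<in>D. \<exists>q\<in>D. ?prev g i p \<and> ?prev g i q \<and> d = tag 4 p q) \<or>
    (\<exists>l\<in>D. l \<epsilon> k \<and> (\<exists>p\<in>D. ?prev g i p \<and> d = tag 5 l p)))"
  show "Def D E (\<lambda>e. ?R (s e) (t e))"
    unfolding mem_atom_def tag_def
    by (intro Def_ex Def_all Def_connectives TDef_pr TDef_up Def_funOn TDef_const D s t r c c')
  have R_iff: "?R m g \<longleftrightarrow> valid k m g" if mg: "m \<in> D" "g \<in> D" for m g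
  proof -
    have gD: "i \<in> D \<and> d \<in> D" if "pr i d \<epsilon> g" for i d using good_pr_in[OF D(1) that mg(2)] .
    have kD: "i \<in> D" if "i \<epsilon> k" for i using good_trans[OF D(1) that D(3)] .
    have prev: "?prev g i p \<longleftrightarrow> (\<exists>j. j \<epsilon> i \<and> pr j p \<epsilon> g)" for i p using gD by blast
    have ex: "(\<exists>l\<in>D. l \<epsilon> k \<and> Q l) \<longleftrightarrow> (\<exists>l. l \<epsilon> k \<and> Q l)" for Q using kD by blast
    have prevD: "(\<exists>p\<in>D. (\<exists>j. j \<epsilon> i \<and> pr j p \<epsilon> g) \<and> Q p) \<longleftrightarrow> (\<exists>p. (\<exists>j. j \<epsilon> i \<and> pr j p \<epsilon> g) \<and> Q p)"
      for i Q using gD by blast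
    have prevD2: "(\<exists>p\<in>D. \<exists>q\<in>D. (\<exists>j. j \<epsilon> i \<and> pr j p \<epsilon> g) \<and> (\<exists>j. j \<epsilon> i \<and> pr j q \<epsilon> g) \<and> Q p q) \<longleftrightarrow>
        (\<exists>p q. (\<exists>j. j \<epsilon> i \<and> pr j p \<epsilon> g) \<and> (\<exists>j. j \<epsilon> i \<and> pr j q \<epsilon> g) \<and> Q p q)" for i Q
      using gD by blast
    have all: "(\<forall>i\<in>D. \<forall>d\<in>D. pr i d \<epsilon> g \<longrightarrow> Q i d) \<longleftrightarrow> (\<forall>i d. pr i d \<epsilon> g \<longrightarrow> Q i d)" for Q
      using gD by blast
    show ?thesis
      unfolding valid_def formula_step_mlang prev ex prevD prevD2 all ..
  qed
  show "?R (s e) (t e) \<longleftrightarrow> valid k (s e) (t e)" if "range e \<subseteq> D" for e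
    by (rule R_iff[OF TDef_mem[OF s that] TDef_mem[OF t that]])
qed

text \<open>A bounded quantifier is one step for \<open>delta_step\<close>, but for formulas it
  takes three: the guard, the implication and the quantifier. This is why a building sequence of a
  bounded formula has to be rewritten.\<close>

lemma delta_extend:
  assumes d: "delta_step k P d" and g: "valid k m g" and P: "\<And>e. P e \<Longrightarrow> \<exists>j. pr j e \<epsilon> g"
    and D: "good D" "m \<in> D" "g \<in> D" "d \<in> D"
  shows "\<exists>m'\<in>D. \<exists>g'\<in>D. valid k m' g' \<and> (\<forall>i d. pr i d \<epsilon> g \<longrightarrow> pr i d \<epsilon> g') \<and> (\<exists>i. pr i d \<epsilon> g')"
proof -
  consider "formula_step mlang k P d" |
    i j p u where "i \<epsilon> k" "j \<epsilon> k" "P p" "is2tup (tag 0 i emp) (tag 0 j emp) u"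
      "d = tag 5 i (tag 4 (tag 3 msym u) p)"
    using d unfolding delta_step_def formula_step_def by blast
  then show ?thesis
  proof cases
    case 1
    then have "formula_step mlang k (\<lambda>e. \<exists>j. pr j e \<epsilon> g) d"
      by (rule mono_stepD[OF mono_formula_step]) (rule P)
    from valid_extend[OF g this D] show ?thesis .
  next
    case 2
    let ?q = "tag 3 msym u" let ?r = "tag 4 ?q p"
    have rD: "?r \<in> D" "?q \<in> D"
      using D(4) unfolding 2(5) tag_def by (simp_all add: good_pr_eq[OF D(1)])
    have "mem_atom i j ?q" using 2(4) unfolding is2tup_iff mem_atom_def by (simp add: fin_2 del: fin.simps)
    then have "formula_step mlang k (\<lambda>e. \<exists>j. pr j e \<epsilon> g) ?q" unfolding formula_step_mlang using 2 by blast
    from valid_extend[OF g this D(1-3) rD(2)] obtain m1 g1 where 1: "m1 \<in> D" "g1 \<in> D" "valid k m1 g1"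
      "\<forall>i d. pr i d \<epsilon> g \<longrightarrow> pr i d \<epsilon> g1" "\<exists>i. pr i ?q \<epsilon> g1" by blast
    obtain j' where "pr j' p \<epsilon> g1" using P[OF 2(3)] 1(4) by blast
    then have "formula_step mlang k (\<lambda>e. \<exists>j. pr j e \<epsilon> g1) ?r"
      unfolding formula_step_mlang using 1(5) by blast
    from valid_extend[OF 1(3) this D(1) 1(1,2) rD(1)] obtain m2 g2 where g2: "m2 \<in> D" "g2 \<in> D"
      "valid k m2 g2" "\<forall>i d. pr i d \<epsilon> g1 \<longrightarrow> pr i d \<epsilon> g2" "\<exists>i. pr i ?r \<epsilon> g2" by blast
    then have "formula_step mlang k (\<lambda>e. \<exists>j. pr j e \<epsilon> g2) d"
      unfolding formula_step_mlang 2(5) using 2(1) by blast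
    from valid_extend[OF g2(3) this D(1) g2(1,2) D(4)] 1(4) g2(4) show ?thesis by meson
  qed
qed

text \<open>The sequence \<open>g\<close> may have nonstandard length, so the rewriting is an
  induction inside the model. Its hypothesis, that some valid sequence in \<open>M\<close> lists the
  entries of \<open>g\<close> below \<open>n\<close>, is definable over \<open>M\<close>.\<close>

lemma delta_valid:
  assumes k: "k \<epsilon> om" and c: "built (delta_step k) c"
  shows "\<exists>m g. valid k m g \<and> (\<exists>i. pr i c \<epsilon> g)"
proof -
  obtain m g where m: "m \<epsilon> om" and g: "funOn g m" "\<exists>i. pr i c \<epsilon> g"
    "\<And>i d. pr i d \<epsilon> g \<Longrightarrow> delta_step k (\<lambda>e. \<exists>j. j \<epsilon> i \<and> pr j e \<epsilon> g) d"
    using c unfolding built_def by blast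
  obtain M where M: "om \<epsilon> M" "g \<epsilon> M" "good (ext M)" using local2 by blast
  let ?D = "ext M"
  have in_D: "om \<in> ?D" "g \<in> ?D" "k \<in> ?D" "emp \<in> ?D"
    using M k good_trans[OF M(3), of k om] good_emp[OF M(3)] by auto
  have ne: "?D \<noteq> {}" using in_D by blast
  let ?P = "\<lambda>n. \<exists>m'\<in>?D. \<exists>g'\<in>?D. valid k m' g' \<and>
    (\<forall>j\<in>?D. \<forall>d\<in>?D. j \<epsilon> n \<longrightarrow> pr j d \<epsilon> g \<longrightarrow> (\<exists>i\<in>?D. pr i d \<epsilon> g'))"
  have d: "Def ?D E (\<lambda>e. ?P (e 0))"
    by (intro Def_ex Def_all Def_connectives Def_valid TDef_var TDef_const TDef_pr M(3) ne in_D)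
  have "?P m"
  proof (rule om_induct_in[OF M(1,3) d _ _ m])
    have "valid k emp emp" unfolding valid_def funOn_def using om_emp by simp
    then show "?P emp" using in_D(4) by (intro bexI[of _ emp]) auto
  next
    fix n assume n: "n \<epsilon> om" "?P n"
    then obtain m' g' where g': "m' \<in> ?D" "g' \<in> ?D" "valid k m' g'"
      and IH: "\<And>j d. j \<in> ?D \<Longrightarrow> d \<in> ?D \<Longrightarrow> j \<epsilon> n \<Longrightarrow> pr j d \<epsilon> g \<Longrightarrow> \<exists>i\<in>?D. pr i d \<epsilon> g'" by blast
    show "?P (sc n)"
    proof (cases "n \<epsilon> m")
      case True
      define d where "d = app g n"
      have d: "pr n x \<epsilon> g \<longleftrightarrow> x = d" for x unfolding d_def by (rule funOn_app[OF g(1) True])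
      then have dg: "pr n d \<epsilon> g" by blast
      have dD: "d \<in> ?D" using good_pr_in[OF M(3) dg in_D(2)] by blast
      have prev: "\<exists>i. pr i e \<epsilon> g'" if "\<exists>j. j \<epsilon> n \<and> pr j e \<epsilon> g" for e
        using that IH good_pr_in[OF M(3) _ in_D(2)] by blast
      obtain m'' g'' where g'': "m'' \<in> ?D" "g'' \<in> ?D" "valid k m'' g''"
        "\<forall>i d. pr i d \<epsilon> g' \<longrightarrow> pr i d \<epsilon> g''" "\<exists>i. pr i d \<epsilon> g''"
        using delta_extend[OF g(3)[OF dg] g'(3) prev M(3) g'(1,2) dD] by blast
      have "\<exists>i\<in>?D. pr i x \<epsilon> g''" if x: "j \<in> ?D" "x \<in> ?D" "j \<epsilon> sc n" "pr j x \<epsilon> g" for j x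
      proof (cases "j = n")
        case True
        then have "x = d" using x d by simp
        with g''(5) show ?thesis using good_pr_in[OF M(3) _ g''(2)] by blast
      next
        case False
        then show ?thesis using x IH[of j x] g''(4) by auto
      qed
      with g''(1-3) show ?thesis by blast
    next
      \<comment> \<open>The induction runs through all of \<open>om\<close>; beyond the length of
        \<open>g\<close> there is nothing new to list.\<close>
      case False
      then have "\<not> pr n x \<epsilon> g" for x using funOn_dom[OF g(1)] by blast
      then have "\<exists>i\<in>?D. pr i x \<epsilon> g'" if "j \<in> ?D" "x \<in> ?D" "j \<epsilon> sc n" "pr j x \<epsilon> g" for j x
        using that IH[of j x] by auto
      with g' show ?thesis by blast
    qed
  qed
  then obtain m' g' where g': "valid k m' g'"
    "\<And>j d. j \<in> ?D \<Longrightarrow> d \<in> ?D \<Longrightarrow> j \<epsilon> m \<Longrightarrow> pr j d \<epsilon> g \<Longrightarrow> \<exists>i\<in>?D. pr i d \<epsilon> g'" by blast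
  obtain i where i: "pr i c \<epsilon> g" using g(2) by blast
  then have "i \<epsilon> m" "i \<in> ?D" "c \<in> ?D" using funOn_dom[OF g(1)] good_pr_in[OF M(3) _ in_D(2)] by blast+
  with g' i show ?thesis by blast
qed

text \<open>The earlier codes \<open>p\<close> and \<open>q\<close> are kept in the conclusion, so
  that falsum stays at hand for the outer negation of a Sigma_1 code.\<close>

lemma valid_step:
  "\<exists>m g. valid k m g \<and> (\<exists>i. pr i p \<epsilon> g) \<and> (\<exists>i. pr i q \<epsilon> g) \<Longrightarrow>
    formula_step mlang k (\<lambda>e. e = p \<or> e = q) c \<Longrightarrow>
    \<exists>m g. valid k m g \<and> (\<exists>i. pr i p \<epsilon> g) \<and> (\<exists>i. pr i q \<epsilon> g) \<and> (\<exists>i. pr i c \<epsilon> g)"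
proof -
  assume "\<exists>m g. valid k m g \<and> (\<exists>i. pr i p \<epsilon> g) \<and> (\<exists>i. pr i q \<epsilon> g)"
    and c: "formula_step mlang k (\<lambda>e. e = p \<or> e = q) c"
  then obtain m g where g: "valid k m g" "\<exists>i. pr i p \<epsilon> g" "\<exists>i. pr i q \<epsilon> g" by blast
  have "formula_step mlang k (\<lambda>e. \<exists>i. pr i e \<epsilon> g) c"
    by (rule mono_stepD[OF mono_formula_step c]) (use g in blast)
  from valid_extend[OF g(1) this good_UNIV] obtain m' g' where
    "valid k m' g'" "\<forall>i d. pr i d \<epsilon> g \<longrightarrow> pr i d \<epsilon> g'" "\<exists>i. pr i c \<epsilon> g'" by blast
  with g show ?thesis by blast
qed

theorem sigma1_mformula:
  assumes k: "k \<epsilon> om" and c: "sigma1 k c"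
  shows "mformula k c"
proof -
  obtain i p where i: "i \<epsilon> k" and p: "built (delta_step k) p"
    and c: "c = tag 4 (tag 5 i (tag 4 p flsc)) flsc" using assms unfolding sigma1_def by blast
  have "\<exists>m g. valid k m g \<and> (\<exists>i. pr i p \<epsilon> g) \<and> (\<exists>i. pr i p \<epsilon> g)"
    using delta_valid[OF k p] by blast
  from valid_step[OF this, of flsc]
  have "\<exists>m g. valid k m g \<and> (\<exists>i. pr i p \<epsilon> g) \<and> (\<exists>i. pr i flsc \<epsilon> g)"
    unfolding formula_step_mlang by blast
  from valid_step[OF this, of "tag 4 p flsc"]
  have "\<exists>m g. valid k m g \<and> (\<exists>i. pr i (tag 4 p flsc) \<epsilon> g) \<and> (\<exists>i. pr i flsc \<epsilon> g)"
    unfolding formula_step_mlang by blast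
  from valid_step[OF this, of "tag 5 i (tag 4 p flsc)"]
  have "\<exists>m g. valid k m g \<and> (\<exists>j. pr j (tag 5 i (tag 4 p flsc)) \<epsilon> g) \<and> (\<exists>i. pr i flsc \<epsilon> g)"
    unfolding formula_step_mlang using i by blast
  from valid_step[OF this, of c]
  show ?thesis unfolding mformula_valid formula_step_mlang c by blast
qed

text \<open>Elementarity for all internal formulas covers every Sigma_1 code, nonstandard ones
  included, since these are formula codes of the model.\<close>

lemma elementary_sigma1: "elementary mformula M N \<Longrightarrow> elementary sigma1 M N"
  unfolding elementary_def using sigma1_mformula by blast

end

section \<open>The theories\<close>

lemma weak_LZFC:
  assumes LZFC: "\<forall>q\<in>LZFC. sat UNIV E e q"
  obtains om where "weak E om" "\<And>x. \<exists>M. E x M \<and> omega.model E om M"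
proof -
  have BST: "\<forall>q\<in>BST. sat UNIV E e q" and Loc: "holds UNIV E e 0 e (Loc is_model)"
    using LZFC sat_holds[of UNIV E e "Loc is_model" e] by (auto simp: LZFC_def)
  have ax: "holds UNIV E e 0 e ax" if "ax 0 \<in> BST" for ax
    using BST that sat_holds[of UNIV E e ax e] by auto
  have h: "holds UNIV E e 0 e ax_empty" "holds UNIV E e 0 e (ax_extensionality fAll)"
    "holds UNIV E e 0 e (ax_pair fAll)" "holds UNIV E e 0 e (ax_union fAll)"
    "holds UNIV E e 0 e ax_omega"
    by (rule ax, simp add: BST_def)+
  have ext: "\<forall>x y. (\<forall>z. E z x \<longleftrightarrow> E z y) \<longrightarrow> x = y"
    using h(2) by (simp add: ax_extensionality_def)
  interpret basic E
  proof
    show "x = y" if "\<And>z. E z x \<longleftrightarrow> E z y" for x y using ext that by blast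
    show "\<exists>x. \<forall>z. \<not> E z x" using h(1) by (simp add: ax_empty_def is_empty_def)
    show "\<exists>z. \<forall>u. E u z \<longleftrightarrow> u = x \<or> u = y" for x y using h(3) by (simp add: ax_pair_def)
    show "\<exists>z. \<forall>u. E u z \<longleftrightarrow> (\<exists>v. E v x \<and> E u v)" for x using h(4) by (simp add: ax_union_def)
  qed
  obtain om where om: "ind om" "\<forall>y. ind y \<longrightarrow> sub om y"
    using h(5) by (auto simp: ax_omega_def holds_omega)
  interpret omega E om by unfold_locales (use om in blast)+
  have loc: "\<exists>M. E x M \<and> model M" for x using Loc by (simp add: Loc_def)
  have "weak E om"
  proof
    fix p a and w :: "nat \<Rightarrow> 'a" assume "p \<in> Delta0"
    then have "closure (ax_separation fAll (at1 p) 0) \<in> BST" unfolding BST_def by blast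
    then have "sat UNIV E e (closure (ax_separation fAll (at1 p) 0))" using BST by blast
    then have "sat UNIV E w (ax_separation fAll (at1 p) 0)" unfolding sat_closure[OF subset_UNIV] by blast
    then show "is_set (\<lambda>x. E x a \<and> sat UNIV E (case_nat x w) p)"
      unfolding sat_holds[of UNIV E w _ w] is_set_def by (simp add: ax_separation_def)
  next
    show "\<exists>M. E x M \<and> good {y. E y M}" for x using loc model_good by blast
  qed
  with loc that show thesis by blast
qed

lemma infinite_LZFC:
  assumes "range e \<subseteq> D" and LZFC: "\<forall>q\<in>LZFC. sat D E e q"
  shows "infinite D"
proof -
  have "sat D E e (ax_empty 0)" "sat D E e (ax_pair fAll 0)"
    using LZFC by (simp_all add: LZFC_def BST_def)
  then have "holds D E e 0 e ax_empty" "holds D E e 0 e (ax_pair fAll)"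
    unfolding sat_holds[of D E e _ e] .
  then have "\<forall>x\<in>D. \<forall>y\<in>D. \<exists>z\<in>D. \<forall>u\<in>D. E u z \<longleftrightarrow> u = x \<or> u = y" "\<exists>x\<in>D. \<forall>z\<in>D. \<not> E z x"
    by (simp_all add: ax_pair_def ax_empty_def is_empty_def)
  then show "infinite D" by (intro infinite_domain[of D E]) (auto, metis)
qed

lemma sat_VPH:
  assumes T: "\<forall>q\<in>LZFC_Sigma1_sext. sat UNIV E e q"
  shows "sat UNIV E e (VPH 0)"
proof -
  obtain om where "weak E om"
    using weak_LZFC[of E e] T unfolding LZFC_Sigma1_sext_def by blast
  then interpret weak E om .
  have "holds UNIV E e 0 e (Loc is_Sigma1_sext)"
    using T sat_holds[of UNIV E e "Loc is_Sigma1_sext" e] unfolding LZFC_Sigma1_sext_def by blast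
  then have "\<forall>x. \<exists>M. E x M \<and> model M \<and> (\<forall>x. \<exists>N. model N \<and> E x N \<and> elementary sigma1 M N)"
    by (simp add: Loc_def)
  then have "\<exists>r. rigid_in UNIV a r" if "\<not> finite_in UNIV a" for a
    using VPH_of_Sigma1_sext[OF _ that] by blast
  then show ?thesis unfolding sat_holds[of UNIV E e VPH e] by (simp add: holds_VPH)
qed

lemma ZFC_of_Sigma1_sext_VP:
  assumes T: "\<forall>q\<in>LZFC_Sigma1_sext \<union> VP. sat UNIV E e q"
  shows "\<forall>q\<in>ZFC. sat UNIV E e q"
proof -
  obtain om where om: "weak E om" "\<And>x. \<exists>M. E x M \<and> omega.model E om M"
    using weak_LZFC[of E e] T unfolding LZFC_Sigma1_sext_def by blast
  then interpret weak E om by blast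
  have "sat UNIV E e (VPH 0)" using T by (intro sat_VPH) blast
  then have vph: "\<exists>r. rigid_in UNIV a r" if "\<not> finite_in UNIV a" for a
    using that unfolding sat_holds[of UNIV E e VPH e] by (simp add: holds_VPH)
  show ?thesis
  proof (rule ZFC_of_vopenka[OF vph _ om(2)])
    fix P L assume P: "Def UNIV E (\<lambda>e. P (e 0))" and *: "isLang L"
      "\<And>x. P x \<Longrightarrow> \<exists>D I. x = pr D I \<and> isInterp L D I" "\<not> is_set P"
    \<comment> \<open>A definable predicate comes from a formula \<open>p\<close> with parameters
      \<open>w\<close>, so it is covered by the universally closed instance of the scheme for
      \<open>p\<close>.\<close>
    obtain p w where p: "\<And>x. P x \<longleftrightarrow> sat UNIV E (case_nat x w) p"
      by (rule Def_unary[OF P]) auto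
    have "closure (vopenka (at1 p) 0) \<in> VP" unfolding VP_def by blast
    then have "sat UNIV E e (closure (vopenka (at1 p) 0))" using T by blast
    then have "sat UNIV E w (vopenka (at1 p) 0)" unfolding sat_closure[OF subset_UNIV] by blast
    then have "isLang L \<and> (\<forall>x. P x \<longrightarrow> (\<exists>D I. x = pr D I \<and> isInterp L D I)) \<and>
        \<not> (\<exists>z. \<forall>x. E x z \<longleftrightarrow> P x) \<longrightarrow>
        (\<exists>x y j. P x \<and> P y \<and> x \<noteq> y \<and> elementary_embedding L x y j)"
      unfolding sat_holds[of UNIV E w _ w] 
      by (simp add: vopenka_def p cong del: imp_cong) (erule allE[of _ L], assumption)
    with * show "\<exists>x y j. P x \<and> P y \<and> x \<noteq> y \<and> elementary_embedding L x y j"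
      unfolding is_set_def by blast
  qed
qed

lemma Sigma1_sext_of_sext:
  assumes T: "\<forall>q\<in>LZFC_sext. sat UNIV E e q"
  shows "\<forall>q\<in>LZFC_Sigma1_sext. sat UNIV E e q"
proof -
  obtain om where "weak E om"
    using weak_LZFC[of E e] T unfolding LZFC_sext_def by blast
  then interpret weak E om .
  have "holds UNIV E e 0 e (Loc is_sext)"
    using T sat_holds[of UNIV E e "Loc is_sext" e] unfolding LZFC_sext_def by blast
  then have "\<forall>x. \<exists>M. E x M \<and> model M \<and> (\<forall>x. \<exists>N. model N \<and> E x N \<and> elementary mformula M N)"
    by (simp add: Loc_def)
  then have "\<forall>x. \<exists>M. E x M \<and> model M \<and> (\<forall>x. \<exists>N. model N \<and> E x N \<and> elementary sigma1 M N)"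
    by (elim all_forward ex_forward conj_forward) (assumption | erule elementary_sigma1)+
  then have "holds UNIV E e 0 e (Loc is_Sigma1_sext)" by (simp add: Loc_def)
  with T show ?thesis
    using sat_holds[of UNIV E e "Loc is_Sigma1_sext" e]
    unfolding LZFC_sext_def LZFC_Sigma1_sext_def by auto
qed

theorem corollary6p11:
  "LZFC_Sigma1_sext \<turnstile> VPH 0 \<and>
   theorems_of ZFC \<subseteq> theorems_of (LZFC_Sigma1_sext \<union> VP) \<and>
   theorems_of (LZFC_Sigma1_sext \<union> VP) \<subseteq> theorems_of (LZFC_sext \<union> VP)"
proof (intro conjI subsetI)
  show "LZFC_Sigma1_sext \<turnstile> VPH 0"
  proof (rule completeness)
    fix D and E :: "nat \<Rightarrow> nat \<Rightarrow> bool" and e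
    assume "range e \<subseteq> D" "\<forall>q\<in>LZFC_Sigma1_sext. sat D E e q"
    then show "infinite D" by (intro infinite_LZFC[of e D E]) (auto simp: LZFC_Sigma1_sext_def)
  qed (rule sat_VPH)
next
  fix p assume "p \<in> theorems_of ZFC"
  then have p: "ZFC \<turnstile> p" by (simp add: theorems_of_def)
  have "LZFC_Sigma1_sext \<union> VP \<turnstile> p"
  proof (rule completeness)
    fix D and E :: "nat \<Rightarrow> nat \<Rightarrow> bool" and e
    assume "range e \<subseteq> D" "\<forall>q\<in>LZFC_Sigma1_sext \<union> VP. sat D E e q"
    then show "infinite D" by (intro infinite_LZFC[of e D E]) (auto simp: LZFC_Sigma1_sext_def)
  next
    fix E :: "nat \<Rightarrow> nat \<Rightarrow> bool" and e
    assume "\<forall>q\<in>LZFC_Sigma1_sext \<union> VP. sat UNIV E e q"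
    from soundness[OF p subset_UNIV ZFC_of_Sigma1_sext_VP[OF this]] show "sat UNIV E e p" .
  qed
  then show "p \<in> theorems_of (LZFC_Sigma1_sext \<union> VP)" by (simp add: theorems_of_def)
next
  fix p assume "p \<in> theorems_of (LZFC_Sigma1_sext \<union> VP)"
  then have p: "LZFC_Sigma1_sext \<union> VP \<turnstile> p" by (simp add: theorems_of_def)
  have "LZFC_sext \<union> VP \<turnstile> p"
  proof (rule completeness)
    fix D and E :: "nat \<Rightarrow> nat \<Rightarrow> bool" and e
    assume "range e \<subseteq> D" "\<forall>q\<in>LZFC_sext \<union> VP. sat D E e q"
    then show "infinite D" by (intro infinite_LZFC[of e D E]) (auto simp: LZFC_sext_def)
  next
    fix E :: "nat \<Rightarrow> nat \<Rightarrow> bool" and e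
    assume "\<forall>q\<in>LZFC_sext \<union> VP. sat UNIV E e q"
    then have "\<forall>q\<in>LZFC_Sigma1_sext \<union> VP. sat UNIV E e q"
      using Sigma1_sext_of_sext[of E e] by blast
    from soundness[OF p subset_UNIV this] show "sat UNIV E e p" .
  qed
  then show "p \<in> theorems_of (LZFC_sext \<union> VP)" by (simp add: theorems_of_def)
qed

end
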